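(* Let $\lambda\in\mathbb{C}$, let $\alpha\in\mathbb{R}\setminus\{0\}$ and let $p>2$. Let $T_0>0$ and suppose $u_0\in \mathbf{H}^{1,0}\cap\mathbf{H}^{0,1}$, $h\in \mathbf{C}^2([0,T_0])$ and $u_0(0)=h(0)=\partial_t h(0)=0$. Let $\rho>0$ be such that $\sup_{t\in[0,T_0]}|h(t)|+\sup_{t\in[0,T_0]}|\partial_t h(t)|\le\rho^p$. Then there exist a constant $C>0$ and a time $T$ with $0<T\le T_0$ and $T\le (C\rho+1)^{-4/3}$ such that the initial-boundary value problem $$\begin{cases} i\partial_t u+\tfrac12\partial_x^2u=\lambda|u|^{p-1}u, & x\in\mathbb{R}^+,\ t>0,\\ u(0,x)=u_0(x), & x\in\mathbb{R}^+,\\ u(t,0)+\alpha\,\partial_xu(t,0)=h(t), & t>0,\end{cases}$$ has a unique local solution $u\in\mathbf{C}\left([0,T];\mathbf{H}^{1,0}\cap\mathbf{H}^{0,1}\right)$.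
   Context: $\mathbb{R}^+=(0,\infty)$ and $\mathbf{L}^2=\mathbf{L}^2(\mathbb{R}^+)$ (complex-valued functions). $\mathbf{H}^{1,0}=\{\phi\in\mathbf{L}^2:\ \|\phi\|_{\mathbf{H}^{1,0}}=\|\phi\|_{\mathbf{L}^2}+\|\partial_x\phi\|_{\mathbf{L}^2}<\infty\}$ and $\mathbf{H}^{0,1}=\{\phi\in\mathbf{L}^2:\ \|\phi\|_{\mathbf{H}^{0,1}}=\|\phi\|_{\mathbf{L}^2}+\|x\phi\|_{\mathbf{L}^2}<\infty\}$. Solutions are decomposed as $u=w+z$, where $z$ solves the linear problem $i\partial_tz+\frac12\partial_x^2z=0$, $z(0,x)=0$, $z(t,0)+\alpha\partial_xz(t,0)=h(t)$, and $w$ solves the problem with homogeneous boundary condition $i\partial_tw+\frac12\partial_x^2w=\lambda|u|^{p-1}u$, $w(0,x)=u_0(x)$, $w(t,0)+\alpha\partial_xw(t,0)=0$. *)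

theory Defs
  imports "HOL-Analysis.Analysis"
begin

text \<open>
  Functions on \<open>\<real>\<^sup>+ = (0,\<infinity>)\<close> are represented by functions on \<open>real\<close> of which only the values
  on \<open>{0<..}\<close> matter, and these only up to null sets: \<open>halfline\<close> is Lebesgue measure there.
\<close>

abbreviation halfline :: "real measure" where
  "halfline \<equiv> lebesgue_on {0<..}"

definition test_function :: "real set \<Rightarrow> (real \<Rightarrow> real) \<Rightarrow> bool" where
  "test_function S \<phi> \<longleftrightarrow>
     (\<forall>n x. (deriv ^^ n) \<phi> field_differentiable (at x)) \<and>
     (\<exists>K. compact K \<and> K \<subseteq> S \<and> (\<forall>x. x \<notin> K \<longrightarrow> \<phi> x = 0))"

subsection \<open>Function spaces\<close>

definition L2 :: "(real \<Rightarrow> complex) set" where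
  "L2 = {f \<in> borel_measurable halfline. integrable halfline (\<lambda>x. (cmod (f x))\<^sup>2)}"

definition L2_norm :: "(real \<Rightarrow> complex) \<Rightarrow> real" where
  "L2_norm f = sqrt (LINT x|halfline. (cmod (f x))\<^sup>2)"

definition locally_integrable :: "(real \<Rightarrow> complex) \<Rightarrow> bool" where
  "locally_integrable f \<longleftrightarrow> (\<forall>K. compact K \<and> K \<subseteq> {0<..} \<longrightarrow> set_integrable lebesgue K f)"

definition has_weak_deriv :: "(real \<Rightarrow> complex) \<Rightarrow> (real \<Rightarrow> complex) \<Rightarrow> bool" where
  "has_weak_deriv f g \<longleftrightarrow> locally_integrable f \<and> locally_integrable g \<and>
     (\<forall>\<phi>. test_function {0<..} \<phi> \<longrightarrow>
        (LINT x|halfline. of_real (deriv \<phi> x) * f x) = - (LINT x|halfline. of_real (\<phi> x) * g x))"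

text \<open>A weak derivative is unique up to null sets, so the choice below is immaterial inside norms.\<close>

definition weak_deriv :: "(real \<Rightarrow> complex) \<Rightarrow> real \<Rightarrow> complex" where
  "weak_deriv f = (SOME g. has_weak_deriv f g)"

definition H10 :: "(real \<Rightarrow> complex) set" where
  "H10 = {f \<in> L2. \<exists>g \<in> L2. has_weak_deriv f g}"

definition H10_norm :: "(real \<Rightarrow> complex) \<Rightarrow> real" where
  "H10_norm f = L2_norm f + L2_norm (weak_deriv f)"

definition H01 :: "(real \<Rightarrow> complex) set" where
  "H01 = {f \<in> L2. (\<lambda>x. of_real x * f x) \<in> L2}"

definition H01_norm :: "(real \<Rightarrow> complex) \<Rightarrow> real" where
  "H01_norm f = L2_norm f + L2_norm (\<lambda>x. of_real x * f x)"

text \<open>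
  Every element of \<open>H10\<close> agrees almost everywhere on \<open>(0,\<infinity>)\<close> with exactly one continuous function
  on \<open>[0,\<infinity>)\<close>. All point values, in particular those at the boundary \<open>x = 0\<close>, are values of this
  representative (which is meaningful on \<open>{0..}\<close> only).
\<close>

definition cont_rep :: "(real \<Rightarrow> complex) \<Rightarrow> real \<Rightarrow> complex" where
  "cont_rep f = (SOME g. continuous_on {0..} g \<and> (AE x in halfline. g x = f x))"

definition C_H10_H01 :: "real \<Rightarrow> (real \<Rightarrow> real \<Rightarrow> complex) \<Rightarrow> bool" where
  "C_H10_H01 T u \<longleftrightarrow>
     (\<forall>t\<in>{0..T}. u t \<in> H10 \<inter> H01) \<and>
     (\<forall>t\<in>{0..T}.
        ((\<lambda>s. H10_norm (\<lambda>x. u s x - u t x) + H01_norm (\<lambda>x. u s x - u t x)) \<longlongrightarrow> 0)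
          (at t within {0..T}))"

definition deriv_within :: "real set \<Rightarrow> (real \<Rightarrow> complex) \<Rightarrow> real \<Rightarrow> complex" where
  "deriv_within I h t = vector_derivative h (at t within I)"

definition C2_on :: "real set \<Rightarrow> (real \<Rightarrow> complex) \<Rightarrow> bool" where
  "C2_on I h \<longleftrightarrow>
     h differentiable_on I \<and> deriv_within I h differentiable_on I \<and>
     continuous_on I (deriv_within I (deriv_within I h))"

subsection \<open>The initial-boundary value problem\<close>

definition nonlinearity :: "real \<Rightarrow> complex \<Rightarrow> complex" where
  "nonlinearity p z = of_real (cmod z powr (p - 1)) * z"

text \<open>
  \<open>u t x\<close> stands for \<open>u(t,x)\<close>. The equation holds at every time \<open>t \<in> (0,T)\<close> in the sense of
  distributions on \<open>(0,\<infinity>)\<close>; that \<open>\<partial>\<^sub>t u(t)\<close> exists as a distribution is part of the claim.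
\<close>

definition nls_equation :: "complex \<Rightarrow> real \<Rightarrow> real \<Rightarrow> (real \<Rightarrow> real \<Rightarrow> complex) \<Rightarrow> bool" where
  "nls_equation lam p T u \<longleftrightarrow>
     (\<forall>\<phi>. test_function {0<..} \<phi> \<longrightarrow> (\<forall>t\<in>{0<..<T}. \<exists>D.
        ((\<lambda>s. LINT x|halfline. of_real (\<phi> x) * u s x) has_vector_derivative D) (at t) \<and>
        \<i> * D + 1/2 * (LINT x|halfline. of_real (deriv (deriv \<phi>) x) * u t x)
          = lam * (LINT x|halfline. of_real (\<phi> x) * nonlinearity p (u t x))))"

text \<open>
  For \<open>u(t) \<in> H10\<close> the value \<open>u(t,0)\<close> is defined at every \<open>t\<close>, but \<open>\<partial>\<^sub>x u(t,0)\<close> need not be. It is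
  the limit of the one-sided difference quotients \<open>(u(t,\<epsilon>) - u(t,0))/\<epsilon>\<close> as \<open>\<epsilon> \<rightarrow> 0+\<close>, taken in the
  sense of distributions in \<open>t\<close> on \<open>(0,T)\<close>.
\<close>

definition robin_condition ::
    "real \<Rightarrow> (real \<Rightarrow> complex) \<Rightarrow> real \<Rightarrow> (real \<Rightarrow> real \<Rightarrow> complex) \<Rightarrow> bool" where
  "robin_condition \<alpha> h T u \<longleftrightarrow>
     (\<forall>\<psi>. test_function {0<..<T} \<psi> \<longrightarrow>
        ((\<lambda>\<epsilon>. LINT t|lebesgue_on {0<..<T}. of_real (\<psi> t) *
             (cont_rep (u t) 0 +
              of_real \<alpha> * ((cont_rep (u t) \<epsilon> - cont_rep (u t) 0) / of_real \<epsilon>)))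
          \<longlongrightarrow> (LINT t|lebesgue_on {0<..<T}. of_real (\<psi> t) * h t)) (at_right 0))"

definition nls_robin_solution ::
    "complex \<Rightarrow> real \<Rightarrow> real \<Rightarrow> (real \<Rightarrow> complex) \<Rightarrow> (real \<Rightarrow> complex) \<Rightarrow> real \<Rightarrow>
      (real \<Rightarrow> real \<Rightarrow> complex) \<Rightarrow> bool" where
  "nls_robin_solution lam \<alpha> p u0 h T u \<longleftrightarrow>
     C_H10_H01 T u \<and>
     nls_equation lam p T u \<and>
     (AE x in halfline. u 0 x = u0 x) \<and>
     robin_condition \<alpha> h T u"

end

theory Submission
  imports Defs "HOL-Analysis.Analysis"
begin

text \<open>
  Let \<open>X = H10 \<inter> H01\<close> and let \<open>G \<in> X\<close> be smooth with \<open>G(0) + \<alpha> G'(0) = 1\<close>. For \<open>w = u - h G\<close> the boundary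
  condition becomes homogeneous and the problem reads \<open>w' = A w + F(t,w)\<close> with \<open>A = (i/2) \<partial>\<^sub>x\<^sup>2 - 1\<close> on Robin
  data. On \<open>X\<close>, with the equivalent inner product obtained by adding the boundary form of the Robin
  Laplacian and a large multiple of the \<open>L\<^sup>2\<close> product, \<open>A\<close> is maximal dissipative; the power nonlinearity
  is Lipschitz on bounded subsets of \<open>X\<close> because \<open>p \<ge> 2\<close>. Truncating it by the radial retraction onto a
  ball, one solves the evolution problem by Yosida approximation, and on a short time interval the
  truncation is not felt. No smoothing or Strichartz estimate is needed, and \<open>C = 1\<close> will do since \<open>T\<close>
  may be chosen small.

  For uniqueness, and for the boundary condition in its distributional form, a solution is averaged in
  time against a test function \<open>\<psi>\<close>: the equation shows that \<open>\<integral> \<psi> u dt\<close> is twice differentiable in \<open>x\<close>, so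
  that \<open>\<integral> \<psi> w dt\<close> lies in the domain of \<open>A\<close>. Applying the resolvent, one sees that every solution is a
  mild solution, and the energy inequality with Gronwall's lemma identifies any two of these.
\<close>

text \<open>What shapes the proof is that a solution lies only in X at each time. There u_xx is a
  distribution and the trace u_x(t,0) need not exist, while the domain of \<open>A\<close> inside X
  asks for u_xx in X. The inner product is dictated by the boundary condition: with the Robin
  boundary term added, (i/2) d^2/dx^2 is skew on its domain. For \<alpha> > 0 that term is negative,
  and the multiple 8 / \<alpha>^2 of the L2 product restores positivity. The weight x does not
  commute with the Laplacian; the commutator is of first order, is bounded by the energy, and is the
  reason for the - 1 in \<open>A\<close>. The power is Lipschitz in X because the derivative of
  |z|^(p-1) z is itself locally Lipschitz when p \<ge> 2.\<close>

section \<open>Gronwall and Picard for ordinary differential equations\<close>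

lemma differential_gronwall:
  fixes \<phi> \<phi>' :: "real \<Rightarrow> real"
  assumes der: "\<And>t. t \<in> {0..T} \<Longrightarrow> (\<phi> has_real_derivative \<phi>' t) (at t within {0..T})"
    and le: "\<And>t. t \<in> {0..T} \<Longrightarrow> \<phi>' t \<le> a * \<phi> t + b"
    and "a \<ge> 0" "b \<ge> 0" "t \<in> {0..T}"
  shows "\<phi> t \<le> exp (a * t) * (\<phi> 0 + b * t)"
proof -
  \<comment> \<open>The integrating factor with the forcing removed linearly. Since exp(- a s) b
    \<le> b, this function decreases; the coarse term \<open>b * t\<close> in the bound spares a
    division by \<open>a\<close>, which is zero in \<open>mild_energy\<close>.\<close>
  define \<psi> where "\<psi> = (\<lambda>t. exp (- a * t) * \<phi> t - b * t)"
  have d: "(\<psi> has_real_derivative (exp (- a * s) * (\<phi>' s - a * \<phi> s) - b)) (at s within {0..T})"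
    if "s \<in> {0..T}" for s
    unfolding \<psi>_def
    by (rule derivative_eq_intros der that refl | simp add: algebra_simps)+
  have "\<psi> t \<le> \<psi> 0"
  proof (rule DERIV_nonpos_imp_decreasing_open[of 0 t])
    show "continuous_on {0..t} \<psi>"
      using \<open>t \<in> {0..T}\<close> by (intro continuous_on_subset[OF DERIV_continuous_on[OF d]]) auto
    show "\<exists>y. (\<psi> has_real_derivative y) (at s) \<and> y \<le> 0" if s: "0 < s" "s < t" for s
    proof -
      have sT: "s \<in> {0..T}" "at s within {0..T} = at s"
        using s \<open>t \<in> {0..T}\<close> by (auto intro!: at_within_interior)
      have "exp (- a * s) * (\<phi>' s - a * \<phi> s) \<le> exp (- a * s) * b"
        using le[OF sT(1)] by (intro mult_left_mono) auto
      also have "\<dots> \<le> 1 * b"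
        using s \<open>a \<ge> 0\<close> \<open>b \<ge> 0\<close> by (intro mult_right_mono) auto
      finally show ?thesis using d[OF sT(1)] unfolding sT(2) by auto
    qed
  qed (use \<open>t \<in> {0..T}\<close> in auto)
  then have "exp (- a * t) * \<phi> t \<le> \<phi> 0 + b * t" by (simp add: \<psi>_def)
  then have "exp (a * t) * (exp (- a * t) * \<phi> t) \<le> exp (a * t) * (\<phi> 0 + b * t)"
    by (intro mult_left_mono) auto
  then show ?thesis by (simp add: exp_minus mult.assoc[symmetric])
qed

text \<open>The unknown is v = exp(- \<kappa> t) w with \<kappa> = 2 L. In the sup norm of v the
  Picard map contracts by 1/2 whatever the length of the interval, so the global solution is one
  fixed point and nothing has to be glued.\<close>

lemma picard_global:
  fixes G :: "real \<Rightarrow> 'a::banach \<Rightarrow> 'a"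
  assumes "T \<ge> 0" "L > 0"
    and cont: "\<And>w. continuous_on {0..T} w \<Longrightarrow> continuous_on {0..T} (\<lambda>t. G t (w t))"
    and lip: "\<And>t x y. t \<in> {0..T} \<Longrightarrow> norm (G t x - G t y) \<le> L * norm (x - y)"
  obtains w where "w 0 = w0"
    "\<And>t. t \<in> {0..T} \<Longrightarrow> (w has_vector_derivative G t (w t)) (at t within {0..T})"
proof -
  define \<kappa> where "\<kappa> = 2 * L"
  define g where "g = (\<lambda>v s. G s (exp (\<kappa> * s) *\<^sub>R v s))"
  define H where "H = (\<lambda>v t. exp (- \<kappa> * t) *\<^sub>R (w0 + integral {0..t} (g v)))"
  have g_cont: "continuous_on {0..T} (g v)" if "continuous_on {0..T} v" for v
    unfolding g_def by (intro cont continuous_intros that)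
  have H_cont: "continuous_on {0..T} (H v)" if "continuous_on {0..T} v" for v
    unfolding H_def using g_cont[OF that]
    by (intro continuous_intros indefinite_integral_continuous_1 integrable_continuous_interval)
  \<comment> \<open>The fixed point is sought in the complete type of bounded continuous functions
    on the whole line; \<open>clamp\<close> extends a function on [0,T] by its end values.\<close>
  have "\<exists>u :: real \<Rightarrow>\<^sub>C 'a. \<forall>t. apply_bcontfun u t = H (apply_bcontfun v) (clamp 0 T t)" for v
  proof -
    have "continuous_on (cbox 0 T) (H (apply_bcontfun v))"
      using H_cont[of "apply_bcontfun v"] by (simp add: continuous_on_apply_bcontfun)
    from continuous_on_cbox_bcontfunE[OF this] show ?thesis by metis
  qed
  then obtain \<Phi> :: "(real \<Rightarrow>\<^sub>C 'a) \<Rightarrow> (real \<Rightarrow>\<^sub>C 'a)"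
    where \<Phi>: "\<And>v t. apply_bcontfun (\<Phi> v) t = H (apply_bcontfun v) (clamp 0 T t)" by metis
  have contr: "dist (\<Phi> u) (\<Phi> v) \<le> 1/2 * dist u v" for u v
  proof (rule dist_bound)
    fix t0 :: real
    define t where "t = clamp 0 T t0"
    have t: "t \<in> {0..T}" using clamp_in_interval[of 0 T t0] \<open>T \<ge> 0\<close> by (simp add: t_def)
    have uc: "continuous_on {0..t} (g (apply_bcontfun x))" for x :: "real \<Rightarrow>\<^sub>C 'a"
      using t by (intro continuous_on_subset[OF g_cont] continuous_intros) auto
    have ui: "g (apply_bcontfun x) integrable_on {0..t}" for x :: "real \<Rightarrow>\<^sub>C 'a"
      by (intro integrable_continuous_interval uc)
    have I: "((\<lambda>s. L * exp (\<kappa> * s) * dist u v) has_integral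
        (exp (\<kappa> * t) * dist u v / 2 - exp (\<kappa> * 0) * dist u v / 2)) {0..t}"
      using t \<open>L > 0\<close>
      by (intro fundamental_theorem_of_calculus)
         (auto simp: \<kappa>_def has_real_derivative_iff_has_vector_derivative[symmetric]
           intro!: derivative_eq_intros)
    have "norm (integral {0..t} (\<lambda>s. g (apply_bcontfun u) s - g (apply_bcontfun v) s))
        \<le> integral {0..t} (\<lambda>s. L * exp (\<kappa> * s) * dist u v)"
    proof (rule integral_norm_bound_integral)
      fix s assume s: "s \<in> {0..t}"
      have "norm (g (apply_bcontfun u) s - g (apply_bcontfun v) s)
          \<le> L * norm (exp (\<kappa> * s) *\<^sub>R apply_bcontfun u s - exp (\<kappa> * s) *\<^sub>R apply_bcontfun v s)"
        unfolding g_def using s t by (intro lip) auto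
      also have "\<dots> = L * exp (\<kappa> * s) * dist (apply_bcontfun u s) (apply_bcontfun v s)"
        by (simp add: dist_norm scaleR_diff_right[symmetric])
      also have "\<dots> \<le> L * exp (\<kappa> * s) * dist u v"
        using \<open>L > 0\<close> by (intro mult_left_mono dist_bounded) auto
      finally show "norm (g (apply_bcontfun u) s - g (apply_bcontfun v) s) \<le> L * exp (\<kappa> * s) * dist u v" .
    qed (use I ui in \<open>auto intro: integrable_diff\<close>)
    also have "\<dots> \<le> exp (\<kappa> * t) * dist u v / 2"
      unfolding integral_unique[OF I] by simp
    finally have *: "norm (integral {0..t} (g (apply_bcontfun u)) - integral {0..t} (g (apply_bcontfun v)))
        \<le> exp (\<kappa> * t) * dist u v / 2"
      using ui by (simp add: integral_diff)
    have "dist (apply_bcontfun (\<Phi> u) t0) (apply_bcontfun (\<Phi> v) t0)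
        = exp (- \<kappa> * t) * norm (integral {0..t} (g (apply_bcontfun u)) - integral {0..t} (g (apply_bcontfun v)))"
      by (simp add: \<Phi> H_def t_def dist_norm scaleR_diff_right[symmetric])
    also have "\<dots> \<le> exp (- \<kappa> * t) * (exp (\<kappa> * t) * dist u v / 2)"
      by (intro mult_left_mono *) auto
    also have "\<dots> = 1/2 * dist u v" by (simp add: exp_minus)
    finally show "dist (apply_bcontfun (\<Phi> u) t0) (apply_bcontfun (\<Phi> v) t0) \<le> 1/2 * dist u v" .
  qed
  have "\<exists>!v\<in>UNIV. \<Phi> v = v"
    by (rule Banach_fix[where c = "1/2"]) (use contr in \<open>auto simp: complete_UNIV\<close>)
  then obtain v where v: "\<Phi> v = v" by auto
  define w where "w = (\<lambda>t. w0 + integral {0..t} (g (apply_bcontfun v)))"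
  have gw: "g (apply_bcontfun v) t = G t (w t)" if "t \<in> {0..T}" for t
  proof -
    have "clamp 0 T t = t" using that by (intro clamp_cancel_cbox) auto
    then have "apply_bcontfun v t = exp (- \<kappa> * t) *\<^sub>R w t"
      using \<Phi>[of v t] by (simp add: v H_def w_def)
    then show ?thesis by (simp add: g_def exp_minus)
  qed
  show thesis
  proof (rule that)
    show "w 0 = w0" by (simp add: w_def)
    fix t assume t: "t \<in> {0..T}"
    have "((\<lambda>t. integral {0..t} (g (apply_bcontfun v))) has_vector_derivative g (apply_bcontfun v) t) (at t within {0..T})"
      by (rule integral_has_vector_derivative[OF g_cont t]) (simp add: continuous_on_apply_bcontfun)
    then show "(w has_vector_derivative G t (w t)) (at t within {0..T})"
      unfolding w_def gw[OF t, symmetric, unfolded w_def] by (auto intro!: derivative_eq_intros)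
  qed
qed

text \<open>Used in \<open>yosida_regular\<close> to turn bounds on increments over shrinking steps
  into bounds on the derivative. The steps are positive, so the one-sided derivative at time 0 is
  covered.\<close>

lemma has_vector_derivative_sequence:
  assumes "(w has_vector_derivative l) (at t within S)"
    and "\<And>n. s n > 0" "s \<longlonglongrightarrow> 0" "\<And>n. t + s n \<in> S"
  shows "(\<lambda>n. (w (t + s n) - w t) /\<^sub>R s n) \<longlonglongrightarrow> l"
proof -
  have "filterlim (\<lambda>n. t + s n) (at t within S) sequentially"
  proof (subst filterlim_at, intro conjI always_eventually allI)
    show "t + s n \<noteq> t" for n using assms(2)[of n] by simp
    show "(\<lambda>n. t + s n) \<longlonglongrightarrow> t" using tendsto_add[OF tendsto_const[of t] assms(3)] by simp
  qed (rule assms(4))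
  moreover have "((\<lambda>y. (1 / norm (y - t)) *\<^sub>R (w y - (w t + (y - t) *\<^sub>R l))) \<longlongrightarrow> 0) (at t within S)"
    using assms(1) unfolding has_vector_derivative_def has_derivative_within by simp
  ultimately have "(\<lambda>n. (1 / norm (t + s n - t)) *\<^sub>R (w (t + s n) - (w t + (t + s n - t) *\<^sub>R l))) \<longlonglongrightarrow> 0"
    by (rule filterlim_compose[rotated])
  moreover have "(1 / norm (t + s n - t)) *\<^sub>R (w (t + s n) - (w t + (t + s n - t) *\<^sub>R l))
      = (w (t + s n) - w t) /\<^sub>R s n - l" for n
    using assms(2)[of n] by (simp add: scaleR_diff_right scaleR_add_right inverse_eq_divide)
  ultimately show ?thesis by (simp add: LIM_zero_iff)
qed

section \<open>Maximal dissipative operators with respect to an equivalent inner product\<close>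

text \<open>\<open>B\<close> is kept apart from the norm: it is bounded as a bilinear map and
  bounded below by \<open>coercive\<close>, so the root of \<open>B u u\<close> is an equivalent
  norm while the type keeps its own. \<open>A\<close> is total but meaningful only on
  \<open>D\<close>. Density of \<open>D\<close> is a consequence, see
  \<open>J_tendsto\<close>.\<close>

locale m_dissipative = B: bounded_bilinear B
  for B :: "'a::banach \<Rightarrow> 'a \<Rightarrow> real" +
  fixes A :: "'a \<Rightarrow> 'a" and D :: "'a set" and c :: real
  assumes B_sym: "B u v = B v u"
    and c_pos: "c > 0"
    and coercive: "c * (norm u)\<^sup>2 \<le> B u u"
    and D_add: "u \<in> D \<Longrightarrow> v \<in> D \<Longrightarrow> u + v \<in> D"
    and D_scaleR: "u \<in> D \<Longrightarrow> r *\<^sub>R u \<in> D"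
    and A_add: "u \<in> D \<Longrightarrow> v \<in> D \<Longrightarrow> A (u + v) = A u + A v"
    and A_scaleR: "u \<in> D \<Longrightarrow> A (r *\<^sub>R u) = r *\<^sub>R A u"
    and dissipative: "u \<in> D \<Longrightarrow> B (A u) u \<le> 0"
    and range_resolvent: "\<mu> > 0 \<Longrightarrow> \<exists>u\<in>D. \<mu> *\<^sub>R u - A u = f"
begin

definition q :: "'a \<Rightarrow> real" where "q u = B u u"

lemma q_nonneg [simp]: "q u \<ge> 0"
  using coercive[of u] c_pos by (smt (verit) mult_nonneg_nonneg q_def zero_le_power2)

lemma q_zero [simp]: "q 0 = 0" by (simp add: q_def B.zero_left)

lemma q_eq_0: "q u \<le> 0 \<Longrightarrow> u = 0"
  using coercive[of u] c_pos
  by (metis mult_pos_pos norm_eq_zero order_trans q_def zero_less_power2 not_le)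

lemma norm_sq_le_q: "(norm u)\<^sup>2 \<le> q u / c"
  using coercive[of u] c_pos by (simp add: q_def field_simps)

lemma q_scaleR: "q (r *\<^sub>R u) = r\<^sup>2 * q u"
  by (simp add: q_def B.scaleR_left B.scaleR_right power2_eq_square)

lemma q_plus: "q (u + v) = q u + 2 * B u v + q v"
  by (simp add: q_def B.add_left B.add_right B_sym[of v u])

lemma q_diff: "q (u - v) = q u - 2 * B u v + q v"
  by (simp add: q_def B.diff_left B.diff_right B_sym[of v u])

lemma young: "2 * B u v \<le> q u + q v"
  using q_nonneg[of "u - v"] unfolding q_diff by simp

lemma young_minus: "- (2 * B u v) \<le> q u + q v"
  using q_nonneg[of "u + v"] unfolding q_plus by simp

lemma q_plus_le: "q (u + v) \<le> 2 * q u + 2 * q v"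
  using young[of u v] unfolding q_plus by simp

lemma q_diff_le: "q (u - v) \<le> 2 * q u + 2 * q v"
  using young_minus[of u v] unfolding q_diff by simp

lemma q_bound: obtains K where "K > 0" "\<And>u. q u \<le> K * (norm u)\<^sup>2"
proof -
  obtain K where "K > 0" "\<And>a b. norm (B a b) \<le> norm a * norm b * K"
    using B.pos_bounded by auto
  then show thesis
    by (intro that[of K]) (auto simp: q_def power2_eq_square mult.commute abs_le_iff)
qed

lemma tendsto_q: "(f \<longlongrightarrow> l) F \<Longrightarrow> ((\<lambda>x. q (f x)) \<longlongrightarrow> q l) F"
  unfolding q_def by (intro B.tendsto)

lemma continuous_on_q: "continuous_on S f \<Longrightarrow> continuous_on S (\<lambda>x. q (f x))"
  unfolding q_def by (intro B.continuous_on)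

lemma q_has_derivative:
  assumes "(f has_vector_derivative f') (at t within S)"
  shows "((\<lambda>t. q (f t)) has_real_derivative 2 * B f' (f t)) (at t within S)"
  using B.has_vector_derivative[OF assms assms]
  by (simp add: q_def has_real_derivative_iff_has_vector_derivative B_sym[of "f t" f'])

subsection \<open>Resolvent and Yosida approximation\<close>

text \<open>\<open>R \<mu>\<close> is the resolvent (\<mu> - A)^-1 and \<open>J \<mu>\<close> is (1
  - A/\<mu>)^-1. \<open>Y \<mu>\<close> is the Yosida approximation A J, by \<open>A_J\<close>, in a
  form without \<open>A\<close> that is visibly bounded on the whole space.\<close>

definition R :: "real \<Rightarrow> 'a \<Rightarrow> 'a" where
  "R \<mu> f = (SOME u. u \<in> D \<and> \<mu> *\<^sub>R u - A u = f)"

definition J :: "real \<Rightarrow> 'a \<Rightarrow> 'a" where "J \<mu> f = \<mu> *\<^sub>R R \<mu> f"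

definition Y :: "real \<Rightarrow> 'a \<Rightarrow> 'a" where "Y \<mu> f = \<mu> *\<^sub>R (J \<mu> f - f)"

lemma R_in_D: "\<mu> > 0 \<Longrightarrow> R \<mu> f \<in> D" and R_eq: "\<mu> > 0 \<Longrightarrow> \<mu> *\<^sub>R R \<mu> f - A (R \<mu> f) = f"
  using range_resolvent[of \<mu> f] someI_ex[of "\<lambda>u. u \<in> D \<and> \<mu> *\<^sub>R u - A u = f"]
  unfolding R_def by blast+

lemma D_diff: "u \<in> D \<Longrightarrow> v \<in> D \<Longrightarrow> u - v \<in> D"
  using D_add[of u "-1 *\<^sub>R v"] D_scaleR[of v "-1"] by simp

lemma A_diff: "u \<in> D \<Longrightarrow> v \<in> D \<Longrightarrow> A (u - v) = A u - A v"
  using A_add[of u "-1 *\<^sub>R v"] D_scaleR[of v "-1"] A_scaleR[of v "-1"] by simp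

lemma R_unique:
  assumes "\<mu> > 0" "u \<in> D" "\<mu> *\<^sub>R u - A u = f"
  shows "R \<mu> f = u"
proof -
  let ?d = "R \<mu> f - u"
  have "?d \<in> D" using assms R_in_D by (intro D_diff) auto
  moreover have "\<mu> *\<^sub>R ?d = A ?d"
    using assms R_eq[of \<mu> f] by (simp add: A_diff R_in_D algebra_simps)
  ultimately have "\<mu> * q ?d \<le> 0"
    using dissipative[of ?d] by (simp add: q_def B.scaleR_left flip: \<open>\<mu> *\<^sub>R ?d = A ?d\<close>)
  then have "q ?d \<le> 0" using \<open>\<mu> > 0\<close> by (simp add: mult_le_0_iff)
  then show ?thesis using q_eq_0 by force
qed

lemma J_in_D: "\<mu> > 0 \<Longrightarrow> J \<mu> f \<in> D"
  by (simp add: J_def D_scaleR R_in_D)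

lemma A_J: assumes "\<mu> > 0" shows "A (J \<mu> f) = Y \<mu> f"
proof -
  have "A (R \<mu> f) = \<mu> *\<^sub>R R \<mu> f - f"
    using R_eq[OF assms, of f] by (metis add_diff_cancel_left' diff_add_cancel)
  then show ?thesis using assms by (simp add: J_def Y_def A_scaleR R_in_D)
qed

text \<open>Characterises \<open>J \<mu>\<close> as the solution operator of u - A u / \<mu> = f;
  its linearity and its commutation with \<open>A\<close> are read off from this.\<close>

lemma J_unique:
  assumes "\<mu> > 0" "u \<in> D" "u - A u /\<^sub>R \<mu> = f"
  shows "J \<mu> f = u"
proof -
  have "R \<mu> f = u /\<^sub>R \<mu>"
    using assms by (intro R_unique) (auto simp: D_scaleR A_scaleR)
  then show ?thesis using assms by (simp add: J_def)
qed

text \<open>Pair u - A u / \<mu> = f with u = \<open>J \<mu> f\<close>: the term with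
  \<open>A\<close> is non-negative by dissipativity, so q u \<le> B f u, and Young's inequality
  finishes.\<close>

lemma q_J: assumes "\<mu> > 0" shows "q (J \<mu> f) \<le> q f"
proof -
  have "B (Y \<mu> f) (J \<mu> f) \<le> 0"
    using dissipative[OF J_in_D] A_J assms by metis
  then have "B (J \<mu> f - f) (J \<mu> f) \<le> 0"
    using assms by (simp add: Y_def B.scaleR_left mult_le_0_iff)
  then have "q (J \<mu> f) \<le> B f (J \<mu> f)" by (simp add: q_def B.diff_left)
  with young[of f "J \<mu> f"] show ?thesis by simp
qed

lemma J_add: "\<mu> > 0 \<Longrightarrow> J \<mu> (f + g) = J \<mu> f + J \<mu> g"
  by (rule J_unique) (auto simp: J_in_D D_add A_add A_J Y_def algebra_simps)

lemma J_scaleR: "\<mu> > 0 \<Longrightarrow> J \<mu> (r *\<^sub>R f) = r *\<^sub>R J \<mu> f"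
proof (rule J_unique)
  assume \<mu>: "\<mu> > 0"
  have "r *\<^sub>R J \<mu> f - A (r *\<^sub>R J \<mu> f) /\<^sub>R \<mu> = r *\<^sub>R (J \<mu> f - Y \<mu> f /\<^sub>R \<mu>)"
    using \<mu> by (simp only: A_scaleR J_in_D A_J scaleR_diff_right scaleR_left_commute)
  also have "J \<mu> f - Y \<mu> f /\<^sub>R \<mu> = f" using \<mu> by (simp add: Y_def)
  finally show "r *\<^sub>R J \<mu> f - A (r *\<^sub>R J \<mu> f) /\<^sub>R \<mu> = r *\<^sub>R f" .
qed (auto simp: J_in_D D_scaleR)

lemma bounded_linear_J: assumes "\<mu> > 0" shows "bounded_linear (J \<mu>)"
proof -
  obtain K where K: "K > 0" "\<And>u. q u \<le> K * (norm u)\<^sup>2" using q_bound by blast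
  have "norm (J \<mu> f) \<le> norm f * sqrt (K / c)" for f
  proof -
    have "(norm (J \<mu> f))\<^sup>2 \<le> q (J \<mu> f) / c" by (rule norm_sq_le_q)
    also have "\<dots> \<le> K * (norm f)\<^sup>2 / c"
      using c_pos K(2)[of f] q_J[OF assms, of f] by (intro divide_right_mono) auto
    also have "\<dots> = (norm f * sqrt (K / c))\<^sup>2"
      using c_pos K(1) by (simp add: power_mult_distrib)
    finally show ?thesis
      using c_pos K(1) by (simp add: power2_le_iff_abs_le)
  qed
  then show ?thesis
    using assms by (intro bounded_linear_intro[where K = "sqrt (K / c)"]) (auto simp: J_add J_scaleR)
qed

lemma bounded_linear_Y: "\<mu> > 0 \<Longrightarrow> bounded_linear (Y \<mu>)"
  unfolding Y_def
  by (intro bounded_linear_scaleR_right bounded_linear_const_scaleR bounded_linear_sub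
      bounded_linear_J bounded_linear_ident)

text \<open>In f = J f - Y f / \<mu>, with Y f = A (J f), the first part contributes at most 0 by
  dissipativity and the second exactly - q (Y f) / \<mu>. So the bounded operators inherit
  dissipativity, which makes the later estimates uniform in \<mu>.\<close>

lemma q_Y_le: "\<mu> > 0 \<Longrightarrow> B (Y \<mu> f) f \<le> 0"
proof -
  assume \<mu>: "\<mu> > 0"
  have "f = J \<mu> f - Y \<mu> f /\<^sub>R \<mu>" using \<mu> by (simp add: Y_def)
  then have "B (Y \<mu> f) f = B (Y \<mu> f) (J \<mu> f) - q (Y \<mu> f) / \<mu>"
    by (metis B.diff_right B.scaleR_right q_def divide_inverse_commute real_scaleR_def)
  moreover have "B (Y \<mu> f) (J \<mu> f) \<le> 0"
    using dissipative[OF J_in_D] A_J \<mu> by metis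
  ultimately show ?thesis using \<mu> by (smt (verit) divide_nonneg_pos q_nonneg)
qed

text \<open>Put f = u - A u / \<mu>, so that \<open>J \<mu> f\<close> = u, and expand by linearity.
  Together with \<open>q_J\<close> this bounds \<open>Y \<mu>\<close> on \<open>D\<close> uniformly
  in \<mu>.\<close>

lemma J_A: assumes "\<mu> > 0" "u \<in> D" shows "J \<mu> (A u) = Y \<mu> u"
proof -
  have "J \<mu> (u - A u /\<^sub>R \<mu>) = u" using assms by (intro J_unique) auto
  then have "J \<mu> u - J \<mu> (A u) /\<^sub>R \<mu> = u"
    using assms bounded_linear_J[OF assms(1)]
    by (metis J_scaleR linear_simps(2))
  then have "J \<mu> (A u) /\<^sub>R \<mu> = J \<mu> u - u" by (simp add: algebra_simps)
  then have "\<mu> *\<^sub>R (J \<mu> (A u) /\<^sub>R \<mu>) = Y \<mu> u" by (simp add: Y_def)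
  then show ?thesis using assms by simp
qed

lemma J_Y: "\<mu> > 0 \<Longrightarrow> \<nu> > 0 \<Longrightarrow> J \<mu> (Y \<nu> u) = Y \<mu> (J \<nu> u)"
  using J_A[of \<mu> "J \<nu> u"] by (simp add: A_J J_in_D)

lemma q_Y_of_D: "\<mu> > 0 \<Longrightarrow> u \<in> D \<Longrightarrow> q (Y \<mu> u) \<le> q (A u)"
  using q_J[of \<mu> "A u"] by (simp add: J_A)

text \<open>Minty's trick: monotonicity alone makes \<open>J n f - f\<close> a Cauchy sequence, and its limit
  is killed by the injective resolvent.\<close>

lemma J_tendsto: "(\<lambda>n. J (real (Suc n)) f) \<longlonglongrightarrow> f"
proof -
  define a where "a = (\<lambda>\<mu>. J \<mu> f - f)"
  \<comment> \<open>Dissipativity at J \<mu> f - J \<nu> f, which \<open>A\<close> sends to \<mu> a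
    \<mu> - \<nu> a \<nu>; the mixed term is then eliminated through \<open>q_diff\<close>.\<close>
  have step: "q (a \<mu> - a \<nu>) \<le> (\<nu> - \<mu>) / (\<mu> + \<nu>) * (q (a \<mu>) - q (a \<nu>))" if "\<mu> > 0" "\<nu> > 0" for \<mu> \<nu>
  proof -
    have "B (A (J \<mu> f - J \<nu> f)) (J \<mu> f - J \<nu> f) \<le> 0"
      using that by (intro dissipative D_diff J_in_D)
    then have "B (\<mu> *\<^sub>R a \<mu> - \<nu> *\<^sub>R a \<nu>) (a \<mu> - a \<nu>) \<le> 0"
      using that by (simp add: A_diff J_in_D A_J Y_def a_def)
    then have "\<mu> * q (a \<mu>) + \<nu> * q (a \<nu>) \<le> (\<mu> + \<nu>) * B (a \<mu>) (a \<nu>)"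
      by (simp add: B.diff_left B.diff_right B.scaleR_left B.scaleR_right q_def B_sym[of "a \<nu>" "a \<mu>"] algebra_simps)
    then have "(\<mu> + \<nu>) * q (a \<mu> - a \<nu>) \<le> (\<nu> - \<mu>) * (q (a \<mu>) - q (a \<nu>))"
      unfolding q_diff by (simp add: algebra_simps)
    then show ?thesis using that by (simp add: field_simps)
  qed
  have mono: "q (a \<nu>) \<le> q (a \<mu>)" if "0 < \<mu>" "\<mu> \<le> \<nu>" for \<mu> \<nu>
  proof (cases "\<mu> = \<nu>")
    case False
    then have "0 \<le> (\<nu> - \<mu>) / (\<mu> + \<nu>) * (q (a \<mu>) - q (a \<nu>))"
      using step[of \<mu> \<nu>] that q_nonneg[of "a \<mu> - a \<nu>"] by linarith
    moreover have "(\<nu> - \<mu>) / (\<mu> + \<nu>) > 0" using that False by simp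
    ultimately show ?thesis by (smt (verit) zero_le_mult_iff)
  qed auto
  \<comment> \<open>For \<mu> \<le> \<nu> the factor in \<open>step\<close> lies between 0 and 1 and
    q (a \<mu>) decreases in \<mu>, so the convergence of these numbers controls the
    differences.\<close>
  have step': "q (a \<mu> - a \<nu>) \<le> q (a \<mu>) - q (a \<nu>)" if "0 < \<mu>" "\<mu> \<le> \<nu>" for \<mu> \<nu>
  proof -
    have "(\<nu> - \<mu>) / (\<mu> + \<nu>) * (q (a \<mu>) - q (a \<nu>)) \<le> 1 * (q (a \<mu>) - q (a \<nu>))"
      using that mono[OF that] by (intro mult_right_mono) auto
    then show ?thesis using step[of \<mu> \<nu>] that by auto
  qed
  define s where "s = (\<lambda>n. a (real (Suc n)))"
  have "decseq (\<lambda>n. q (s n))" by (auto simp: decseq_def s_def intro!: mono)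
  then obtain ql where "(\<lambda>n. q (s n)) \<longlonglongrightarrow> ql"
    using decseq_convergent[of "\<lambda>n. q (s n)" 0] by auto
  then have "convergent (\<lambda>n. q (s n))" by (rule convergentI)
  then have qC: "Cauchy (\<lambda>n. q (s n))" by (rule convergent_Cauchy)
  have "Cauchy s"
  proof (rule CauchyI')
    fix e :: real assume "e > 0"
    then have "c * e\<^sup>2 > 0" using c_pos by simp
    then obtain M where M: "\<And>m n. m \<ge> M \<Longrightarrow> n \<ge> M \<Longrightarrow> norm (q (s m) - q (s n)) < c * e\<^sup>2"
      using CauchyD[OF qC] by blast
    show "\<exists>M. \<forall>m\<ge>M. \<forall>n>m. dist (s m) (s n) < e"
    proof (intro exI allI impI)
      fix m n assume mn: "m \<ge> M" "n > m"
      have "c * (norm (s m - s n))\<^sup>2 \<le> q (s m) - q (s n)"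
        using step'[of "real (Suc m)" "real (Suc n)"] coercive[of "s m - s n"] mn
        by (simp add: s_def q_def)
      also have "\<dots> < c * e\<^sup>2" using M[of m n] mn by auto
      finally show "dist (s m) (s n) < e"
        using c_pos \<open>e > 0\<close> by (simp add: dist_norm power2_less_imp_less)
    qed
  qed
  then obtain l where l: "s \<longlonglongrightarrow> l" by (auto simp: Cauchy_convergent_iff convergent_def)
  have "(\<lambda>n. J 1 (s n)) \<longlonglongrightarrow> J 1 l"
    by (rule bounded_linear.tendsto[OF bounded_linear_J l]) simp
  moreover have "(\<lambda>n. J 1 (s n)) \<longlonglongrightarrow> 0"
  proof -
    \<comment> \<open>\<open>s n\<close> is \<open>Y (Suc n) f\<close> divided by
      \<open>Suc n\<close>. Behind \<open>J 1\<close> the varying operators \<open>Y (Suc n)\<close>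
      turn into the single bounded \<open>Y 1\<close>, so the division sends everything to
      0.\<close>
    have eq: "J 1 (s n) = Y 1 (J (real (Suc n)) f) /\<^sub>R real (Suc n)" for n
    proof -
      have "s n = Y (real (Suc n)) f /\<^sub>R real (Suc n)" by (simp add: s_def a_def Y_def)
      then show ?thesis by (simp add: J_scaleR J_Y)
    qed
    have "(\<lambda>n. Y 1 (s n + f) /\<^sub>R real (Suc n)) \<longlonglongrightarrow> 0 *\<^sub>R Y 1 (l + f)"
      by (intro tendsto_scaleR bounded_linear.tendsto[OF bounded_linear_Y] tendsto_add l tendsto_const
          LIMSEQ_inverse_real_of_nat) simp
    then show ?thesis unfolding eq by (simp add: s_def a_def)
  qed
  ultimately have "J 1 l = 0" by (rule LIMSEQ_unique)
  then have "R 1 l = 0" by (simp add: J_def)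
  then have "l = 0" using R_eq[of 1 l] A_scaleR[of "R 1 l" 0] R_in_D[of 1 l] by simp
  then show ?thesis using l unfolding s_def a_def
    by (simp add: LIM_zero_iff)
qed

subsection \<open>Mild solutions\<close>

text \<open>The equation \<open>w' = A w + f\<close> is only required after smoothing by \<open>J \<mu>\<close>, where it makes sense
  for every continuous \<open>w\<close>.\<close>

definition mild :: "real \<Rightarrow> (real \<Rightarrow> 'a) \<Rightarrow> (real \<Rightarrow> 'a) \<Rightarrow> 'a \<Rightarrow> bool" where
  "mild T w f w0 \<longleftrightarrow> continuous_on {0..T} w \<and>
     (\<forall>\<mu>>0. \<forall>t\<in>{0..T}.
       ((\<lambda>s. Y \<mu> (w s) + J \<mu> (f s)) has_integral (J \<mu> (w t) - J \<mu> w0)) {0..t})"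

lemma mild_diff:
  assumes "mild T w f w0" "mild T v g v0"
  shows "mild T (\<lambda>t. w t - v t) (\<lambda>t. f t - g t) (w0 - v0)"
  unfolding mild_def
proof (intro conjI allI impI ballI)
  show "continuous_on {0..T} (\<lambda>t. w t - v t)"
    using assms by (auto simp: mild_def intro!: continuous_intros)
  fix \<mu> :: real and t assume \<mu>: "\<mu> > 0" and t: "t \<in> {0..T}"
  have "((\<lambda>s. (Y \<mu> (w s) + J \<mu> (f s)) - (Y \<mu> (v s) + J \<mu> (g s))) has_integral
      ((J \<mu> (w t) - J \<mu> w0) - (J \<mu> (v t) - J \<mu> v0))) {0..t}"
    using assms \<mu> t by (intro has_integral_diff) (auto simp: mild_def)
  then show "((\<lambda>s. Y \<mu> (w s - v s) + J \<mu> (f s - g s)) has_integral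
      (J \<mu> (w t - v t) - J \<mu> (w0 - v0))) {0..t}"
    by (simp add: linear_simps(2)[OF bounded_linear_J[OF \<mu>]] linear_simps(2)[OF bounded_linear_Y[OF \<mu>]]
        algebra_simps)
qed

text \<open>At t = 0 the integral is over a point, so \<open>J 1\<close> takes the same value at
  both sides, and the resolvent is injective.\<close>

lemma mild_initial:
  assumes "mild T w f w0" "T \<ge> 0"
  shows "w 0 = w0"
proof -
  have "((\<lambda>s. Y 1 (w s) + J 1 (f s)) has_integral (J 1 (w 0) - J 1 w0)) {0..0}"
    using assms unfolding mild_def by (metis atLeastAtMost_iff order_refl zero_less_one)
  then have "((\<lambda>s. Y 1 (w s) + J 1 (f s)) has_integral (J 1 (w 0) - J 1 w0)) (cbox 0 0)"
    by (simp only: cbox_interval)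
  then have "J 1 (w 0) - J 1 w0 = 0"
    by (rule has_integral_unique[OF _ has_integral_refl(1)])
  then have "R 1 (w 0) = R 1 w0" by (simp add: J_def)
  then show ?thesis by (metis R_eq zero_less_one)
qed

text \<open>The function itself need not be differentiable, but \<open>J \<mu> (d t)\<close> is,
  with derivative A (J d) + J f. Dissipativity removes \<open>A\<close>, Young's inequality splits
  the rest, and letting \<mu> tend to infinity returns to \<open>d\<close>.\<close>

lemma mild_energy:
  assumes w: "mild T d f d0" and f: "continuous_on {0..T} f" and t: "t \<in> {0..T}"
  shows "q (d t) \<le> q d0 + integral {0..t} (\<lambda>s. q (f s) + q (d s))"
proof (rule LIMSEQ_le_const2)
  show "(\<lambda>n. q (J (real (Suc n)) (d t))) \<longlonglongrightarrow> q (d t)"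
    by (intro tendsto_q J_tendsto)
  have d: "continuous_on {0..T} d" using w by (simp add: mild_def)
  have "q (J (real (Suc n)) (d t)) \<le> q d0 + integral {0..t} (\<lambda>s. q (f s) + q (d s))" for n
  proof -
    define \<mu> where "\<mu> = real (Suc n)"
    have \<mu>: "\<mu> > 0" by (simp add: \<mu>_def)
    define r where "r = (\<lambda>s. Y \<mu> (d s) + J \<mu> (f s))"
    define e where "e = (\<lambda>s. q (f s) + q (d s))"
    have r: "continuous_on {0..T} r" unfolding r_def
      by (intro continuous_intros bounded_linear.continuous_on[OF bounded_linear_Y[OF \<mu>]]
          bounded_linear.continuous_on[OF bounded_linear_J[OF \<mu>]] d f)
    have e: "continuous_on {0..T} e"
      unfolding e_def by (intro continuous_intros continuous_on_q d f)
    have Jd: "J \<mu> (d s) = J \<mu> d0 + integral {0..s} r" if "s \<in> {0..T}" for s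
    proof -
      have "(r has_integral (J \<mu> (d s) - J \<mu> d0)) {0..s}"
        using w \<mu> that by (simp add: mild_def r_def)
      then show ?thesis by (simp add: integral_unique)
    qed
    have der: "((\<lambda>s. J \<mu> (d s)) has_vector_derivative r s) (at s within {0..T})" if "s \<in> {0..T}" for s
    proof (rule has_vector_derivative_transform[OF that])
      show "((\<lambda>s. J \<mu> d0 + integral {0..s} r) has_vector_derivative r s) (at s within {0..T})"
        using integral_has_vector_derivative[OF r that] by (auto intro!: derivative_eq_intros)
    qed (simp add: Jd)
    define \<phi> where "\<phi> = (\<lambda>s. q (J \<mu> (d s)) - integral {0..s} e)"
    \<comment> \<open>With both constants 0 the Gronwall lemma says just that \<phi>
      decreases.\<close>
    have "\<phi> t \<le> exp (0 * t) * (\<phi> 0 + 0 * t)"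
    proof (rule differential_gronwall[OF _ _ _ _ t])
      fix s assume s: "s \<in> {0..T}"
      have "((\<lambda>s. integral {0..s} e) has_real_derivative e s) (at s within {0..T})"
        using integral_has_vector_derivative[OF e s]
        by (simp add: has_real_derivative_iff_has_vector_derivative)
      with q_has_derivative[OF der[OF s]]
      show "(\<phi> has_real_derivative (2 * B (r s) (J \<mu> (d s)) - e s)) (at s within {0..T})"
        unfolding \<phi>_def by (rule DERIV_diff)
      have "2 * B (r s) (J \<mu> (d s)) = 2 * B (A (J \<mu> (d s))) (J \<mu> (d s)) + 2 * B (J \<mu> (f s)) (J \<mu> (d s))"
        by (simp add: r_def B.add_left A_J \<mu>)
      also have "\<dots> \<le> 0 + (q (J \<mu> (f s)) + q (J \<mu> (d s)))"
        using dissipative[OF J_in_D[OF \<mu>]] young by (intro add_mono) (auto simp: mult_le_0_iff)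
      also have "\<dots> \<le> e s" unfolding e_def using q_J[OF \<mu>] by (simp add: add_mono)
      finally show "2 * B (r s) (J \<mu> (d s)) - e s \<le> 0 * \<phi> s + 0" by simp
    qed auto
    moreover have "\<phi> 0 \<le> q d0"
      using Jd[of 0] t q_J[OF \<mu>, of d0] by (simp add: \<phi>_def)
    ultimately show ?thesis by (simp add: \<phi>_def \<mu>_def e_def)
  qed
  then show "\<exists>N. \<forall>n\<ge>N. q (J (real (Suc n)) (d t)) \<le> q d0 + integral {0..t} (\<lambda>s. q (f s) + q (d s))"
    by blast
qed

text \<open>Only the integrated inequality is at hand, so Gronwall is applied to the primitive of q
  d, which is differentiable, and the result is put back into that inequality; hence the shape of
  the constant.\<close>

lemma mild_gronwall:
  assumes w: "mild T d f d0" and f: "continuous_on {0..T} f" and t: "t \<in> {0..T}"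
    and M: "M \<ge> 0" "\<And>t. t \<in> {0..T} \<Longrightarrow> q (f t) \<le> M * q (d t)"
  shows "q (d t) \<le> q d0 * (1 + (M + 1) * (exp ((M + 1) * T) * T))"
proof -
  define \<Phi> where "\<Phi> = (\<lambda>t. integral {0..t} (\<lambda>s. q (d s)))"
  have d: "continuous_on {0..T} (\<lambda>s. q (d s))" using w by (simp add: mild_def continuous_on_q)
  have le: "q (d s) \<le> q d0 + (M + 1) * \<Phi> s" if s: "s \<in> {0..T}" for s
  proof -
    have "integral {0..s} (\<lambda>s. q (f s) + q (d s)) \<le> integral {0..s} (\<lambda>s. (M + 1) * q (d s))"
    proof (intro integral_le integrable_continuous_interval)
      show "continuous_on {0..s} (\<lambda>s. q (f s) + q (d s))" "continuous_on {0..s} (\<lambda>s. (M + 1) * q (d s))"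
        using s by (auto intro!: continuous_intros continuous_on_subset[OF d]
            continuous_on_subset[OF continuous_on_q[OF f]])
      show "q (f r) + q (d r) \<le> (M + 1) * q (d r)" if "r \<in> {0..s}" for r
        using M(2)[of r] that s by (simp add: algebra_simps)
    qed
    with mild_energy[OF w f s] show ?thesis by (simp add: \<Phi>_def)
  qed
  have "\<Phi> t \<le> exp ((M + 1) * t) * (\<Phi> 0 + q d0 * t)"
  proof (rule differential_gronwall[OF _ _ _ _ t])
    show "(\<Phi> has_real_derivative q (d s)) (at s within {0..T})" if "s \<in> {0..T}" for s
      using integral_has_vector_derivative[OF d that]
      by (simp add: \<Phi>_def has_real_derivative_iff_has_vector_derivative)
  qed (use M le in \<open>auto simp: algebra_simps\<close>)
  also have "\<dots> \<le> exp ((M + 1) * T) * (q d0 * T)"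
    using t M by (intro mult_mono) (auto simp: \<Phi>_def intro!: mult_left_mono)
  finally have "(M + 1) * \<Phi> t \<le> (M + 1) * (exp ((M + 1) * T) * (q d0 * T))"
    using M by (intro mult_left_mono) auto
  then show ?thesis using le[OF t] by (simp add: algebra_simps)
qed

lemma mild_unique:
  assumes "mild T w f w0" "mild T v g w0" and "continuous_on {0..T} f" "continuous_on {0..T} g"
    and "M \<ge> 0" "\<And>t. t \<in> {0..T} \<Longrightarrow> q (f t - g t) \<le> M * q (w t - v t)" and "t \<in> {0..T}"
  shows "w t = v t"
proof -
  have "q (w t - v t) \<le> q (w0 - w0) * (1 + (M + 1) * (exp ((M + 1) * T) * T))"
    using assms by (intro mild_gronwall[OF mild_diff]) (auto intro!: continuous_intros)
  then show ?thesis using q_eq_0[of "w t - v t"] by simp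
qed

text \<open>Two sequences \<open>w\<close> and \<open>v\<close> with the same limit occur because in
  the Yosida scheme J \<nu> (Y \<mu> w) becomes Y \<nu> (J \<mu> w), so the two places of the
  equation carry different functions. All operators involved are bounded, so uniform limits pass
  through.\<close>

lemma mild_limit:
  assumes w: "uniform_limit {0..T} w w' sequentially" and v: "uniform_limit {0..T} v w' sequentially"
    and f: "uniform_limit {0..T} f f' sequentially" and w0: "w0 \<longlonglongrightarrow> w0'"
    and cont: "\<And>n. continuous_on {0..T} (w n)" "\<And>n. continuous_on {0..T} (v n)"
      "\<And>n. continuous_on {0..T} (f n)"
    and eq: "\<And>n \<mu> t. \<mu> > 0 \<Longrightarrow> t \<in> {0..T} \<Longrightarrow>
      ((\<lambda>s. Y \<mu> (v n s) + J \<mu> (f n s)) has_integral (J \<mu> (w n t) - J \<mu> (w0 n))) {0..t}"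
  shows "mild T w' f' w0'"
  unfolding mild_def
proof (intro conjI allI impI ballI)
  show "continuous_on {0..T} w'"
    by (rule uniform_limit_theorem[OF _ w]) (auto simp: cont)
  fix \<mu> :: real and t assume \<mu>: "\<mu> > 0" and t: "t \<in> {0..T}"
  have sub: "{0..t} \<subseteq> {0..T}" using t by auto
  have u: "uniform_limit {0..t} (\<lambda>n s. Y \<mu> (v n s) + J \<mu> (f n s)) (\<lambda>s. Y \<mu> (w' s) + J \<mu> (f' s)) sequentially"
    by (rule uniform_limit_on_subset[OF _ sub])
       (intro uniform_limit_add bounded_linear.uniform_limit[OF bounded_linear_Y[OF \<mu>]]
         bounded_linear.uniform_limit[OF bounded_linear_J[OF \<mu>]] v f)
  have c: "continuous_on {0..t} (\<lambda>s. Y \<mu> (v n s) + J \<mu> (f n s))" for n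
    by (rule continuous_on_subset[OF _ sub])
       (intro continuous_intros bounded_linear.continuous_on[OF bounded_linear_Y[OF \<mu>]]
         bounded_linear.continuous_on[OF bounded_linear_J[OF \<mu>]] cont)
  obtain I K where I: "\<And>n. ((\<lambda>s. Y \<mu> (v n s) + J \<mu> (f n s)) has_integral I n) {0..t}"
    and K: "((\<lambda>s. Y \<mu> (w' s) + J \<mu> (f' s)) has_integral K) {0..t}" and IK: "I \<longlonglongrightarrow> K"
    using uniform_limit_integral[OF u c] by auto
  have "I = (\<lambda>n. J \<mu> (w n t) - J \<mu> (w0 n))"
    by (rule ext) (rule has_integral_unique[OF I eq[OF \<mu> t]])
  moreover have "(\<lambda>n. J \<mu> (w n t) - J \<mu> (w0 n)) \<longlonglongrightarrow> J \<mu> (w' t) - J \<mu> w0'"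
    by (intro tendsto_diff bounded_linear.tendsto[OF bounded_linear_J[OF \<mu>]] w0
        tendsto_uniform_limitI[OF w t])
  ultimately have "K = J \<mu> (w' t) - J \<mu> w0'" using IK LIMSEQ_unique by blast
  with K show "((\<lambda>s. Y \<mu> (w' s) + J \<mu> (f' s)) has_integral (J \<mu> (w' t) - J \<mu> w0')) {0..t}" by simp
qed

subsection \<open>Existence of mild solutions\<close>

lemma uniformly_Cauchy_on_of_q:
  assumes "\<And>m n t. t \<in> S \<Longrightarrow> q (w m t - w n t) \<le> C * e m n"
    and "\<And>\<epsilon>. \<epsilon> > 0 \<Longrightarrow> \<exists>N. \<forall>m\<ge>N. \<forall>n\<ge>N. e m n < (\<epsilon>::real)" and "C > 0"
  shows "uniformly_Cauchy_on S w"
proof (rule uniformly_Cauchy_onI)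
  fix \<epsilon> :: real assume "\<epsilon> > 0"
  then have "c * \<epsilon>\<^sup>2 / C > 0" using c_pos \<open>C > 0\<close> by simp
  then obtain N where N: "\<forall>m\<ge>N. \<forall>n\<ge>N. e m n < c * \<epsilon>\<^sup>2 / C" using assms(2) by blast
  show "\<exists>N. \<forall>t\<in>S. \<forall>m\<ge>N. \<forall>n\<ge>N. dist (w m t) (w n t) < \<epsilon>"
  proof (intro exI ballI allI impI)
    fix t m n assume "t \<in> S" "m \<ge> N" "n \<ge> N"
    then have "c * (norm (w m t - w n t))\<^sup>2 \<le> C * e m n" "e m n < c * \<epsilon>\<^sup>2 / C"
      using coercive[of "w m t - w n t"] assms(1)[of t m n] N by (auto simp: q_def)
    then have "c * (norm (w m t - w n t))\<^sup>2 < c * \<epsilon>\<^sup>2"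
      using \<open>C > 0\<close> by (simp add: field_simps)
    then show "dist (w m t) (w n t) < \<epsilon>"
      using c_pos \<open>\<epsilon> > 0\<close> by (simp add: dist_norm power2_less_imp_less)
  qed
qed

end

section \<open>Evolution with Lipschitz forcing: Yosida approximation\<close>

text \<open>Lipschitz continuity is demanded in time as well: the a priori bound on
  \<open>Y \<mu>\<close> compares a solution with its time translates, and the forcing may change
  only by a multiple of the shift.\<close>

locale lipschitz_forcing = m_dissipative B A D c
  for B :: "'a::banach \<Rightarrow> 'a \<Rightarrow> real" and A D c +
  fixes F :: "real \<Rightarrow> 'a \<Rightarrow> 'a" and T L :: real
  assumes T_pos: "T > 0" and L_nonneg: "L \<ge> 0"
    and F_lipschitz: "t \<in> {0..T} \<Longrightarrow> s \<in> {0..T} \<Longrightarrow>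
      norm (F t x - F s y) \<le> L * (\<bar>t - s\<bar> + norm (x - y))"
begin

lemma F_continuous:
  assumes "continuous_on {0..T} w"
  shows "continuous_on {0..T} (\<lambda>t. F t (w t))"
  unfolding continuous_on_def
proof
  fix t assume t: "t \<in> {0..T}"
  have "(w \<longlongrightarrow> w t) (at t within {0..T})"
    using assms t by (simp add: continuous_on_def)
  then have "((\<lambda>s. L * (\<bar>s - t\<bar> + norm (w s - w t))) \<longlongrightarrow> L * (\<bar>t - t\<bar> + norm (w t - w t))) (at t within {0..T})"
    by (intro tendsto_mult tendsto_add tendsto_norm tendsto_rabs tendsto_diff tendsto_const tendsto_ident_at)
  then have lim: "((\<lambda>s. L * (\<bar>s - t\<bar> + norm (w s - w t))) \<longlongrightarrow> 0) (at t within {0..T})" by simp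
  have "((\<lambda>s. F s (w s) - F t (w t)) \<longlongrightarrow> 0) (at t within {0..T})"
  proof (rule Lim_null_comparison[OF _ lim])
    show "\<forall>\<^sub>F s in at t within {0..T}. norm (F s (w s) - F t (w t)) \<le> L * (\<bar>s - t\<bar> + norm (w s - w t))"
      unfolding eventually_at_filter
    proof (intro always_eventually allI impI)
      fix s assume "s \<in> {0..T}"
      then show "norm (F s (w s) - F t (w t)) \<le> L * (\<bar>s - t\<bar> + norm (w s - w t))"
        by (rule F_lipschitz[OF _ t])
    qed
  qed
  then show "((\<lambda>s. F s (w s)) \<longlongrightarrow> F t (w t)) (at t within {0..T})"
    by (rule LIM_zero_cancel)
qed

lemma F_uniform_limit:
  assumes "uniform_limit {0..T} w w' sequentially"
  shows "uniform_limit {0..T} (\<lambda>n t. F t (w n t)) (\<lambda>t. F t (w' t)) sequentially"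
proof (rule uniform_limitI)
  fix e :: real assume "e > 0"
  then have "e / (L + 1) > 0" using L_nonneg by simp
  then have "\<forall>\<^sub>F n in sequentially. \<forall>t\<in>{0..T}. dist (w n t) (w' t) < e / (L + 1)"
    using assms uniform_limitD by blast
  then show "\<forall>\<^sub>F n in sequentially. \<forall>t\<in>{0..T}. dist (F t (w n t)) (F t (w' t)) < e"
  proof eventually_elim
    case (elim n)
    show ?case
    proof
      fix t assume t: "t \<in> {0..T}"
      have "dist (F t (w n t)) (F t (w' t)) \<le> L * dist (w n t) (w' t)"
        using F_lipschitz[OF t t, of "w n t" "w' t"] by (simp add: dist_norm)
      also have "\<dots> \<le> (L + 1) * dist (w n t) (w' t)" by (intro mult_right_mono) auto
      also have "\<dots> < e" using elim t L_nonneg by (auto simp: field_simps)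
      finally show "dist (F t (w n t)) (F t (w' t)) < e" .
    qed
  qed
qed

text \<open>\<open>F_lipschitz\<close> restated for \<open>q\<close>, the quantity that the energy
  estimates follow, with one constant for time and space.\<close>

definition M :: real where
  "M = (SOME M. M \<ge> 0 \<and> (\<forall>t\<in>{0..T}. \<forall>s\<in>{0..T}. \<forall>x y. q (F t x - F s y) \<le> M * ((t - s)\<^sup>2 + q (x - y))))"

lemma M_nonneg: "M \<ge> 0"
  and q_F: "t \<in> {0..T} \<Longrightarrow> s \<in> {0..T} \<Longrightarrow> q (F t x - F s y) \<le> M * ((t - s)\<^sup>2 + q (x - y))"
proof -
  obtain K where K: "K > 0" "\<And>u. q u \<le> K * (norm u)\<^sup>2" using q_bound by blast
  define N where "N = 2 * K * L\<^sup>2 * (1 + 1 / c)"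
  have "N \<ge> 0 \<and> (\<forall>t\<in>{0..T}. \<forall>s\<in>{0..T}. \<forall>x y. q (F t x - F s y) \<le> N * ((t - s)\<^sup>2 + q (x - y)))"
  proof (intro conjI ballI allI)
    show "N \<ge> 0" using K c_pos by (simp add: N_def)
    fix t s x y assume ts: "t \<in> {0..T}" "s \<in> {0..T}"
    have "(norm (F t x - F s y))\<^sup>2 \<le> (L * (\<bar>t - s\<bar> + norm (x - y)))\<^sup>2"
      using F_lipschitz[OF ts] by (intro power_mono) auto
    also have "\<dots> = L\<^sup>2 * (\<bar>t - s\<bar> + norm (x - y))\<^sup>2" by (simp add: power_mult_distrib)
    also have "\<dots> \<le> L\<^sup>2 * (2 * ((t - s)\<^sup>2 + (norm (x - y))\<^sup>2))"
      using sum_squares_bound[of "\<bar>t - s\<bar>" "norm (x - y)"]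
      by (intro mult_left_mono) (auto simp: power2_sum)
    also have "\<dots> \<le> L\<^sup>2 * (2 * ((t - s)\<^sup>2 + q (x - y) / c))"
      using norm_sq_le_q by (intro mult_left_mono add_left_mono) auto
    also have "\<dots> \<le> L\<^sup>2 * (2 * ((1 + 1 / c) * ((t - s)\<^sup>2 + q (x - y))))"
      using c_pos by (intro mult_left_mono) (auto simp: algebra_simps)
    finally have "K * (norm (F t x - F s y))\<^sup>2 \<le> K * (L\<^sup>2 * (2 * ((1 + 1 / c) * ((t - s)\<^sup>2 + q (x - y)))))"
      using K(1) by (intro mult_left_mono) auto
    with K(2)[of "F t x - F s y"] show "q (F t x - F s y) \<le> N * ((t - s)\<^sup>2 + q (x - y))"
      by (simp add: N_def mult_ac)
  qed
  from someI[of "\<lambda>M. M \<ge> 0 \<and> (\<forall>t\<in>{0..T}. \<forall>s\<in>{0..T}. \<forall>x y. q (F t x - F s y) \<le> M * ((t - s)\<^sup>2 + q (x - y)))", OF this]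
  show "M \<ge> 0" "t \<in> {0..T} \<Longrightarrow> s \<in> {0..T} \<Longrightarrow> q (F t x - F s y) \<le> M * ((t - s)\<^sup>2 + q (x - y))"
    unfolding M_def by blast+
qed

lemma q_F_le: "t \<in> {0..T} \<Longrightarrow> q (F t x) \<le> 2 * (M * (T\<^sup>2 + q x)) + 2 * q (F 0 0)"
proof -
  assume t: "t \<in> {0..T}"
  have "q (F t x) \<le> 2 * q (F t x - F 0 0) + 2 * q (F 0 0)"
    using q_plus_le[of "F t x - F 0 0" "F 0 0"] by simp
  also have "q (F t x - F 0 0) \<le> M * (t\<^sup>2 + q x)" using q_F[OF t, of 0 x 0] t by simp
  also have "\<dots> \<le> M * (T\<^sup>2 + q x)"
    using t M_nonneg by (intro mult_left_mono add_right_mono power_mono) auto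
  finally show ?thesis by simp
qed

definition yosida :: "real \<Rightarrow> 'a \<Rightarrow> (real \<Rightarrow> 'a) \<Rightarrow> bool" where
  "yosida \<mu> w0 w \<longleftrightarrow> w 0 = w0 \<and>
     (\<forall>t\<in>{0..T}. (w has_vector_derivative (Y \<mu> (w t) + F t (w t))) (at t within {0..T}))"

lemma yosida_exists:
  assumes \<mu>: "\<mu> > 0" shows "\<exists>w. yosida \<mu> w0 w"
proof -
  obtain K where K: "K > 0" "\<And>x. norm (Y \<mu> x) \<le> norm x * K"
    using bounded_linear.pos_bounded[OF bounded_linear_Y[OF \<mu>]] by auto
  obtain w where "w 0 = w0"
    "\<And>t. t \<in> {0..T} \<Longrightarrow> (w has_vector_derivative (Y \<mu> (w t) + F t (w t))) (at t within {0..T})"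
  proof (rule picard_global[of T "K + L" "\<lambda>t x. Y \<mu> x + F t x" w0])
    show "continuous_on {0..T} (\<lambda>t. Y \<mu> (w t) + F t (w t))" if "continuous_on {0..T} w" for w
      by (intro continuous_intros F_continuous bounded_linear.continuous_on[OF bounded_linear_Y[OF \<mu>]] that)
    fix t x y assume t: "t \<in> {0..T}"
    have "norm (Y \<mu> x + F t x - (Y \<mu> y + F t y)) = norm (Y \<mu> (x - y) + (F t x - F t y))"
      by (simp add: linear_simps(2)[OF bounded_linear_Y[OF \<mu>]] algebra_simps)
    also have "\<dots> \<le> norm (x - y) * K + L * norm (x - y)"
      using K(2) F_lipschitz[OF t t, of x y] by (intro order_trans[OF norm_triangle_ineq] add_mono) auto
    finally show "norm (Y \<mu> x + F t x - (Y \<mu> y + F t y)) \<le> (K + L) * norm (x - y)"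
      by (simp add: algebra_simps)
  qed (use T_pos K L_nonneg in auto)
  then show ?thesis unfolding yosida_def by blast
qed

lemma yosida_continuous: "yosida \<mu> w0 w \<Longrightarrow> continuous_on {0..T} w"
  unfolding yosida_def
  by (metis continuous_on_eq_continuous_within has_vector_derivative_continuous)

text \<open>\<open>Y \<mu>\<close> is dissipative, so it drops out of the derivative of q w and the
  bound does not see \<mu>. In the exponent 2 M comes from \<open>q_F_le\<close> and 1 from Young's
  inequality.\<close>

lemma yosida_bounded:
  assumes w: "yosida \<mu> w0 w" and \<mu>: "\<mu> > 0" and t: "t \<in> {0..T}"
  shows "q (w t) \<le> exp ((2 * M + 1) * T) * (q w0 + (2 * (M * T\<^sup>2) + 2 * q (F 0 0)) * T)"
proof -
  have "q (w t) \<le> exp ((2 * M + 1) * t) * (q (w 0) + (2 * (M * T\<^sup>2) + 2 * q (F 0 0)) * t)"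
  proof (rule differential_gronwall[OF _ _ _ _ t])
    fix s assume s: "s \<in> {0..T}"
    show "((\<lambda>t. q (w t)) has_real_derivative 2 * B (Y \<mu> (w s) + F s (w s)) (w s)) (at s within {0..T})"
      using w s by (intro q_has_derivative) (auto simp: yosida_def)
    have "2 * B (Y \<mu> (w s) + F s (w s)) (w s) \<le> 0 + (q (F s (w s)) + q (w s))"
      using q_Y_le[OF \<mu>, of "w s"] young[of "F s (w s)" "w s"] by (simp add: B.add_left)
    then show "2 * B (Y \<mu> (w s) + F s (w s)) (w s) \<le> (2 * M + 1) * q (w s) + (2 * (M * T\<^sup>2) + 2 * q (F 0 0))"
      using q_F_le[OF s, of "w s"] by (simp add: algebra_simps)
  qed (use M_nonneg in auto)
  also have "\<dots> \<le> exp ((2 * M + 1) * T) * (q w0 + (2 * (M * T\<^sup>2) + 2 * q (F 0 0)) * T)"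
    using w t M_nonneg by (intro mult_mono add_mono) (auto simp: yosida_def intro!: mult_left_mono)
  finally show ?thesis .
qed

text \<open>A solution and its translate solve the same equation up to the time shift in
  \<open>F\<close>, which costs M s^2. Divided by s^2 with s tending to 0, this carries a bound on
  the derivative from time 0 to later times.\<close>

lemma yosida_increment:
  assumes w: "yosida \<mu> w0 w" and \<mu>: "\<mu> > 0" and s: "s > 0" and t: "t \<ge> 0" "t + s \<le> T"
  shows "q (w (t + s) - w t) \<le> exp ((M + 1) * T) * (q (w (0 + s) - w 0) + M * s\<^sup>2 * T)"
proof -
  have "q (w (t + s) - w t) \<le> exp ((M + 1) * t) * (q (w (0 + s) - w 0) + (M * s\<^sup>2) * t)"
  proof (rule differential_gronwall[where T = "T - s"])
    fix r assume r: "r \<in> {0..T - s}"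
    have d1: "(w has_vector_derivative (Y \<mu> (w r) + F r (w r))) (at r within {0..T - s})"
      by (rule has_vector_derivative_within_subset[of _ _ _ "{0..T}"]) (use w r s in \<open>auto simp: yosida_def\<close>)
    have "(w has_vector_derivative (Y \<mu> (w (r + s)) + F (r + s) (w (r + s)))) (at (r + s) within (\<lambda>t. t + s) ` {0..T - s})"
      by (rule has_vector_derivative_within_subset[of _ _ _ "{0..T}"]) (use w r s in \<open>auto simp: yosida_def\<close>)
    then have "(w \<circ> (\<lambda>t. t + s) has_vector_derivative 1 *\<^sub>R (Y \<mu> (w (r + s)) + F (r + s) (w (r + s)))) (at r within {0..T - s})"
      by (intro vector_diff_chain_within) (auto intro!: derivative_eq_intros)
    then have d2: "((\<lambda>t. w (t + s)) has_vector_derivative (Y \<mu> (w (r + s)) + F (r + s) (w (r + s)))) (at r within {0..T - s})"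
      by (simp add: o_def)
    show "((\<lambda>t. q (w (t + s) - w t)) has_real_derivative
        2 * B ((Y \<mu> (w (r + s)) + F (r + s) (w (r + s))) - (Y \<mu> (w r) + F r (w r))) (w (r + s) - w r)) (at r within {0..T - s})"
      by (intro q_has_derivative has_vector_derivative_diff d1 d2)
    have "2 * B ((Y \<mu> (w (r + s)) + F (r + s) (w (r + s))) - (Y \<mu> (w r) + F r (w r))) (w (r + s) - w r)
      = 2 * B (Y \<mu> (w (r + s) - w r)) (w (r + s) - w r) + 2 * B (F (r + s) (w (r + s)) - F r (w r)) (w (r + s) - w r)"
      by (simp add: linear_simps(2)[OF bounded_linear_Y[OF \<mu>]] B.add_left B.diff_left)
    also have "\<dots> \<le> 0 + (q (F (r + s) (w (r + s)) - F r (w r)) + q (w (r + s) - w r))"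
      using q_Y_le[OF \<mu>, of "w (r + s) - w r"] by (intro add_mono young) auto
    also have "\<dots> \<le> M * (s\<^sup>2 + q (w (r + s) - w r)) + q (w (r + s) - w r)"
      using q_F[of "r + s" r "w (r + s)" "w r"] r s by auto
    finally show "2 * B ((Y \<mu> (w (r + s)) + F (r + s) (w (r + s))) - (Y \<mu> (w r) + F r (w r))) (w (r + s) - w r)
      \<le> (M + 1) * q (w (r + s) - w r) + M * s\<^sup>2" by (simp add: algebra_simps)
  qed (use M_nonneg s t in auto)
  also have "\<dots> \<le> exp ((M + 1) * T) * (q (w (0 + s) - w 0) + M * s\<^sup>2 * T)"
    using s t M_nonneg by (intro mult_mono add_mono) (auto intro!: mult_left_mono)
  finally show ?thesis .
qed

text \<open>The bound does not depend on \<open>\<mu>\<close>: it comes from comparing \<open>w\<close> with its time translates.\<close>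

lemma yosida_regular:
  assumes "w0 \<in> D"
  shows "\<exists>C>0. \<forall>\<mu>>0. \<forall>w. yosida \<mu> w0 w \<longrightarrow> (\<forall>t\<in>{0..T}. q (Y \<mu> (w t)) \<le> C)"
proof -
  define C0 where "C0 = exp ((2 * M + 1) * T) * (q w0 + (2 * (M * T\<^sup>2) + 2 * q (F 0 0)) * T)"
  define C1 where "C1 = 2 * (M * (T\<^sup>2 + C0)) + 2 * q (F 0 0)"
  define C2 where "C2 = exp ((M + 1) * T) * (2 * q (A w0) + 2 * q (F 0 w0) + M * T)"
  have main: "q (Y \<mu> (w t)) \<le> 2 * C2 + 2 * C1"
    if \<mu>: "\<mu> > 0" and w: "yosida \<mu> w0 w" and t: "t \<in> {0..<T}" for \<mu> w t
  proof -
    \<comment> \<open>Steps that keep t + s n inside [0,T]. This needs t < T; the end point is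
      recovered afterwards by continuity.\<close>
    define s where "s = (\<lambda>n. (T - t) / real (Suc n))"
    have s: "s n > 0" "s n \<le> T - t" "s n \<le> T" for n
    proof -
      show "s n > 0" unfolding s_def using t by (intro divide_pos_pos) auto
      show le: "s n \<le> T - t"
        unfolding s_def using t mult_left_mono[of 1 "real (Suc n)" "T - t"]
        by (subst pos_divide_le_eq) auto
      show "s n \<le> T" using le t by simp
    qed
    have s0: "s \<longlonglongrightarrow> 0"
      unfolding s_def divide_inverse by (rule tendsto_mult_right_zero[OF LIMSEQ_inverse_real_of_nat])
    have lim: "(\<lambda>n. q ((w (r + s n) - w r) /\<^sub>R s n)) \<longlonglongrightarrow> q (Y \<mu> (w r) + F r (w r))"
      if r: "0 \<le> r" "r \<le> t" for r
    proof (intro tendsto_q has_vector_derivative_sequence[where S = "{0..T}"] s0 s(1))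
      show "(w has_vector_derivative (Y \<mu> (w r) + F r (w r))) (at r within {0..T})"
        using w r t by (simp add: yosida_def)
      show "r + s n \<in> {0..T}" for n using s(1,2)[of n] r by simp
    qed
    have "q (Y \<mu> (w t) + F t (w t)) \<le> exp ((M + 1) * T) * (q (Y \<mu> (w 0) + F 0 (w 0)) + M * T)"
    proof (rule LIMSEQ_le[OF lim[of t]])
      show "(\<lambda>n. exp ((M + 1) * T) * (q ((w (0 + s n) - w 0) /\<^sub>R s n) + M * T))
          \<longlonglongrightarrow> exp ((M + 1) * T) * (q (Y \<mu> (w 0) + F 0 (w 0)) + M * T)"
        using t by (intro tendsto_mult tendsto_add tendsto_const lim) auto
      have "q ((w (t + s n) - w t) /\<^sub>R s n) \<le> exp ((M + 1) * T) * (q ((w (0 + s n) - w 0) /\<^sub>R s n) + M * T)" for n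
      proof -
        have "q (w (t + s n) - w t) / (s n)\<^sup>2 \<le>
            exp ((M + 1) * T) * (q (w (0 + s n) - w 0) + M * (s n)\<^sup>2 * T) / (s n)\<^sup>2"
          using t s(2)[of n] by (intro divide_right_mono yosida_increment[OF w \<mu> s(1)]) auto
        also have "\<dots> = exp ((M + 1) * T) * (q (w (0 + s n) - w 0) / (s n)\<^sup>2 + M * T)"
          using s(1)[of n] by (simp add: field_simps)
        finally show ?thesis by (simp add: q_scaleR power_inverse divide_inverse mult.commute)
      qed
      then show "\<exists>N. \<forall>n\<ge>N. q ((w (t + s n) - w t) /\<^sub>R s n)
          \<le> exp ((M + 1) * T) * (q ((w (0 + s n) - w 0) /\<^sub>R s n) + M * T)" by blast
    qed (use t in auto)
    also have "\<dots> \<le> C2"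
    proof -
      \<comment> \<open>Here w0 \<in> D enters: on the domain \<open>Y \<mu> w0\<close> is bounded
        by \<open>A w0\<close> for all \<mu>.\<close>
      have "q (Y \<mu> (w 0) + F 0 (w 0)) \<le> 2 * q (A w0) + 2 * q (F 0 w0)"
        using q_plus_le[of "Y \<mu> w0" "F 0 w0"] q_Y_of_D[OF \<mu> assms] w by (simp add: yosida_def)
      then show ?thesis unfolding C2_def by (intro mult_left_mono add_right_mono) auto
    qed
    finally have *: "q (Y \<mu> (w t) + F t (w t)) \<le> C2" .
    have "q (F t (w t)) \<le> 2 * (M * (T\<^sup>2 + q (w t))) + 2 * q (F 0 0)" using t by (intro q_F_le) auto
    also have "\<dots> \<le> C1"
      unfolding C1_def C0_def using yosida_bounded[OF w \<mu>, of t] t M_nonneg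
      by (intro add_right_mono mult_left_mono add_left_mono) auto
    finally show ?thesis using * q_diff_le[of "Y \<mu> (w t) + F t (w t)" "F t (w t)"] by simp
  qed
  have "q (Y \<mu> (w t)) \<le> 2 * C2 + 2 * C1"
    if \<mu>: "\<mu> > 0" and w: "yosida \<mu> w0 w" and t: "t \<in> {0..T}" for \<mu> w t
  proof (rule continuous_le_on_closure[where S = "{0..<T}" and f = "\<lambda>t. q (Y \<mu> (w t))"])
    have "closure {0..<T} = {0..T}" using T_pos by simp
    then show "continuous_on (closure {0..<T}) (\<lambda>t. q (Y \<mu> (w t)))" "t \<in> closure {0..<T}"
      using t by (auto intro!: continuous_on_q bounded_linear.continuous_on[OF bounded_linear_Y[OF \<mu>]]
          yosida_continuous[OF w])
  qed (use main \<mu> w in auto)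
  then show ?thesis by (intro exI[of _ "max 1 (2 * C2 + 2 * C1)"]) (auto simp: le_max_iff_disj)
qed

text \<open>The difference w - v is split into J w - J v, which \<open>A\<close> sends to Y w - Y v
  so that dissipativity applies, and Y w / \<mu> - Y v / \<nu>, which is small because
  \<open>Y\<close> is bounded by \<open>C\<close> along both solutions.\<close>

lemma yosida_difference:
  assumes w: "yosida \<mu> w0 w" and v: "yosida \<nu> w0 v" and \<mu>: "\<mu> > 0" and \<nu>: "\<nu> > 0"
    and C: "\<And>t. t \<in> {0..T} \<Longrightarrow> q (Y \<mu> (w t)) \<le> C" "\<And>t. t \<in> {0..T} \<Longrightarrow> q (Y \<nu> (v t)) \<le> C"
    and t: "t \<in> {0..T}"
  shows "q (w t - v t) \<le> exp ((M + 1) * T) * (2 * C * T) * (1 / \<mu> + 1 / \<nu>)"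
proof -
  have C0: "C \<ge> 0" using C(1)[OF t] q_nonneg order_trans by blast
  have "q (w t - v t) \<le> exp ((M + 1) * t) * (q (w 0 - v 0) + (2 * C * (1 / \<mu> + 1 / \<nu>)) * t)"
  proof (rule differential_gronwall[OF _ _ _ _ t])
    fix s assume s: "s \<in> {0..T}"
    let ?a = "Y \<mu> (w s)" and ?b = "Y \<nu> (v s)"
    show "((\<lambda>t. q (w t - v t)) has_real_derivative
        2 * B ((?a + F s (w s)) - (?b + F s (v s))) (w s - v s)) (at s within {0..T})"
      using w v s by (intro q_has_derivative has_vector_derivative_diff) (auto simp: yosida_def)
    have "w s - v s = (J \<mu> (w s) - J \<nu> (v s)) - (?a /\<^sub>R \<mu> - ?b /\<^sub>R \<nu>)"
      using \<mu> \<nu> by (simp add: Y_def)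
    then have "B (?a - ?b) (w s - v s) = B (?a - ?b) ((J \<mu> (w s) - J \<nu> (v s)) - (?a /\<^sub>R \<mu> - ?b /\<^sub>R \<nu>))"
      by (rule arg_cong)
    also have "\<dots> = B (?a - ?b) (J \<mu> (w s) - J \<nu> (v s)) - B (?a - ?b) (?a /\<^sub>R \<mu> - ?b /\<^sub>R \<nu>)"
      by (rule B.diff_right)
    also have "B (?a - ?b) (J \<mu> (w s) - J \<nu> (v s)) \<le> 0"
    proof -
      have "A (J \<mu> (w s) - J \<nu> (v s)) = ?a - ?b"
        using A_diff[OF J_in_D[OF \<mu>] J_in_D[OF \<nu>]] A_J[OF \<mu>] A_J[OF \<nu>] by simp
      then show ?thesis
        using dissipative[OF D_diff[OF J_in_D[OF \<mu>, of "w s"] J_in_D[OF \<nu>, of "v s"]]] by simp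
    qed
    also have "0 - B (?a - ?b) (?a /\<^sub>R \<mu> - ?b /\<^sub>R \<nu>)
        = - (q ?a / \<mu> + q ?b / \<nu>) + B ?a ?b * (1 / \<mu> + 1 / \<nu>)"
    proof -
      \<comment> \<open>Here x, y stand for the inverses of \<mu>, \<nu>. The squares come out with
        the good sign, so only the mixed term B a b has to be bounded.\<close>
      have gen: "0 - ((x * p - y * r) - (x * r - y * s)) = - (p * x + s * y) + r * (1 * x + 1 * y)"
        for p r s x y :: real by (simp add: algebra_simps)
      have "B (?a - ?b) (?a /\<^sub>R \<mu> - ?b /\<^sub>R \<nu>)
          = (inverse \<mu> * q ?a - inverse \<nu> * B ?a ?b) - (inverse \<mu> * B ?a ?b - inverse \<nu> * q ?b)"
        unfolding q_def by (subst B.diff_left) (simp only: B.diff_right B.scaleR_right real_scaleR_def B_sym[of ?b ?a])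
      then show ?thesis unfolding divide_inverse by (simp only: gen)
    qed
    also have "\<dots> \<le> 0 + C * (1 / \<mu> + 1 / \<nu>)"
    proof (intro add_mono mult_right_mono)
      show "- (q ?a / \<mu> + q ?b / \<nu>) \<le> 0"
        using \<mu> \<nu> by (smt (verit) divide_nonneg_pos q_nonneg)
      show "B ?a ?b \<le> C" using young[of ?a ?b] C(1)[OF s] C(2)[OF s] by linarith
    qed (use \<mu> \<nu> in simp)
    finally have *: "2 * B (?a - ?b) (w s - v s) \<le> 2 * C * (1 / \<mu> + 1 / \<nu>)" by simp
    have "2 * B ((?a + F s (w s)) - (?b + F s (v s))) (w s - v s)
        = 2 * B (?a - ?b) (w s - v s) + 2 * B (F s (w s) - F s (v s)) (w s - v s)"
      by (simp add: B.add_left B.diff_left)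
    also have "\<dots> \<le> 2 * C * (1 / \<mu> + 1 / \<nu>) + (q (F s (w s) - F s (v s)) + q (w s - v s))"
      by (intro add_mono * young)
    also have "\<dots> \<le> (M + 1) * q (w s - v s) + 2 * C * (1 / \<mu> + 1 / \<nu>)"
      using q_F[OF s s, of "w s" "v s"] by (simp add: algebra_simps)
    finally show "2 * B ((?a + F s (w s)) - (?b + F s (v s))) (w s - v s)
        \<le> (M + 1) * q (w s - v s) + 2 * C * (1 / \<mu> + 1 / \<nu>)" .
  qed (use M_nonneg C0 \<mu> \<nu> in auto)
  also have "\<dots> \<le> exp ((M + 1) * T) * (0 + (2 * C * (1 / \<mu> + 1 / \<nu>)) * T)"
    using w v t M_nonneg C0 \<mu> \<nu> by (intro mult_mono add_mono) (auto simp: yosida_def intro!: mult_left_mono)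
  also have "\<dots> = exp ((M + 1) * T) * (2 * C * T) * (1 / \<mu> + 1 / \<nu>)"
    by (simp only: add_0_left mult_ac)
  finally show ?thesis .
qed

lemma mild_exists_regular:
  assumes w0: "w0 \<in> D"
  shows "\<exists>w. mild T w (\<lambda>t. F t (w t)) w0"
proof -
  define \<mu> where "\<mu> = (\<lambda>n. real (Suc n))"
  have \<mu>: "\<mu> n > 0" for n by (simp add: \<mu>_def)
  have \<mu>_lim: "(\<lambda>n. 1 / \<mu> n) \<longlonglongrightarrow> 0"
    using LIMSEQ_inverse_real_of_nat by (simp add: \<mu>_def inverse_eq_divide)
  have "\<forall>n. \<exists>w. yosida (\<mu> n) w0 w" using yosida_exists[OF \<mu>] by blast
  from choice[OF this] obtain w where w: "\<And>n. yosida (\<mu> n) w0 (w n)" by blast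
  obtain C where "C > 0" "\<forall>\<mu>>0. \<forall>w. yosida \<mu> w0 w \<longrightarrow> (\<forall>t\<in>{0..T}. q (Y \<mu> (w t)) \<le> C)"
    using yosida_regular[OF w0] by blast
  then have C: "C > 0" "\<And>n t. t \<in> {0..T} \<Longrightarrow> q (Y (\<mu> n) (w n t)) \<le> C"
    using \<mu> w by blast+
  have wc: "continuous_on {0..T} (w n)" for n by (rule yosida_continuous[OF w])
  have "uniformly_Cauchy_on {0..T} w"
  proof (rule uniformly_Cauchy_on_of_q)
    show "q (w m t - w n t) \<le> exp ((M + 1) * T) * (2 * C * T) * (1 / \<mu> m + 1 / \<mu> n)" if "t \<in> {0..T}" for m n t
      using C that \<mu> w by (intro yosida_difference) auto
    show "exp ((M + 1) * T) * (2 * C * T) > 0" using C T_pos by simp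
    fix \<epsilon> :: real assume "\<epsilon> > 0"
    then have "\<forall>\<^sub>F n in sequentially. 1 / \<mu> n < \<epsilon> / 2" using \<mu>_lim order_tendstoD(2) half_gt_zero by blast
    then obtain N where N: "1 / \<mu> n < \<epsilon> / 2" if "n \<ge> N" for n
      unfolding eventually_sequentially by blast
    show "\<exists>N. \<forall>m\<ge>N. \<forall>n\<ge>N. 1 / \<mu> m + 1 / \<mu> n < \<epsilon>"
    proof (intro exI allI impI)
      show "1 / \<mu> m + 1 / \<mu> n < \<epsilon>" if "m \<ge> N" "n \<ge> N" for m n
        using N[OF that(1)] N[OF that(2)] by linarith
    qed
  qed
  then obtain w' where w': "uniform_limit {0..T} w w' sequentially"
    using Cauchy_uniformly_convergent uniformly_convergent_on_def by blast
  \<comment> \<open>Since J \<nu> (Y \<mu> w) = Y \<nu> (J \<mu> w), it is J \<mu> w that enters the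
    limit equation. It differs from w by Y w / \<mu>, which tends to 0 uniformly.\<close>
  define v where "v = (\<lambda>n t. J (\<mu> n) (w n t))"
  have vw: "v n t = w n t + Y (\<mu> n) (w n t) /\<^sub>R \<mu> n" for n t
    using \<mu>[of n] by (simp add: v_def Y_def)
  have "uniform_limit {0..T} (\<lambda>n t. Y (\<mu> n) (w n t) /\<^sub>R \<mu> n) (\<lambda>t. 0) sequentially"
  proof (rule uniform_limitI)
    fix e :: real assume "e > 0"
    have "(\<lambda>n. sqrt (C / c) * (1 / \<mu> n)) \<longlonglongrightarrow> sqrt (C / c) * 0" by (intro tendsto_intros \<mu>_lim)
    then have "\<forall>\<^sub>F n in sequentially. sqrt (C / c) * (1 / \<mu> n) < e"
      using \<open>e > 0\<close> order_tendstoD(2) by fastforce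
    then show "\<forall>\<^sub>F n in sequentially. \<forall>t\<in>{0..T}. dist (Y (\<mu> n) (w n t) /\<^sub>R \<mu> n) 0 < e"
    proof eventually_elim
      case (elim n)
      show ?case
      proof
        fix t assume t: "t \<in> {0..T}"
        have "(norm (Y (\<mu> n) (w n t)))\<^sup>2 \<le> C / c"
          using norm_sq_le_q[of "Y (\<mu> n) (w n t)"] divide_right_mono[OF C(2)[OF t, of n], of c] c_pos
          by linarith
        then have "norm (Y (\<mu> n) (w n t)) \<le> sqrt (C / c)" by (rule real_le_rsqrt)
        then have "norm (Y (\<mu> n) (w n t)) * (1 / \<mu> n) \<le> sqrt (C / c) * (1 / \<mu> n)"
          using \<mu>[of n] by (intro mult_right_mono) auto
        moreover have "dist (Y (\<mu> n) (w n t) /\<^sub>R \<mu> n) 0 = norm (Y (\<mu> n) (w n t)) * (1 / \<mu> n)"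
          using \<mu>[of n] by (simp add: divide_inverse)
        ultimately show "dist (Y (\<mu> n) (w n t) /\<^sub>R \<mu> n) 0 < e" using elim by linarith
      qed
    qed
  qed
  from uniform_limit_add[OF w' this] have v: "uniform_limit {0..T} v w' sequentially"
    by (simp add: vw[abs_def])
  have "mild T w' (\<lambda>t. F t (w' t)) w0"
  proof (rule mild_limit[OF w' v F_uniform_limit[OF w'] tendsto_const])
    fix n \<nu> t assume \<nu>: "(\<nu>::real) > 0" and t: "t \<in> {0..T}"
    have "((\<lambda>s. Y (\<mu> n) (w n s) + F s (w n s)) has_integral (w n t - w n 0)) {0..t}"
    proof (rule fundamental_theorem_of_calculus)
      show "(w n has_vector_derivative Y (\<mu> n) (w n s) + F s (w n s)) (at s within {0..t})" if "s \<in> {0..t}" for s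
        by (rule has_vector_derivative_within_subset[of _ _ _ "{0..T}"])
           (use w[of n] t that in \<open>auto simp: yosida_def\<close>)
    qed (use t in simp)
    from has_integral_linear[OF this bounded_linear_J[OF \<nu>]]
    show "((\<lambda>s. Y \<nu> (v n s) + J \<nu> (F s (w n s))) has_integral (J \<nu> (w n t) - J \<nu> w0)) {0..t}"
      using w[of n] \<nu> \<mu>[of n]
      by (simp add: o_def v_def J_add J_Y linear_simps(2)[OF bounded_linear_J[OF \<nu>]] yosida_def)
  next
    show "continuous_on {0..T} (v n)" for n
      unfolding v_def by (intro bounded_linear.continuous_on[OF bounded_linear_J[OF \<mu>]] wc)
  qed (intro wc F_continuous)+
  then show ?thesis by blast
qed

text \<open>Initial values outside \<open>D\<close> are approximated by \<open>J n w0\<close>, and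
  \<open>mild_gronwall\<close> makes the corresponding solutions uniformly Cauchy. Being a mild
  solution is preserved in this limit.\<close>

theorem mild_exists: "\<exists>w. mild T w (\<lambda>t. F t (w t)) w0"
proof -
  define v where "v = (\<lambda>n. J (real (Suc n)) w0)"
  have v: "v \<longlonglongrightarrow> w0" unfolding v_def by (rule J_tendsto)
  have "v n \<in> D" for n by (simp add: v_def J_in_D)
  then have "\<forall>n. \<exists>w. mild T w (\<lambda>t. F t (w t)) (v n)" using mild_exists_regular by blast
  from choice[OF this] obtain w where w: "\<And>n. mild T (w n) (\<lambda>t. F t (w n t)) (v n)" by blast
  have wc: "continuous_on {0..T} (w n)" for n using w by (simp add: mild_def)
  have "uniformly_Cauchy_on {0..T} w"
  proof (rule uniformly_Cauchy_on_of_q)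
    show "1 + (M + 1) * (exp ((M + 1) * T) * T) > 0"
      using M_nonneg T_pos by (simp add: add_pos_nonneg)
    show "q (w m t - w n t) \<le> (1 + (M + 1) * (exp ((M + 1) * T) * T)) * q (v m - v n)"
      if "t \<in> {0..T}" for m n t
    proof -
      have "q (w m t - w n t) \<le> q (v m - v n) * (1 + (M + 1) * (exp ((M + 1) * T) * T))"
      proof (rule mild_gronwall[OF mild_diff[OF w w] _ that M_nonneg])
        show "continuous_on {0..T} (\<lambda>t. F t (w m t) - F t (w n t))"
          by (intro continuous_on_diff F_continuous wc)
        show "q (F t (w m t) - F t (w n t)) \<le> M * q (w m t - w n t)" if "t \<in> {0..T}" for t
          using q_F[OF that that, of "w m t" "w n t"] by simp
      qed
      then show ?thesis by (simp add: mult.commute)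
    qed
    fix \<epsilon> :: real assume \<epsilon>: "\<epsilon> > 0"
    obtain K where K: "K > 0" "\<And>u. q u \<le> K * (norm u)\<^sup>2" using q_bound by blast
    have "Cauchy v" using v by (rule LIMSEQ_imp_Cauchy)
    then obtain N where N: "\<forall>m\<ge>N. \<forall>n\<ge>N. norm (v m - v n) < sqrt (\<epsilon> / K)"
      using CauchyD[of v "sqrt (\<epsilon> / K)"] \<epsilon> K by auto
    have "q (v m - v n) < \<epsilon>" if "m \<ge> N" "n \<ge> N" for m n
    proof -
      have "(norm (v m - v n))\<^sup>2 < (sqrt (\<epsilon> / K))\<^sup>2"
        using N that by (intro power_strict_mono) auto
      then have "K * (norm (v m - v n))\<^sup>2 < \<epsilon>" using \<epsilon> K(1) by (simp add: field_simps)
      with K(2)[of "v m - v n"] show ?thesis by linarith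
    qed
    then show "\<exists>N. \<forall>m\<ge>N. \<forall>n\<ge>N. q (v m - v n) < \<epsilon>" by blast
  qed
  then obtain w' where w': "uniform_limit {0..T} w w' sequentially"
    using Cauchy_uniformly_convergent uniformly_convergent_on_def by blast
  have "mild T w' (\<lambda>t. F t (w' t)) w0"
  proof (rule mild_limit[OF w' w' F_uniform_limit[OF w'] v wc wc])
    show "continuous_on {0..T} (\<lambda>t. F t (w n t))" for n by (rule F_continuous[OF wc])
    show "((\<lambda>s. Y \<mu> (w n s) + J \<mu> (F s (w n s))) has_integral J \<mu> (w n t) - J \<mu> (v n)) {0..t}"
      if "\<mu> > 0" "t \<in> {0..T}" for \<mu> t n
      using w[of n] that unfolding mild_def by blast
  qed
  then show ?thesis by blast
qed

end

subsection \<open>Square-integrable functions on the half-line\<close>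

lemma L2_measurable: "f \<in> L2 \<Longrightarrow> f \<in> borel_measurable halfline"
  and L2_integrable: "f \<in> L2 \<Longrightarrow> integrable halfline (\<lambda>x. (cmod (f x))\<^sup>2)"
  by (auto simp: L2_def)

lemma L2I_bound:
  assumes "f \<in> borel_measurable halfline" "integrable halfline g"
    and "\<And>x. x > 0 \<Longrightarrow> (cmod (f x))\<^sup>2 \<le> g x"
  shows "f \<in> L2"
  unfolding L2_def
proof (intro CollectI conjI)
  show "integrable halfline (\<lambda>x. (cmod (f x))\<^sup>2)"
  proof (rule Bochner_Integration.integrable_bound[OF assms(2)])
    show "(\<lambda>x. (cmod (f x))\<^sup>2) \<in> borel_measurable halfline" using assms(1) by measurable
    show "AE x in halfline. norm ((cmod (f x))\<^sup>2) \<le> norm (g x)"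
      using assms(3) by (intro AE_I2) (fastforce intro: order_trans[OF _ abs_ge_self])
  qed
qed (rule assms)

lemma norm_add_sq_le: "(cmod (a + b))\<^sup>2 \<le> 2 * (cmod a)\<^sup>2 + 2 * (cmod b)\<^sup>2"
proof -
  have "(cmod (a + b))\<^sup>2 \<le> (cmod a + cmod b)\<^sup>2" by (intro power_mono norm_triangle_ineq) auto
  also have "\<dots> \<le> 2 * (cmod a)\<^sup>2 + 2 * (cmod b)\<^sup>2"
    using sum_squares_bound[of "cmod a" "cmod b"] by (simp add: power2_sum)
  finally show ?thesis .
qed

lemma L2_zero [simp]: "(\<lambda>x. 0) \<in> L2" by (simp add: L2_def)

lemma L2_add: assumes "f \<in> L2" "g \<in> L2" shows "(\<lambda>x. f x + g x) \<in> L2"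
proof (rule L2I_bound)
  show "(\<lambda>x. f x + g x) \<in> borel_measurable halfline"
    using assms[THEN L2_measurable] by measurable
  show "integrable halfline (\<lambda>x. 2 * (cmod (f x))\<^sup>2 + 2 * (cmod (g x))\<^sup>2)"
    using assms[THEN L2_integrable] by auto
qed (rule norm_add_sq_le)

lemma L2_mult_bounded:
  assumes "f \<in> L2" "b \<in> borel_measurable halfline" "\<And>x. x > 0 \<Longrightarrow> cmod (b x) \<le> C"
  shows "(\<lambda>x. b x * f x) \<in> L2"
proof (rule L2I_bound)
  show "(\<lambda>x. b x * f x) \<in> borel_measurable halfline"
    using L2_measurable[OF assms(1)] assms(2) by measurable
  show "integrable halfline (\<lambda>x. C\<^sup>2 * (cmod (f x))\<^sup>2)" using L2_integrable[OF assms(1)] by auto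
  show "(cmod (b x * f x))\<^sup>2 \<le> C\<^sup>2 * (cmod (f x))\<^sup>2" if "x > 0" for x
    using assms(3)[OF that] by (simp add: norm_mult power_mult_distrib mult_right_mono power_mono)
qed

lemma L2_cmult: "f \<in> L2 \<Longrightarrow> (\<lambda>x. c * f x) \<in> L2"
  by (rule L2_mult_bounded[where C = "cmod c"]) auto

lemma L2_scaleR: "f \<in> L2 \<Longrightarrow> (\<lambda>x. r *\<^sub>R f x) \<in> L2"
  using L2_cmult[of f "of_real r"] by (simp add: scaleR_conv_of_real)

lemma L2_uminus: "f \<in> L2 \<Longrightarrow> (\<lambda>x. - f x) \<in> L2"
  using L2_cmult[of f "-1"] by simp

lemma L2_diff: "f \<in> L2 \<Longrightarrow> g \<in> L2 \<Longrightarrow> (\<lambda>x. f x - g x) \<in> L2"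
  using L2_add[OF _ L2_uminus, of f g] by simp

lemma L2_cnj: assumes "f \<in> L2" shows "(\<lambda>x. cnj (f x)) \<in> L2"
proof -
  have "cnj \<in> borel_measurable borel"
    by (intro borel_measurable_continuous_onI continuous_on_cnj continuous_on_id)
  then have "(\<lambda>x. cnj (f x)) \<in> borel_measurable halfline"
    by (rule measurable_compose[OF L2_measurable[OF assms]])
  then show ?thesis using assms by (simp add: L2_def)
qed

lemma L2_prod_integrable:
  assumes "f \<in> L2" "g \<in> L2"
  shows "integrable halfline (\<lambda>x. f x * g x)"
proof (rule Bochner_Integration.integrable_bound)
  show "integrable halfline (\<lambda>x. (cmod (f x))\<^sup>2 + (cmod (g x))\<^sup>2)"
    using assms[THEN L2_integrable] by auto
  show "(\<lambda>x. f x * g x) \<in> borel_measurable halfline"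
    using assms[THEN L2_measurable] by measurable
  show "AE x in halfline. norm (f x * g x) \<le> norm ((cmod (f x))\<^sup>2 + (cmod (g x))\<^sup>2)"
  proof (intro AE_I2)
    fix x
    have "2 * (cmod (f x) * cmod (g x)) \<le> (cmod (f x))\<^sup>2 + (cmod (g x))\<^sup>2"
      using sum_squares_bound[of "cmod (f x)" "cmod (g x)"] by simp
    moreover have "0 \<le> cmod (f x) * cmod (g x)" by simp
    ultimately have "cmod (f x) * cmod (g x) \<le> (cmod (f x))\<^sup>2 + (cmod (g x))\<^sup>2" by linarith
    then show "norm (f x * g x) \<le> norm ((cmod (f x))\<^sup>2 + (cmod (g x))\<^sup>2)"
      by (simp add: norm_mult)
  qed
qed

lemma L2_norm_prod_integrable:
  assumes "f \<in> L2" "g \<in> L2"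
  shows "integrable halfline (\<lambda>x. cmod (f x) * cmod (g x))"
  using L2_prod_integrable[OF assms] by (simp flip: norm_mult add: integrable_norm)

lemma L2_cauchy_schwarz:
  assumes "f \<in> L2" "g \<in> L2"
  shows "(LINT x|halfline. cmod (f x) * cmod (g x))\<^sup>2
    \<le> (LINT x|halfline. (cmod (f x))\<^sup>2) * (LINT x|halfline. (cmod (g x))\<^sup>2)"
proof -
  let ?a = "LINT x|halfline. (cmod (f x))\<^sup>2" and ?b = "LINT x|halfline. (cmod (g x))\<^sup>2"
  let ?c = "LINT x|halfline. cmod (f x) * cmod (g x)"
  have q: "0 \<le> t\<^sup>2 * ?a - 2 * t * ?c + ?b" for t
  proof -
    have "0 \<le> (LINT x|halfline. (t * cmod (f x) - cmod (g x))\<^sup>2)"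
      by (intro Bochner_Integration.integral_nonneg) auto
    also have "\<dots> = (LINT x|halfline. t\<^sup>2 * (cmod (f x))\<^sup>2 - 2 * t * (cmod (f x) * cmod (g x)) + (cmod (g x))\<^sup>2)"
      by (intro Bochner_Integration.integral_cong) (auto simp: power2_diff power_mult_distrib)
    also have "\<dots> = t\<^sup>2 * ?a - 2 * t * ?c + ?b"
      using assms[THEN L2_integrable] L2_norm_prod_integrable[OF assms] by simp
    finally show ?thesis .
  qed
  have ab: "?a \<ge> 0" "?b \<ge> 0" "?c \<ge> 0" by (intro Bochner_Integration.integral_nonneg; simp)+
  show ?thesis
  proof (cases "?a = 0")
    case True
    have "?c = 0"
    proof (rule ccontr)
      assume "?c \<noteq> 0"
      then have "?c > 0" using ab(3) by linarith
      \<comment> \<open>At this \<open>t\<close> the polynomial, which is linear because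
        \<open>?a\<close> is 0, takes the value -1.\<close>
      with q[of "(?b + 1) / (2 * ?c)"] True show False by (simp add: field_simps)
    qed
    then show ?thesis by (simp add: True)
  next
    case False
    then have "?a > 0" using ab(1) by linarith
    with q[of "?c / ?a"] show ?thesis by (simp add: field_simps power2_eq_square)
  qed
qed

lemma L2_indicator: "(\<lambda>x. indicator {0<..b} x) \<in> L2"
  unfolding L2_def
proof (intro CollectI conjI)
  show "(\<lambda>x. indicator {0<..b} x) \<in> borel_measurable halfline"
    by (intro borel_measurable_indicator) (auto simp: sets_restrict_space_iff)
  have "integrable lebesgue (indicator {0<..b} :: real \<Rightarrow> real)"
    by (rule integrable_real_indicator) (cases "0 \<le> b"; auto)+
  then have "integrable lebesgue (\<lambda>x. indicator {0<..} x *\<^sub>R (cmod (indicator {0<..b} x))\<^sup>2)"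
    by (rule Bochner_Integration.integrable_cong[THEN iffD1, rotated 2]) (auto simp: indicator_def)
  then show "integrable halfline (\<lambda>x. (cmod (indicator {0<..b} x))\<^sup>2)"
    by (subst integrable_restrict_space) auto
qed

lemma halfline_absolutely_integrable:
  fixes F :: "real \<Rightarrow> 'a::euclidean_space"
  assumes "integrable halfline (\<lambda>x. indicator {0<..b} x *\<^sub>R F x)"
  shows "F absolutely_integrable_on {0..b}"
proof -
  have "integrable lebesgue (\<lambda>x. indicator {0<..} x *\<^sub>R indicator {0<..b} x *\<^sub>R F x)"
    using assms by (subst (asm) integrable_restrict_space) auto
  then have "F absolutely_integrable_on {0<..b}"
    unfolding set_integrable_def
    by (rule Bochner_Integration.integrable_cong[THEN iffD1, rotated 2]) (auto simp: indicator_def)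
  then show ?thesis
    by (rule absolutely_integrable_spike_set)
       (auto intro: negligible_subset[of "{0}"])
qed

lemma L2_absolutely_integrable:
  assumes "f \<in> L2" shows "f absolutely_integrable_on {0..b}"
proof (rule halfline_absolutely_integrable)
  show "integrable halfline (\<lambda>x. indicator {0<..b} x *\<^sub>R f x)"
    using L2_prod_integrable[OF L2_indicator assms, of b]
    by (rule Bochner_Integration.integrable_cong[THEN iffD1, rotated 2]) (auto simp: indicator_def)
qed

lemma L2_integrable_on: "f \<in> L2 \<Longrightarrow> f integrable_on {0..b}"
  using L2_absolutely_integrable set_lebesgue_integral_eq_integral(1) by blast

lemma integrable_halfline_indicator:
  fixes F :: "real \<Rightarrow> 'a::euclidean_space"
  assumes "integrable halfline F"
  shows "integrable halfline (\<lambda>x. indicator {0<..b} x *\<^sub>R F x)"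
  by (rule integrable_mult_indicator[OF _ assms]) (auto simp: sets_restrict_space_iff)

lemma halfline_absolutely_integrable':
  fixes F :: "real \<Rightarrow> 'a::euclidean_space"
  assumes "integrable halfline F"
  shows "F absolutely_integrable_on {0..b}"
  by (intro halfline_absolutely_integrable integrable_halfline_indicator assms)

text \<open>The bridge between two integrals: norms are Bochner integrals over the open half-line,
  while the fundamental theorem and integration by parts concern gauge integrals over [0,b]. The end
  point 0 is a null set.\<close>

lemma integral_eq_halfline:
  fixes F :: "real \<Rightarrow> 'a::euclidean_space"
  assumes "integrable halfline (\<lambda>x. indicator {0<..b} x *\<^sub>R F x)"
  shows "integral {0..b} F = (LINT x|halfline. indicator {0<..b} x *\<^sub>R F x)"
proof -
  have e: "(\<lambda>x. indicator {0<..b} x *\<^sub>R F x) = (\<lambda>x. if x \<in> {0<..b} then F x else 0)"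
    by (auto simp: indicator_def)
  have "(LINT x|halfline. indicator {0<..b} x *\<^sub>R F x) = integral {0<..} (\<lambda>x. indicator {0<..b} x *\<^sub>R F x)"
    by (rule lebesgue_integral_eq_integral) (use assms in auto)
  also have "\<dots> = integral {0<..} (\<lambda>x. if x \<in> {0<..b} then F x else 0)" by (simp only: e)
  also have "\<dots> = integral ({0<..b} \<inter> {0<..}) F" by (rule integral_restrict_Int)
  also have "{0<..b} \<inter> {0<..} = {0<..b}" by auto
  also have "integral {0<..b} F = integral {0..b} F"
    by (rule integral_spike_set) (auto intro: negligible_subset[of "{0}"])
  finally show ?thesis by (rule sym)
qed

lemma integral_tendsto_halfline:
  fixes F :: "real \<Rightarrow> 'a::euclidean_space"
  assumes F: "integrable halfline F" and X: "filterlim X at_top sequentially"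
  shows "(\<lambda>n. integral {0..X n} F) \<longlonglongrightarrow> (LINT x|halfline. F x)"
  unfolding integral_eq_halfline[OF integrable_halfline_indicator[OF F]]
proof (rule integral_dominated_convergence[where w = "\<lambda>x. norm (F x)"])
  show "AE x in halfline. (\<lambda>i. indicator {0<..X i} x *\<^sub>R F x) \<longlonglongrightarrow> F x"
  proof (intro AE_I2)
    fix x assume "x \<in> space halfline"
    then have "x > 0" by simp
    have "\<forall>\<^sub>F n in sequentially. x \<le> X n" using X by (auto simp: filterlim_at_top)
    then have "\<forall>\<^sub>F n in sequentially. F x = indicator {0<..X n} x *\<^sub>R F x"
      by eventually_elim (use \<open>x > 0\<close> in simp)
    then show "(\<lambda>i. indicator {0<..X i} x *\<^sub>R F x) \<longlonglongrightarrow> F x"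
      by (rule Lim_transform_eventually[OF tendsto_const])
  qed
  show "(\<lambda>x. indicator {0<..X i} x *\<^sub>R F x) \<in> borel_measurable halfline" for i
    by (intro borel_measurable_integrable integrable_halfline_indicator F)
  show "AE x in halfline. norm (indicator {0<..X i} x *\<^sub>R F x) \<le> norm (F x)" for i
    by (intro AE_I2) (simp add: indicator_def)
qed (use F in auto)

text \<open>Monotone convergence along growing intervals. Energy estimates give bounds on [0,b] that
  do not depend on b; this turns them into integrability, as in \<open>weighted_L2I\<close>.\<close>

lemma halfline_integrableI_bounded:
  fixes F :: "real \<Rightarrow> real"
  assumes F: "F \<in> borel_measurable halfline" "\<And>x. x > 0 \<Longrightarrow> F x \<ge> 0"
    and int: "\<And>b. b > 0 \<Longrightarrow> F integrable_on {0..b}"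
    and bound: "\<And>b. b > 0 \<Longrightarrow> integral {0..b} F \<le> C"
  shows "integrable halfline F" "(LINT x|halfline. F x) \<le> C"
proof -
  define G where "G = (\<lambda>n x. indicator {0<..real (Suc n)} x *\<^sub>R F x)"
  have G: "integrable halfline (G n)" for n
  proof -
    have "F integrable_on {0<..real (Suc n)}"
      by (rule integrable_spike_set[OF int[of "real (Suc n)"]]) (auto intro: negligible_subset[of "{0}"])
    then have "F absolutely_integrable_on {0<..real (Suc n)}"
      using F by (subst absolutely_integrable_on_iff_nonneg) auto
    then have "integrable lebesgue (\<lambda>x. indicator {0<..} x *\<^sub>R G n x)"
      unfolding set_integrable_def
      by (rule Bochner_Integration.integrable_cong[THEN iffD1, rotated 2]) (auto simp: G_def indicator_def)
    then show ?thesis by (subst integrable_restrict_space) auto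
  qed
  have Gi: "(LINT x|halfline. G n x) = integral {0..real (Suc n)} F" for n
    using integral_eq_halfline[of "real (Suc n)" F] G[of n] by (simp add: G_def)
  have inc: "(LINT x|halfline. G m x) \<le> (LINT x|halfline. G n x)" if "m \<le> n" for m n
    using that F by (intro integral_mono G) (auto simp: G_def indicator_def)
  have "\<exists>L. (\<lambda>n. LINT x|halfline. G n x) \<longlonglongrightarrow> L"
  proof (rule incseq_convergent[of _ C])
    show "incseq (\<lambda>n. LINT x|halfline. G n x)" using inc by (simp add: incseq_def)
    show "\<forall>n. (LINT x|halfline. G n x) \<le> C" using Gi bound by simp
  qed blast
  then obtain L where L: "(\<lambda>n. LINT x|halfline. G n x) \<longlonglongrightarrow> L" by blast
  have AEmono: "AE x in halfline. mono (\<lambda>n. G n x)"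
    using F by (intro AE_I2) (auto simp: mono_def G_def indicator_def)
  have AElim: "AE x in halfline. (\<lambda>n. G n x) \<longlonglongrightarrow> F x"
  proof (intro AE_I2)
    fix x assume "x \<in> space halfline"
    then have "x > 0" by simp
    obtain N where "x \<le> real N" using real_arch_simple by blast
    then have "\<forall>\<^sub>F n in sequentially. F x = G n x"
      using \<open>x > 0\<close> by (intro eventually_sequentiallyI[of N]) (auto simp: G_def indicator_def)
    then show "(\<lambda>n. G n x) \<longlonglongrightarrow> F x" by (rule Lim_transform_eventually[OF tendsto_const])
  qed
  note mc = integral_monotone_convergence[OF G AEmono AElim L F(1)]
  show "integrable halfline F" by (rule integrable_monotone_convergence[OF G AEmono AElim L F(1)])
  show "(LINT x|halfline. F x) \<le> C" unfolding mc
    using L Gi bound by (intro LIMSEQ_le_const2[OF L]) auto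
qed

text \<open>If \<open>x * F x\<close> stayed away from zero, \<open>F\<close> would dominate a multiple of \<open>1/x\<close>.\<close>

lemma integrable_vanishing_sequence:
  fixes F :: "real \<Rightarrow> real"
  assumes "integrable halfline F" "\<And>x. x > 0 \<Longrightarrow> F x \<ge> 0"
  obtains X where "filterlim X at_top sequentially" "\<And>n. X n \<ge> 1" "(\<lambda>n. X n * F (X n)) \<longlonglongrightarrow> 0"
proof -
  have ex: "\<exists>x\<ge>b. x * F x < e" if b: "b \<ge> 1" and e: "e > 0" for b e
  proof (rule ccontr)
    assume "\<not> ?thesis"
    then have lower: "x * F x \<ge> e" if "x \<ge> b" for x using that by force
    \<comment> \<open>So large that the integral of e/x over [b,c] equals the whole integral of F
      plus e.\<close>
    define c where "c = b * exp ((LINT x|halfline. F x) / e + 1)"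
    have I0: "(LINT x|halfline. F x) \<ge> 0" using assms(2) by (intro Bochner_Integration.integral_nonneg) auto
    have cb: "c \<ge> b" using b e I0 by (simp add: c_def)
    have Fi: "F integrable_on {0..c}"
      using halfline_absolutely_integrable'[OF assms(1)] set_lebesgue_integral_eq_integral(1) by blast
    have "((\<lambda>x. e / x) has_integral (e * ln c - e * ln b)) {b..c}"
      using b cb by (intro fundamental_theorem_of_calculus)
        (auto intro!: derivative_eq_intros simp: has_real_derivative_iff_has_vector_derivative[symmetric])
    moreover have "integral {b..c} (\<lambda>x. e / x) \<le> integral {b..c} F"
    proof (rule integral_le)
      show "F integrable_on {b..c}" using b by (intro integrable_subinterval_real[OF Fi]) auto
      show "e / x \<le> F x" if "x \<in> {b..c}" for x
        using lower[of x] that b by (simp add: divide_le_eq mult.commute)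
    qed (use calculation in blast)
    moreover have "integral {b..c} F \<le> (LINT x|halfline. F x)"
    proof -
      have "integral {0..b} F + integral {b..c} F = integral {0..c} F"
        using b cb by (intro Henstock_Kurzweil_Integration.integral_combine Fi) auto
      moreover have "integral {0..b} F \<ge> 0"
        unfolding integral_eq_halfline[OF integrable_halfline_indicator[OF assms(1)]]
        using assms(2) by (intro Bochner_Integration.integral_nonneg) (auto simp: indicator_def)
      moreover have "integral {0..c} F \<le> (LINT x|halfline. F x)"
        unfolding integral_eq_halfline[OF integrable_halfline_indicator[OF assms(1)]]
        using assms(2) by (intro integral_mono integrable_halfline_indicator assms) (auto simp: indicator_def)
      ultimately show ?thesis by linarith
    qed
    moreover have "e * ln c - e * ln b = (LINT x|halfline. F x) + e"
      using b e by (simp add: c_def ln_mult field_simps)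
    ultimately show False using e by (simp add: integral_unique)
  qed
  have "\<forall>n. \<exists>x\<ge>real (Suc n). x * F x < 1 / real (Suc n)" by (intro allI ex) auto
  then obtain X where X: "\<And>n. X n \<ge> real (Suc n)" "\<And>n. X n * F (X n) < 1 / real (Suc n)"
    by metis
  show thesis
  proof (rule that)
    show "filterlim X at_top sequentially"
    proof (rule filterlim_at_top_mono[OF filterlim_real_sequentially])
      show "\<forall>\<^sub>F n in sequentially. real n \<le> X n"
        using X(1) by (intro always_eventually allI) (metis of_nat_Suc add_increasing order_trans le_add_same_cancel2 zero_le_one)
    qed
    show X1: "X n \<ge> 1" for n using X(1)[of n] by simp
    show "(\<lambda>n. X n * F (X n)) \<longlonglongrightarrow> 0"
    proof (rule tendsto_sandwich[OF _ _ tendsto_const])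
      show "\<forall>\<^sub>F n in sequentially. X n * F (X n) \<le> inverse (real (Suc n))"
        using X(2) by (intro always_eventually allI) (simp add: inverse_eq_divide less_imp_le)
      have "0 \<le> X n * F (X n)" for n
        using X1[of n] assms(2)[of "X n"] by (intro mult_nonneg_nonneg) auto
      then show "\<forall>\<^sub>F n in sequentially. 0 \<le> X n * F (X n)" by (intro always_eventually allI)
    qed (rule LIMSEQ_inverse_real_of_nat)
  qed
qed

section \<open>Functions determined by their integrals; completeness of L2\<close>

text \<open>The sets over which the integral vanishes contain the intervals and are closed under
  complement and countable disjoint union, hence include all Borel sets. A Lebesgue set differs from
  a Borel set by a null set, and a function with zero integral over every measurable set vanishes
  almost everywhere.\<close>

lemma AE_zero_of_integrals_zero:
  fixes f :: "real \<Rightarrow> complex"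
  assumes f: "f absolutely_integrable_on {a..b}" and ab: "a \<le> b"
    and zero: "\<And>c d. a \<le> c \<Longrightarrow> c \<le> d \<Longrightarrow> d \<le> b \<Longrightarrow> integral {c..d} f = 0"
  shows "AE x in lebesgue_on {a..b}. f x = 0"
proof -
  let ?M = "lebesgue_on {a..b}"
  interpret finite_measure ?M by (rule finite_measure_lebesgue_on) simp
  have fi: "integrable ?M f"
    using f by (simp add: integrable_restrict_space set_integrable_def)
  have fS: "set_integrable lebesgue {a..b} f" by (rule f)
  have sub: "set_integrable lebesgue (A \<inter> {a..b}) f" if "A \<in> sets lebesgue" for A
    by (rule set_integrable_subset[OF fS]) (use that in auto)
  have total: "(LINT x:{a..b}|lebesgue. f x) = 0"
    using zero[of a b] ab by (simp add: set_lebesgue_integral_eq_integral(2)[OF f])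
  have borel: "(LINT x:A \<inter> {a..b}|lebesgue. f x) = 0" if "A \<in> sets borel" for A
    using that
  proof (induction rule: borel_set_induct)
    case empty
    then show ?case by (simp add: set_lebesgue_integral_def)
  next
    case (interval c d)
    have e: "{c..d} \<inter> {a..b} = {max a c..min b d}" by auto
    have s: "f absolutely_integrable_on {max a c..min b d}"
    proof -
      have "{c..d} \<in> sets lebesgue" by simp
      from sub[OF this] show ?thesis unfolding e .
    qed
    show ?case
    proof (cases "max a c \<le> min b d")
      case True
      then show ?thesis unfolding e set_lebesgue_integral_eq_integral(2)[OF s] by (intro zero) auto
    next
      case False
      then have "{max a c..min b d} = {}" by auto
      then show ?thesis unfolding e by (simp add: set_lebesgue_integral_def)
    qed
  next
    case (compl A)
    have A: "A \<in> sets lebesgue" "- A \<in> sets lebesgue" using compl.hyps by (auto simp: sets_completionI_sets)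
    have "(LINT x:(A \<inter> {a..b}) \<union> (- A \<inter> {a..b})|lebesgue. f x)
        = (LINT x:A \<inter> {a..b}|lebesgue. f x) + (LINT x:- A \<inter> {a..b}|lebesgue. f x)"
      by (rule set_integral_Un) (use A sub in auto)
    moreover have "(A \<inter> {a..b}) \<union> (- A \<inter> {a..b}) = {a..b}" by auto
    ultimately show ?case using compl total by simp
  next
    case (union A)
    have A: "A i \<in> sets lebesgue" for i using union.hyps by (auto simp: sets_completionI_sets)
    have e: "(\<Union>i. A i) \<inter> {a..b} = (\<Union>i. A i \<inter> {a..b})" by auto
    have "(LINT x:(\<Union>i. A i \<inter> {a..b})|lebesgue. f x) = (\<Sum>i. LINT x:A i \<inter> {a..b}|lebesgue. f x)"
    proof (rule lebesgue_integral_countable_add)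
      show "A i \<inter> {a..b} \<inter> (A j \<inter> {a..b}) = {}" if "i \<noteq> j" for i j
        using union.hyps that by (auto simp: disjoint_family_on_def)
      show "set_integrable lebesgue (\<Union>i. A i \<inter> {a..b}) f"
        unfolding e[symmetric] using A by (intro sub sets.countable_UN) auto
    qed (use A in auto)
    then show ?case unfolding e using union.IH by simp
  qed
  show ?thesis
  proof (rule density_zero[OF fi])
    fix A assume "A \<in> sets ?M"
    then have A: "A \<in> sets lebesgue" "A \<subseteq> {a..b}" by (auto simp: sets_restrict_space_iff)
    obtain S N N' where S: "A = S \<union> N" "N \<subseteq> N'" "N' \<in> null_sets lborel" "S \<in> sets lborel"
      using sets_completionE[OF A(1)] by metis
    have N': "N' \<in> null_sets lebesgue" using S(3) by (rule null_sets_completionI)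
    have "(LINT x:A|?M. f x) = (LINT x:A|lebesgue. f x)"
      using A unfolding set_lebesgue_integral_def
      by (subst integral_restrict_space) (auto intro!: Bochner_Integration.integral_cong simp: indicator_def)
    also have "\<dots> = (LINT x:S \<inter> {a..b}|lebesgue. f x)"
    proof (rule set_integral_cong_set)
      show "set_borel_measurable lebesgue A f"
        using sub[OF A(1)] A(2) by (simp add: set_borel_measurable_def set_integrable_def inf.absorb1)
      show "set_borel_measurable lebesgue (S \<inter> {a..b}) f"
        using sub[of S] S(4) by (simp add: set_borel_measurable_def set_integrable_def sets_completionI_sets)
      have "AE x in lebesgue. x \<notin> N'" using N' by (rule AE_not_in)
      then show "AE x in lebesgue. x \<in> S \<inter> {a..b} \<longleftrightarrow> x \<in> A"
        by eventually_elim (use S(1,2) A(2) in auto)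
    qed
    also have "\<dots> = 0" using borel S(4) by simp
    finally show "(LINT x:A|?M. f x) = 0" .
  qed
qed

lemma halfline_AE_iff: "(AE x in halfline. P x) \<longleftrightarrow> (AE x in lebesgue. 0 < x \<longrightarrow> P x)"
  by (subst AE_restrict_space_iff) auto

lemma halfline_AE_I_intervals:
  assumes "\<And>b. b > 0 \<Longrightarrow> AE x in lebesgue_on {0..b}. P x"
  shows "AE x in halfline. P x"
proof -
  have "AE x in lebesgue. x \<in> {0..real (Suc n)} \<longrightarrow> P x" for n
    using assms[of "real (Suc n)"] AE_restrict_space_iff[of "{0..real (Suc n)}" lebesgue P] by simp
  then have "AE x in lebesgue. \<forall>n. x \<in> {0..real (Suc n)} \<longrightarrow> P x"
    unfolding AE_all_countable by blast
  then have "AE x in lebesgue. 0 < x \<longrightarrow> P x"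
  proof eventually_elim
    case (elim x)
    obtain n where "x \<le> real n" using real_arch_simple by blast
    with elim[rule_format, of n] show ?case by auto
  qed
  then show ?thesis by (simp add: halfline_AE_iff)
qed

lemma L2_AE_unique:
  assumes "f \<in> L2" "g \<in> L2" and eq: "\<And>x. x \<ge> 0 \<Longrightarrow> integral {0..x} f = integral {0..x} g"
  shows "AE x in halfline. f x = g x"
proof -
  have d: "(\<lambda>x. f x - g x) \<in> L2" by (rule L2_diff[OF assms(1,2)])
  have z: "integral {0..x} (\<lambda>x. f x - g x) = 0" if "x \<ge> 0" for x
    using eq[OF that] by (simp add: integral_diff L2_integrable_on assms)
  have "AE x in halfline. f x - g x = 0"
  proof (rule halfline_AE_I_intervals, rule AE_zero_of_integrals_zero)
    fix b :: real assume "b > 0"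
    show "(\<lambda>x. f x - g x) absolutely_integrable_on {0..b}" by (rule L2_absolutely_integrable[OF d])
    fix c e assume "0 \<le> c" "c \<le> e" "e \<le> b"
    then have "integral {0..c} (\<lambda>x. f x - g x) + integral {c..e} (\<lambda>x. f x - g x) = integral {0..e} (\<lambda>x. f x - g x)"
      by (intro Henstock_Kurzweil_Integration.integral_combine L2_integrable_on d) auto
    then show "integral {c..e} (\<lambda>x. f x - g x) = 0" using z[of c] z[of e] \<open>0 \<le> c\<close> \<open>c \<le> e\<close> by simp
  qed auto
  then show ?thesis by simp
qed

text \<open>Almost everywhere convergent subsequences come from L1, but on a half-line L2 is not
  contained in L1. So the sequence is first multiplied by the positive L2 function exp(-x), and
  Fatou's lemma turns the pointwise limit into an L2 limit. The subsequence belongs to the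
  conclusion because it identifies limits in the completeness proof for
  \<open>energy\<close>.\<close>

lemma L2_complete:
  assumes s: "\<And>n. s n \<in> L2"
    and cauchy: "\<And>e. e > 0 \<Longrightarrow> \<exists>N. \<forall>m\<ge>N. \<forall>n\<ge>N. (LINT x|halfline. (cmod (s m x - s n x))\<^sup>2) < e"
  obtains g r where "g \<in> L2" "strict_mono (r::nat\<Rightarrow>nat)" "AE x in halfline. (\<lambda>i. s (r i) x) \<longlonglongrightarrow> g x"
    "(\<lambda>n. LINT x|halfline. (cmod (s n x - g x))\<^sup>2) \<longlonglongrightarrow> 0"
proof -
  define \<omega> :: "real \<Rightarrow> complex" where "\<omega> = (\<lambda>x. of_real (exp (- x)))"
  have \<omega>: "\<omega> \<in> L2"
  proof -
    have c: "continuous_on S (\<lambda>x. exp (-2 * x))" for S :: "real set" by (intro continuous_intros)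
    have "integrable halfline (\<lambda>x. exp (-2 * x))"
    proof (rule halfline_integrableI_bounded[where C = 1])
      show "(\<lambda>x. exp (-2 * x)) \<in> borel_measurable halfline"
        by (rule continuous_imp_measurable_on_sets_lebesgue[OF c]) simp
      fix b :: real assume b: "b > 0"
      show "(\<lambda>x. exp (-2 * x)) integrable_on {0..b}" by (rule integrable_continuous_interval[OF c])
      have "((\<lambda>x. exp (-2 * x)) has_integral (- exp (-2 * b) / 2 - (- exp (-2 * 0) / 2))) {0..b}"
        using b by (intro fundamental_theorem_of_calculus)
          (auto intro!: derivative_eq_intros simp: has_real_derivative_iff_has_vector_derivative[symmetric])
      then have "integral {0..b} (\<lambda>x. exp (-2 * x)) = 1/2 - exp (- (2 * b)) / 2"
        by (simp add: integral_unique)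
      moreover have "exp (- (2 * b)) > 0" by simp
      ultimately show "integral {0..b} (\<lambda>x. exp (-2 * x)) \<le> 1" by linarith
    qed auto
    moreover have "(cmod (\<omega> x))\<^sup>2 = exp (-2 * x)" for x
      by (simp add: \<omega>_def power2_eq_square exp_add[symmetric])
    moreover have "\<omega> \<in> borel_measurable halfline"
      unfolding \<omega>_def by (rule continuous_imp_measurable_on_sets_lebesgue) (auto intro!: continuous_intros)
    ultimately show ?thesis by (simp add: L2_def)
  qed
  define W where "W = (LINT x|halfline. (cmod (\<omega> x))\<^sup>2)"
  have W: "W \<ge> 0" unfolding W_def by (intro Bochner_Integration.integral_nonneg) simp
  have d: "(\<lambda>x. s m x - s n x) \<in> L2" for m n by (rule L2_diff[OF s s])
  obtain r where r: "strict_mono r" "AE x in halfline. Cauchy (\<lambda>i. \<omega> x * s (r i) x)"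
  proof (rule cauchy_L1_AE_cauchy_subseq[of halfline "\<lambda>n x. \<omega> x * s n x"])
    show "integrable halfline (\<lambda>x. \<omega> x * s n x)" for n by (rule L2_prod_integrable[OF \<omega> s])
    fix e :: real assume e: "e > 0"
    then obtain N where N: "\<And>m n. m \<ge> N \<Longrightarrow> n \<ge> N \<Longrightarrow> (LINT x|halfline. (cmod (s m x - s n x))\<^sup>2) < e\<^sup>2 / (W + 1)"
      using cauchy[of "e\<^sup>2 / (W + 1)"] W by auto
    show "\<exists>N. \<forall>i\<ge>N. \<forall>j\<ge>N. (LINT x|halfline. norm (\<omega> x * s i x - \<omega> x * s j x)) < e"
    proof (intro exI allI impI)
      fix i j assume ij: "i \<ge> N" "j \<ge> N"
      have "(LINT x|halfline. norm (\<omega> x * s i x - \<omega> x * s j x)) = (LINT x|halfline. cmod (\<omega> x) * cmod (s i x - s j x))"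
        by (simp add: norm_mult flip: right_diff_distrib)
      moreover have "(LINT x|halfline. cmod (\<omega> x) * cmod (s i x - s j x))\<^sup>2 \<le> W * (LINT x|halfline. (cmod (s i x - s j x))\<^sup>2)"
        unfolding W_def by (rule L2_cauchy_schwarz[OF \<omega> d])
      moreover have "W * (LINT x|halfline. (cmod (s i x - s j x))\<^sup>2) \<le> W * (e\<^sup>2 / (W + 1))"
        using N[OF ij] W by (intro mult_left_mono) auto
      moreover have "W * (e\<^sup>2 / (W + 1)) < e\<^sup>2" using W e by (simp add: field_simps)
      ultimately have "(LINT x|halfline. norm (\<omega> x * s i x - \<omega> x * s j x))\<^sup>2 < e\<^sup>2" by simp
      then show "(LINT x|halfline. norm (\<omega> x * s i x - \<omega> x * s j x)) < e"
        using e by (simp add: power2_less_imp_less)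
    qed
  qed
  define g where "g = (\<lambda>x. lim (\<lambda>i. s (r i) x))"
  have lim: "AE x in halfline. (\<lambda>i. s (r i) x) \<longlonglongrightarrow> g x"
    using r(2)
  proof eventually_elim
    case (elim x)
    then obtain l where "(\<lambda>i. \<omega> x * s (r i) x) \<longlonglongrightarrow> l" by (auto simp: Cauchy_convergent_iff convergent_def)
    then have "(\<lambda>i. inverse (\<omega> x) * (\<omega> x * s (r i) x)) \<longlonglongrightarrow> inverse (\<omega> x) * l" by (intro tendsto_intros)
    moreover have "\<omega> x \<noteq> 0" by (simp add: \<omega>_def)
    ultimately have "(\<lambda>i. s (r i) x) \<longlonglongrightarrow> inverse (\<omega> x) * l" by (simp flip: mult.assoc)
    then have "convergent (\<lambda>i. s (r i) x)" by (rule convergentI)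
    then show ?case unfolding g_def by (simp add: convergent_LIMSEQ_iff)
  qed
  have gm: "g \<in> borel_measurable halfline"
    unfolding g_def by (intro borel_measurable_lim_metric L2_measurable s)
  have key: "integrable halfline (\<lambda>x. (cmod (s n x - g x))\<^sup>2) \<and> (LINT x|halfline. (cmod (s n x - g x))\<^sup>2) \<le> e"
    if N: "\<And>m n. m \<ge> N \<Longrightarrow> n \<ge> N \<Longrightarrow> (LINT x|halfline. (cmod (s m x - s n x))\<^sup>2) < e" and n: "n \<ge> N" and e: "e > 0" for N n e
  proof -
    have "(\<integral>\<^sup>+x. ennreal ((cmod (s n x - g x))\<^sup>2) \<partial>halfline)
        = (\<integral>\<^sup>+x. liminf (\<lambda>i. ennreal ((cmod (s n x - s (r i) x))\<^sup>2)) \<partial>halfline)"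
    proof (rule nn_integral_cong_AE)
      show "AE x in halfline. ennreal ((cmod (s n x - g x))\<^sup>2) = liminf (\<lambda>i. ennreal ((cmod (s n x - s (r i) x))\<^sup>2))"
        using lim
      proof eventually_elim
        case (elim x)
        then have "(\<lambda>i. ennreal ((cmod (s n x - s (r i) x))\<^sup>2)) \<longlonglongrightarrow> ennreal ((cmod (s n x - g x))\<^sup>2)"
          by (intro tendsto_intros)
        then show ?case by (metis lim_imp_Liminf sequentially_bot)
      qed
    qed
    also have "\<dots> \<le> liminf (\<lambda>i. \<integral>\<^sup>+x. ennreal ((cmod (s n x - s (r i) x))\<^sup>2) \<partial>halfline)"
    proof (rule nn_integral_liminf)
      show "(\<lambda>x. ennreal ((cmod (s n x - s (r i) x))\<^sup>2)) \<in> borel_measurable halfline" for i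
        using L2_measurable[OF d[of n "r i"]] by measurable
    qed
    also have "\<dots> \<le> liminf (\<lambda>i. ennreal e)"
    proof (rule Liminf_mono)
      show "\<forall>\<^sub>F i in sequentially. (\<integral>\<^sup>+x. ennreal ((cmod (s n x - s (r i) x))\<^sup>2) \<partial>halfline) \<le> ennreal e"
      proof (rule eventually_sequentiallyI[of N])
        fix i assume "i \<ge> N"
        then have "r i \<ge> N" using seq_suble[OF r(1), of i] by simp
        have "(\<integral>\<^sup>+x. ennreal ((cmod (s n x - s (r i) x))\<^sup>2) \<partial>halfline) = ennreal (LINT x|halfline. (cmod (s n x - s (r i) x))\<^sup>2)"
          by (intro nn_integral_eq_integral L2_integrable d) auto
        also have "\<dots> \<le> ennreal e" using N[OF n \<open>r i \<ge> N\<close>] by (intro ennreal_leI) simp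
        finally show "(\<integral>\<^sup>+x. ennreal ((cmod (s n x - s (r i) x))\<^sup>2) \<partial>halfline) \<le> ennreal e" .
      qed
    qed
    also have "\<dots> = ennreal e" by (simp add: Liminf_const)
    finally have le: "(\<integral>\<^sup>+x. ennreal ((cmod (s n x - g x))\<^sup>2) \<partial>halfline) \<le> ennreal e" .
    have m: "(\<lambda>x. (cmod (s n x - g x))\<^sup>2) \<in> borel_measurable halfline"
      using L2_measurable[OF s[of n]] gm by measurable
    have I: "integrable halfline (\<lambda>x. (cmod (s n x - g x))\<^sup>2)"
      using le by (intro integrableI_bounded m) (auto intro: order_le_less_trans[of _ "ennreal e"])
    moreover have "(LINT x|halfline. (cmod (s n x - g x))\<^sup>2) \<le> e"
    proof -
      have "ennreal (LINT x|halfline. (cmod (s n x - g x))\<^sup>2) \<le> ennreal e"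
        using le nn_integral_eq_integral[OF I] by simp
      then show ?thesis using e by (simp add: ennreal_le_iff)
    qed
    ultimately show ?thesis by blast
  qed
  have "g \<in> L2"
  proof -
    obtain N where N: "\<And>m n. m \<ge> N \<Longrightarrow> n \<ge> N \<Longrightarrow> (LINT x|halfline. (cmod (s m x - s n x))\<^sup>2) < 1"
      using cauchy[of 1] by auto
    have "(\<lambda>x. s N x - g x) \<in> L2"
      using key[OF N, of N] L2_measurable[OF s[of N]] gm by (simp add: L2_def)
    from L2_diff[OF s[of N] this] show ?thesis by simp
  qed
  moreover have "(\<lambda>n. LINT x|halfline. (cmod (s n x - g x))\<^sup>2) \<longlonglongrightarrow> 0"
  proof (rule LIMSEQ_I)
    fix e :: real assume e: "e > 0"
    then obtain N where N: "\<And>m n. m \<ge> N \<Longrightarrow> n \<ge> N \<Longrightarrow> (LINT x|halfline. (cmod (s m x - s n x))\<^sup>2) < e / 2"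
      using cauchy[of "e / 2"] by auto
    have "norm ((LINT x|halfline. (cmod (s n x - g x))\<^sup>2) - 0) < e" if "n \<ge> N" for n
    proof -
      have "(LINT x|halfline. (cmod (s n x - g x))\<^sup>2) \<le> e / 2" using key[OF N that] e by auto
      moreover have "(LINT x|halfline. (cmod (s n x - g x))\<^sup>2) \<ge> 0"
        by (intro Bochner_Integration.integral_nonneg) simp
      ultimately show ?thesis using e by simp
    qed
    then show "\<exists>N. \<forall>n\<ge>N. norm ((LINT x|halfline. (cmod (s n x - g x))\<^sup>2) - 0) < e" by blast
  qed
  ultimately show thesis using that r(1) lim by blast
qed

subsection \<open>The energy space\<close>

text \<open>Each class in \<open>H10 \<inter> H01\<close> is represented by its continuous member, extended by zero to the
  left, so that equality in the type below is equality of functions.\<close>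

definition energy_function :: "(real \<Rightarrow> complex) \<Rightarrow> bool" where
  "energy_function f \<longleftrightarrow> (\<forall>x<0. f x = 0) \<and> f \<in> H01 \<and>
     (\<exists>g\<in>L2. \<forall>x\<ge>0. f x = f 0 + integral {0..x} g)"

lemma energy_function_zero: "energy_function (\<lambda>x. 0)"
  unfolding energy_function_def H01_def
proof (intro conjI CollectI allI impI)
  show "\<exists>g\<in>L2. \<forall>x\<ge>0. (0::complex) = 0 + integral {0..x} g"
    by (rule bexI[of _ "\<lambda>x. 0"]) simp_all
qed simp_all

typedef energy = "{f. energy_function f}" morphisms rep Abs_energy
  using energy_function_zero by blast

lemma rep_neg: "x < 0 \<Longrightarrow> rep u x = 0"
  using rep[of u] by (simp add: energy_function_def)

lemma energy_eqI:
  assumes "\<And>x. x \<ge> 0 \<Longrightarrow> rep u x = rep v x" shows "u = v"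
proof -
  have "rep u x = rep v x" for x
    using assms[of x] rep_neg[of x u] rep_neg[of x v] by (cases "x \<ge> 0") auto
  then show ?thesis by (simp add: rep_inject[symmetric] fun_eq_iff)
qed

text \<open>The choice is determined up to null sets, so the rules for \<open>der\<close> hold
  almost everywhere and are used through \<open>pair_cong\<close> and
  \<open>nsq_cong\<close>.\<close>

definition der :: "energy \<Rightarrow> real \<Rightarrow> complex" where
  "der u = (SOME g. g \<in> L2 \<and> (\<forall>x\<ge>0. rep u x = rep u 0 + integral {0..x} g))"

lemma der_L2: "der u \<in> L2"
  and rep_eq_integral_der: "x \<ge> 0 \<Longrightarrow> rep u x = rep u 0 + integral {0..x} (der u)"
proof -
  have "\<exists>g. g \<in> L2 \<and> (\<forall>x\<ge>0. rep u x = rep u 0 + integral {0..x} g)"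
    using rep[of u] unfolding energy_function_def by blast
  from someI_ex[OF this, folded der_def]
  show "der u \<in> L2" "x \<ge> 0 \<Longrightarrow> rep u x = rep u 0 + integral {0..x} (der u)" by blast+
qed

lemma rep_L2: "rep u \<in> L2" and rep_weighted_L2: "(\<lambda>x. of_real x * rep u x) \<in> L2"
  using rep[of u] by (auto simp: energy_function_def H01_def)

lemma der_unique:
  assumes "g \<in> L2" "\<And>x. x \<ge> 0 \<Longrightarrow> rep u x = rep u 0 + integral {0..x} g"
  shows "AE x in halfline. der u x = g x"
proof (rule L2_AE_unique[OF der_L2 assms(1)])
  show "integral {0..x} (der u) = integral {0..x} g" if "x \<ge> 0" for x
    using rep_eq_integral_der[OF that, of u] assms(2)[OF that] by (metis add_left_cancel)
qed

lemma energy_exists: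
  assumes "f \<in> H01" "g \<in> L2" "\<And>x. x \<ge> 0 \<Longrightarrow> f x = f 0 + integral {0..x} g"
  obtains u where "\<And>x. x \<ge> 0 \<Longrightarrow> rep u x = f x" "AE x in halfline. der u x = g x"
proof -
  \<comment> \<open>Extended by zero to the left, as the type demands; nothing changes for x \<ge>
    0.\<close>
  define f' where "f' = (\<lambda>x. if x < 0 then 0 else f x)"
  have cong: "h' \<in> L2" if "h \<in> L2" "\<And>x. x > 0 \<Longrightarrow> h x = h' x" for h h' :: "real \<Rightarrow> complex"
  proof -
    have "h' \<in> borel_measurable halfline"
      using L2_measurable[OF that(1)] that(2) by (subst measurable_cong[of halfline h' h]) auto
    moreover have "integrable halfline (\<lambda>x. (cmod (h' x))\<^sup>2)"
      using L2_integrable[OF that(1)] that(2)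
      by (subst Bochner_Integration.integrable_cong[of halfline halfline _ "\<lambda>x. (cmod (h x))\<^sup>2"]) auto
    ultimately show ?thesis by (simp add: L2_def)
  qed
  have "f' \<in> H01"
    using assms(1) cong[of f f'] cong[of "\<lambda>x. of_real x * f x" "\<lambda>x. of_real x * f' x"]
    unfolding H01_def by (auto simp: f'_def)
  then have "energy_function f'"
    unfolding energy_function_def
  proof (intro conjI bexI[of _ g] allI impI)
    show "f' x = f' 0 + integral {0..x} g" if "x \<ge> 0" for x
      using assms(3)[OF that] that by (simp add: f'_def)
  qed (use assms(2) in \<open>simp_all add: f'_def\<close>)
  then have r: "rep (Abs_energy f') = f'" by (simp add: Abs_energy_inverse)
  show thesis
  proof (rule that)
    show "rep (Abs_energy f') x = f x" if "x \<ge> 0" for x using that unfolding r by (simp add: f'_def)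
    show "AE x in halfline. der (Abs_energy f') x = g x"
    proof (rule der_unique[OF assms(2)])
      show "rep (Abs_energy f') x = rep (Abs_energy f') 0 + integral {0..x} g" if "x \<ge> 0" for x
        using assms(3)[OF that] that unfolding r by (simp add: f'_def)
    qed
  qed
qed

instantiation energy :: real_vector
begin

definition "0 = Abs_energy (\<lambda>x. 0)"
definition "u + v = Abs_energy (\<lambda>x. rep u x + rep v x)"
definition "- u = Abs_energy (\<lambda>x. - rep u x)"
definition "u - v = u + (- v :: energy)"
definition "r *\<^sub>R u = Abs_energy (\<lambda>x. r *\<^sub>R rep u x)"

lemma rep_zero [simp]: "rep 0 x = 0"
  by (simp add: zero_energy_def Abs_energy_inverse energy_function_zero)

lemma rep_add [simp]: "rep (u + v) x = rep u x + rep v x"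
proof -
  have "energy_function (\<lambda>x. rep u x + rep v x)"
    unfolding energy_function_def H01_def
  proof (intro conjI allI impI CollectI bexI[of _ "\<lambda>x. der u x + der v x"])
    show "(\<lambda>x. of_real x * (rep u x + rep v x)) \<in> L2"
      using L2_add[OF rep_weighted_L2[of u] rep_weighted_L2[of v]] by (simp add: distrib_left)
    show "rep u x + rep v x = rep u 0 + rep v 0 + integral {0..x} (\<lambda>x. der u x + der v x)" if "x \<ge> 0" for x
      using that rep_eq_integral_der[of x u] rep_eq_integral_der[of x v]
      by (simp add: integral_add L2_integrable_on der_L2)
  qed (auto simp: rep_neg intro: L2_add rep_L2 der_L2)
  then show ?thesis by (simp add: plus_energy_def Abs_energy_inverse)
qed

lemma rep_scaleR [simp]: "rep (r *\<^sub>R u) x = r *\<^sub>R rep u x"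
proof -
  have "energy_function (\<lambda>x. r *\<^sub>R rep u x)"
    unfolding energy_function_def H01_def
  proof (intro conjI allI impI CollectI bexI[of _ "\<lambda>x. r *\<^sub>R der u x"])
    show "(\<lambda>x. of_real x * r *\<^sub>R rep u x) \<in> L2"
      using L2_scaleR[OF rep_weighted_L2[of u], of r] by simp
    show "r *\<^sub>R rep u x = r *\<^sub>R rep u 0 + integral {0..x} (\<lambda>x. r *\<^sub>R der u x)" if "x \<ge> 0" for x
      using that rep_eq_integral_der[of x u] by (simp add: scaleR_add_right)
  qed (auto simp: rep_neg intro: L2_scaleR rep_L2 der_L2)
  then show ?thesis by (simp add: scaleR_energy_def Abs_energy_inverse)
qed

lemma rep_uminus [simp]: "rep (- u) x = - rep u x"
proof -
  have "- u = (-1) *\<^sub>R u" by (simp add: uminus_energy_def scaleR_energy_def)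
  then show ?thesis by simp
qed

lemma rep_diff [simp]: "rep (u - v) x = rep u x - rep v x"
  by (simp add: minus_energy_def)

instance
  by standard (auto intro!: energy_eqI simp: algebra_simps scaleR_add_right scaleR_add_left)

end

lemma L2_indicator_integrable:
  assumes "f \<in> L2" shows "integrable halfline (\<lambda>x. indicator {0<..b} x *\<^sub>R f x)"
  using L2_prod_integrable[OF L2_indicator assms, of b]
  by (rule Bochner_Integration.integrable_cong[THEN iffD1, rotated 2]) (auto simp: indicator_def)

lemma halfline_AE_const: assumes "AE x in halfline. P" shows P
proof (rule ccontr)
  assume "\<not> P"
  from assms have "AE x in lebesgue. x \<notin> {0<..<1::real}"
    unfolding halfline_AE_iff by (rule eventually_mono) (use \<open>\<not> P\<close> in auto)
  then have "{0<..<1::real} \<in> null_sets lebesgue" by (subst AE_iff_null_sets) auto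
  then show False by (simp add: null_sets_def)
qed

lemma der_add: "AE x in halfline. der (u + v) x = der u x + der v x"
proof (rule der_unique)
  show "rep (u + v) x = rep (u + v) 0 + integral {0..x} (\<lambda>x. der u x + der v x)" if "x \<ge> 0" for x
    using that rep_eq_integral_der[of x u] rep_eq_integral_der[of x v]
    by (simp add: integral_add L2_integrable_on der_L2)
qed (intro L2_add der_L2)

lemma der_scaleR: "AE x in halfline. der (r *\<^sub>R u) x = r *\<^sub>R der u x"
proof (rule der_unique)
  show "rep (r *\<^sub>R u) x = rep (r *\<^sub>R u) 0 + integral {0..x} (\<lambda>x. r *\<^sub>R der u x)" if "x \<ge> 0" for x
    using that rep_eq_integral_der[of x u] by (simp add: scaleR_add_right)
qed (intro L2_scaleR der_L2)

lemma der_diff: "AE x in halfline. der (u - v) x = der u x - der v x"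
proof (rule der_unique)
  show "rep (u - v) x = rep (u - v) 0 + integral {0..x} (\<lambda>x. der u x - der v x)" if "x \<ge> 0" for x
    using that rep_eq_integral_der[of x u] rep_eq_integral_der[of x v]
    by (simp add: integral_diff L2_integrable_on der_L2)
qed (intro L2_diff der_L2)

definition pair :: "(real \<Rightarrow> complex) \<Rightarrow> (real \<Rightarrow> complex) \<Rightarrow> complex" where
  "pair f g = (LINT x|halfline. f x * cnj (g x))"

lemma pair_integrable: "f \<in> L2 \<Longrightarrow> g \<in> L2 \<Longrightarrow> integrable halfline (\<lambda>x. f x * cnj (g x))"
  by (intro L2_prod_integrable L2_cnj)

lemma pair_cong:
  assumes "AE x in halfline. f x = f' x" "AE x in halfline. g x = g' x"
    "f \<in> L2" "f' \<in> L2" "g \<in> L2" "g' \<in> L2"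
  shows "pair f g = pair f' g'"
  unfolding pair_def
proof (rule integral_cong_AE)
  show "AE x in halfline. f x * cnj (g x) = f' x * cnj (g' x)"
    using assms(1,2) by eventually_elim simp
qed (use assms in \<open>auto intro!: borel_measurable_integrable pair_integrable\<close>)

lemma pair_add_left: "f \<in> L2 \<Longrightarrow> g \<in> L2 \<Longrightarrow> h \<in> L2 \<Longrightarrow> pair (\<lambda>x. f x + g x) h = pair f h + pair g h"
  unfolding pair_def by (simp add: distrib_right pair_integrable)

lemma pair_cmult_left: "pair (\<lambda>x. c * f x) h = c * pair f h"
  unfolding pair_def by (simp add: mult.assoc)

lemma pair_scaleR_left: "pair (\<lambda>x. r *\<^sub>R f x) h = r *\<^sub>R pair f h"
  unfolding pair_def by (simp add: scaleR_conv_of_real mult.assoc)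

lemma pair_cnj: "cnj (pair f g) = pair g f"
  unfolding pair_def by (subst Bochner_Integration.integral_cnj[symmetric]) (simp add: mult.commute)

definition nsq :: "(real \<Rightarrow> complex) \<Rightarrow> real" where
  "nsq f = (LINT x|halfline. (cmod (f x))\<^sup>2)"

lemma nsq_nonneg [simp]: "nsq f \<ge> 0"
  unfolding nsq_def by (intro Bochner_Integration.integral_nonneg) simp

lemma pair_self: "pair f f = of_real (nsq f)"
  unfolding pair_def nsq_def by (simp only: complex_norm_square[symmetric] integral_complex_of_real)

lemma L2_norm_eq: "L2_norm f = sqrt (nsq f)"
  by (simp add: L2_norm_def nsq_def)

lemma norm_pair_le:
  assumes "f \<in> L2" "g \<in> L2" shows "(cmod (pair f g))\<^sup>2 \<le> nsq f * nsq g"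
proof -
  have "cmod (pair f g) \<le> (LINT x|halfline. cmod (f x) * cmod (g x))"
    unfolding pair_def using integral_norm_bound[of halfline "\<lambda>x. f x * cnj (g x)"] by (simp add: norm_mult)
  then have "(cmod (pair f g))\<^sup>2 \<le> (LINT x|halfline. cmod (f x) * cmod (g x))\<^sup>2"
    by (intro power_mono) auto
  also have "\<dots> \<le> nsq f * nsq g" unfolding nsq_def by (rule L2_cauchy_schwarz[OF assms])
  finally show ?thesis .
qed

lemma norm_pair_le_half:
  assumes "f \<in> L2" "g \<in> L2" shows "cmod (pair f g) \<le> (nsq f + nsq g) / 2"
proof (rule power2_le_imp_le)
  have "(cmod (pair f g))\<^sup>2 \<le> nsq f * nsq g" by (rule norm_pair_le[OF assms])
  also have "\<dots> \<le> ((nsq f + nsq g) / 2)\<^sup>2"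
    using sum_squares_bound[of "nsq f" "nsq g"] by (simp add: power2_eq_square algebra_simps)
  finally show "(cmod (pair f g))\<^sup>2 \<le> ((nsq f + nsq g) / 2)\<^sup>2" .
qed simp

lemma nsq_cong:
  assumes "AE x in halfline. f x = g x" "f \<in> L2" "g \<in> L2" shows "nsq f = nsq g"
  using pair_cong[OF assms(1) assms(1) assms(2,3,2,3)] by (simp add: pair_self)

lemma nsq_eq_0: "f \<in> L2 \<Longrightarrow> nsq f = 0 \<Longrightarrow> AE x in halfline. f x = 0"
  unfolding nsq_def by (subst (asm) integral_nonneg_eq_0_iff_AE) (auto simp: L2_integrable)

lemma nsq_add_le: "f \<in> L2 \<Longrightarrow> g \<in> L2 \<Longrightarrow> nsq (\<lambda>x. f x + g x) \<le> 2 * nsq f + 2 * nsq g"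
proof -
  assume f: "f \<in> L2" "g \<in> L2"
  have "nsq (\<lambda>x. f x + g x) \<le> (LINT x|halfline. 2 * (cmod (f x))\<^sup>2 + 2 * (cmod (g x))\<^sup>2)"
    unfolding nsq_def using L2_integrable[OF L2_add[OF f]] f[THEN L2_integrable]
    by (intro integral_mono norm_add_sq_le) auto
  also have "\<dots> = 2 * nsq f + 2 * nsq g" using f[THEN L2_integrable] by (simp add: nsq_def)
  finally show ?thesis .
qed

lemma nsq_cmult: "nsq (\<lambda>x. c * f x) = (cmod c)\<^sup>2 * nsq f"
  unfolding nsq_def by (simp add: norm_mult power_mult_distrib)

definition wrep :: "energy \<Rightarrow> real \<Rightarrow> complex" where "wrep u x = of_real x * rep u x"

lemma wrep_L2: "wrep u \<in> L2" using rep_weighted_L2[of u] by (simp add: wrep_def[abs_def])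

lemma wrep_add: "wrep (u + v) = (\<lambda>x. wrep u x + wrep v x)"
  and wrep_scaleR: "wrep (r *\<^sub>R u) = (\<lambda>x. r *\<^sub>R wrep u x)"
  by (auto simp: wrep_def distrib_left fun_eq_iff)

lemma rep_add': "rep (u + v) = (\<lambda>x. rep u x + rep v x)"
  and rep_scaleR': "rep (r *\<^sub>R u) = (\<lambda>x. r *\<^sub>R rep u x)"
  by (auto simp: fun_eq_iff)

lemma rep_diff': "rep (u - v) = (\<lambda>x. rep u x - rep v x)"
  by (auto simp: fun_eq_iff)

lemma pair_der_add_left: "h \<in> L2 \<Longrightarrow> pair (der (u + v)) h = pair (der u) h + pair (der v) h"
  by (subst pair_add_left[symmetric]) (auto intro!: pair_cong der_add der_L2 L2_add)

lemma pair_der_scaleR_left: "h \<in> L2 \<Longrightarrow> pair (der (r *\<^sub>R u)) h = r *\<^sub>R pair (der u) h"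
  by (subst pair_scaleR_left[symmetric]) (auto intro!: pair_cong der_scaleR der_L2 L2_scaleR)

instantiation energy :: real_inner
begin

text \<open>Only the real part: the dissipative theory is over the reals, and multiplication by i
  enters separately as \<open>cmul\<close>. The resulting norm is equivalent to the sum of the H10
  and H01 norms, see \<open>norm_energy_equiv\<close>.\<close>

definition "inner u v = Re (pair (der u) (der v)) + Re (pair (rep u) (rep v)) + Re (pair (wrep u) (wrep v))"
definition "norm u = sqrt (inner u (u :: energy))"
definition "sgn u = u /\<^sub>R norm (u :: energy)"
definition "dist u v = norm (u - v :: energy)"
definition [code del]: "(uniformity :: (energy \<times> energy) filter) = (INF e\<in>{0<..}. principal {(x, y). dist x y < e})"
definition [code del]: "open (U :: energy set) \<longleftrightarrow> (\<forall>x\<in>U. eventually (\<lambda>(x', y). x' = x \<longrightarrow> y \<in> U) uniformity)"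

lemma inner_self: "inner u u = nsq (der u) + nsq (rep u) + nsq (wrep u)"
  by (simp add: inner_energy_def pair_self)

instance
proof
  fix u v w :: energy and r :: real
  have "Re (pair f g) = Re (pair g f)" for f g
    by (subst pair_cnj[symmetric]) simp
  then show "inner u v = inner v u" unfolding inner_energy_def by metis
  show "inner (u + v) w = inner u w + inner v w"
    by (simp add: inner_energy_def pair_der_add_left der_L2 rep_add' wrep_add pair_add_left rep_L2 wrep_L2)
  have sc: "inner (r *\<^sub>R u) w = r * inner u w" for r and u w :: energy
    by (simp add: inner_energy_def pair_der_scaleR_left der_L2 rep_scaleR' wrep_scaleR pair_scaleR_left algebra_simps)
  then show "inner (r *\<^sub>R u) w = r * inner u w" .
  show "0 \<le> inner u u" by (simp add: inner_self)
  show "inner u u = 0 \<longleftrightarrow> u = 0"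
  proof
    assume "inner u u = 0"
    then have 0: "nsq (der u) = 0" "nsq (rep u) = 0"
      using nsq_nonneg[of "der u"] nsq_nonneg[of "rep u"] nsq_nonneg[of "wrep u"] unfolding inner_self by linarith+
    have d0: "AE x in halfline. der u x = 0" by (rule nsq_eq_0[OF der_L2 0(1)])
    have const: "rep u x = rep u 0" if "x \<ge> 0" for x
    proof -
      have "integral {0..x} (der u) = (LINT x'|halfline. indicator {0<..x} x' *\<^sub>R der u x')"
        by (rule integral_eq_halfline[OF L2_indicator_integrable[OF der_L2]])
      also have "\<dots> = 0" by (rule integral_eq_zero_AE) (use d0 in eventually_elim, simp)
      finally show ?thesis using rep_eq_integral_der[OF that, of u] by simp
    qed
    have "AE x in halfline. rep u x = 0" by (rule nsq_eq_0[OF rep_L2 0(2)])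
    then have "AE x in halfline. rep u 0 = 0"
      unfolding halfline_AE_iff by (rule eventually_mono) (metis const less_imp_le)
    then have u0: "rep u 0 = 0" by (rule halfline_AE_const)
    show "u = 0"
    proof (rule energy_eqI)
      show "rep u x = rep 0 x" if "x \<ge> 0" for x unfolding const[OF that] u0 by simp
    qed
  qed (use sc[of 0 0 0] in simp)
qed (auto simp: norm_energy_def sgn_energy_def dist_energy_def uniformity_energy_def open_energy_def)

end

lemma norm_energy_sq: "(norm u)\<^sup>2 = nsq (der u) + nsq (rep u) + nsq (wrep u)"
  by (simp add: norm_energy_def inner_self)

lemma nsq_der_le: "nsq (der u) \<le> (norm u)\<^sup>2"
  and nsq_rep_le: "nsq (rep u) \<le> (norm u)\<^sup>2"
  and nsq_wrep_le: "nsq (wrep u) \<le> (norm u)\<^sup>2"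
  using nsq_nonneg[of "der u"] nsq_nonneg[of "rep u"] nsq_nonneg[of "wrep u"] unfolding norm_energy_sq by linarith+

subsection \<open>Point evaluation\<close>

lemma continuous_on_Ici_of_Icc:
  fixes f :: "real \<Rightarrow> 'a::topological_space"
  assumes "\<And>b. continuous_on {0..b} f" shows "continuous_on {0..} f"
proof -
  have "continuous (at x within {0..}) f" if "x \<ge> 0" for x
  proof -
    have "continuous (at x within {0..x + 1}) f"
      using assms[of "x + 1"] that by (simp add: continuous_on_eq_continuous_within)
    moreover have "at x within {0..x + 1} = at x within {0..}"
      using that by (intro at_within_nhd[of x "{..<x + 1}"]) auto
    ultimately show ?thesis by simp
  qed
  then show ?thesis by (simp add: continuous_on_eq_continuous_within)
qed

lemma rep_continuous_on: "continuous_on {0..} (rep u)"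
proof (rule continuous_on_Ici_of_Icc)
  show "continuous_on {0..b} (rep u)" for b
  proof (rule continuous_on_cong[THEN iffD2, OF refl])
    show "continuous_on {0..b} (\<lambda>x. rep u 0 + integral {0..x} (der u))"
      by (intro continuous_on_add continuous_on_const indefinite_integral_continuous_1 L2_integrable_on der_L2)
    show "rep u x = rep u 0 + integral {0..x} (der u)" if "x \<in> {0..b}" for x
      using that by (intro rep_eq_integral_der) simp
  qed
qed

lemma integral_der: "0 \<le> x \<Longrightarrow> x \<le> y \<Longrightarrow> integral {x..y} (der u) = rep u y - rep u x"
proof -
  assume xy: "0 \<le> x" "x \<le> y"
  then have "integral {0..x} (der u) + integral {x..y} (der u) = integral {0..y} (der u)"
    by (intro Henstock_Kurzweil_Integration.integral_combine L2_integrable_on der_L2) auto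
  then show ?thesis using rep_eq_integral_der[of x u] rep_eq_integral_der[of y u] xy by (simp add: algebra_simps)
qed

lemma L2_norm_integrable_on:
  assumes "f \<in> L2" "0 \<le> x" shows "(\<lambda>t. cmod (f t)) integrable_on {x..y}"
proof -
  have "(\<lambda>t. cmod (f t)) absolutely_integrable_on {0..y}"
    by (intro absolutely_integrable_norm[unfolded o_def] L2_absolutely_integrable assms)
  then have "(\<lambda>t. cmod (f t)) integrable_on {0..y}" using set_lebesgue_integral_eq_integral(1) by blast
  then show ?thesis by (rule integrable_subinterval_real) (use assms in auto)
qed

lemma integral_sq_le_nsq:
  assumes "f \<in> L2" "0 \<le> x"
  shows "(\<lambda>t. (cmod (f t))\<^sup>2) integrable_on {x..y}" "integral {x..y} (\<lambda>t. (cmod (f t))\<^sup>2) \<le> nsq f"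
proof -
  let ?F = "\<lambda>t. (cmod (f t))\<^sup>2"
  have i: "?F integrable_on {0..y}"
    using halfline_absolutely_integrable'[OF L2_integrable[OF assms(1)]] set_lebesgue_integral_eq_integral(1) by blast
  then show I: "?F integrable_on {x..y}" by (rule integrable_subinterval_real) (use assms in auto)
  have "integral {x..y} ?F \<le> integral {0..y} ?F"
    by (rule integral_subset_le) (use assms I i in auto)
  also have "\<dots> \<le> nsq f"
    unfolding integral_eq_halfline[OF integrable_halfline_indicator[OF L2_integrable[OF assms(1)]]] nsq_def
    by (intro integral_mono integrable_halfline_indicator L2_integrable assms) (auto simp: indicator_def)
  finally show "integral {x..y} ?F \<le> nsq f" .
qed

text \<open>Young's inequality with a free \<eta>, to be optimised in the next lemma.\<close>

lemma integral_norm_le_nsq: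
  assumes f: "f \<in> L2" and xy: "0 \<le> x" "x \<le> y" and e: "\<eta> > 0"
  shows "integral {x..y} (\<lambda>t. cmod (f t)) \<le> (\<eta> * (y - x) + nsq f / \<eta>) / 2"
proof -
  have "integral {x..y} (\<lambda>t. cmod (f t)) \<le> integral {x..y} (\<lambda>t. \<eta> / 2 + (cmod (f t))\<^sup>2 / (2 * \<eta>))"
  proof (rule integral_le)
    show "(\<lambda>t. \<eta> / 2 + (cmod (f t))\<^sup>2 / (2 * \<eta>)) integrable_on {x..y}"
      by (intro integrable_add integrable_const_ivl integrable_on_divide integral_sq_le_nsq f xy)
    fix t
    show "cmod (f t) \<le> \<eta> / 2 + (cmod (f t))\<^sup>2 / (2 * \<eta>)"
      using sum_squares_bound[of "cmod (f t)" \<eta>] e by (simp add: field_simps power2_eq_square)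
  qed (intro L2_norm_integrable_on f xy)
  also have "\<dots> = \<eta> / 2 * (y - x) + integral {x..y} (\<lambda>t. (cmod (f t))\<^sup>2) / (2 * \<eta>)"
    using xy integral_sq_le_nsq(1)[OF f xy(1), of y]
    by (subst integral_add) (auto intro!: integrable_on_divide)
  also have "\<dots> \<le> \<eta> / 2 * (y - x) + nsq f / (2 * \<eta>)"
    using e by (intro add_left_mono divide_right_mono integral_sq_le_nsq f xy) auto
  finally show ?thesis by (simp add: field_simps)
qed

lemma norm_integral_le_L2:
  assumes f: "f \<in> L2" and xy: "0 \<le> x" "x \<le> y"
  shows "(cmod (integral {x..y} f))\<^sup>2 \<le> (y - x) * nsq f"
proof -
  have le: "cmod (integral {x..y} f) \<le> (\<eta> * (y - x) + nsq f / \<eta>) / 2" if "\<eta> > 0" for \<eta>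
  proof -
    have "f integrable_on {x..y}"
      using L2_integrable_on[OF f, of y] by (rule integrable_subinterval_real) (use xy in auto)
    then have "cmod (integral {x..y} f) \<le> integral {x..y} (\<lambda>t. cmod (f t))"
      by (intro integral_norm_bound_integral L2_norm_integrable_on f xy) auto
    with integral_norm_le_nsq[OF f xy that] show ?thesis by linarith
  qed
  show ?thesis
  proof (cases "x = y \<or> cmod (integral {x..y} f) = 0")
    case True
    then show ?thesis using xy by (auto intro: mult_nonneg_nonneg)
  next
    case False
    let ?c = "cmod (integral {x..y} f)"
    have c: "?c > 0" and d: "y - x > 0" using False xy by auto
    \<comment> \<open>The optimal \<eta>: with it the bound becomes the square of \<open>?c\<close>
      at most (y - x) times \<open>nsq f\<close>.\<close>
    from le[of "?c / (y - x)"] c d have "?c \<le> (?c + nsq f * (y - x) / ?c) / 2" by simp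
    then show ?thesis using c by (simp add: field_simps power2_eq_square)
  qed
qed

text \<open>Compare u(x) with u(y) for y in [x, x + \<delta>] and average over y. A small \<delta>
  makes the derivative term small at the expense of the other one, which is how the boundary term is
  absorbed in \<open>bform_coercive\<close>.\<close>

lemma sobolev_point:
  assumes \<delta>: "\<delta> > 0" and x: "x \<ge> 0"
  shows "(cmod (rep u x))\<^sup>2 \<le> 2 / \<delta> * nsq (rep u) + 2 * \<delta> * nsq (der u)"
proof -
  have pt: "(cmod (rep u x))\<^sup>2 \<le> 2 * (cmod (rep u y))\<^sup>2 + 2 * \<delta> * nsq (der u)" if y: "y \<in> {x..x + \<delta>}" for y
  proof -
    have "(cmod (rep u y + - integral {x..y} (der u)))\<^sup>2
        \<le> 2 * (cmod (rep u y))\<^sup>2 + 2 * (cmod (- integral {x..y} (der u)))\<^sup>2" by (rule norm_add_sq_le)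
    moreover have "(cmod (- integral {x..y} (der u)))\<^sup>2 \<le> (y - x) * nsq (der u)"
      using norm_integral_le_L2[OF der_L2, of x y u] x y by simp
    moreover have "(y - x) * nsq (der u) \<le> \<delta> * nsq (der u)" using y by (intro mult_right_mono) auto
    moreover have "rep u x = rep u y + - integral {x..y} (der u)" using integral_der[of x y u] x y by simp
    ultimately show ?thesis by (simp add: mult.assoc)
  qed
  have "integral {x..x + \<delta>} (\<lambda>y. (cmod (rep u x))\<^sup>2)
      \<le> integral {x..x + \<delta>} (\<lambda>y. 2 * (cmod (rep u y))\<^sup>2 + 2 * \<delta> * nsq (der u))"
    by (intro integral_le pt integrable_add integrable_on_mult_right integrable_const_ivl integral_sq_le_nsq rep_L2 x)
  also have "\<dots> = 2 * integral {x..x + \<delta>} (\<lambda>y. (cmod (rep u y))\<^sup>2) + \<delta> * (2 * \<delta> * nsq (der u))"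
    using \<delta> integral_sq_le_nsq(1)[OF rep_L2 x, of u "x + \<delta>"]
    by (subst integral_add) (auto intro!: integrable_on_mult_right)
  also have "\<dots> \<le> 2 * nsq (rep u) + \<delta> * (2 * \<delta> * nsq (der u))"
    by (intro add_right_mono mult_left_mono integral_sq_le_nsq rep_L2 x) auto
  finally show ?thesis using \<delta> by (simp add: field_simps)
qed

lemma norm_rep_le: "cmod (rep u x) \<le> 2 * norm u"
proof (cases "x \<ge> 0")
  case True
  have "(cmod (rep u x))\<^sup>2 \<le> 2 / 1 * nsq (rep u) + 2 * 1 * nsq (der u)"
    by (rule sobolev_point[OF _ True]) simp
  also have "\<dots> \<le> (2 * norm u)\<^sup>2"
    using nsq_nonneg[of "wrep u"] nsq_nonneg[of "rep u"] nsq_nonneg[of "der u"]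
    by (simp add: power_mult_distrib norm_energy_sq)
  finally show ?thesis by (rule power2_le_imp_le) simp
qed (simp add: rep_neg)

lemma bounded_linear_rep: "bounded_linear (\<lambda>u. rep u x)"
  by (rule bounded_linear_intro[where K = 2]) (auto intro: order_trans[OF norm_rep_le])

subsection \<open>Completeness\<close>

lemma nsq_cauchy_limit:
  assumes "Cauchy (X :: nat \<Rightarrow> energy)"
    and f: "\<And>n. f (X n) \<in> L2" and le: "\<And>m n. nsq (\<lambda>x. f (X m) x - f (X n) x) \<le> (norm (X m - X n))\<^sup>2"
  obtains g r where "g \<in> L2" "strict_mono (r::nat\<Rightarrow>nat)" "AE x in halfline. (\<lambda>i. f (X (r i)) x) \<longlonglongrightarrow> g x"
    "(\<lambda>n. nsq (\<lambda>x. f (X n) x - g x)) \<longlonglongrightarrow> 0"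
  unfolding nsq_def
proof (rule L2_complete[of "\<lambda>n. f (X n)"])
  fix e :: real assume e: "e > 0"
  then have "sqrt e > 0" by simp
  from CauchyD[OF assms(1) this] obtain N where N: "\<forall>m\<ge>N. \<forall>n\<ge>N. norm (X m - X n) < sqrt e" by blast
  have "(LINT x|halfline. (cmod (f (X m) x - f (X n) x))\<^sup>2) < e" if "m \<ge> N" "n \<ge> N" for m n
  proof -
    have "(norm (X m - X n))\<^sup>2 < (sqrt e)\<^sup>2" using N that by (intro power_strict_mono) auto
    then show ?thesis using le[of m n] e by (simp add: nsq_def)
  qed
  then show "\<exists>N. \<forall>m\<ge>N. \<forall>n\<ge>N. (LINT x|halfline. (cmod (f (X m) x - f (X n) x))\<^sup>2) < e" by blast
qed (use f in auto)

lemma L2_AE_cong: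
  assumes "f \<in> L2" "AE x in halfline. f x = g x" "g \<in> borel_measurable halfline"
  shows "g \<in> L2"
proof -
  have "integrable halfline (\<lambda>x. (cmod (g x))\<^sup>2)"
    using L2_integrable[OF assms(1)] L2_measurable[OF assms(1)] assms(2,3)
    by (subst integrable_cong_AE[of _ _ "\<lambda>x. (cmod (f x))\<^sup>2"]) auto
  then show ?thesis using assms(3) by (simp add: L2_def)
qed

text \<open>Point evaluation is bounded, so a Cauchy sequence converges pointwise. The L2 limits of
  \<open>rep\<close> and \<open>wrep\<close> agree with the pointwise limit along almost everywhere
  convergent subsequences; the L2 limit of \<open>der\<close> is identified by passing to the limit
  in the integral formula.\<close>

instance energy :: banach
proof
  fix X :: "nat \<Rightarrow> energy" assume X: "Cauchy X"
  have pt: "\<exists>l. (\<lambda>n. rep (X n) x) \<longlonglongrightarrow> l" for x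
  proof -
    have "Cauchy (\<lambda>n. rep (X n) x)"
      by (rule bounded_linear.Cauchy[OF bounded_linear_rep X])
    then show ?thesis by (simp add: Cauchy_convergent_iff convergent_def)
  qed
  then have "\<forall>x. \<exists>l. (\<lambda>n. rep (X n) x) \<longlonglongrightarrow> l" by blast
  from choice[OF this] obtain f where f: "\<And>x. (\<lambda>n. rep (X n) x) \<longlonglongrightarrow> f x" by blast
  have dd: "nsq (\<lambda>x. der (X m) x - der (X n) x) \<le> (norm (X m - X n))\<^sup>2" for m n
    using nsq_der_le[of "X m - X n"] nsq_cong[OF der_diff der_L2 L2_diff[OF der_L2 der_L2], of "X m" "X n"] by simp
  obtain g where g: "g \<in> L2" and gl: "(\<lambda>n. nsq (\<lambda>x. der (X n) x - g x)) \<longlonglongrightarrow> 0"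
    by (rule nsq_cauchy_limit[where f = der, OF X der_L2 dd])
  have rd: "nsq (\<lambda>x. rep (X m) x - rep (X n) x) \<le> (norm (X m - X n))\<^sup>2" for m n
    using nsq_rep_le[of "X m - X n"] unfolding rep_diff' .
  obtain f1 r1 where f1: "f1 \<in> L2" "strict_mono (r1 :: nat \<Rightarrow> nat)" "AE x in halfline. (\<lambda>i. rep (X (r1 i)) x) \<longlonglongrightarrow> f1 x"
    and f1l: "(\<lambda>n. nsq (\<lambda>x. rep (X n) x - f1 x)) \<longlonglongrightarrow> 0"
    by (rule nsq_cauchy_limit[where f = rep, OF X rep_L2 rd])
  have wd: "nsq (\<lambda>x. wrep (X m) x - wrep (X n) x) \<le> (norm (X m - X n))\<^sup>2" for m n
    using nsq_wrep_le[of "X m - X n"] by (simp add: wrep_def[abs_def] right_diff_distrib)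
  obtain f2 r2 where f2: "f2 \<in> L2" "strict_mono (r2 :: nat \<Rightarrow> nat)" "AE x in halfline. (\<lambda>i. wrep (X (r2 i)) x) \<longlonglongrightarrow> f2 x"
    and f2l: "(\<lambda>n. nsq (\<lambda>x. wrep (X n) x - f2 x)) \<longlonglongrightarrow> 0"
    by (rule nsq_cauchy_limit[where f = wrep, OF X wrep_L2 wd])
  have f1f: "AE x in halfline. f1 x = f x"
    using f1(3)
  proof eventually_elim
    case (elim x)
    then show ?case using LIMSEQ_subseq_LIMSEQ[OF f[of x] f1(2)] LIMSEQ_unique by (fastforce simp: o_def)
  qed
  have f2f: "AE x in halfline. f2 x = of_real x * f x"
    using f2(3)
  proof eventually_elim
    case (elim x)
    have "(\<lambda>i. of_real x * rep (X (r2 i)) x) \<longlonglongrightarrow> of_real x * f x"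
      using LIMSEQ_subseq_LIMSEQ[OF f[of x] f2(2)] by (intro tendsto_intros) (simp add: o_def)
    with elim show ?case unfolding wrep_def by (rule LIMSEQ_unique)
  qed
  have fm: "f \<in> borel_measurable halfline"
    by (rule borel_measurable_LIMSEQ_metric[OF L2_measurable[OF rep_L2] f])
  have fL: "f \<in> L2" by (rule L2_AE_cong[OF f1(1) f1f fm])
  have wL: "(\<lambda>x. of_real x * f x) \<in> L2"
    by (rule L2_AE_cong[OF f2(1) f2f])
       (intro borel_measurable_times fm, rule continuous_imp_measurable_on_sets_lebesgue, auto intro!: continuous_intros)
  have fg: "f x = f 0 + integral {0..x} g" if x: "x \<ge> 0" for x
  proof -
    have "(\<lambda>n. integral {0..x} (der (X n)) - integral {0..x} g) \<longlonglongrightarrow> 0"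
    proof (rule tendsto_norm_zero_cancel)
      have "(\<lambda>n. sqrt (x * nsq (\<lambda>x. der (X n) x - g x))) \<longlonglongrightarrow> sqrt (x * 0)"
        by (intro tendsto_intros gl)
      then have lim0: "(\<lambda>n. sqrt (x * nsq (\<lambda>x. der (X n) x - g x))) \<longlonglongrightarrow> 0" by simp
      show "(\<lambda>n. norm (integral {0..x} (der (X n)) - integral {0..x} g)) \<longlonglongrightarrow> 0"
      proof (rule tendsto_sandwich[OF _ _ tendsto_const lim0])
        have "cmod (integral {0..x} (der (X n)) - integral {0..x} g) \<le> sqrt (x * nsq (\<lambda>x. der (X n) x - g x))" for n
          using norm_integral_le_L2[OF L2_diff[OF der_L2 g], of 0 x "X n"] x
          by (intro real_le_rsqrt) (simp add: integral_diff L2_integrable_on der_L2 g)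
        then show "\<forall>\<^sub>F n in sequentially. norm (integral {0..x} (der (X n)) - integral {0..x} g) \<le> sqrt (x * nsq (\<lambda>x. der (X n) x - g x))"
          by (intro always_eventually allI)
      qed auto
    qed
    then have "(\<lambda>n. rep (X n) x - rep (X n) 0 - integral {0..x} g) \<longlonglongrightarrow> 0"
      using rep_eq_integral_der[OF x] by simp
    moreover have "(\<lambda>n. rep (X n) x - rep (X n) 0 - integral {0..x} g) \<longlonglongrightarrow> f x - f 0 - integral {0..x} g"
      by (intro tendsto_intros f)
    ultimately have "f x - f 0 - integral {0..x} g = 0" using LIMSEQ_unique by blast
    then show ?thesis by (simp add: algebra_simps)
  qed
  obtain u where u: "\<And>x. x \<ge> 0 \<Longrightarrow> rep u x = f x" "AE x in halfline. der u x = g x"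
  proof (rule energy_exists)
    show "f \<in> H01" using fL wL by (simp add: H01_def)
    show "f x = f 0 + integral {0..x} g" if "x \<ge> 0" for x by (rule fg[OF that])
  qed (use g in auto)
  have e1: "nsq (der (X n - u)) = nsq (\<lambda>x. der (X n) x - g x)" for n
  proof (rule nsq_cong)
    show "AE x in halfline. der (X n - u) x = der (X n) x - g x"
      using der_diff[of "X n" u] u(2) by eventually_elim simp
  qed (intro L2_diff der_L2 g)+
  have e2: "nsq (rep (X n - u)) = nsq (\<lambda>x. rep (X n) x - f1 x)" for n
  proof (rule nsq_cong)
    show "AE x in halfline. rep (X n - u) x = rep (X n) x - f1 x"
      using f1f unfolding halfline_AE_iff by eventually_elim (use u(1) in auto)
  qed (intro L2_diff rep_L2 f1)+
  have e3: "nsq (wrep (X n - u)) = nsq (\<lambda>x. wrep (X n) x - f2 x)" for n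
  proof (rule nsq_cong)
    show "AE x in halfline. wrep (X n - u) x = wrep (X n) x - f2 x"
      using f2f unfolding halfline_AE_iff by eventually_elim (use u(1) in \<open>auto simp: wrep_def right_diff_distrib\<close>)
  qed (intro L2_diff wrep_L2 f2)+
  have "(\<lambda>n. sqrt ((norm (X n - u))\<^sup>2)) \<longlonglongrightarrow> sqrt (0 + 0 + 0)"
    unfolding norm_energy_sq e1 e2 e3 by (intro tendsto_intros gl f1l f2l)
  then have "(\<lambda>n. norm (X n - u)) \<longlonglongrightarrow> 0" by (simp only: real_sqrt_abs abs_norm_cancel add_0 real_sqrt_zero)
  then have "(\<lambda>n. X n - u) \<longlonglongrightarrow> 0" by (rule tendsto_norm_zero_cancel)
  then have "X \<longlonglongrightarrow> u" by (rule LIM_zero_cancel)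
  then show "convergent X" by (rule convergentI)
qed

subsection \<open>Integration by parts\<close>

text \<open>One factor is only absolutely continuous. The defect \<open>P\<close> of the formula satisfies
  \<open>|P y - P x| \<le> C |y - x| |V y - V x|\<close> with \<open>V\<close> continuous, hence is constant.\<close>

lemma integration_by_parts_ac:
  fixes f g \<phi> \<phi>' :: "real \<Rightarrow> complex"
  assumes ab: "a \<le> b" and g: "g absolutely_integrable_on {a..b}"
    and f: "\<And>x. x \<in> {a..b} \<Longrightarrow> f x = f a + integral {a..x} g"
    and \<phi>: "\<And>x. x \<in> {a..b} \<Longrightarrow> (\<phi> has_vector_derivative \<phi>' x) (at x within {a..b})"
    and \<phi>': "continuous_on {a..b} \<phi>'"
  shows "((\<lambda>x. \<phi> x * g x) has_integral (\<phi> b * f b - \<phi> a * f a - integral {a..b} (\<lambda>x. \<phi>' x * f x))) {a..b}"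
proof -
  have gi: "g integrable_on {a..b}" using g set_lebesgue_integral_eq_integral(1) by blast
  have ni: "(\<lambda>x. cmod (g x)) integrable_on {a..b}"
    using absolutely_integrable_norm[OF g] set_lebesgue_integral_eq_integral(1) by (auto simp: o_def)
  have \<phi>c: "continuous_on {a..b} \<phi>"
    unfolding continuous_on_eq_continuous_within
    by (intro ballI has_vector_derivative_continuous[OF \<phi>])
  have fc: "continuous_on {a..b} f"
  proof -
    have "continuous_on {a..b} (\<lambda>x. f a + integral {a..x} g)"
      by (intro continuous_on_add continuous_on_const indefinite_integral_continuous_1 gi)
    then show ?thesis
      by (rule continuous_on_eq) (rule f[symmetric])
  qed
  have pg: "(\<lambda>x. \<phi> x * g x) integrable_on {a..b}"
  proof -
    have "(\<lambda>x. \<phi> x * g x) absolutely_integrable_on {a..b}"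
    proof (rule absolutely_integrable_bounded_measurable_product[OF bounded_bilinear_mult[THEN bilinear_conv_bounded_bilinear[THEN iffD2]] _ _ _ g])
      show "\<phi> \<in> borel_measurable (lebesgue_on {a..b})"
        by (rule continuous_imp_measurable_on_sets_lebesgue[OF \<phi>c]) simp
      show "bounded (\<phi> ` {a..b})"
        by (rule compact_imp_bounded[OF compact_continuous_image[OF \<phi>c compact_Icc]])
    qed simp
    then show ?thesis using set_lebesgue_integral_eq_integral(1) by blast
  qed
  have pf: "continuous_on {a..b} (\<lambda>x. \<phi>' x * f x)" by (intro continuous_on_mult \<phi>' fc)
  define V where "V = (\<lambda>x. integral {a..x} (\<lambda>x. cmod (g x)))"
  have Vc: "continuous_on {a..b} V" unfolding V_def by (rule indefinite_integral_continuous_1[OF ni])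
  obtain C where C: "\<And>x. x \<in> {a..b} \<Longrightarrow> cmod (\<phi>' x) \<le> C"
    using compact_imp_bounded[OF compact_continuous_image[OF \<phi>' compact_Icc]]
    unfolding bounded_iff by blast
  have C0: "0 \<le> C" using ab by (intro order_trans[OF norm_ge_zero C[of a]]) simp
  define P where "P = (\<lambda>x. \<phi> x * f x - integral {a..x} (\<lambda>x. \<phi> x * g x) - integral {a..x} (\<lambda>x. \<phi>' x * f x))"
  have split: "integral {a..y} h - integral {a..x} h = integral {x..y} h"
    if "h integrable_on {a..b}" "a \<le> x" "x \<le> y" "y \<le> b" for x y and h :: "real \<Rightarrow> 'e::banach"
    using Henstock_Kurzweil_Integration.integral_combine[of a x y h] that
      integrable_subinterval_real[OF that(1), of a y] by (simp add: algebra_simps)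
  have sub: "h integrable_on {x..y}" if "h integrable_on {a..b}" "a \<le> x" "y \<le> b" for x y and h :: "real \<Rightarrow> 'e::banach"
    using that by (intro integrable_subinterval_real[OF that(1)]) auto
  have inc: "cmod (P y - P x) \<le> 2 * C * (y - x) * (V y - V x)" if xy: "a \<le> x" "x \<le> y" "y \<le> b" for x y
  proof -
    have Vxy: "V y - V x = integral {x..y} (\<lambda>s. cmod (g s))" unfolding V_def by (rule split[OF ni xy])
    have fV: "cmod (f y - f s) \<le> V y - V x" if "s \<in> {x..y}" for s
    proof -
      have "f y - f s = integral {s..y} g" using f[of y] f[of s] split[OF gi, of s y] that xy by simp
      also have "cmod \<dots> \<le> integral {s..y} (\<lambda>s. cmod (g s))"
        using that xy by (intro integral_norm_bound_integral sub[OF gi] sub[OF ni]) auto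
      also have "\<dots> \<le> integral {x..y} (\<lambda>s. cmod (g s))"
        using that xy by (intro integral_subset_le sub[OF ni]) auto
      finally show ?thesis by (simp add: Vxy)
    qed
    have \<phi>L: "cmod (\<phi> x - \<phi> s) \<le> C * (y - x)" if "s \<in> {x..y}" for s
    proof -
      have "(\<phi>' has_integral (\<phi> s - \<phi> x)) {x..s}"
      proof (rule fundamental_theorem_of_calculus)
        show "(\<phi> has_vector_derivative \<phi>' r) (at r within {x..s})" if "r \<in> {x..s}" for r
          by (rule has_vector_derivative_within_subset[OF \<phi>]) (use that \<open>s \<in> {x..y}\<close> xy in auto)
      qed (use that in auto)
      then have "cmod (\<phi> s - \<phi> x) \<le> C * measure lborel {x..s}"
      proof (rule has_integral_bound_real[where S = "{}", rotated 2])
        show "0 \<le> C" by (rule C0)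
        show "cmod (\<phi>' r) \<le> C" if "r \<in> {x..s} - {}" for r using C[of r] that \<open>s \<in> {x..y}\<close> xy by simp
      qed simp
      then have "cmod (\<phi> s - \<phi> x) \<le> C * (s - x)" using that by simp
      moreover have "C * (s - x) \<le> C * (y - x)"
        using that C0 by (intro mult_left_mono) auto
      ultimately show ?thesis by (simp add: norm_minus_commute)
    qed
    have \<phi>i: "(\<phi>' has_integral (\<phi> y - \<phi> x)) {x..y}"
    proof (rule fundamental_theorem_of_calculus)
      show "(\<phi> has_vector_derivative \<phi>' r) (at r within {x..y})" if "r \<in> {x..y}" for r
        by (rule has_vector_derivative_within_subset[OF \<phi>]) (use that xy in auto)
    qed (use xy in auto)
    have i1: "integral {x..y} (\<lambda>s. (\<phi> x - \<phi> s) * g s) = \<phi> x * (f y - f x) - integral {x..y} (\<lambda>s. \<phi> s * g s)"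
    proof -
      have "integral {x..y} (\<lambda>s. (\<phi> x - \<phi> s) * g s) = integral {x..y} (\<lambda>s. \<phi> x * g s) - integral {x..y} (\<lambda>s. \<phi> s * g s)"
        unfolding left_diff_distrib
        by (intro integral_diff integrable_on_mult_right sub[OF gi xy(1,3)] sub[OF pg xy(1,3)])
      also have "integral {x..y} (\<lambda>s. \<phi> x * g s) = \<phi> x * (f y - f x)"
        using f[of y] f[of x] split[OF gi xy] xy by simp
      finally show ?thesis .
    qed
    have i2: "integral {x..y} (\<lambda>s. \<phi>' s * (f y - f s)) = (\<phi> y - \<phi> x) * f y - integral {x..y} (\<lambda>s. \<phi>' s * f s)"
    proof -
      have "integral {x..y} (\<lambda>s. \<phi>' s * (f y - f s)) = integral {x..y} (\<lambda>s. \<phi>' s * f y) - integral {x..y} (\<lambda>s. \<phi>' s * f s)"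
        unfolding right_diff_distrib
        by (intro integral_diff integrable_on_mult_left has_integral_integrable[OF \<phi>i]
            sub[OF integrable_continuous_interval[OF pf] xy(1,3)])
      then show ?thesis using integral_unique[OF \<phi>i] by simp
    qed
    have j1: "(\<lambda>s. (\<phi> x - \<phi> s) * g s) integrable_on {x..y}"
      using integrable_diff[OF integrable_on_mult_right[OF sub[OF gi xy(1,3)], of "\<phi> x"] sub[OF pg xy(1,3)]]
      by (simp add: left_diff_distrib)
    have j2: "(\<lambda>s. \<phi>' s * (f y - f s)) integrable_on {x..y}"
      by (intro integrable_continuous_interval continuous_on_mult continuous_on_diff continuous_on_const
          continuous_on_subset[OF \<phi>'] continuous_on_subset[OF fc]) (use xy in auto)
    \<comment> \<open>The increment of the defect is the error of freezing \<phi> at x against g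
      plus that of freezing f at y against \<phi>'; each is at most C (y - x) (V y - V x).\<close>
    have "P y - P x = integral {x..y} (\<lambda>s. (\<phi> x - \<phi> s) * g s) + integral {x..y} (\<lambda>s. \<phi>' s * (f y - f s))"
      unfolding i1 i2 using split[OF pg xy] split[OF integrable_continuous_interval[OF pf] xy]
      by (simp add: P_def algebra_simps)
    also have "cmod \<dots> \<le> cmod (integral {x..y} (\<lambda>s. (\<phi> x - \<phi> s) * g s)) + cmod (integral {x..y} (\<lambda>s. \<phi>' s * (f y - f s)))"
      by (rule norm_triangle_ineq)
    also have "cmod (integral {x..y} (\<lambda>s. (\<phi> x - \<phi> s) * g s)) \<le> integral {x..y} (\<lambda>s. C * (y - x) * cmod (g s))"
      by (intro integral_norm_bound_integral j1 integrable_on_mult_right sub[OF ni xy(1,3)])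
         (simp add: norm_mult mult_right_mono \<phi>L)
    also have "\<dots> = C * (y - x) * (V y - V x)" by (simp add: Vxy)
    also have "cmod (integral {x..y} (\<lambda>s. \<phi>' s * (f y - f s))) \<le> integral {x..y} (\<lambda>s. C * (V y - V x))"
    proof (intro integral_norm_bound_integral j2 integrable_const_ivl)
      fix s assume s: "s \<in> {x..y}"
      have "cmod (\<phi>' s) * cmod (f y - f s) \<le> C * (V y - V x)"
        using s xy C[of s] fV[OF s] C0 by (intro mult_mono) auto
      then show "cmod (\<phi>' s * (f y - f s)) \<le> C * (V y - V x)" by (simp add: norm_mult)
    qed
    also have "\<dots> = C * (y - x) * (V y - V x)" using xy by simp
    finally show ?thesis by simp
  qed
  have "\<exists>k. \<forall>x\<in>{a..b}. P x = k"
  proof (rule has_derivative_zero_constant)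
    fix x assume x: "x \<in> {a..b}"
    have "((\<lambda>y. (1 / norm (y - x)) *\<^sub>R (P y - (P x + 0))) \<longlongrightarrow> 0) (at x within {a..b})"
    proof (rule Lim_null_comparison)
      show "\<forall>\<^sub>F y in at x within {a..b}. norm ((1 / norm (y - x)) *\<^sub>R (P y - (P x + 0))) \<le> 2 * C * \<bar>V y - V x\<bar>"
        unfolding eventually_at_filter
      proof (intro always_eventually allI impI)
        fix y assume y: "y \<noteq> x" "y \<in> {a..b}"
        have "cmod (P y - P x) \<le> 2 * C * \<bar>y - x\<bar> * \<bar>V y - V x\<bar>"
        proof (cases "x \<le> y")
          case True
          have "V x \<le> V y" unfolding V_def using x y True by (intro integral_subset_le sub[OF ni]) auto
          then show ?thesis using inc[of x y] x y True by simp
        next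
          case False
          have "V y \<le> V x" unfolding V_def using x y False by (intro integral_subset_le sub[OF ni]) auto
          then show ?thesis using inc[of y x] x y False by (simp add: norm_minus_commute abs_minus_commute)
        qed
        then show "norm ((1 / norm (y - x)) *\<^sub>R (P y - (P x + 0))) \<le> 2 * C * \<bar>V y - V x\<bar>"
          using y by (simp add: divide_le_eq mult_ac)
      qed
      have "(V \<longlongrightarrow> V x) (at x within {a..b})" using Vc x by (simp add: continuous_on_def)
      then have "((\<lambda>y. 2 * C * \<bar>V y - V x\<bar>) \<longlongrightarrow> 2 * C * \<bar>V x - V x\<bar>) (at x within {a..b})"
        by (intro tendsto_mult tendsto_const tendsto_rabs tendsto_diff)
      then show "((\<lambda>y. 2 * C * \<bar>V y - V x\<bar>) \<longlongrightarrow> 0) (at x within {a..b})" by simp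
    qed
    then show "(P has_derivative (\<lambda>h. 0)) (at x within {a..b})"
      unfolding has_derivative_within by simp
  qed simp
  then have "P b = P a" using ab by force
  then have "integral {a..b} (\<lambda>x. \<phi> x * g x) = \<phi> b * f b - \<phi> a * f a - integral {a..b} (\<lambda>x. \<phi>' x * f x)"
    by (simp add: P_def algebra_simps)
  with pg show ?thesis by (simp add: has_integral_integrable_integral)
qed

lemma has_vector_derivative_within_Icc:
  assumes "(f has_vector_derivative f') (at x within {0..})" "0 \<le> a"
  shows "(f has_vector_derivative f') (at x within {a..b::real})"
  by (rule has_vector_derivative_within_subset[OF assms(1)]) (use assms(2) in auto)

lemma integration_by_parts_energy:
  assumes \<phi>: "\<And>x. x \<ge> 0 \<Longrightarrow> (\<phi> has_vector_derivative \<phi>' x) (at x within {0..})"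
    and \<phi>': "continuous_on {0..} \<phi>'" and b: "b \<ge> 0"
  shows "integral {0..b} (\<lambda>x. \<phi> x * der u x)
    = \<phi> b * rep u b - \<phi> 0 * rep u 0 - integral {0..b} (\<lambda>x. \<phi>' x * rep u x)"
proof (rule integral_unique, rule integration_by_parts_ac[OF b])
  show "der u absolutely_integrable_on {0..b}" by (rule L2_absolutely_integrable[OF der_L2])
  show "rep u x = rep u 0 + integral {0..x} (der u)" if "x \<in> {0..b}" for x
    using that by (intro rep_eq_integral_der) simp
  show "(\<phi> has_vector_derivative \<phi>' x) (at x within {0..b})" if "x \<in> {0..b}" for x
    using that by (intro has_vector_derivative_within_Icc[OF \<phi>]) auto
  show "continuous_on {0..b} \<phi>'" by (rule continuous_on_subset[OF \<phi>']) auto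
qed

lemma continuous_on_of_vector_derivative:
  assumes "\<And>x. x \<in> S \<Longrightarrow> (f has_vector_derivative f' x) (at x within S)"
  shows "continuous_on S f"
  unfolding continuous_on_eq_continuous_within
  by (intro ballI has_vector_derivative_continuous[OF assms])

text \<open>A product of two L2 functions is integrable, so by
  \<open>integrable_vanishing_sequence\<close> the boundary term vanishes along some sequence
  tending to infinity. This takes the place of pointwise decay.\<close>

lemma integration_by_parts_infinite:
  assumes \<phi>: "\<And>x. x \<ge> 0 \<Longrightarrow> (\<phi> has_vector_derivative \<phi>' x) (at x within {0..})"
    and \<phi>': "continuous_on {0..} \<phi>'" and L2: "\<phi> \<in> L2" "\<phi>' \<in> L2"
  shows "(LINT x|halfline. \<phi> x * der u x) = - \<phi> 0 * rep u 0 - (LINT x|halfline. \<phi>' x * rep u x)"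
proof -
  have "integrable halfline (\<lambda>x. cmod (\<phi> x) * cmod (rep u x))"
    by (rule L2_norm_prod_integrable[OF L2(1) rep_L2])
  then obtain X where X: "filterlim X at_top sequentially" "\<And>n. X n \<ge> 1"
    "(\<lambda>n. X n * (cmod (\<phi> (X n)) * cmod (rep u (X n)))) \<longlonglongrightarrow> 0"
    by (rule integrable_vanishing_sequence) auto
  have "(\<lambda>n. \<phi> (X n) * rep u (X n)) \<longlonglongrightarrow> 0"
  proof (rule Lim_null_comparison[OF _ X(3)])
    have "norm (\<phi> (X n) * rep u (X n)) \<le> X n * (cmod (\<phi> (X n)) * cmod (rep u (X n)))" for n
      using mult_right_mono[OF X(2)[of n], of "cmod (\<phi> (X n)) * cmod (rep u (X n))"] by (simp add: norm_mult)
    then show "\<forall>\<^sub>F n in sequentially. norm (\<phi> (X n) * rep u (X n)) \<le> X n * (cmod (\<phi> (X n)) * cmod (rep u (X n)))"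
      by (intro always_eventually allI)
  qed
  then have "(\<lambda>n. \<phi> (X n) * rep u (X n) - \<phi> 0 * rep u 0 - integral {0..X n} (\<lambda>x. \<phi>' x * rep u x))
      \<longlonglongrightarrow> 0 - \<phi> 0 * rep u 0 - (LINT x|halfline. \<phi>' x * rep u x)"
    by (intro tendsto_diff tendsto_const integral_tendsto_halfline X L2_prod_integrable L2 rep_L2)
  moreover have "(\<lambda>n. integral {0..X n} (\<lambda>x. \<phi> x * der u x)) \<longlonglongrightarrow> (LINT x|halfline. \<phi> x * der u x)"
    by (intro integral_tendsto_halfline X L2_prod_integrable L2 der_L2)
  moreover have "integral {0..X n} (\<lambda>x. \<phi> x * der u x)
      = \<phi> (X n) * rep u (X n) - \<phi> 0 * rep u 0 - integral {0..X n} (\<lambda>x. \<phi>' x * rep u x)" for n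
    by (rule integration_by_parts_energy[OF \<phi> \<phi>']) (use X(2)[of n] in auto)
  ultimately show ?thesis using LIMSEQ_unique by fastforce
qed

subsection \<open>Complex scalars\<close>

definition cmul :: "complex \<Rightarrow> energy \<Rightarrow> energy" where
  "cmul c u = Abs_energy (\<lambda>x. c * rep u x)"

lemma rep_cmul [simp]: "rep (cmul c u) x = c * rep u x"
proof -
  have "energy_function (\<lambda>x. c * rep u x)"
    unfolding energy_function_def H01_def
  proof (intro conjI allI impI CollectI bexI[of _ "\<lambda>x. c * der u x"])
    show "(\<lambda>x. of_real x * (c * rep u x)) \<in> L2"
      using L2_cmult[OF rep_weighted_L2[of u], of c] by (simp add: mult.left_commute)
    show "c * rep u x = c * rep u 0 + integral {0..x} (\<lambda>x. c * der u x)" if "x \<ge> 0" for x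
      using that rep_eq_integral_der[of x u] by (simp add: distrib_left)
  qed (auto simp: rep_neg intro: L2_cmult rep_L2 der_L2)
  then show ?thesis by (simp add: cmul_def Abs_energy_inverse)
qed

lemma der_cmul: "AE x in halfline. der (cmul c u) x = c * der u x"
proof (rule der_unique)
  show "rep (cmul c u) x = rep (cmul c u) 0 + integral {0..x} (\<lambda>x. c * der u x)" if "x \<ge> 0" for x
    using that rep_eq_integral_der[of x u] by (simp add: distrib_left)
qed (intro L2_cmult der_L2)

lemma norm_cmul: "norm (cmul c u) = cmod c * norm u"
proof -
  have "nsq (der (cmul c u)) = nsq (\<lambda>x. c * der u x)" by (rule nsq_cong[OF der_cmul der_L2 L2_cmult[OF der_L2]])
  moreover have "rep (cmul c u) = (\<lambda>x. c * rep u x)" "wrep (cmul c u) = (\<lambda>x. c * wrep u x)"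
    by (auto simp: wrep_def)
  ultimately have "(norm (cmul c u))\<^sup>2 = (cmod c * norm u)\<^sup>2"
    by (simp add: norm_energy_sq nsq_cmult power_mult_distrib distrib_left)
  then show ?thesis by (simp add: power2_eq_iff_nonneg)
qed

lemma bounded_linear_cmul: "bounded_linear (cmul c)"
  by (rule bounded_linear_intro[where K = "cmod c"])
     (auto intro!: energy_eqI simp: distrib_left norm_cmul mult.commute)

subsection \<open>The Robin Laplacian\<close>

text \<open>Derivatives are classical, one-sided at 0, so that \<open>u1 0\<close> is a genuine
  boundary value for the Robin condition. The second derivative must again be an
  \<open>energy\<close>, since the Laplacian is to act inside this space.\<close>

definition twice :: "energy \<Rightarrow> (real \<Rightarrow> complex) \<Rightarrow> energy \<Rightarrow> bool" where
  "twice u u1 v \<longleftrightarrow>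
     (\<forall>x\<ge>0. (rep u has_vector_derivative u1 x) (at x within {0..})) \<and>
     (\<forall>x\<ge>0. (u1 has_vector_derivative rep v x) (at x within {0..}))"

lemma has_vector_derivative_unique_halfline:
  assumes "(f has_vector_derivative a) (at x within {0..})" "(f has_vector_derivative b) (at x within {0..})" "x \<ge> 0"
  shows "a = b"
proof -
  have "(f has_vector_derivative a) (at x within {x..x + 1})" "(f has_vector_derivative b) (at x within {x..x + 1})"
    using assms by (auto intro: has_vector_derivative_within_Icc)
  then show ?thesis by (intro vector_derivative_unique_within_closed_interval[of x "x + 1" x]) auto
qed

lemma twice_unique:
  assumes "twice u u1 v" "twice u u1' v'" shows "v = v'" "u1 0 = u1' 0"
proof -
  have e: "u1 x = u1' x" if "x \<ge> 0" for x
    using assms that unfolding twice_def by (blast intro: has_vector_derivative_unique_halfline)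
  then show "u1 0 = u1' 0" by simp
  show "v = v'"
  proof (rule energy_eqI)
    fix x :: real assume x: "x \<ge> 0"
    have "(u1 has_vector_derivative rep v x) (at x within {0..})" using assms(1) x by (simp add: twice_def)
    moreover have "(u1 has_vector_derivative rep v' x) (at x within {0..})"
    proof (rule has_vector_derivative_transform)
      show "(u1' has_vector_derivative rep v' x) (at x within {0..})" using assms(2) x by (simp add: twice_def)
    qed (use x e in auto)
    ultimately show "rep v x = rep v' x" using x by (rule has_vector_derivative_unique_halfline)
  qed
qed

lemma der_eq_C1:
  assumes d: "\<And>x. x \<ge> 0 \<Longrightarrow> (rep u has_vector_derivative u1 x) (at x within {0..})"
    and c: "continuous_on {0..} u1"
  shows "AE x in halfline. der u x = u1 x" "u1 \<in> L2"
proof -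
  have FTC: "integral {p..q} u1 = rep u q - rep u p" if "0 \<le> p" "p \<le> q" for p q
    using that by (intro integral_unique fundamental_theorem_of_calculus)
      (auto intro!: has_vector_derivative_within_Icc[OF d])
  show 1: "AE x in halfline. der u x = u1 x"
  proof -
    have "AE x in halfline. der u x - u1 x = 0"
    proof (rule halfline_AE_I_intervals, rule AE_zero_of_integrals_zero)
      fix b :: real assume "b > 0"
      have u1: "u1 absolutely_integrable_on {p..q}" if "0 \<le> p" for p q
        by (rule absolutely_integrable_continuous_real, rule continuous_on_subset[OF c]) (use that in auto)
      show "(\<lambda>x. der u x - u1 x) absolutely_integrable_on {0..b}"
        by (intro set_integral_diff(1) L2_absolutely_integrable der_L2 u1) auto
      fix p q assume pq: "0 \<le> p" "p \<le> q" "q \<le> b"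
      have "der u integrable_on {p..q}"
        by (rule integrable_subinterval_real[OF L2_integrable_on[OF der_L2, where b = q]]) (use pq in auto)
      moreover have "u1 integrable_on {p..q}" using u1[OF pq(1)] set_lebesgue_integral_eq_integral(1) by blast
      ultimately show "integral {p..q} (\<lambda>x. der u x - u1 x) = 0"
        using pq FTC integral_der[of p q u] by (simp add: integral_diff)
    qed auto
    then show ?thesis by simp
  qed
  show "u1 \<in> L2"
  proof (rule L2_AE_cong[OF der_L2 1])
    show "u1 \<in> borel_measurable halfline"
      by (rule continuous_imp_measurable_on_sets_lebesgue, rule continuous_on_subset[OF c]) auto
  qed
qed

lemma twice_C1:
  assumes "twice u u1 v"
  shows "continuous_on {0..} u1" "AE x in halfline. der u x = u1 x" "u1 \<in> L2"
proof -
  show c: "continuous_on {0..} u1"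
    using assms by (intro continuous_on_of_vector_derivative[of _ u1 "rep v"]) (auto simp: twice_def)
  show "AE x in halfline. der u x = u1 x" "u1 \<in> L2"
    using der_eq_C1[OF _ c] assms unfolding twice_def by blast+
qed

lemma twice_add:
  assumes "twice u u1 v" "twice u' u1' v'"
  shows "twice (u + u') (\<lambda>x. u1 x + u1' x) (v + v')"
  using assms unfolding twice_def rep_add' by (auto intro: has_vector_derivative_add)

lemma twice_scaleR: "twice u u1 v \<Longrightarrow> twice (r *\<^sub>R u) (\<lambda>x. r *\<^sub>R u1 x) (r *\<^sub>R v)"
  unfolding twice_def rep_scaleR'
  using bounded_linear.has_vector_derivative[OF bounded_linear_scaleR_right] by fastforce

definition dom :: "real \<Rightarrow> energy set" where
  "dom \<alpha> = {u. \<exists>u1 v. twice u u1 v \<and> rep u 0 + of_real \<alpha> * u1 0 = 0}"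

definition lap :: "energy \<Rightarrow> energy" where "lap u = (SOME v. \<exists>u1. twice u u1 v)"

lemma lap_eq: "twice u u1 v \<Longrightarrow> lap u = v"
  unfolding lap_def by (rule some_equality) (auto dest: twice_unique)

text \<open>The shift by the identity absorbs the growth of the weighted norm.\<close>

definition gen :: "energy \<Rightarrow> energy" where "gen u = cmul (\<i> / 2) (lap u) - u"

text \<open>The last term is the boundary term of the Robin Laplacian: for u in
  \<open>dom \<alpha>\<close> integration by parts gives <u',v'> - u(0) conj v(0) / \<alpha> = -
  <u'',v>.\<close>

definition bform :: "real \<Rightarrow> energy \<Rightarrow> energy \<Rightarrow> real" where
  "bform \<alpha> u v = inner u v + 8 / \<alpha>\<^sup>2 * Re (pair (rep u) (rep v)) - Re (rep u 0 * cnj (rep v 0)) / \<alpha>"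

lemma Re_pair_rep_le: "\<bar>Re (pair (rep u) (rep v))\<bar> \<le> norm u * norm v"
proof -
  have "(cmod (pair (rep u) (rep v)))\<^sup>2 \<le> nsq (rep u) * nsq (rep v)" by (rule norm_pair_le[OF rep_L2 rep_L2])
  also have "\<dots> \<le> (norm u)\<^sup>2 * (norm v)\<^sup>2" by (intro mult_mono nsq_rep_le) auto
  also have "\<dots> = (norm u * norm v)\<^sup>2" by (rule power_mult_distrib[symmetric])
  finally have "cmod (pair (rep u) (rep v)) \<le> norm u * norm v"
    by (rule power2_le_imp_le) (intro mult_nonneg_nonneg norm_ge_zero)
  then show ?thesis by (rule order_trans[OF abs_Re_le_cmod])
qed

lemma bounded_bilinear_bform: "bounded_bilinear (bform \<alpha>)"
proof
  fix u u' v v' :: energy and r :: real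
  have Rsym: "Re (pair f g) = Re (pair g f)" for f g by (subst pair_cnj[symmetric]) simp
  have sym: "bform \<alpha> u v = bform \<alpha> v u" for u v
    unfolding bform_def using Rsym[of "rep u" "rep v"] by (simp add: inner_commute mult.commute)
  have al: "bform \<alpha> (u + u') v = bform \<alpha> u v + bform \<alpha> u' v" for u u' v
    by (simp only: bform_def inner_add_left rep_add' pair_add_left rep_L2 plus_complex.sel
        distrib_left distrib_right add_divide_distrib)
  have sl: "bform \<alpha> (r *\<^sub>R u) v = r *\<^sub>R bform \<alpha> u v" for r u v
    by (simp add: bform_def rep_scaleR' pair_scaleR_left right_diff_distrib distrib_left)
  show "bform \<alpha> (u + u') v = bform \<alpha> u v + bform \<alpha> u' v" by (rule al)
  show "bform \<alpha> (r *\<^sub>R u) v = r *\<^sub>R bform \<alpha> u v" by (rule sl)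
  show "bform \<alpha> u (v + v') = bform \<alpha> u v + bform \<alpha> u v'" using al[of v v' u] sym by metis
  show "bform \<alpha> u (r *\<^sub>R v) = r *\<^sub>R bform \<alpha> u v" using sl[of r v u] sym by metis
  have "norm (bform \<alpha> u v) \<le> norm u * norm v * (1 + 8 / \<alpha>\<^sup>2 + 4 / \<bar>\<alpha>\<bar>)" for u v
  proof -
    have 1: "\<bar>inner u v\<bar> \<le> norm u * norm v" by (rule Cauchy_Schwarz_ineq2)
    have 2: "\<bar>8 / \<alpha>\<^sup>2 * Re (pair (rep u) (rep v))\<bar> \<le> 8 / \<alpha>\<^sup>2 * (norm u * norm v)"
      unfolding abs_mult using Re_pair_rep_le by (intro mult_mono) auto
    have "\<bar>Re (rep u 0 * cnj (rep v 0))\<bar> \<le> cmod (rep u 0) * cmod (rep v 0)"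
      using abs_Re_le_cmod[of "rep u 0 * cnj (rep v 0)"] by (simp add: norm_mult)
    also have "\<dots> \<le> (2 * norm u) * (2 * norm v)" by (intro mult_mono norm_rep_le) auto
    finally have 3: "\<bar>Re (rep u 0 * cnj (rep v 0)) / \<alpha>\<bar> \<le> 4 * (norm u * norm v) / \<bar>\<alpha>\<bar>"
      unfolding abs_divide by (intro divide_right_mono) auto
    have "norm (bform \<alpha> u v) \<le> norm u * norm v + 8 / \<alpha>\<^sup>2 * (norm u * norm v) + 4 * (norm u * norm v) / \<bar>\<alpha>\<bar>"
      unfolding bform_def real_norm_def using 1 2 3 by linarith
    then show ?thesis by (simp add: algebra_simps)
  qed
  then show "\<exists>K. \<forall>a b. norm (bform \<alpha> a b) \<le> norm a * norm b * K" by blast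
qed

lemma bform_sym: "bform \<alpha> u v = bform \<alpha> v u"
proof -
  have "Re (pair f g) = Re (pair g f)" for f g by (subst pair_cnj[symmetric]) simp
  from this[of "rep u" "rep v"] show ?thesis unfolding bform_def by (simp add: inner_commute mult.commute)
qed

lemma bform_coercive:
  assumes "\<alpha> \<noteq> 0" shows "1 / 2 * (norm u)\<^sup>2 \<le> bform \<alpha> u u"
proof -
  \<comment> \<open>With \<delta> = |\<alpha>| / 4, after division by |\<alpha>|, the derivative
    enters with the factor 1/2 and u with 8 / \<alpha>^2, the multiple built into
    \<open>bform\<close>.\<close>
  have "(cmod (rep u 0))\<^sup>2 \<le> 2 / (\<bar>\<alpha>\<bar> / 4) * nsq (rep u) + 2 * (\<bar>\<alpha>\<bar> / 4) * nsq (der u)"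
    using assms by (intro sobolev_point) auto
  then have "(cmod (rep u 0))\<^sup>2 / \<bar>\<alpha>\<bar> \<le> (2 / (\<bar>\<alpha>\<bar> / 4) * nsq (rep u) + 2 * (\<bar>\<alpha>\<bar> / 4) * nsq (der u)) / \<bar>\<alpha>\<bar>"
    by (intro divide_right_mono) auto
  also have "\<dots> = 8 / \<alpha>\<^sup>2 * nsq (rep u) + nsq (der u) / 2"
    using assms by (simp add: add_divide_distrib power2_eq_square)
  finally have "(cmod (rep u 0))\<^sup>2 / \<bar>\<alpha>\<bar> \<le> 8 / \<alpha>\<^sup>2 * nsq (rep u) + nsq (der u) / 2" .
  moreover have "(cmod (rep u 0))\<^sup>2 / \<alpha> \<le> (cmod (rep u 0))\<^sup>2 / \<bar>\<alpha>\<bar>"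
  proof (cases "\<alpha> > 0")
    case False
    then have "(cmod (rep u 0))\<^sup>2 / \<alpha> \<le> 0" by (intro divide_nonneg_nonpos) auto
    moreover have "0 \<le> (cmod (rep u 0))\<^sup>2 / \<bar>\<alpha>\<bar>" by simp
    ultimately show ?thesis by linarith
  qed simp
  moreover have "bform \<alpha> u u = nsq (der u) + nsq (rep u) + nsq (wrep u) + 8 / \<alpha>\<^sup>2 * nsq (rep u) - (cmod (rep u 0))\<^sup>2 / \<alpha>"
    unfolding bform_def pair_self Re_complex_of_real inner_self complex_norm_square[symmetric] ..
  moreover have "nsq (rep u) \<ge> 0" "nsq (wrep u) \<ge> 0" by (rule nsq_nonneg)+
  ultimately have "(nsq (der u) + nsq (rep u) + nsq (wrep u)) / 2 \<le> bform \<alpha> u u" by argo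
  then show ?thesis by (simp add: norm_energy_sq)
qed

text \<open>Without the weight the operator (i/2) d^2/dx^2 contributes no real part. The weighted
  part leaves the commutator Im <u', x u>, which is at most half the squared norm, hence at most
  \<open>bform \<alpha> u u\<close>; exactly this is what the - u in \<open>gen\<close>
  subtracts.\<close>

lemma bform_gen_le:
  assumes \<alpha>: "\<alpha> \<noteq> 0" and u: "u \<in> dom \<alpha>"
  shows "bform \<alpha> (gen u) u \<le> 0"
proof -
  obtain u1 v where tw: "twice u u1 v" and robin: "rep u 0 + of_real \<alpha> * u1 0 = 0"
    using u by (auto simp: dom_def)
  note C1 = twice_C1[OF tw]
  have du: "\<And>x. x \<ge> 0 \<Longrightarrow> (rep u has_vector_derivative u1 x) (at x within {0..})"
    and du1: "\<And>x. x \<ge> 0 \<Longrightarrow> (u1 has_vector_derivative rep v x) (at x within {0..})"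
    using tw by (auto simp: twice_def)
  have lu: "lap u = v" by (rule lap_eq[OF tw])
  have dcu1: "((\<lambda>x. cnj (u1 x)) has_vector_derivative cnj (rep v x)) (at x within {0..})" if "x \<ge> 0" for x
    using bounded_linear.has_vector_derivative[OF bounded_linear_cnj du1[OF that]] by (simp add: o_def)
  have vc: "continuous_on {0..} (\<lambda>x. cnj (rep v x))"
    by (intro continuous_on_cnj rep_continuous_on)
  have u10: "cnj (u1 0) = - cnj (rep u 0) / of_real \<alpha>"
  proof -
    have "u1 0 = - rep u 0 / of_real \<alpha>" using robin \<alpha> by (simp add: field_simps add_eq_0_iff)
    then show ?thesis by simp
  qed
  have i: "pair (der v) u1 = - cnj (u1 0) * rep v 0 - of_real (nsq (rep v))"
    using integration_by_parts_infinite[OF dcu1 vc L2_cnj[OF C1(3)] L2_cnj[OF rep_L2], of v]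
    by (simp add: pair_def pair_self[symmetric] mult.commute)
  have ii: "pair (rep u) (rep v) = - cnj (u1 0) * rep u 0 - of_real (nsq u1)"
  proof -
    have "pair (der u) u1 = - cnj (u1 0) * rep u 0 - pair (rep u) (rep v)"
      using integration_by_parts_infinite[OF dcu1 vc L2_cnj[OF C1(3)] L2_cnj[OF rep_L2], of u]
      by (simp add: pair_def mult.commute)
    moreover have "pair (der u) u1 = of_real (nsq u1)"
      unfolding pair_self[symmetric] by (rule pair_cong[OF C1(2)]) (auto intro: der_L2 C1)
    ultimately show ?thesis by (simp add: algebra_simps)
  qed
  \<comment> \<open>Obtained from the derivative of x^2 u' conj u, integrated over [0, X n], where
    the boundary term vanishes along \<open>X\<close>.\<close>
  have iii: "Im (pair (wrep v) (wrep u)) = - 2 * Im (pair u1 (wrep u))"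
  proof -
    have "integrable halfline (\<lambda>x. cmod (u1 x) * cmod (wrep u x))"
      by (rule L2_norm_prod_integrable[OF C1(3) wrep_L2])
    then obtain X where X: "filterlim X at_top sequentially" "\<And>n. X n \<ge> 1"
      "(\<lambda>n. X n * (cmod (u1 (X n)) * cmod (wrep u (X n)))) \<longlonglongrightarrow> 0"
      by (rule integrable_vanishing_sequence) auto
    define G where "G = (\<lambda>x. (of_real x)\<^sup>2 * (u1 x * cnj (rep u x)))"
    define G' where "G' = (\<lambda>x. 2 * of_real x * (u1 x * cnj (rep u x)) + (of_real x)\<^sup>2 * (rep v x * cnj (rep u x) + u1 x * cnj (u1 x)))"
    have dG: "(G has_vector_derivative G' x) (at x within {0..})" if x: "x \<ge> 0" for x
    proof -
      have "((\<lambda>x. cnj (rep u x)) has_vector_derivative cnj (u1 x)) (at x within {0..})"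
        using bounded_linear.has_vector_derivative[OF bounded_linear_cnj du[OF x]] by (simp add: o_def)
      from has_vector_derivative_mult[OF du1[OF x] this]
      have 1: "((\<lambda>x. u1 x * cnj (rep u x)) has_vector_derivative (u1 x * cnj (u1 x) + rep v x * cnj (rep u x))) (at x within {0..})" .
      have 2: "((\<lambda>x. (of_real x :: complex)\<^sup>2) has_vector_derivative (2 * of_real x)) (at x within {0..})"
        unfolding power2_eq_square
        by (rule has_vector_derivative_eq_rhs[OF has_vector_derivative_mult[OF has_vector_derivative_of_real has_vector_derivative_of_real]])
           (auto intro!: has_vector_derivative_real_field derivative_eq_intros)
      show ?thesis unfolding G_def G'_def
        by (rule has_vector_derivative_eq_rhs[OF has_vector_derivative_mult[OF 2 1]]) (simp add: algebra_simps)
    qed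
    have Glim: "(\<lambda>n. G (X n)) \<longlonglongrightarrow> 0"
    proof (rule Lim_null_comparison[OF _ X(3)])
      have "norm (G (X n)) \<le> X n * (cmod (u1 (X n)) * cmod (wrep u (X n)))" for n
        using X(2)[of n] by (simp add: G_def wrep_def norm_mult norm_power power2_eq_square)
      then show "\<forall>\<^sub>F n in sequentially. norm (G (X n)) \<le> X n * (cmod (u1 (X n)) * cmod (wrep u (X n)))"
        by (intro always_eventually allI)
    qed
    define H where "H = (\<lambda>x. wrep v x * cnj (wrep u x) + 2 * (u1 x * cnj (wrep u x)))"
    \<comment> \<open>The term x^2 |u'|^2, whose integrability over the half-line is not known, is
      real; taking imaginary parts removes it before the limit.\<close>
    have ImH: "Im (G' x) = Im (H x)" for x
    proof -
      have "G' x = H x + of_real (x\<^sup>2 * (cmod (u1 x))\<^sup>2)"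
        unfolding of_real_mult complex_norm_square
        by (simp add: G'_def H_def wrep_def algebra_simps power2_eq_square)
      then show ?thesis by simp
    qed
    have Hint: "integrable halfline H"
      unfolding H_def by (intro Bochner_Integration.integrable_add integrable_mult_right pair_integrable wrep_L2 C1)
    have "integral {0..X n} (\<lambda>x. Im (H x)) = Im (G (X n))" for n
    proof -
      have "(G' has_integral (G (X n) - G 0)) {0..X n}"
        using X(2)[of n] by (intro fundamental_theorem_of_calculus has_vector_derivative_within_Icc[OF dG]) auto
      from has_integral_linear[OF this bounded_linear_Im]
      have "((\<lambda>x. Im (H x)) has_integral Im (G (X n) - G 0)) {0..X n}" by (simp add: o_def ImH)
      then show ?thesis by (simp add: integral_unique G_def)
    qed
    moreover have "(\<lambda>n. integral {0..X n} (\<lambda>x. Im (H x))) \<longlonglongrightarrow> (LINT x|halfline. Im (H x))"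
      by (intro integral_tendsto_halfline X integrable_Im Hint)
    ultimately have "(\<lambda>n. Im (G (X n))) \<longlonglongrightarrow> (LINT x|halfline. Im (H x))" by simp
    moreover have "(\<lambda>n. Im (G (X n))) \<longlonglongrightarrow> 0" using tendsto_Im[OF Glim] by simp
    ultimately have "(LINT x|halfline. Im (H x)) = 0" by (rule LIMSEQ_unique)
    then have "Im (LINT x|halfline. H x) = 0" using integral_Im[OF Hint] by simp
    moreover have "(LINT x|halfline. H x) = pair (wrep v) (wrep u) + 2 * pair u1 (wrep u)"
      unfolding H_def pair_def by (simp add: pair_integrable wrep_L2 C1)
    ultimately show ?thesis by simp
  qed
  define w where "w = cmul (\<i> / 2) v"
  have dw: "pair (der w) (der u) = \<i> / 2 * pair (der v) u1"
  proof -
    have "pair (der w) (der u) = pair (\<lambda>x. \<i> / 2 * der v x) u1"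
      unfolding w_def by (rule pair_cong[OF der_cmul C1(2) der_L2 L2_cmult[OF der_L2] der_L2 C1(3)])
    then show ?thesis by (simp only: pair_cmult_left)
  qed
  have rw: "pair (rep w) (rep u) = \<i> / 2 * pair (rep v) (rep u)"
    unfolding w_def pair_cmult_left[symmetric] by (rule arg_cong2[where f = pair]) auto
  have ww: "pair (wrep w) (wrep u) = \<i> / 2 * pair (wrep v) (wrep u)"
    unfolding w_def pair_cmult_left[symmetric] by (rule arg_cong2[where f = pair]) (auto simp: wrep_def)
  \<comment> \<open>By \<open>ii\<close> and the Robin condition <u,u''> is real, so i/2 times it
    has no real part.\<close>
  have uv: "Im (pair (rep v) (rep u)) = 0"
  proof -
    have "cnj (u1 0) * rep u 0 = - of_real ((cmod (rep u 0))\<^sup>2 / \<alpha>)"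
      unfolding u10 of_real_divide complex_norm_square by (simp add: mult.commute)
    then have "Im (pair (rep u) (rep v)) = 0" unfolding ii by simp
    then show ?thesis by (subst pair_cnj[symmetric]) simp
  qed
  \<comment> \<open>The boundary term of \<open>bform\<close> reappears as
    \<open>cnj (u1 0) * rep v 0\<close> and completes \<open>i\<close> to - nsq (rep v), which is
    real and therefore disappears after multiplication by i/2.\<close>
  have "bform \<alpha> w u = Re (\<i> / 2 * (pair (der v) u1 + cnj (u1 0) * rep v 0)) + Re (\<i> / 2 * pair (wrep v) (wrep u))"
    unfolding bform_def inner_energy_def dw rw ww using uv
    by (simp add: w_def u10 algebra_simps)
  also have "\<dots> = Im (pair u1 (wrep u))" unfolding i using iii by simp
  also have "\<dots> \<le> (nsq u1 + nsq (wrep u)) / 2"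
    using norm_pair_le_half[OF C1(3) wrep_L2, of u] abs_Im_le_cmod[of "pair u1 (wrep u)"] by linarith
  also have "nsq u1 = nsq (der u)" by (rule nsq_cong[symmetric, OF C1(2) der_L2 C1(3)])
  also have "(nsq (der u) + nsq (wrep u)) / 2 \<le> 1 / 2 * (norm u)\<^sup>2"
    unfolding norm_energy_sq by simp
  also have "\<dots> \<le> bform \<alpha> u u" by (rule bform_coercive[OF \<alpha>])
  finally have "bform \<alpha> w u \<le> bform \<alpha> u u" .
  then show ?thesis
    unfolding gen_def lu w_def[symmetric] by (simp add: bounded_bilinear.diff_left[OF bounded_bilinear_bform])
qed

subsection \<open>The resolvent equation\<close>

lemma has_real_derivative_cmod_sq:
  assumes "(f has_vector_derivative f') (at x within S)"
  shows "((\<lambda>x. (cmod (f x))\<^sup>2) has_real_derivative 2 * inner f' (f x)) (at x within S)"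
  using bounded_bilinear.has_vector_derivative[OF bounded_bilinear_inner assms assms]
  by (simp add: has_real_derivative_iff_has_vector_derivative power2_norm_eq_inner inner_commute)

lemma inner_mult_self: "inner (k * z) z = Re k * (cmod z)\<^sup>2"
  unfolding inner_complex_def cmod_power2 by (simp add: algebra_simps power2_eq_square)

lemma weighted_derivative:
  fixes \<epsilon> :: real
  assumes "(f has_vector_derivative f') (at x within {0..})"
  shows "((\<lambda>x. (1 + \<epsilon> * x\<^sup>2) * (cmod (f x))\<^sup>2) has_real_derivative
    2 * \<epsilon> * x * (cmod (f x))\<^sup>2 + (1 + \<epsilon> * x\<^sup>2) * (2 * inner f' (f x))) (at x within {0..})"
  by (rule derivative_eq_intros has_real_derivative_cmod_sq[OF assms] refl | simp add: algebra_simps)+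

text \<open>For every \<epsilon> > 0 the weight is comparable to 1 + x^2. Keeping \<epsilon> free
  lets the differentiated weight be absorbed by the damping in
  \<open>first_order_from_boundary\<close>.\<close>

lemma weighted_L2I:
  assumes c: "continuous_on {0..} f" and \<epsilon>: "\<epsilon> > 0"
    and le: "\<And>b. b > 0 \<Longrightarrow> integral {0..b} (\<lambda>x. (1 + \<epsilon> * x\<^sup>2) * (cmod (f x))\<^sup>2) \<le> C"
  shows "f \<in> H01"
proof -
  have cc: "continuous_on {0..} (\<lambda>x. (1 + \<epsilon> * x\<^sup>2) * (cmod (f x))\<^sup>2)"
    by (intro continuous_intros c)
  have m: "h \<in> borel_measurable halfline" if "continuous_on {0..} h" for h :: "real \<Rightarrow> 'e::{second_countable_topology,real_normed_vector}"
    by (rule continuous_imp_measurable_on_sets_lebesgue, rule continuous_on_subset[OF that]) auto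
  have I: "integrable halfline (\<lambda>x. (1 + \<epsilon> * x\<^sup>2) * (cmod (f x))\<^sup>2)"
  proof (rule halfline_integrableI_bounded(1)[OF m[OF cc] _ _ le])
    show "0 \<le> (1 + \<epsilon> * x\<^sup>2) * (cmod (f x))\<^sup>2" if "x > 0" for x
      using \<epsilon> by (intro mult_nonneg_nonneg add_nonneg_nonneg) auto
    show "(\<lambda>x. (1 + \<epsilon> * x\<^sup>2) * (cmod (f x))\<^sup>2) integrable_on {0..b}" if "b > 0" for b
      by (rule integrable_continuous_interval, rule continuous_on_subset[OF cc]) auto
  qed auto
  have "f \<in> L2"
  proof (rule L2I_bound[OF m[OF c] I])
    show "(cmod (f x))\<^sup>2 \<le> (1 + \<epsilon> * x\<^sup>2) * (cmod (f x))\<^sup>2" for x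
      using \<epsilon> mult_right_mono[of 1 "1 + \<epsilon> * x\<^sup>2" "(cmod (f x))\<^sup>2"] by simp
  qed
  moreover have "(\<lambda>x. of_real x * f x) \<in> L2"
  proof (rule L2I_bound)
    show "(\<lambda>x. of_real x * f x) \<in> borel_measurable halfline"
      by (intro m continuous_intros c)
    show "integrable halfline (\<lambda>x. (1 / \<epsilon>) * ((1 + \<epsilon> * x\<^sup>2) * (cmod (f x))\<^sup>2))"
      by (intro integrable_mult_right I)
    show "(cmod (of_real x * f x))\<^sup>2 \<le> (1 / \<epsilon>) * ((1 + \<epsilon> * x\<^sup>2) * (cmod (f x))\<^sup>2)" for x
      using \<epsilon> by (simp add: norm_mult power_mult_distrib field_simps)
  qed
  ultimately show ?thesis by (simp add: H01_def)
qed

lemma has_vector_derivative_exp_mult: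
  fixes k :: complex
  shows "((\<lambda>x. exp (k * of_real x)) has_vector_derivative k * exp (k * of_real x)) (at x within S)"
proof -
  have "((\<lambda>z. exp (k * z)) has_field_derivative k * exp (k * of_real x)) (at (of_real x))"
    by (auto intro!: derivative_eq_intros)
  from has_vector_derivative_real_field[OF this] show ?thesis .
qed

text \<open>Decaying solutions of the two first-order factors of \<open>u'' - k\<^sup>2 u\<close>: the first is integrated
  from infinity, the second from the boundary. In both, \<open>(1 + \<epsilon> x\<^sup>2)|\<cdot>|\<^sup>2\<close> is the energy.\<close>

lemma first_order_from_infinity:
  fixes k :: complex
  assumes k: "Re k > 0"
  obtains v where "\<And>x. x \<ge> 0 \<Longrightarrow> (v has_vector_derivative (k * v x + rep f x)) (at x within {0..})"
    "v \<in> H01" "continuous_on {0..} v"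
proof -
  define \<kappa> where "\<kappa> = Re k"
  have \<kappa>: "\<kappa> > 0" using k by (simp add: \<kappa>_def)
  define e where "e = (\<lambda>x. exp (- k * of_real x) * rep f x)"
  have ec: "continuous_on {0..} e" unfolding e_def by (intro continuous_intros rep_continuous_on)
  have ne: "cmod (e y) = exp (- \<kappa> * y) * cmod (rep f y)" for y
    by (simp add: e_def norm_mult \<kappa>_def)
  define Q where "Q = (1 / \<kappa> + 2 * nsq (rep f) + 2 * nsq (wrep f)) / 2"
  have Q: "Q \<ge> 0" using \<kappa> by (auto simp: Q_def intro!: add_nonneg_nonneg)
  have fc: "continuous_on {x..y} (rep f)" if "x \<ge> 0" for x y
    by (rule continuous_on_subset[OF rep_continuous_on]) (use that in auto)
  \<comment> \<open>Decay of the integral from x on, with a gain of 1 + x. After multiplication by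
    exp(k x) it leaves (1 + x) |v x| \<le> Q, which bounds the energy at the right end of every
    interval.\<close>
  have tail: "(1 + x) * integral {x..y} (\<lambda>s. exp (- \<kappa> * s) * cmod (rep f s)) \<le> exp (- \<kappa> * x) * Q"
    if xy: "0 \<le> x" "x \<le> y" for x y
  proof -
    have "(1 + x) * integral {x..y} (\<lambda>s. exp (- \<kappa> * s) * cmod (rep f s))
        = integral {x..y} (\<lambda>s. (1 + x) * (exp (- \<kappa> * s) * cmod (rep f s)))" by simp
    also have "\<dots> \<le> integral {x..y} (\<lambda>s. exp (- \<kappa> * x) * (exp (- 2 * \<kappa> * (s - x)) / 2 + ((cmod (rep f s))\<^sup>2 + (cmod (wrep f s))\<^sup>2)))"
    proof (rule integral_le)
      show "(\<lambda>s. (1 + x) * (exp (- \<kappa> * s) * cmod (rep f s))) integrable_on {x..y}"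
        by (intro integrable_continuous_interval continuous_intros fc xy)
      show "(\<lambda>s. exp (- \<kappa> * x) * (exp (- 2 * \<kappa> * (s - x)) / 2 + ((cmod (rep f s))\<^sup>2 + (cmod (wrep f s))\<^sup>2))) integrable_on {x..y}"
        unfolding wrep_def by (intro integrable_continuous_interval continuous_intros fc xy) simp
      fix s assume s: "s \<in> {x..y}"
      define E where "E = exp (- \<kappa> * (s - x))"
      have "(1 + x) * cmod (rep f s) \<le> (1 + s) * cmod (rep f s)" using s by (intro mult_right_mono) auto
      then have "E * ((1 + x) * cmod (rep f s)) \<le> E * ((1 + s) * cmod (rep f s))"
        by (intro mult_left_mono) (auto simp: E_def)
      also have "\<dots> \<le> E\<^sup>2 / 2 + ((1 + s) * cmod (rep f s))\<^sup>2 / 2"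
        using sum_squares_bound[of E "(1 + s) * cmod (rep f s)"] by simp
      also have "((1 + s) * cmod (rep f s))\<^sup>2 / 2 \<le> (cmod (rep f s))\<^sup>2 + (cmod (wrep f s))\<^sup>2"
      proof -
        have "(1 + s)\<^sup>2 / 2 \<le> 1 + s\<^sup>2" using sum_squares_bound[of 1 s] by (simp add: power2_sum)
        then have "(1 + s)\<^sup>2 / 2 * (cmod (rep f s))\<^sup>2 \<le> (1 + s\<^sup>2) * (cmod (rep f s))\<^sup>2"
          by (rule mult_right_mono) simp
        also have "\<dots> = (cmod (rep f s))\<^sup>2 + (cmod (wrep f s))\<^sup>2"
          by (simp add: wrep_def norm_mult power_mult_distrib distrib_right)
        finally show ?thesis by (simp only: power_mult_distrib times_divide_eq_left)
      qed
      finally have 1: "E * ((1 + x) * cmod (rep f s)) \<le> E\<^sup>2 / 2 + ((cmod (rep f s))\<^sup>2 + (cmod (wrep f s))\<^sup>2)" by simp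
      have E2: "E\<^sup>2 = exp (- 2 * \<kappa> * (s - x))" by (simp add: E_def power2_eq_square flip: exp_add)
      have "exp (- \<kappa> * s) = exp (- \<kappa> * x) * E" by (simp add: E_def algebra_simps flip: exp_add)
      then have "(1 + x) * (exp (- \<kappa> * s) * cmod (rep f s)) = exp (- \<kappa> * x) * (E * ((1 + x) * cmod (rep f s)))" by simp
      also have "\<dots> \<le> exp (- \<kappa> * x) * (E\<^sup>2 / 2 + ((cmod (rep f s))\<^sup>2 + (cmod (wrep f s))\<^sup>2))"
        using 1 by (intro mult_left_mono) auto
      finally show "(1 + x) * (exp (- \<kappa> * s) * cmod (rep f s))
          \<le> exp (- \<kappa> * x) * (exp (- 2 * \<kappa> * (s - x)) / 2 + ((cmod (rep f s))\<^sup>2 + (cmod (wrep f s))\<^sup>2))"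
        unfolding E2 .
    qed
    also have "\<dots> = exp (- \<kappa> * x) * integral {x..y} (\<lambda>s. exp (- 2 * \<kappa> * (s - x)) / 2 + ((cmod (rep f s))\<^sup>2 + (cmod (wrep f s))\<^sup>2))"
      by simp
    also have "\<dots> \<le> exp (- \<kappa> * x) * Q"
    proof (rule mult_left_mono)
      have I: "((\<lambda>s. exp (- 2 * \<kappa> * (s - x)) / 2) has_integral
          (- exp (- 2 * \<kappa> * (y - x)) / (4 * \<kappa>) - (- exp (- 2 * \<kappa> * (x - x)) / (4 * \<kappa>)))) {x..y}"
        using xy \<kappa> by (intro fundamental_theorem_of_calculus)
          (auto intro!: derivative_eq_intros simp: has_real_derivative_iff_has_vector_derivative[symmetric])
      have "integral {x..y} (\<lambda>s. exp (- 2 * \<kappa> * (s - x)) / 2 + ((cmod (rep f s))\<^sup>2 + (cmod (wrep f s))\<^sup>2))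
          = integral {x..y} (\<lambda>s. exp (- 2 * \<kappa> * (s - x)) / 2) + (integral {x..y} (\<lambda>s. (cmod (rep f s))\<^sup>2) + integral {x..y} (\<lambda>s. (cmod (wrep f s))\<^sup>2))"
        using has_integral_integrable[OF I] integral_sq_le_nsq(1)[OF rep_L2 xy(1), of f y] integral_sq_le_nsq(1)[OF wrep_L2 xy(1), of f y]
        by (simp add: integral_add integrable_add)
      also have "\<dots> \<le> 1 / (2 * \<kappa>) + (nsq (rep f) + nsq (wrep f))"
      proof (intro add_mono integral_sq_le_nsq rep_L2 wrep_L2 xy)
        have "integral {x..y} (\<lambda>s. exp (- 2 * \<kappa> * (s - x)) / 2) \<le> 1 / (4 * \<kappa>)"
          unfolding integral_unique[OF I] using \<kappa> by simp
        also have "\<dots> \<le> 1 / (2 * \<kappa>)" using \<kappa> by (intro divide_left_mono) auto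
        finally show "integral {x..y} (\<lambda>s. exp (- 2 * \<kappa> * (s - x)) / 2) \<le> 1 / (2 * \<kappa>)" .
      qed
      also have "\<dots> = Q" by (simp add: Q_def)
      finally show "integral {x..y} (\<lambda>s. exp (- 2 * \<kappa> * (s - x)) / 2 + ((cmod (rep f s))\<^sup>2 + (cmod (wrep f s))\<^sup>2)) \<le> Q" .
    qed simp
    finally show ?thesis .
  qed
  have eint: "integrable halfline e"
  proof -
    have m: "e \<in> borel_measurable halfline"
      by (rule continuous_imp_measurable_on_sets_lebesgue, rule continuous_on_subset[OF ec]) auto
    have "integrable halfline (\<lambda>x. cmod (e x))"
    proof (rule halfline_integrableI_bounded(1)[where C = Q])
      show "(\<lambda>x. cmod (e x)) \<in> borel_measurable halfline" using m by measurable
      fix b :: real assume b: "b > 0"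
      show "(\<lambda>x. cmod (e x)) integrable_on {0..b}"
        by (intro integrable_continuous_interval continuous_on_norm continuous_on_subset[OF ec]) auto
      show "integral {0..b} (\<lambda>x. cmod (e x)) \<le> Q" using tail[of 0 b] b by (simp add: ne)
    qed auto
    then show ?thesis using m by (simp add: integrable_norm_iff)
  qed
  \<comment> \<open>Subtracting the full integral makes v x equal to - exp(k x) times the integral
    of e from x to infinity; any other solution differs by a multiple of exp(k x) and grows.\<close>
  define L where "L = (LINT x|halfline. e x)"
  define v where "v = (\<lambda>x. exp (k * of_real x) * (integral {0..x} e - L))"
  have tail': "(1 + x) * cmod (integral {0..x} e - L) \<le> exp (- \<kappa> * x) * Q" if x: "x \<ge> 0" for x
  proof (rule LIMSEQ_le_const2)
    show "(\<lambda>n. (1 + x) * cmod (integral {0..x} e - integral {0..real n} e)) \<longlonglongrightarrow> (1 + x) * cmod (integral {0..x} e - L)"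
      unfolding L_def by (intro tendsto_intros integral_tendsto_halfline eint filterlim_real_sequentially)
    obtain N where N: "x \<le> real N" using real_arch_simple by blast
    show "\<exists>N. \<forall>n\<ge>N. (1 + x) * cmod (integral {0..x} e - integral {0..real n} e) \<le> exp (- \<kappa> * x) * Q"
    proof (intro exI allI impI)
      fix n assume "n \<ge> N"
      then have n: "x \<le> real n" using N by linarith
      have ei: "e integrable_on {p..q}" if "p \<ge> 0" for p q
        by (rule integrable_continuous_interval, rule continuous_on_subset[OF ec]) (use that in auto)
      have "integral {0..x} e + integral {x..real n} e = integral {0..real n} e"
        by (intro Henstock_Kurzweil_Integration.integral_combine ei x n) auto
      then have "cmod (integral {0..x} e - integral {0..real n} e) = cmod (integral {x..real n} e)"
        by (metis add_diff_cancel_left' norm_minus_commute)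
      also have "\<dots> \<le> integral {x..real n} (\<lambda>s. exp (- \<kappa> * s) * cmod (rep f s))"
        by (rule integral_norm_bound_integral[OF ei[OF x]])
           (auto simp: ne intro!: integrable_continuous_interval continuous_intros fc x)
      finally have "(1 + x) * cmod (integral {0..x} e - integral {0..real n} e)
          \<le> (1 + x) * integral {x..real n} (\<lambda>s. exp (- \<kappa> * s) * cmod (rep f s))"
        using x by (intro mult_left_mono) auto
      with tail[OF x n] show "(1 + x) * cmod (integral {0..x} e - integral {0..real n} e) \<le> exp (- \<kappa> * x) * Q"
        by linarith
    qed
  qed
  have vb: "(1 + x) * cmod (v x) \<le> Q" if x: "x \<ge> 0" for x
  proof -
    have "(1 + x) * cmod (v x) = exp (\<kappa> * x) * ((1 + x) * cmod (integral {0..x} e - L))"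
      by (simp add: v_def norm_mult \<kappa>_def)
    also have "\<dots> \<le> exp (\<kappa> * x) * (exp (- \<kappa> * x) * Q)" by (intro mult_left_mono tail' x) auto
    also have "\<dots> = Q" by (simp add: exp_minus)
    finally show ?thesis .
  qed
  have dv: "(v has_vector_derivative (k * v x + rep f x)) (at x within {0..})" if x: "x \<ge> 0" for x
  proof -
    have "((\<lambda>x. integral {0..x} e) has_vector_derivative e x) (at x within {0..x + 1})"
      by (rule integral_has_vector_derivative[OF continuous_on_subset[OF ec]]) (use x in auto)
    moreover have "at x within {0..x + 1} = at x within {0..}"
      using x by (intro at_within_nhd[of x "{..<x + 1}"]) auto
    ultimately have "((\<lambda>x. integral {0..x} e - L) has_vector_derivative e x) (at x within {0..})"
      by (auto intro!: derivative_eq_intros)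
    from has_vector_derivative_mult[OF has_vector_derivative_exp_mult[of k] this]
    have "(v has_vector_derivative (exp (k * of_real x) * e x + k * exp (k * of_real x) * (integral {0..x} e - L))) (at x within {0..})"
      by (simp add: v_def)
    moreover have "exp (k * of_real x) * e x = rep f x"
      by (simp add: e_def exp_minus flip: mult.assoc)
    ultimately show ?thesis by (simp add: v_def mult.assoc add.commute)
  qed
  have vc: "continuous_on {0..} v" by (rule continuous_on_of_vector_derivative[OF dv]) simp
  have "v \<in> H01"
  proof (rule weighted_L2I[OF vc, of 1])
    fix b :: real assume b: "b > 0"
    define W where "W = (\<lambda>x. (1 + 1 * x\<^sup>2) * (cmod (v x))\<^sup>2)"
    define W' where "W' = (\<lambda>x. 2 * 1 * x * (cmod (v x))\<^sup>2 + (1 + 1 * x\<^sup>2) * (2 * inner (k * v x + rep f x) (v x)))"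
    have I: "(W' has_integral (W b - W 0)) {0..b}"
    proof (rule fundamental_theorem_of_calculus)
      show "(W has_vector_derivative W' x) (at x within {0..b})" if "x \<in> {0..b}" for x
        using weighted_derivative[OF dv, of x 1] that
        unfolding W_def W'_def has_real_derivative_iff_has_vector_derivative
        by (intro has_vector_derivative_within_Icc) auto
    qed (use b in simp)
    define K where "K = (\<lambda>x. (cmod (rep f x))\<^sup>2 + (cmod (wrep f x))\<^sup>2)"
    \<comment> \<open>Growth at rate \<kappa> bounds W by its derivative and the data, so
      integration leaves the value at the right end. The derivative of the weight has the good sign
      here.\<close>
    have low: "\<kappa> * W x \<le> W' x + K x / \<kappa>" if "x \<in> {0..b}" for x
    proof -
      have "- (2 * inner (rep f x) (v x)) \<le> 2 * (cmod (rep f x) * cmod (v x))"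
        using Cauchy_Schwarz_ineq2[of "rep f x" "v x"] by linarith
      also have "\<dots> \<le> \<kappa> * (cmod (v x))\<^sup>2 + (cmod (rep f x))\<^sup>2 / \<kappa>"
        using sum_squares_bound[of "\<kappa> * cmod (v x)" "cmod (rep f x)"] \<kappa>
        by (simp add: field_simps power2_eq_square)
      finally have "\<kappa> * (cmod (v x))\<^sup>2 \<le> 2 * inner (k * v x + rep f x) (v x) + (cmod (rep f x))\<^sup>2 / \<kappa>"
        by (simp add: inner_add_left inner_mult_self \<kappa>_def)
      then have "(1 + x\<^sup>2) * (\<kappa> * (cmod (v x))\<^sup>2) \<le> (1 + x\<^sup>2) * (2 * inner (k * v x + rep f x) (v x) + (cmod (rep f x))\<^sup>2 / \<kappa>)"
        by (intro mult_left_mono) auto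
      moreover have "(1 + x\<^sup>2) * ((cmod (rep f x))\<^sup>2 / \<kappa>) = K x / \<kappa>"
        by (simp add: K_def wrep_def norm_mult power_mult_distrib algebra_simps add_divide_distrib)
      moreover have "(1 + x\<^sup>2) * (\<kappa> * (cmod (v x))\<^sup>2) = \<kappa> * W x" by (simp add: W_def)
      moreover have "W' x = 2 * x * (cmod (v x))\<^sup>2 + (1 + x\<^sup>2) * (2 * inner (k * v x + rep f x) (v x))"
        by (simp add: W'_def)
      moreover have "0 \<le> 2 * x * (cmod (v x))\<^sup>2" using that by simp
      ultimately show ?thesis by (simp only: distrib_left[of "1 + x\<^sup>2"])
    qed
    have Ki: "K integrable_on {0..b}" "integral {0..b} K \<le> nsq (rep f) + nsq (wrep f)"
      unfolding K_def
      using integral_sq_le_nsq[of "rep f" 0 b, OF rep_L2 order_refl] integral_sq_le_nsq[of "wrep f" 0 b, OF wrep_L2 order_refl]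
      by (auto simp: integral_add integrable_add)
    have Wi: "W integrable_on {0..b}" unfolding W_def
      by (intro integrable_continuous_interval continuous_intros continuous_on_subset[OF vc]) auto
    have "\<kappa> * integral {0..b} W \<le> integral {0..b} (\<lambda>x. W' x + K x / \<kappa>)"
      using low by (subst integral_mult_right[symmetric], intro integral_le integrable_add integrable_on_divide
          integrable_on_mult_right Wi Ki has_integral_integrable[OF I]) auto
    also have "\<dots> = (W b - W 0) + integral {0..b} K / \<kappa>"
      using integral_unique[OF I] has_integral_integrable[OF I] Ki(1)
      by (subst integral_add) (auto intro!: integrable_on_divide)
    also have "\<dots> \<le> Q\<^sup>2 + (nsq (rep f) + nsq (wrep f)) / \<kappa>"
    proof (intro add_mono divide_right_mono Ki)
      have "W b \<le> ((1 + b) * cmod (v b))\<^sup>2"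
        using b by (simp add: W_def power_mult_distrib power2_sum mult_right_mono)
      also have "\<dots> \<le> Q\<^sup>2" using b by (intro power_mono vb) auto
      finally have "W b \<le> Q\<^sup>2" .
      moreover have "W 0 \<ge> 0" by (simp add: W_def)
      ultimately show "W b - W 0 \<le> Q\<^sup>2" by linarith
    qed (use \<kappa> in auto)
    finally show "integral {0..b} W \<le> (Q\<^sup>2 + (nsq (rep f) + nsq (wrep f)) / \<kappa>) / \<kappa>"
      using \<kappa> by (simp add: field_simps)
  qed simp
  then show thesis using that dv vc by blast
qed

lemma first_order_from_boundary:
  fixes k c :: complex
  assumes k: "Re k > 0" and v: "v \<in> H01" "continuous_on {0..} v"
  obtains u where "\<And>x. x \<ge> 0 \<Longrightarrow> (u has_vector_derivative (v x - k * u x)) (at x within {0..})"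
    "u \<in> H01" "u 0 = c"
proof -
  define \<kappa> where "\<kappa> = Re k"
  have \<kappa>: "\<kappa> > 0" using k by (simp add: \<kappa>_def)
  have vL: "v \<in> L2" "(\<lambda>x. of_real x * v x) \<in> L2" using v(1) by (auto simp: H01_def)
  define e where "e = (\<lambda>x. exp (k * of_real x) * v x)"
  have ec: "continuous_on {0..} e" unfolding e_def by (intro continuous_intros v(2))
  define u where "u = (\<lambda>x. exp (- k * of_real x) * (c + integral {0..x} e))"
  have du: "(u has_vector_derivative (v x - k * u x)) (at x within {0..})" if x: "x \<ge> 0" for x
  proof -
    have "((\<lambda>x. integral {0..x} e) has_vector_derivative e x) (at x within {0..x + 1})"
      by (rule integral_has_vector_derivative[OF continuous_on_subset[OF ec]]) (use x in auto)
    moreover have "at x within {0..x + 1} = at x within {0..}"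
      using x by (intro at_within_nhd[of x "{..<x + 1}"]) auto
    ultimately have "((\<lambda>x. c + integral {0..x} e) has_vector_derivative e x) (at x within {0..})"
      by (auto intro!: derivative_eq_intros)
    from has_vector_derivative_mult[OF has_vector_derivative_exp_mult[of "- k"] this]
    have "(u has_vector_derivative (exp (- k * of_real x) * e x + - k * exp (- k * of_real x) * (c + integral {0..x} e))) (at x within {0..})"
      by (simp only: u_def)
    moreover have "exp (- k * of_real x) * e x = v x"
      by (simp add: e_def exp_minus flip: mult.assoc)
    ultimately show ?thesis by (simp add: u_def mult.assoc)
  qed
  have uc: "continuous_on {0..} u" by (rule continuous_on_of_vector_derivative[OF du]) simp
  \<comment> \<open>Small enough that the derivative 2 \<epsilon> x of the weight is at most
    \<kappa>/2 times the weight, by (1 - \<kappa> x / 2)^2 \<ge> 0; half of the damping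
    remains.\<close>
  define \<epsilon> where "\<epsilon> = \<kappa>\<^sup>2 / 4"
  have \<epsilon>: "\<epsilon> > 0" using \<kappa> by (simp add: \<epsilon>_def)
  have "u \<in> H01"
  proof (rule weighted_L2I[OF uc \<epsilon>])
    fix b :: real assume b: "b > 0"
    define W where "W = (\<lambda>x. (1 + \<epsilon> * x\<^sup>2) * (cmod (u x))\<^sup>2)"
    define W' where "W' = (\<lambda>x. 2 * \<epsilon> * x * (cmod (u x))\<^sup>2 + (1 + \<epsilon> * x\<^sup>2) * (2 * inner (v x - k * u x) (u x)))"
    have I: "(W' has_integral (W b - W 0)) {0..b}"
    proof (rule fundamental_theorem_of_calculus)
      show "(W has_vector_derivative W' x) (at x within {0..b})" if "x \<in> {0..b}" for x
        using weighted_derivative[OF du, of x \<epsilon>] that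
        unfolding W_def W'_def has_real_derivative_iff_has_vector_derivative
        by (intro has_vector_derivative_within_Icc) auto
    qed (use b in simp)
    define K where "K = (\<lambda>x. (cmod (v x))\<^sup>2 + \<epsilon> * (cmod (of_real x * v x))\<^sup>2)"
    \<comment> \<open>Now the homogeneous part damps the energy, so integration leaves its value at
      the left end 0.\<close>
    have low: "\<kappa> / 2 * W x \<le> K x / \<kappa> - W' x" if "x \<in> {0..b}" for x
    proof -
      have "2 * inner (v x) (u x) \<le> 2 * (cmod (v x) * cmod (u x))"
        using Cauchy_Schwarz_ineq2[of "v x" "u x"] by linarith
      also have "\<dots> \<le> \<kappa> * (cmod (u x))\<^sup>2 + (cmod (v x))\<^sup>2 / \<kappa>"
        using sum_squares_bound[of "\<kappa> * cmod (u x)" "cmod (v x)"] \<kappa>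
        by (simp add: field_simps power2_eq_square)
      finally have "2 * inner (v x - k * u x) (u x) \<le> (cmod (v x))\<^sup>2 / \<kappa> - \<kappa> * (cmod (u x))\<^sup>2"
        by (simp add: inner_diff_left inner_mult_self \<kappa>_def)
      then have "(1 + \<epsilon> * x\<^sup>2) * (2 * inner (v x - k * u x) (u x)) \<le> (1 + \<epsilon> * x\<^sup>2) * ((cmod (v x))\<^sup>2 / \<kappa> - \<kappa> * (cmod (u x))\<^sup>2)"
        using \<epsilon> by (intro mult_left_mono add_nonneg_nonneg) auto
      also have "\<dots> = (1 + \<epsilon> * x\<^sup>2) * ((cmod (v x))\<^sup>2 / \<kappa>) - \<kappa> * W x"
        by (simp add: W_def right_diff_distrib)
      also have "(1 + \<epsilon> * x\<^sup>2) * ((cmod (v x))\<^sup>2 / \<kappa>) = K x / \<kappa>"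
        by (simp add: K_def norm_mult power_mult_distrib algebra_simps add_divide_distrib)
      finally have 1: "(1 + \<epsilon> * x\<^sup>2) * (2 * inner (v x - k * u x) (u x)) \<le> K x / \<kappa> - \<kappa> * W x" .
      have "2 * \<epsilon> * x \<le> \<kappa> / 2 * (1 + \<epsilon> * x\<^sup>2)"
      proof -
        have "0 \<le> \<kappa> / 2 * (1 - \<kappa> / 2 * x)\<^sup>2" using \<kappa> by simp
        then show ?thesis by (simp add: \<epsilon>_def power2_eq_square algebra_simps)
      qed
      from mult_right_mono[OF this, of "(cmod (u x))\<^sup>2"]
      have "2 * \<epsilon> * x * (cmod (u x))\<^sup>2 \<le> \<kappa> / 2 * W x" by (simp add: W_def)
      then show ?thesis using 1 unfolding W'_def by linarith
    qed
    have s: "(\<lambda>x. (cmod (v x))\<^sup>2) integrable_on {0..b}" "integral {0..b} (\<lambda>x. (cmod (v x))\<^sup>2) \<le> nsq v"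
      "(\<lambda>x. (cmod (of_real x * v x))\<^sup>2) integrable_on {0..b}"
      "integral {0..b} (\<lambda>x. (cmod (of_real x * v x))\<^sup>2) \<le> nsq (\<lambda>x. of_real x * v x)"
      using integral_sq_le_nsq[OF vL(1) order_refl, of b] integral_sq_le_nsq[OF vL(2) order_refl, of b] by blast+
    have Ki: "K integrable_on {0..b}"
      unfolding K_def by (intro integrable_add integrable_on_mult_right s)
    have Kl: "integral {0..b} K \<le> nsq v + \<epsilon> * nsq (\<lambda>x. of_real x * v x)"
    proof -
      have "integral {0..b} K = integral {0..b} (\<lambda>x. (cmod (v x))\<^sup>2) + \<epsilon> * integral {0..b} (\<lambda>x. (cmod (of_real x * v x))\<^sup>2)"
        unfolding K_def using s by (subst integral_add) (auto intro: integrable_on_mult_right)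
      also have "\<dots> \<le> nsq v + \<epsilon> * nsq (\<lambda>x. of_real x * v x)"
        using \<epsilon> s by (intro add_mono mult_left_mono) auto
      finally show ?thesis .
    qed
    have Wi: "W integrable_on {0..b}" unfolding W_def
      by (intro integrable_continuous_interval continuous_intros continuous_on_subset[OF uc]) auto
    have "\<kappa> / 2 * integral {0..b} W = integral {0..b} (\<lambda>x. \<kappa> / 2 * W x)"
      by (rule integral_mult_right[symmetric])
    also have "\<dots> \<le> integral {0..b} (\<lambda>x. K x / \<kappa> - W' x)"
      using low by (intro integral_le integrable_diff integrable_on_divide
          integrable_on_mult_right Wi Ki has_integral_integrable[OF I]) auto
    also have "\<dots> = integral {0..b} K / \<kappa> - (W b - W 0)"
      using integral_unique[OF I] has_integral_integrable[OF I] Ki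
      by (subst integral_diff) (auto intro!: integrable_on_divide)
    also have "\<dots> \<le> (nsq v + \<epsilon> * nsq (\<lambda>x. of_real x * v x)) / \<kappa> + W 0"
    proof -
      have "integral {0..b} K / \<kappa> \<le> (nsq v + \<epsilon> * nsq (\<lambda>x. of_real x * v x)) / \<kappa>"
        using Kl \<kappa> by (intro divide_right_mono) auto
      moreover have "W b \<ge> 0" using \<epsilon> by (simp add: W_def)
      ultimately show ?thesis by linarith
    qed
    finally have "\<kappa> / 2 * integral {0..b} W \<le> (nsq v + \<epsilon> * nsq (\<lambda>x. of_real x * v x)) / \<kappa> + W 0" .
    from mult_left_mono[OF this, of "2 / \<kappa>"]
    show "integral {0..b} W \<le> 2 / \<kappa> * ((nsq v + \<epsilon> * nsq (\<lambda>x. of_real x * v x)) / \<kappa> + W 0)"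
      using \<kappa> by simp
  qed
  then show thesis using du by (intro that[of u]) (auto simp: u_def)
qed

lemma H01_cmult: "f \<in> H01 \<Longrightarrow> (\<lambda>x. c * f x) \<in> H01"
  unfolding H01_def using L2_cmult[of f c] L2_cmult[of "\<lambda>x. of_real x * f x" c] by (simp add: mult.left_commute)

lemma H01_diff: "f \<in> H01 \<Longrightarrow> g \<in> H01 \<Longrightarrow> (\<lambda>x. f x - g x) \<in> H01"
  unfolding H01_def using L2_diff[of f g] L2_diff[of "\<lambda>x. of_real x * f x" "\<lambda>x. of_real x * g x"]
  by (simp add: right_diff_distrib)

lemma rep_H01: "rep u \<in> H01"
  using rep_L2 rep_weighted_L2 by (simp add: H01_def)

lemma energy_of_C1:
  assumes "f \<in> H01" "g \<in> L2" "continuous_on {0..} g"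
    and d: "\<And>x. x \<ge> 0 \<Longrightarrow> (f has_vector_derivative g x) (at x within {0..})"
  obtains u where "\<And>x. x \<ge> 0 \<Longrightarrow> rep u x = f x"
    "\<And>x. x \<ge> 0 \<Longrightarrow> (rep u has_vector_derivative g x) (at x within {0..})"
proof (rule energy_exists[OF assms(1,2)])
  fix x :: real assume x: "x \<ge> 0"
  have "(g has_integral (f x - f 0)) {0..x}"
    using x by (intro fundamental_theorem_of_calculus has_vector_derivative_within_Icc[OF d]) auto
  then show "f x = f 0 + integral {0..x} g" by (simp add: integral_unique)
next
  fix u assume u: "\<And>x. x \<ge> 0 \<Longrightarrow> rep u x = f x"
  have "(rep u has_vector_derivative g x) (at x within {0..})" if "x \<ge> 0" for x
    by (rule has_vector_derivative_transform[OF _ _ d[OF that]]) (use that u in auto)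
  with u show thesis by (rule that)
qed

text \<open>With m = \<mu> + 1 the equation m u - (i/2) u'' = f reads u'' - k^2 u = 2 i f for k^2 =
  - 2 i m. It factors as (d/dx - k)(d/dx + k), so v = u' + k u solves a first-order problem from
  infinity, and then u one from the boundary.\<close>

lemma resolvent_range:
  assumes \<alpha>: "\<alpha> \<noteq> 0" and \<mu>: "\<mu> > 0"
  shows "\<exists>u\<in>dom \<alpha>. \<mu> *\<^sub>R u - gen u = f"
proof -
  define m where "m = \<mu> + 1"
  \<comment> \<open>The square root of - 2 i m with positive real part.\<close>
  define k where "k = of_real (sqrt m) * (1 - \<i>)"
  have m: "m > 0" using \<mu> by (simp add: m_def)
  have k2: "k * k = - (2 * \<i> * of_real m)"
  proof -
    have "k * k = of_real (sqrt m * sqrt m) * ((1 - \<i>) * (1 - \<i>))"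
      by (simp only: k_def of_real_mult mult_ac)
    then show ?thesis using m by (simp add: algebra_simps)
  qed
  have Rek: "Re k > 0" using m by (simp add: k_def)
  \<comment> \<open>For u' = v - k u the Robin condition reads (1 - \<alpha> k) u(0) = - \<alpha>
    v(0). It can be solved because \<alpha> is real and non-zero while k is not real.\<close>
  have nz: "1 - of_real \<alpha> * k \<noteq> 0"
  proof
    assume "1 - of_real \<alpha> * k = 0"
    then have "Im (1 - of_real \<alpha> * k) = 0" by simp
    then show False using \<alpha> m by (simp add: k_def)
  qed
  define g where "g = cmul (2 * \<i>) f"
  obtain v where v: "\<And>x. x \<ge> 0 \<Longrightarrow> (v has_vector_derivative (k * v x + rep g x)) (at x within {0..})"
    "v \<in> H01" "continuous_on {0..} v"
    using first_order_from_infinity[OF Rek] by blast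
  obtain u where u: "\<And>x. x \<ge> 0 \<Longrightarrow> (u has_vector_derivative (v x - k * u x)) (at x within {0..})"
    "u \<in> H01" "u 0 = - of_real \<alpha> * v 0 / (1 - of_real \<alpha> * k)"
    using first_order_from_boundary[OF Rek v(2,3)] by blast
  define u1 where "u1 = (\<lambda>x. v x - k * u x)"
  have uc: "continuous_on {0..} u" by (rule continuous_on_of_vector_derivative[OF u(1)]) simp
  have u1H: "u1 \<in> H01" unfolding u1_def by (intro H01_diff H01_cmult u v)
  have u1c: "continuous_on {0..} u1" unfolding u1_def by (intro continuous_intros uc v)
  have u1L: "u1 \<in> L2" using u1H by (simp add: H01_def)
  obtain U where U: "\<And>x. x \<ge> 0 \<Longrightarrow> rep U x = u x"
    "\<And>x. x \<ge> 0 \<Longrightarrow> (rep U has_vector_derivative u1 x) (at x within {0..})"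
  proof (rule energy_of_C1[OF u(2) u1L u1c])
    show "(u has_vector_derivative u1 x) (at x within {0..})" if "x \<ge> 0" for x
      using u(1)[OF that] by (simp add: u1_def)
  qed blast
  define V where "V = cmul (k * k) U + g"
  have tw: "twice U u1 V"
    unfolding twice_def
  proof (intro conjI allI impI U(2))
    fix x :: real assume x: "x \<ge> 0"
    have "(u1 has_vector_derivative ((k * v x + rep g x) - k * (v x - k * u x))) (at x within {0..})"
      unfolding u1_def
      by (intro has_vector_derivative_diff v(1) x
          bounded_linear.has_vector_derivative[OF bounded_linear_mult_right, unfolded o_def] u(1))
    moreover have "(k * v x + rep g x) - k * (v x - k * u x) = rep V x"
      using U(1)[OF x] by (simp add: V_def algebra_simps)
    ultimately show "(u1 has_vector_derivative rep V x) (at x within {0..})" by simp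
  qed
  have "rep U 0 + of_real \<alpha> * u1 0 = 0"
    unfolding U(1)[OF order_refl] using u(3) nz by (simp add: u1_def field_simps)
  with tw have dom: "U \<in> dom \<alpha>" by (auto simp: dom_def)
  have "\<mu> *\<^sub>R U - gen U = f"
  proof (rule energy_eqI)
    fix x :: real
    have "rep (\<mu> *\<^sub>R U - gen U) x = of_real m * rep U x - \<i> / 2 * (k * k * rep U x + 2 * \<i> * rep f x)"
      by (simp add: gen_def lap_eq[OF tw] V_def g_def m_def scaleR_conv_of_real algebra_simps)
    also have "\<dots> = rep f x" unfolding k2 by (simp add: algebra_simps)
    finally show "rep (\<mu> *\<^sub>R U - gen U) x = rep f x" .
  qed
  with dom show ?thesis by blast
qed

theorem robin_m_dissipative:
  assumes \<alpha>: "\<alpha> \<noteq> 0"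
  shows "m_dissipative (bform \<alpha>) gen (dom \<alpha>) (1 / 2)"
proof -
  have lin: "u \<in> dom \<alpha> \<Longrightarrow> u' \<in> dom \<alpha> \<Longrightarrow> u + u' \<in> dom \<alpha> \<and> gen (u + u') = gen u + gen u'" for u u'
  proof -
    assume "u \<in> dom \<alpha>" "u' \<in> dom \<alpha>"
    then obtain u1 v u1' v' where t: "twice u u1 v" "twice u' u1' v'"
      and r: "rep u 0 + of_real \<alpha> * u1 0 = 0" "rep u' 0 + of_real \<alpha> * u1' 0 = 0"
      by (auto simp: dom_def)
    note ta = twice_add[OF t]
    have "rep (u + u') 0 + of_real \<alpha> * (u1 0 + u1' 0) = (rep u 0 + of_real \<alpha> * u1 0) + (rep u' 0 + of_real \<alpha> * u1' 0)"
      by (simp add: algebra_simps)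
    then have "rep (u + u') 0 + of_real \<alpha> * (u1 0 + u1' 0) = 0" unfolding r by simp
    with ta have "u + u' \<in> dom \<alpha>" unfolding dom_def by blast
    moreover have "gen (u + u') = gen u + gen u'"
      unfolding gen_def lap_eq[OF ta] lap_eq[OF t(1)] lap_eq[OF t(2)]
      by (simp add: linear_simps(1)[OF bounded_linear_cmul])
    ultimately show "u + u' \<in> dom \<alpha> \<and> gen (u + u') = gen u + gen u'" by blast
  qed
  have scal: "u \<in> dom \<alpha> \<Longrightarrow> r *\<^sub>R u \<in> dom \<alpha> \<and> gen (r *\<^sub>R u) = r *\<^sub>R gen u" for u r
  proof -
    assume "u \<in> dom \<alpha>"
    then obtain u1 v where t: "twice u u1 v" and rb: "rep u 0 + of_real \<alpha> * u1 0 = 0" by (auto simp: dom_def)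
    note ts = twice_scaleR[OF t, of r]
    have "rep (r *\<^sub>R u) 0 + of_real \<alpha> * (r *\<^sub>R u1 0) = r *\<^sub>R (rep u 0 + of_real \<alpha> * u1 0)"
      by (simp add: scaleR_add_right)
    then have "rep (r *\<^sub>R u) 0 + of_real \<alpha> * (r *\<^sub>R u1 0) = 0" unfolding rb by simp
    with ts have "r *\<^sub>R u \<in> dom \<alpha>" unfolding dom_def by blast
    moreover have "gen (r *\<^sub>R u) = r *\<^sub>R gen u"
      unfolding gen_def lap_eq[OF ts] lap_eq[OF t]
      by (simp add: linear_simps(5)[OF bounded_linear_cmul] scaleR_diff_right)
    ultimately show "r *\<^sub>R u \<in> dom \<alpha> \<and> gen (r *\<^sub>R u) = r *\<^sub>R gen u" by blast
  qed
  interpret bb: bounded_bilinear "bform \<alpha>" by (rule bounded_bilinear_bform)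
  show ?thesis
    by unfold_locales
       (use lin scal bform_sym bform_coercive[OF \<alpha>] bform_gen_le[OF \<alpha>] resolvent_range[OF \<alpha>] in auto)
qed

subsection \<open>The power nonlinearity\<close>

lemma powr_diff_le:
  fixes r s M q :: real
  assumes "0 \<le> r" "r \<le> s" "s \<le> M" "q \<ge> 1"
  shows "s powr q - r powr q \<le> q * M powr (q - 1) * (s - r)"
proof (cases "r = 0 \<or> r = s")
  case True
  then show ?thesis
  proof
    assume r: "r = 0"
    show ?thesis
    proof (cases "s = 0")
      case False
      then have s: "s > 0" using assms by simp
      have "s powr q = s powr (q - 1) * s" using s by (simp add: powr_mult_base powr_diff)
      also have "\<dots> \<le> M powr (q - 1) * s" using assms s by (intro mult_right_mono powr_mono2) auto
      also have "\<dots> \<le> q * (M powr (q - 1) * s)"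
        using mult_right_mono[of 1 q "M powr (q - 1) * s"] assms s by simp
      finally show ?thesis using r by simp
    qed (use r in simp)
  qed simp
next
  case False
  then have r: "0 < r" "r < s" using assms by auto
  have d: "((\<lambda>x. x powr q) has_real_derivative q * x powr (q - 1)) (at x)" if "r \<le> x" for x
    using r that by (intro has_real_derivative_powr) auto
  obtain z where z: "r < z" "z < s" "s powr q - r powr q = (s - r) * (q * z powr (q - 1))"
    using MVT2[OF r(2) d] by blast
  have "z powr (q - 1) \<le> M powr (q - 1)" using z r assms by (intro powr_mono2) auto
  then have "(s - r) * (q * z powr (q - 1)) \<le> (s - r) * (q * M powr (q - 1))"
    using r assms by (intro mult_left_mono) auto
  then show ?thesis using z by (simp add: mult_ac)
qed

lemma abs_powr_diff_le:
  fixes z w :: complex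
  assumes "cmod z \<le> M" "cmod w \<le> M" "q \<ge> 1"
  shows "\<bar>cmod z powr q - cmod w powr q\<bar> \<le> q * M powr (q - 1) * cmod (z - w)"
proof -
  have M: "q * M powr (q - 1) \<ge> 0" using assms by simp
  have le: "cmod a powr q - cmod b powr q \<le> q * M powr (q - 1) * cmod (a - b)"
    if ab: "cmod a \<le> M" "cmod b \<le> cmod a" for a b
  proof -
    have "cmod a powr q - cmod b powr q \<le> q * M powr (q - 1) * (cmod a - cmod b)"
      using ab assms by (intro powr_diff_le) auto
    also have "\<dots> \<le> q * M powr (q - 1) * cmod (a - b)"
      by (intro mult_left_mono norm_triangle_ineq2 M)
    finally show ?thesis .
  qed
  have mono: "cmod b powr q \<le> cmod a powr q" if "cmod b \<le> cmod a" for a b :: complex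
    using that assms by (intro powr_mono2) auto
  show ?thesis
  proof (cases "cmod w \<le> cmod z")
    case True
    then show ?thesis using le[OF assms(1) True] mono[OF True] by simp
  next
    case False
    then have "cmod z \<le> cmod w" by simp
    then show ?thesis using le[OF assms(2), of z] mono[of z w] by (simp add: norm_minus_commute)
  qed
qed

text \<open>The real Frechet derivative of |z|^q z, see \<open>nonlinearity_has_derivative\<close>.
  Written with \<open>sgn z\<close> it covers z = 0, where it vanishes.\<close>

definition DN :: "real \<Rightarrow> complex \<Rightarrow> complex \<Rightarrow> complex" where
  "DN q z h = (cmod z powr q) *\<^sub>R h + (q * cmod z powr q * inner (sgn z) h) *\<^sub>R sgn z"

lemma nonlinearity_has_derivative:
  assumes q: "q > 0"
  shows "(nonlinearity (q + 1) has_derivative DN q z) (at z)"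
proof (cases "z = 0")
  case True
  have "((\<lambda>y. cmod y powr q) \<longlongrightarrow> cmod 0 powr q) (at 0)"
    using q by (intro tendsto_powr2 tendsto_norm tendsto_ident_at tendsto_const) (auto intro!: always_eventually)
  then have lim: "((\<lambda>y. cmod y powr q) \<longlongrightarrow> 0) (at 0)" by simp
  have "(nonlinearity (q + 1) has_derivative (\<lambda>h. 0)) (at 0)"
    unfolding has_derivative_at2
  proof (intro conjI bounded_linear_zero Lim_null_comparison[OF _ lim] always_eventually allI)
    show "norm ((1 / norm (y - 0)) *\<^sub>R (nonlinearity (q + 1) y - (nonlinearity (q + 1) 0 + 0))) \<le> cmod y powr q" for y
      by (cases "y = 0") (auto simp: nonlinearity_def norm_mult)
  qed
  moreover have "DN q 0 = (\<lambda>h. 0)" by (simp add: DN_def fun_eq_iff)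
  ultimately show ?thesis using True by simp
next
  case False
  have n: "(cmod has_derivative (\<lambda>h. inner (sgn z) h)) (at z)"
    using has_derivative_norm[OF False] by (simp only: inner_commute[of _ "sgn z"])
  have p: "((\<lambda>x. x powr q) has_derivative (\<lambda>t. t * (q * cmod z powr (q - 1)))) (at (cmod z))"
    by (rule has_derivative_eq_rhs[OF has_real_derivative_powr[of "cmod z" q, unfolded has_field_derivative_def]])
       (use False in \<open>auto simp: mult.commute\<close>)
  have "((\<lambda>z. cmod z powr q) has_derivative (\<lambda>h. inner (sgn z) h * (q * cmod z powr (q - 1)))) (at z)"
    using has_derivative_compose[OF n p] .
  from has_derivative_scaleR[OF this has_derivative_ident]
  have "((\<lambda>z. (cmod z powr q) *\<^sub>R z) has_derivative
      (\<lambda>h. (cmod z powr q) *\<^sub>R h + (inner (sgn z) h * (q * cmod z powr (q - 1))) *\<^sub>R z)) (at z)" .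
  moreover have "(inner (sgn z) h * (q * cmod z powr (q - 1))) *\<^sub>R z = (q * cmod z powr q * inner (sgn z) h) *\<^sub>R sgn z" for h
  proof -
    have "z = cmod z *\<^sub>R sgn z" by (simp add: sgn_div_norm False)
    then have "(inner (sgn z) h * (q * cmod z powr (q - 1))) *\<^sub>R z
        = (inner (sgn z) h * (q * cmod z powr (q - 1))) *\<^sub>R (cmod z *\<^sub>R sgn z)" by simp
    also have "\<dots> = (q * (cmod z powr (q - 1) * cmod z) * inner (sgn z) h) *\<^sub>R sgn z"
      by (simp add: mult_ac)
    also have "cmod z powr (q - 1) * cmod z = cmod z powr q" using False by (simp add: powr_diff)
    finally show ?thesis .
  qed
  ultimately have "((\<lambda>z. (cmod z powr q) *\<^sub>R z) has_derivative DN q z) (at z)"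
    by (simp only: DN_def[abs_def])
  moreover have "(\<lambda>z. (cmod z powr q) *\<^sub>R z) = nonlinearity (q + 1)"
    by (simp add: nonlinearity_def fun_eq_iff scaleR_conv_of_real)
  ultimately show ?thesis by simp
qed

lemma norm_sgn_le: "cmod (sgn z) \<le> 1" by (simp add: norm_sgn)

lemma DN_bound:
  assumes "cmod z \<le> M" "q \<ge> 0"
  shows "cmod (DN q z h) \<le> (1 + q) * M powr q * cmod h"
proof -
  have i: "\<bar>inner (sgn z) h\<bar> \<le> cmod h"
    using Cauchy_Schwarz_ineq2[of "sgn z" h] mult_right_mono[OF norm_sgn_le, of "cmod h" z] by simp
  have m: "cmod z powr q \<le> M powr q" using assms by (intro powr_mono2) auto
  have "cmod (DN q z h) \<le> cmod z powr q * cmod h + q * cmod z powr q * \<bar>inner (sgn z) h\<bar> * cmod (sgn z)"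
    unfolding DN_def by (rule order_trans[OF norm_triangle_ineq]) (use assms in \<open>simp add: abs_mult\<close>)
  also have "\<dots> \<le> cmod z powr q * cmod h + q * cmod z powr q * cmod h * 1"
    using assms i norm_sgn_le by (intro add_left_mono mult_mono mult_left_mono) auto
  also have "\<dots> = (1 + q) * (cmod z powr q * cmod h)" by (simp add: algebra_simps)
  also have "\<dots> \<le> (1 + q) * (M powr q * cmod h)"
    using assms m by (intro mult_left_mono mult_right_mono) auto
  finally show ?thesis by (simp add: mult.assoc)
qed

text \<open>The direction \<open>sgn\<close> is not Lipschitz near 0 but becomes so after
  multiplication by the smaller modulus: |w| (sgn z - sgn w) = (z - w) + (|w| - |z|) sgn z.\<close>

lemma norm_sgn_diff_le:
  fixes z w :: complex
  assumes "cmod w \<le> cmod z" shows "cmod w * cmod (sgn z - sgn w) \<le> 2 * cmod (z - w)"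
proof (cases "w = 0")
  case False
  then have "cmod w > 0" by simp
  with assms have z: "cmod z > 0" by linarith
  have "cmod w *\<^sub>R (sgn z - sgn w) = (z - w) + (cmod w - cmod z) *\<^sub>R sgn z"
    using False z by (simp add: sgn_div_norm algebra_simps)
  then have "cmod w * cmod (sgn z - sgn w) = cmod ((z - w) + (cmod w - cmod z) *\<^sub>R sgn z)"
    by (metis norm_scaleR abs_norm_cancel)
  also have "\<dots> \<le> cmod (z - w) + \<bar>cmod w - cmod z\<bar> * cmod (sgn z)"
    by (rule order_trans[OF norm_triangle_ineq]) simp
  also have "\<dots> \<le> cmod (z - w) + cmod (z - w) * 1"
    using norm_triangle_ineq3[of w z] norm_sgn_le[of z] by (intro add_left_mono mult_mono) (auto simp: norm_minus_commute)
  finally show ?thesis by simp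
qed simp

text \<open>For q \<ge> 1 the factor |b|^q contains the power of |b| that tames the difference of
  directions, and |b|^(q-1) \<le> M^(q-1) is left over. The pair is ordered so that the smaller
  modulus multiplies that difference.\<close>

lemma DN_lipschitz:
  assumes M: "cmod z \<le> M" "cmod w \<le> M" and q: "q \<ge> 1"
  shows "cmod (DN q z h - DN q w h) \<le> (q + q * (q + 4)) * M powr (q - 1) * cmod (z - w) * cmod h"
proof -
  define N where "N = M powr (q - 1)"
  have N: "N \<ge> 0" by (simp add: N_def)
  define T where "T = (\<lambda>z. (cmod z powr q * inner (sgn z) h) *\<^sub>R sgn z)"
  have DNT: "DN q z h = (cmod z powr q) *\<^sub>R h + q *\<^sub>R T z" for z
    by (simp add: DN_def T_def mult.assoc)
  have main: "cmod (T a - T b) \<le> (q + 4) * N * cmod (a - b) * cmod h"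
    if ab: "cmod b \<le> cmod a" "cmod a \<le> M" for a b
  proof -
    have bM: "cmod b \<le> M" using ab by linarith
    have i: "\<bar>inner (sgn c) h\<bar> \<le> cmod h" for c
      using Cauchy_Schwarz_ineq2[of "sgn c" h] mult_right_mono[OF norm_sgn_le, of "cmod h" c] by simp
    have eq: "T a - T b = ((cmod a powr q - cmod b powr q) * inner (sgn a) h) *\<^sub>R sgn a
        + cmod b powr q *\<^sub>R (inner (sgn a - sgn b) h *\<^sub>R sgn a + inner (sgn b) h *\<^sub>R (sgn a - sgn b))"
      by (simp add: T_def inner_diff_left algebra_simps)
    have n1: "cmod (((cmod a powr q - cmod b powr q) * inner (sgn a) h) *\<^sub>R sgn a) \<le> (q * N * cmod (a - b)) * cmod h * 1"
      unfolding norm_scaleR abs_mult N_def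
      by (intro mult_mono abs_powr_diff_le ab bM q i norm_sgn_le) (use q in auto)
    have n2: "cmod (inner (sgn a - sgn b) h *\<^sub>R sgn a + inner (sgn b) h *\<^sub>R (sgn a - sgn b)) \<le> 2 * cmod (sgn a - sgn b) * cmod h"
    proof -
      have "\<bar>inner (sgn a - sgn b) h\<bar> * cmod (sgn a) \<le> (cmod (sgn a - sgn b) * cmod h) * 1"
        by (intro mult_mono Cauchy_Schwarz_ineq2 norm_sgn_le) auto
      moreover have "\<bar>inner (sgn b) h\<bar> * cmod (sgn a - sgn b) \<le> cmod h * cmod (sgn a - sgn b)"
        by (intro mult_right_mono i) auto
      ultimately show ?thesis
        by (intro order_trans[OF norm_triangle_ineq]) (simp add: mult.commute)
    qed
    have bq: "cmod b powr q * cmod (sgn a - sgn b) \<le> N * (2 * cmod (a - b))"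
    proof (cases "b = 0")
      case False
      have "cmod b powr q = cmod b powr (q - 1) * cmod b" using False by (simp add: powr_diff)
      then have "cmod b powr q * cmod (sgn a - sgn b) = cmod b powr (q - 1) * (cmod b * cmod (sgn a - sgn b))" by simp
      also have "\<dots> \<le> N * (2 * cmod (a - b))"
        unfolding N_def using bM q by (intro mult_mono powr_mono2 norm_sgn_diff_le ab) auto
      finally show ?thesis .
    qed (use N in simp)
    have "cmod (T a - T b) \<le> (q * N * cmod (a - b)) * cmod h * 1 + cmod b powr q * (2 * cmod (sgn a - sgn b) * cmod h)"
      unfolding eq
      by (rule order_trans[OF norm_triangle_ineq], rule add_mono[OF n1])
         (simp only: norm_scaleR abs_of_nonneg[OF powr_ge_zero], rule mult_left_mono[OF n2], simp)
    also have "cmod b powr q * (2 * cmod (sgn a - sgn b) * cmod h) = 2 * (cmod b powr q * cmod (sgn a - sgn b)) * cmod h" by simp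
    also have "\<dots> \<le> 2 * (N * (2 * cmod (a - b))) * cmod h"
      using bq by (intro mult_right_mono mult_left_mono) auto
    finally show ?thesis by (simp add: algebra_simps)
  qed
  have Tzw: "cmod (T z - T w) \<le> (q + 4) * N * cmod (z - w) * cmod h"
  proof (cases "cmod w \<le> cmod z")
    case True then show ?thesis using main M by blast
  next
    case False then show ?thesis using main[of z w] M by (simp add: norm_minus_commute)
  qed
  have "DN q z h - DN q w h = (cmod z powr q - cmod w powr q) *\<^sub>R h + q *\<^sub>R (T z - T w)"
    unfolding DNT by (simp add: algebra_simps)
  also have "cmod \<dots> \<le> \<bar>cmod z powr q - cmod w powr q\<bar> * cmod h + q * cmod (T z - T w)"
    by (rule order_trans[OF norm_triangle_ineq]) (use q in simp)
  also have "\<dots> \<le> (q * N * cmod (z - w)) * cmod h + q * ((q + 4) * N * cmod (z - w) * cmod h)"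
    unfolding N_def using Tzw[unfolded N_def] q
    by (intro add_mono mult_right_mono mult_left_mono abs_powr_diff_le M) auto
  finally show ?thesis by (simp add: N_def algebra_simps)
qed

lemma DN_diff: "DN q z (h - k) = DN q z h - DN q z k"
  by (simp add: DN_def inner_diff_right algebra_simps)

lemma nonlinearity_lipschitz:
  assumes M: "cmod z \<le> M" "cmod w \<le> M" and q: "q \<ge> 1"
  shows "cmod (nonlinearity (q + 1) z - nonlinearity (q + 1) w) \<le> (1 + q) * M powr q * cmod (z - w)"
proof (cases "M = 0")
  case False
  then have "M > 0" using M(1) norm_ge_zero[of z] by linarith
  have "nonlinearity (q + 1) z - nonlinearity (q + 1) w
      = (cmod z powr q) *\<^sub>R (z - w) + (cmod z powr q - cmod w powr q) *\<^sub>R w"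
    by (simp add: nonlinearity_def scaleR_conv_of_real algebra_simps)
  also have "cmod \<dots> \<le> cmod z powr q * cmod (z - w) + \<bar>cmod z powr q - cmod w powr q\<bar> * cmod w"
    by (rule order_trans[OF norm_triangle_ineq]) simp
  also have "\<dots> \<le> M powr q * cmod (z - w) + (q * M powr (q - 1) * cmod (z - w)) * M"
    using M q by (intro add_mono mult_mono mult_right_mono powr_mono2 abs_powr_diff_le) auto
  also have "\<dots> = M powr q * cmod (z - w) + q * (M powr (q - 1) * M) * cmod (z - w)" by simp
  also have "M powr (q - 1) * M = M powr q" using \<open>M > 0\<close> by (simp add: powr_diff)
  finally show ?thesis by (simp add: algebra_simps)
qed (use M in simp)

lemma nonlinearity_zero: "nonlinearity p 0 = 0" by (simp add: nonlinearity_def)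

lemma nsq_le_of_bound:
  assumes "f \<in> L2" "g \<in> L2" "\<And>x. x > 0 \<Longrightarrow> cmod (f x) \<le> C * cmod (g x)"
  shows "nsq f \<le> C\<^sup>2 * nsq g"
proof -
  have "nsq f \<le> (LINT x|halfline. C\<^sup>2 * (cmod (g x))\<^sup>2)"
    unfolding nsq_def
  proof (intro integral_mono L2_integrable assms integrable_mult_right)
    fix x assume "x \<in> space halfline"
    then have "(cmod (f x))\<^sup>2 \<le> (C * cmod (g x))\<^sup>2" using assms(3) by (intro power_mono) auto
    then show "(cmod (f x))\<^sup>2 \<le> C\<^sup>2 * (cmod (g x))\<^sup>2" by (simp add: power_mult_distrib)
  qed
  then show ?thesis by (simp add: nsq_def)
qed

lemma L2_of_bound:
  assumes "g \<in> L2" "continuous_on {0..} f" "\<And>x. x > 0 \<Longrightarrow> cmod (f x) \<le> C * cmod (g x)"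
  shows "f \<in> L2"
proof (rule L2I_bound)
  show "f \<in> borel_measurable halfline"
    by (rule continuous_imp_measurable_on_sets_lebesgue, rule continuous_on_subset[OF assms(2)]) auto
  show "integrable halfline (\<lambda>x. C\<^sup>2 * (cmod (g x))\<^sup>2)" by (intro integrable_mult_right L2_integrable assms)
  show "(cmod (f x))\<^sup>2 \<le> C\<^sup>2 * (cmod (g x))\<^sup>2" if "x > 0" for x
    using power_mono[OF assms(3)[OF that], of 2] by (simp add: power_mult_distrib)
qed

lemma continuous_nonlinearity: assumes "q > 0" shows "continuous_on UNIV (nonlinearity (q + 1))"
  by (intro continuous_at_imp_continuous_on ballI has_derivative_continuous[OF nonlinearity_has_derivative[OF assms]])

lemma continuous_on_DN:
  assumes f: "continuous_on S f" and g: "continuous_on S g" and M: "\<And>x. x \<in> S \<Longrightarrow> cmod (f x) \<le> M" and q: "q \<ge> 1"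
  shows "continuous_on S (\<lambda>x. DN q (f x) (g x))"
  unfolding continuous_on_def
proof
  fix x assume x: "x \<in> S"
  define C where "C = (q + q * (q + 4)) * M powr (q - 1)"
  define C' where "C' = (1 + q) * M powr q"
  have "((\<lambda>y. DN q (f y) (g y) - DN q (f x) (g x)) \<longlongrightarrow> 0) (at x within S)"
  proof (rule Lim_null_comparison)
    show "\<forall>\<^sub>F y in at x within S. norm (DN q (f y) (g y) - DN q (f x) (g x))
        \<le> C * cmod (f y - f x) * cmod (g y) + C' * cmod (g y - g x)"
      unfolding eventually_at_filter
    proof (intro always_eventually allI impI)
      fix y assume y: "y \<in> S"
      have "DN q (f y) (g y) - DN q (f x) (g x) = (DN q (f y) (g y) - DN q (f x) (g y)) + DN q (f x) (g y - g x)"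
        by (simp add: DN_diff)
      also have "cmod \<dots> \<le> cmod (DN q (f y) (g y) - DN q (f x) (g y)) + cmod (DN q (f x) (g y - g x))"
        by (rule norm_triangle_ineq)
      also have "\<dots> \<le> C * cmod (f y - f x) * cmod (g y) + C' * cmod (g y - g x)"
        unfolding C_def C'_def using q by (intro add_mono DN_lipschitz DN_bound M x y) auto
      finally show "norm (DN q (f y) (g y) - DN q (f x) (g x)) \<le> C * cmod (f y - f x) * cmod (g y) + C' * cmod (g y - g x)" .
    qed
    have "(f \<longlongrightarrow> f x) (at x within S)" "(g \<longlongrightarrow> g x) (at x within S)"
      using f g x by (auto simp: continuous_on_def)
    then have "((\<lambda>y. C * cmod (f y - f x) * cmod (g y) + C' * cmod (g y - g x))
        \<longlongrightarrow> C * cmod (f x - f x) * cmod (g x) + C' * cmod (g x - g x)) (at x within S)"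
      by (intro tendsto_add tendsto_mult tendsto_const tendsto_norm tendsto_diff)
    then show "((\<lambda>y. C * cmod (f y - f x) * cmod (g y) + C' * cmod (g y - g x)) \<longlongrightarrow> 0) (at x within S)" by simp
  qed
  then show "((\<lambda>y. DN q (f y) (g y)) \<longlongrightarrow> DN q (f x) (g x)) (at x within S)" by (rule LIM_zero_cancel)
qed

text \<open>That |u|^(p-1) u is again an \<open>energy\<close> is seen for \<open>twice\<close>
  differentiable u by the classical chain rule and for all u by density. The choice operator lets
  the name be used before; \<open>rep_Nop\<close> closes the gap.\<close>

definition Nop :: "real \<Rightarrow> energy \<Rightarrow> energy" where
  "Nop p u = (SOME w. \<forall>x\<ge>0. rep w x = nonlinearity p (rep u x))"

lemma Nop_unique:
  assumes "\<And>x. x \<ge> 0 \<Longrightarrow> rep w x = nonlinearity p (rep u x)" shows "Nop p u = w"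
  unfolding Nop_def
proof (rule some_equality)
  show "w' = w" if "\<forall>x\<ge>0. rep w' x = nonlinearity p (rep u x)" for w'
    by (rule energy_eqI) (use that assms in simp)
qed (use assms in blast)

lemma Nop_twice:
  assumes tw: "twice u u1 v" and q: "q \<ge> 1"
  shows "\<forall>x\<ge>0. rep (Nop (q + 1) u) x = nonlinearity (q + 1) (rep u x)"
    "AE x in halfline. der (Nop (q + 1) u) x = DN q (rep u x) (u1 x)"
    "(\<lambda>x. DN q (rep u x) (u1 x)) \<in> L2"
proof -
  note C1 = twice_C1[OF tw]
  define M where "M = 2 * norm u"
  have M: "cmod (rep u x) \<le> M" for x unfolding M_def by (rule norm_rep_le)
  define f where "f = (\<lambda>x. nonlinearity (q + 1) (rep u x))"
  define g where "g = (\<lambda>x. DN q (rep u x) (u1 x))"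
  have gc: "continuous_on {0..} g"
    unfolding g_def by (rule continuous_on_DN[OF rep_continuous_on C1(1) M q])
  have fc: "continuous_on {0..} f"
    unfolding f_def using q
    by (intro continuous_on_compose2[OF continuous_nonlinearity rep_continuous_on]) auto
  have fb: "cmod (f x) \<le> ((1 + q) * M powr q) * cmod (rep u x)" for x
    using nonlinearity_lipschitz[OF M[of x] _ q, of 0] M[of x] by (simp add: f_def nonlinearity_zero order_trans[OF norm_ge_zero])
  have gL: "g \<in> L2"
  proof (rule L2_of_bound[OF C1(3) gc])
    show "cmod (g x) \<le> ((1 + q) * M powr q) * cmod (u1 x)" for x
      unfolding g_def using q by (intro DN_bound M) auto
  qed
  have fL: "f \<in> L2" by (rule L2_of_bound[OF rep_L2 fc fb])
  have wL: "(\<lambda>x. of_real x * f x) \<in> L2"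
  proof (rule L2_of_bound[OF wrep_L2])
    show "continuous_on {0..} (\<lambda>x. of_real x * f x)" by (intro continuous_intros fc)
    show "cmod (of_real x * f x) \<le> ((1 + q) * M powr q) * cmod (wrep u x)" for x
      using mult_left_mono[OF fb[of x], of "\<bar>x\<bar>"] by (simp add: wrep_def norm_mult mult_ac)
  qed
  have d: "(f has_vector_derivative g x) (at x within {0..})" if x: "x \<ge> 0" for x
  proof -
    have "(rep u has_derivative (\<lambda>t. t *\<^sub>R u1 x)) (at x within {0..})"
      using tw x by (simp add: twice_def has_vector_derivative_def)
    moreover have "(nonlinearity (q + 1) has_derivative DN q (rep u x)) (at (rep u x))"
      using q by (intro nonlinearity_has_derivative) auto
    ultimately have "(f has_derivative (\<lambda>t. DN q (rep u x) (t *\<^sub>R u1 x))) (at x within {0..})"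
      unfolding f_def by (rule has_derivative_compose)
    moreover have "DN q (rep u x) (t *\<^sub>R u1 x) = t *\<^sub>R g x" for t
      by (simp add: g_def DN_def algebra_simps)
    ultimately show ?thesis by (simp add: has_vector_derivative_def)
  qed
  have fH: "f \<in> H01" using fL wL by (simp add: H01_def)
  obtain w where w: "\<And>x. x \<ge> 0 \<Longrightarrow> rep w x = f x"
    "\<And>x. x \<ge> 0 \<Longrightarrow> (rep w has_vector_derivative g x) (at x within {0..})"
    using energy_of_C1[OF fH gL gc d] by blast
  have N: "Nop (q + 1) u = w" by (rule Nop_unique) (simp add: w f_def)
  show "\<forall>x\<ge>0. rep (Nop (q + 1) u) x = nonlinearity (q + 1) (rep u x)"
    unfolding N using w(1) by (simp add: f_def)
  show "AE x in halfline. der (Nop (q + 1) u) x = DN q (rep u x) (u1 x)"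
    unfolding N using der_eq_C1(1)[OF w(2) gc] by (simp add: g_def)
  show "(\<lambda>x. DN q (rep u x) (u1 x)) \<in> L2" using gL by (simp add: g_def)
qed

text \<open>If norm u \<le> M then |u| \<le> 2 M pointwise, by \<open>norm_rep_le\<close>. On this
  disc \<open>C\<close> is the Lipschitz constant of the derivative of the power and
  \<open>C'\<close> that of the power itself.\<close>

definition Nlip :: "real \<Rightarrow> real \<Rightarrow> real" where
  "Nlip q M = (let C = (q + q * (q + 4)) * (2 * M) powr (q - 1); C' = (1 + q) * (2 * M) powr q
    in sqrt (8 * C\<^sup>2 * M\<^sup>2 + 4 * C'\<^sup>2))"

lemma Nop_lipschitz_twice:
  assumes tu: "twice u u1 uu" and tv: "twice v v1 vv" and q: "q \<ge> 1" and M: "norm u \<le> M" "norm v \<le> M"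
  shows "norm (Nop (q + 1) u - Nop (q + 1) v) \<le> Nlip q M * norm (u - v)"
proof -
  define C where "C = (q + q * (q + 4)) * (2 * M) powr (q - 1)"
  define C' where "C' = (1 + q) * (2 * M) powr q"
  have C: "C \<ge> 0" "C' \<ge> 0" using q by (auto simp: C_def C'_def)
  note Cu = twice_C1[OF tu] and Cv = twice_C1[OF tv]
  note Nu = Nop_twice[OF tu q] and Nv = Nop_twice[OF tv q]
  have Mu: "cmod (rep u x) \<le> 2 * M" "cmod (rep v x) \<le> 2 * M" for x
    using norm_rep_le[of u x] norm_rep_le[of v x] M by linarith+
  let ?d = "u - v" and ?D = "Nop (q + 1) u - Nop (q + 1) v"
  have ud: "nsq (\<lambda>x. u1 x - v1 x) = nsq (der ?d)"
  proof (rule nsq_cong)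
    show "AE x in halfline. u1 x - v1 x = der ?d x"
      using der_diff[of u v] Cu(2) Cv(2) by eventually_elim simp
  qed (intro L2_diff Cu Cv der_L2)+
  have uu: "nsq u1 = nsq (der u)" by (rule nsq_cong[symmetric, OF Cu(2) der_L2 Cu(3)])
  have r: "cmod (rep ?D x) \<le> C' * cmod (rep ?d x)" if "x > 0" for x
    using nonlinearity_lipschitz[OF Mu q, of x x] Nu(1) Nv(1) that by (simp add: C'_def)
  have 1: "nsq (rep ?D) \<le> C'\<^sup>2 * nsq (rep ?d)"
    by (rule nsq_le_of_bound[OF rep_L2 rep_L2 r])
  have 2: "nsq (wrep ?D) \<le> C'\<^sup>2 * nsq (wrep ?d)"
  proof (rule nsq_le_of_bound[OF wrep_L2 wrep_L2])
    show "cmod (wrep ?D x) \<le> C' * cmod (wrep ?d x)" if "x > 0" for x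
      using mult_left_mono[OF r[OF that], of "\<bar>x\<bar>"] by (simp add: wrep_def norm_mult mult_ac)
  qed
  \<comment> \<open>The difference of the derivatives is P + Q: \<open>P\<close> moves the base
    point and is bounded by the sup norm of u - v times |u1|, while \<open>Q\<close> moves the
    direction at a fixed base point.\<close>
  define P where "P = (\<lambda>x. DN q (rep u x) (u1 x) - DN q (rep v x) (u1 x))"
  define Q where "Q = (\<lambda>x. DN q (rep v x) (u1 x - v1 x))"
  have Pc: "continuous_on {0..} P" unfolding P_def
    by (rule continuous_on_diff[OF continuous_on_DN[OF rep_continuous_on Cu(1) Mu(1) q]
        continuous_on_DN[OF rep_continuous_on Cu(1) Mu(2) q]])
  have Qc: "continuous_on {0..} Q" unfolding Q_def
    by (rule continuous_on_DN[OF rep_continuous_on continuous_on_diff[OF Cu(1) Cv(1)] Mu(2) q])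
  have Pb: "cmod (P x) \<le> (C * (2 * norm ?d)) * cmod (u1 x)" for x
  proof -
    have "cmod (P x) \<le> C * cmod (rep u x - rep v x) * cmod (u1 x)"
      unfolding P_def C_def by (rule DN_lipschitz[OF Mu q])
    also have "\<dots> \<le> C * (2 * norm ?d) * cmod (u1 x)"
      using C norm_rep_le[of ?d x] by (intro mult_right_mono mult_left_mono) auto
    finally show ?thesis .
  qed
  have Qb: "cmod (Q x) \<le> C' * cmod (u1 x - v1 x)" for x
    unfolding Q_def C'_def using q by (intro DN_bound Mu) auto
  have PL: "P \<in> L2" by (rule L2_of_bound[OF Cu(3) Pc Pb])
  have QL: "Q \<in> L2" by (rule L2_of_bound[OF L2_diff[OF Cu(3) Cv(3)] Qc Qb])
  have "nsq (der ?D) = nsq (\<lambda>x. P x + Q x)"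
  proof (rule nsq_cong)
    show "AE x in halfline. der ?D x = P x + Q x"
      using der_diff[of "Nop (q + 1) u" "Nop (q + 1) v"] Nu(2) Nv(2)
      by eventually_elim (simp add: P_def Q_def DN_diff)
  qed (intro L2_add PL QL der_L2)+
  also have "\<dots> \<le> 2 * nsq P + 2 * nsq Q" by (rule nsq_add_le[OF PL QL])
  also have "\<dots> \<le> 2 * ((C * (2 * norm ?d))\<^sup>2 * nsq u1) + 2 * (C'\<^sup>2 * nsq (\<lambda>x. u1 x - v1 x))"
    by (intro add_mono mult_left_mono nsq_le_of_bound[OF PL Cu(3) Pb] nsq_le_of_bound[OF QL L2_diff[OF Cu(3) Cv(3)] Qb]) auto
  also have "nsq u1 \<le> M\<^sup>2"
  proof -
    have "nsq u1 \<le> (norm u)\<^sup>2" unfolding uu by (rule nsq_der_le)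
    also have "\<dots> \<le> M\<^sup>2" using M by (intro power_mono) auto
    finally show ?thesis .
  qed
  also have "2 * ((C * (2 * norm ?d))\<^sup>2 * M\<^sup>2) + 2 * (C'\<^sup>2 * nsq (\<lambda>x. u1 x - v1 x))
      = 8 * C\<^sup>2 * M\<^sup>2 * (norm ?d)\<^sup>2 + 2 * C'\<^sup>2 * nsq (der ?d)"
    unfolding ud by (simp add: power_mult_distrib)
  finally have 3: "nsq (der ?D) \<le> 8 * C\<^sup>2 * M\<^sup>2 * (norm ?d)\<^sup>2 + 2 * C'\<^sup>2 * nsq (der ?d)"
    by (simp add: mult_left_mono)
  have "(norm ?D)\<^sup>2 = nsq (der ?D) + nsq (rep ?D) + nsq (wrep ?D)" by (rule norm_energy_sq)
  also have "\<dots> \<le> 8 * C\<^sup>2 * M\<^sup>2 * (norm ?d)\<^sup>2 + 2 * C'\<^sup>2 * nsq (der ?d) + C'\<^sup>2 * nsq (rep ?d) + C'\<^sup>2 * nsq (wrep ?d)"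
    using 1 2 3 by linarith
  also have "\<dots> \<le> 8 * C\<^sup>2 * M\<^sup>2 * (norm ?d)\<^sup>2 + 4 * C'\<^sup>2 * (nsq (der ?d) + nsq (rep ?d) + nsq (wrep ?d))"
  proof -
    have "0 \<le> C'\<^sup>2 * nsq (der ?d)" "0 \<le> C'\<^sup>2 * nsq (rep ?d)" "0 \<le> C'\<^sup>2 * nsq (wrep ?d)"
      by (intro mult_nonneg_nonneg nsq_nonneg zero_le_power2)+
    then show ?thesis by (simp add: distrib_left)
  qed
  also have "\<dots> = (8 * C\<^sup>2 * M\<^sup>2 + 4 * C'\<^sup>2) * (norm ?d)\<^sup>2"
    unfolding norm_energy_sq[symmetric] by (simp add: algebra_simps)
  also have "\<dots> = (Nlip q M * norm ?d)\<^sup>2"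
    by (simp add: Nlip_def Let_def power_mult_distrib flip: C_def C'_def)
  finally show ?thesis
  proof (rule power2_le_imp_le)
    show "0 \<le> Nlip q M * norm ?d" by (intro mult_nonneg_nonneg norm_ge_zero) (simp add: Nlip_def Let_def)
  qed
qed

lemma twice_dense:
  obtains w where "w \<longlonglongrightarrow> (u :: energy)" "\<And>n. \<exists>u1 v. twice (w n) u1 v"
proof -
  \<comment> \<open>The parameter 1 stands for any non-zero one; what is wanted is a dense set of
    smooth elements.\<close>
  interpret m_dissipative "bform 1" gen "dom 1" "1 / 2" by (rule robin_m_dissipative) simp
  show thesis
  proof (rule that[OF J_tendsto])
    show "\<exists>u1 v. twice (J (real (Suc n)) u) u1 v" for n
      using J_in_D[of "real (Suc n)" u] by (auto simp: dom_def)
  qed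
qed

lemma eventually_norm_le:
  assumes "w \<longlonglongrightarrow> u" "norm u \<le> M" shows "\<forall>\<^sub>F n in sequentially. norm (w n) \<le> M + 1"
proof -
  have "\<forall>\<^sub>F n in sequentially. norm (w n) < M + 1"
    using order_tendstoD(2)[OF tendsto_norm[OF assms(1)], of "M + 1"] assms(2) by simp
  then show ?thesis by (rule eventually_mono) simp
qed

text \<open>On the dense set the map is Lipschitz on balls, so the images of an approximating
  sequence are Cauchy; evaluation at each x shows that their limit represents the pointwise
  power.\<close>

lemma Nop_tendsto_twice:
  assumes w: "w \<longlonglongrightarrow> u" "\<And>n. \<exists>u1 v. twice (w n) u1 v" and q: "q \<ge> 1"
  shows "(\<lambda>n. Nop (q + 1) (w n)) \<longlonglongrightarrow> Nop (q + 1) u"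
    "\<forall>x\<ge>0. rep (Nop (q + 1) u) x = nonlinearity (q + 1) (rep u x)"
proof -
  define M where "M = norm u + 1"
  have lip: "norm (Nop (q + 1) (w m) - Nop (q + 1) (w n)) \<le> Nlip q M * norm (w m - w n)"
    if "norm (w m) \<le> M" "norm (w n) \<le> M" for m n
    using w(2)[of m] w(2)[of n] Nop_lipschitz_twice[OF _ _ q that] by blast
  obtain N where N: "\<And>n. n \<ge> N \<Longrightarrow> norm (w n) \<le> M"
    using eventually_norm_le[OF w(1) order_refl] unfolding eventually_sequentially M_def by blast
  have L: "Nlip q M \<ge> 0" by (simp add: Nlip_def Let_def)
  have "Cauchy (\<lambda>n. Nop (q + 1) (w n))"
  proof (rule CauchyI)
    fix e :: real assume e: "e > 0"
    then have "e / (Nlip q M + 1) > 0" using L by simp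
    from CauchyD[OF LIMSEQ_imp_Cauchy[OF w(1)] this] obtain K
      where K: "\<And>m n. m \<ge> K \<Longrightarrow> n \<ge> K \<Longrightarrow> norm (w m - w n) < e / (Nlip q M + 1)" by blast
    have "norm (Nop (q + 1) (w m) - Nop (q + 1) (w n)) < e" if "m \<ge> max N K" "n \<ge> max N K" for m n
    proof -
      have "norm (Nop (q + 1) (w m) - Nop (q + 1) (w n)) \<le> Nlip q M * norm (w m - w n)"
        using that by (intro lip N) auto
      also have "\<dots> \<le> (Nlip q M + 1) * norm (w m - w n)" by (intro mult_right_mono) auto
      also have "\<dots> < e" using K[of m n] that L by (simp add: field_simps)
      finally show ?thesis .
    qed
    then show "\<exists>K. \<forall>m\<ge>K. \<forall>n\<ge>K. norm (Nop (q + 1) (w m) - Nop (q + 1) (w n)) < e" by blast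
  qed
  then obtain W where W: "(\<lambda>n. Nop (q + 1) (w n)) \<longlonglongrightarrow> W" by (auto simp: Cauchy_convergent_iff convergent_def)
  have rW: "rep W x = nonlinearity (q + 1) (rep u x)" if x: "x \<ge> 0" for x
  proof -
    have "(\<lambda>n. rep (Nop (q + 1) (w n)) x) \<longlonglongrightarrow> rep W x"
      by (rule bounded_linear.tendsto[OF bounded_linear_rep W])
    moreover have "rep (Nop (q + 1) (w n)) x = nonlinearity (q + 1) (rep (w n) x)" for n
      using w(2)[of n] Nop_twice(1)[OF _ q] x by blast
    moreover have "(\<lambda>n. nonlinearity (q + 1) (rep (w n) x)) \<longlonglongrightarrow> nonlinearity (q + 1) (rep u x)"
    proof (rule isCont_tendsto_compose[of _ "nonlinearity (q + 1)"])
      show "isCont (nonlinearity (q + 1)) (rep u x)"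
        using q by (intro has_derivative_continuous[OF nonlinearity_has_derivative]) auto
      show "(\<lambda>n. rep (w n) x) \<longlonglongrightarrow> rep u x" by (rule bounded_linear.tendsto[OF bounded_linear_rep w(1)])
    qed
    ultimately show ?thesis using LIMSEQ_unique by fastforce
  qed
  have "Nop (q + 1) u = W" by (rule Nop_unique[OF rW])
  then show "(\<lambda>n. Nop (q + 1) (w n)) \<longlonglongrightarrow> Nop (q + 1) u"
    "\<forall>x\<ge>0. rep (Nop (q + 1) u) x = nonlinearity (q + 1) (rep u x)" using W rW by auto
qed

lemma rep_Nop:
  assumes "p \<ge> 2" "x \<ge> 0" shows "rep (Nop p u) x = nonlinearity p (rep u x)"
proof -
  obtain w where w: "w \<longlonglongrightarrow> u" "\<And>n. \<exists>u1 v. twice (w n) u1 v" using twice_dense by blast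
  show ?thesis using Nop_tendsto_twice(2)[OF w, of "p - 1"] assms by simp
qed

text \<open>The argument \<open>M + 1\<close> of the constant leaves room for the approximating
  sequences, whose norms eventually exceed \<open>M\<close> by at most 1.\<close>

lemma Nop_lipschitz:
  assumes "p \<ge> 2" "norm u \<le> M" "norm v \<le> M"
  shows "norm (Nop p u - Nop p v) \<le> Nlip (p - 1) (M + 1) * norm (u - v)"
proof -
  have q: "p - 1 \<ge> 1" using assms by simp
  obtain w where w: "w \<longlonglongrightarrow> u" "\<And>n. \<exists>u1 v. twice (w n) u1 v" using twice_dense by blast
  obtain z where z: "z \<longlonglongrightarrow> v" "\<And>n. \<exists>u1 v. twice (z n) u1 v" using twice_dense by blast
  show ?thesis
  proof (rule tendsto_le[OF sequentially_bot])
    show "(\<lambda>n. norm (Nop p (w n) - Nop p (z n))) \<longlonglongrightarrow> norm (Nop p u - Nop p v)"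
      using Nop_tendsto_twice(1)[OF w q] Nop_tendsto_twice(1)[OF z q] by (intro tendsto_norm tendsto_diff) auto
    show "(\<lambda>n. Nlip (p - 1) (M + 1) * norm (w n - z n)) \<longlonglongrightarrow> Nlip (p - 1) (M + 1) * norm (u - v)"
      by (intro tendsto_intros w z)
    show "\<forall>\<^sub>F n in sequentially. norm (Nop p (w n) - Nop p (z n)) \<le> Nlip (p - 1) (M + 1) * norm (w n - z n)"
      using eventually_norm_le[OF w(1) assms(2)] eventually_norm_le[OF z(1) assms(3)]
    proof eventually_elim
      case (elim n)
      then show ?case using w(2)[of n] z(2)[of n] Nop_lipschitz_twice[OF _ _ q elim] by auto
    qed
  qed
qed

subsection \<open>Bump functions\<close>

text \<open>The powers of 1/y are included because differentiation of exp(-c/y) produces them. The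
  parameter \<open>c\<close> will tend to 0, which makes exp(-c/y) tend to 1.\<close>

definition flat :: "real \<Rightarrow> nat \<Rightarrow> real \<Rightarrow> real" where
  "flat c i y = (if y > 0 then exp (- c / y) / y ^ i else 0)"

lemma flat_nonneg [simp]: "flat c i y \<ge> 0"
  by (simp add: flat_def)

text \<open>From (s/n)^n \<le> exp s with s = c/y and n = i + 2. The two powers beyond i give the
  square of y, which makes the difference quotient at 0 vanish.\<close>

lemma flat_bound:
  assumes c: "c > 0"
  shows "flat c i y \<le> (real (i + 2) / c) ^ (i + 2) * y\<^sup>2"
proof (cases "y > 0")
  case True
  let ?n = "i + 2"
  have x: "c / y > 0" using c True by simp
  have "(c / y / real ?n) ^ ?n \<le> (exp (c / y / real ?n)) ^ ?n"
  proof (rule power_mono)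
    show "0 \<le> c / y / real ?n" by (rule divide_nonneg_nonneg[OF less_imp_le[OF x]]) simp
    show "c / y / real ?n \<le> exp (c / y / real ?n)" using exp_ge_add_one_self[of "c / y / real ?n"] by linarith
  qed
  also have "\<dots> = exp (real ?n * (c / y / real ?n))" by (rule exp_of_nat_mult[symmetric])
  also have "\<dots> = exp (c / y)" by (subst times_divide_eq_right, subst nonzero_mult_div_cancel_left) auto
  finally have e: "(c / y / real ?n) ^ ?n \<le> exp (c / y)" .
  have pos: "(c / y / real ?n) ^ ?n > 0" by (rule zero_less_power, rule divide_pos_pos[OF x]) simp
  have "exp (- c / y) = inverse (exp (c / y))" by (simp add: exp_minus)
  also have "\<dots> \<le> inverse ((c / y / real ?n) ^ ?n)" using e pos by (rule le_imp_inverse_le)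
  also have "\<dots> = inverse (c / y / real ?n) ^ ?n" by (rule power_inverse[symmetric])
  also have "inverse (c / y / real ?n) = real ?n / c * y" by (simp add: divide_inverse ac_simps)
  also have "(real ?n / c * y) ^ ?n = (real ?n / c) ^ ?n * y ^ ?n" by (rule power_mult_distrib)
  finally have "exp (- c / y) / y ^ i \<le> (real ?n / c) ^ ?n * y ^ ?n / y ^ i"
    using True by (intro divide_right_mono) auto
  also have "\<dots> = (real ?n / c) ^ ?n * y\<^sup>2" using True by (simp add: power_add power2_eq_square)
  finally show ?thesis using True by (simp add: flat_def)
next
  case False
  then show ?thesis using c by (simp add: flat_def)
qed

lemma flat_has_derivative:
  assumes c: "c > 0"
  shows "(flat c i has_real_derivative (c * flat c (i + 2) y - real i * flat c (i + 1) y)) (at y)"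
proof -
  consider "y > 0" | "y < 0" | "y = 0" by linarith
  then show ?thesis
  proof cases
    case 1
    have "((\<lambda>y. exp (- c / y) / y ^ i) has_real_derivative (c * flat c (i + 2) y - real i * flat c (i + 1) y)) (at y)"
      using 1 by (auto intro!: derivative_eq_intros simp: flat_def power2_eq_square field_simps)
        (cases i; simp add: field_simps)
    then show ?thesis
      by (rule has_field_derivative_transform_within_open[of _ _ _ "{0<..}"]) (use 1 in \<open>auto simp: flat_def\<close>)
  next
    case 2
    have "((\<lambda>y. 0) has_real_derivative 0) (at y)" by simp
    then have "(flat c i has_real_derivative 0) (at y)"
      by (rule has_field_derivative_transform_within_open[of _ _ _ "{..<0}"]) (use 2 in \<open>auto simp: flat_def\<close>)
    then show ?thesis using 2 by (simp add: flat_def)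
  next
    case 3
    define K where "K = (real (i + 2) / c) ^ (i + 2)"
    have "((\<lambda>h. (flat c i (0 + h) - flat c i 0) / h) \<longlongrightarrow> 0) (at 0)"
    proof (rule Lim_null_comparison)
      have "norm ((flat c i (0 + h) - flat c i 0) / h) \<le> K * \<bar>h\<bar>" for h
      proof -
        have "flat c i h / \<bar>h\<bar> \<le> K * h\<^sup>2 / \<bar>h\<bar>"
          unfolding K_def by (intro divide_right_mono flat_bound c) auto
        also have "\<dots> = K * \<bar>h\<bar>" by (cases "h = 0") (auto simp: power2_eq_square abs_if)
        finally show ?thesis by (simp add: flat_def[of c i 0] abs_divide)
      qed
      then show "\<forall>\<^sub>F h in at 0. norm ((flat c i (0 + h) - flat c i 0) / h) \<le> K * \<bar>h\<bar>"
        by (intro always_eventually allI)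
      have "((\<lambda>h::real. K * \<bar>h\<bar>) \<longlongrightarrow> K * \<bar>0\<bar>) (at 0)" by (intro tendsto_intros)
      then show "((\<lambda>h::real. K * \<bar>h\<bar>) \<longlongrightarrow> 0) (at 0)" by simp
    qed
    then have "(flat c i has_real_derivative 0) (at 0)" by (simp add: DERIV_def)
    then show ?thesis using 3 by (simp add: flat_def)
  qed
qed

text \<open>Closed under differentiation and consisting of functions vanishing off \<open>(a,b)\<close>.\<close>

inductive bump_span :: "real \<Rightarrow> real \<Rightarrow> real \<Rightarrow> (real \<Rightarrow> real) \<Rightarrow> bool" for c a b where
  monomial: "bump_span c a b (\<lambda>x. flat c i (x - a) * flat c j (b - x))"
| combine: "bump_span c a b f \<Longrightarrow> bump_span c a b g \<Longrightarrow> bump_span c a b (\<lambda>x. r * f x + g x)"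

lemma bump_span_derivative:
  assumes c: "c > 0" and "bump_span c a b f"
  shows "\<exists>f'. bump_span c a b f' \<and> (\<forall>x. (f has_real_derivative f' x) (at x))"
  using assms(2)
proof induction
  case (monomial i j)
  let ?m = "\<lambda>i j x. flat c i (x - a) * flat c j (b - x)"
  \<comment> \<open>The trailing zero terms close the nested sum, since \<open>combine\<close>
    always expects one more summand.\<close>
  define f' where "f' = (\<lambda>x. c * ?m (i + 2) j x + (- real i * ?m (i + 1) j x + (- c * ?m i (j + 2) x + (real j * ?m i (j + 1) x + (0 * ?m 0 0 x + 0 * ?m 0 0 x)))))"
  have zero: "bump_span c a b (\<lambda>x. 0 * ?m 0 0 x + 0 * ?m 0 0 x)"
  proof -
    have "bump_span c a b (\<lambda>x. (-1) * ?m 0 0 x + ?m 0 0 x)" by (intro bump_span.intros)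
    then show ?thesis by simp
  qed
  have "bump_span c a b f'" unfolding f'_def by (intro bump_span.combine bump_span.monomial zero)
  moreover have "(?m i j has_real_derivative f' x) (at x)" for x
  proof -
    have d1: "((\<lambda>x. flat c i (x - a)) has_real_derivative (c * flat c (i + 2) (x - a) - real i * flat c (i + 1) (x - a)) * 1) (at x)"
      by (rule DERIV_chain2[OF flat_has_derivative[OF c]]) (auto intro!: derivative_eq_intros)
    have d2: "((\<lambda>x. flat c j (b - x)) has_real_derivative (c * flat c (j + 2) (b - x) - real j * flat c (j + 1) (b - x)) * (-1)) (at x)"
      by (rule DERIV_chain2[OF flat_has_derivative[OF c]]) (auto intro!: derivative_eq_intros)
    show ?thesis
      by (rule DERIV_cong[OF DERIV_mult[OF d1 d2]]) (simp add: f'_def algebra_simps)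
  qed
  ultimately show ?case by blast
next
  case (combine f g r)
  then obtain f' g' where "bump_span c a b f'" "\<And>x. (f has_real_derivative f' x) (at x)"
    "bump_span c a b g'" "\<And>x. (g has_real_derivative g' x) (at x)" by blast
  then show ?case
    by (intro exI[of _ "\<lambda>x. r * f' x + g' x"]) (auto intro!: bump_span.combine DERIV_add DERIV_cmult)
qed

lemma bump_span_outside:
  assumes "bump_span c a b f" "x \<notin> {a<..<b}" shows "f x = 0"
  using assms by induction (auto simp: flat_def)

lemma bump_span_smooth:
  assumes c: "c > 0" and f: "bump_span c a b f"
  shows "(deriv ^^ n) f field_differentiable (at x)"
proof -
  have "bump_span c a b ((deriv ^^ n) f)"
  proof (induction n)
    case (Suc n)
    then obtain f' where f': "bump_span c a b f'" "\<And>x. ((deriv ^^ n) f has_real_derivative f' x) (at x)"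
      using bump_span_derivative[OF c] by blast
    have "deriv ((deriv ^^ n) f) = f'" using DERIV_imp_deriv[OF f'(2)] by (simp add: fun_eq_iff)
    then show ?case using f'(1) by simp
  qed (simp add: f)
  then show ?thesis using bump_span_derivative[OF c] unfolding field_differentiable_def by blast
qed

text \<open>The parameter 1 / (n + 1) makes the bumps tend to 1 on the open interval, so that its
  indicator is a limit of test functions.\<close>

definition bump :: "real \<Rightarrow> real \<Rightarrow> nat \<Rightarrow> real \<Rightarrow> real" where
  "bump a b n x = flat (1 / real (Suc n)) 0 (x - a) * flat (1 / real (Suc n)) 0 (b - x)"

lemma bump_in_span: "bump_span (1 / real (Suc n)) a b (bump a b n)"
  unfolding bump_def[abs_def] by (rule bump_span.monomial)

lemma bump_outside: "x \<notin> {a<..<b} \<Longrightarrow> bump a b n x = 0"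
  by (rule bump_span_outside[OF bump_in_span])

lemma bump_bounds: "0 \<le> bump a b n x" "bump a b n x \<le> 1"
proof -
  have "flat (1 / real (Suc n)) 0 y \<le> 1" for y by (simp add: flat_def)
  then show "0 \<le> bump a b n x" "bump a b n x \<le> 1"
    unfolding bump_def by (auto intro!: mult_le_one)
qed

lemma bump_continuous: "continuous_on A (bump a b n)"
proof -
  obtain f' where "\<And>x. (bump a b n has_real_derivative f' x) (at x)"
    using bump_span_derivative[OF _ bump_in_span, of n] by fastforce
  then have "isCont (bump a b n) x" for x by (rule DERIV_isCont)
  then show ?thesis by (simp add: continuous_at_imp_continuous_on)
qed

lemma bump_tendsto: assumes "x \<in> {a<..<b}" shows "(\<lambda>n. bump a b n x) \<longlonglongrightarrow> 1"
proof -
  have l: "(\<lambda>n. exp (- (inverse (real (Suc n))) / y)) \<longlonglongrightarrow> exp (- 0 / y)" if "y > 0" for y :: real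
    using that by (intro tendsto_exp tendsto_divide tendsto_minus LIMSEQ_inverse_real_of_nat tendsto_const) auto
  have "(\<lambda>n. exp (- (inverse (real (Suc n))) / (x - a)) * exp (- (inverse (real (Suc n))) / (b - x))) \<longlonglongrightarrow> exp (- 0 / (x - a)) * exp (- 0 / (b - x))"
    using assms by (intro tendsto_mult l) auto
  then show ?thesis using assms by (simp add: bump_def flat_def inverse_eq_divide)
qed

subsection \<open>Test functions\<close>

lemma test_function_bump:
  assumes "{a..b} \<subseteq> S" shows "test_function S (bump a b n)"
  unfolding test_function_def
proof (intro conjI allI exI[of _ "{a..b}"] impI)
  show "(deriv ^^ m) (bump a b n) field_differentiable (at x)" for m x
    by (rule bump_span_smooth[OF _ bump_in_span]) simp
qed (use assms in \<open>auto intro: bump_outside\<close>)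

lemma test_function_derivative:
  assumes "test_function S \<phi>" shows "(\<phi> has_real_derivative deriv \<phi> x) (at x)"
proof -
  have "(deriv ^^ 0) \<phi> field_differentiable (at x)" using assms unfolding test_function_def by blast
  then show ?thesis by (simp add: DERIV_deriv_iff_field_differentiable)
qed

lemma test_function_continuous: "test_function S \<phi> \<Longrightarrow> continuous_on A \<phi>"
  by (intro continuous_at_imp_continuous_on ballI DERIV_isCont[OF test_function_derivative])

lemma deriv_eq_0_outside:
  fixes \<phi> :: "real \<Rightarrow> real"
  assumes "closed K" "\<And>x. x \<notin> K \<Longrightarrow> \<phi> x = 0" "x \<notin> K"
  shows "deriv \<phi> x = 0"
proof (rule DERIV_imp_deriv)
  have "((\<lambda>x. 0) has_real_derivative 0) (at x)" by simp
  then show "(\<phi> has_real_derivative 0) (at x)"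
    by (rule has_field_derivative_transform_within_open[of _ _ _ "- K"]) (use assms in auto)
qed

lemma test_function_deriv:
  assumes "test_function S \<phi>" shows "test_function S (deriv \<phi>)"
proof -
  obtain K where K: "compact K" "K \<subseteq> S" "\<And>x. x \<notin> K \<Longrightarrow> \<phi> x = 0"
    using assms unfolding test_function_def by blast
  have "deriv \<phi> x = 0" if "x \<notin> K" for x
    by (rule deriv_eq_0_outside[OF _ _ that]) (use K compact_imp_closed in auto)
  moreover have "(deriv ^^ n) (deriv \<phi>) field_differentiable (at x)" for n x
    using assms unfolding test_function_def by (metis funpow_Suc_right comp_apply)
  ultimately show ?thesis using K unfolding test_function_def by blast
qed

lemma test_functionI_derivative:
  assumes d: "\<And>x. (\<phi> has_real_derivative \<psi> x) (at x)"
    and \<psi>: "\<And>n x. (deriv ^^ n) \<psi> field_differentiable (at x)"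
    and K: "\<And>x. x \<notin> {l..r} \<Longrightarrow> \<phi> x = 0" "{l..r} \<subseteq> S"
  shows "test_function S \<phi>"
  unfolding test_function_def
proof (intro conjI allI exI[of _ "{l..r}"] impI)
  have e: "deriv \<phi> = \<psi>" using DERIV_imp_deriv[OF d] by (simp add: fun_eq_iff)
  show "(deriv ^^ n) \<phi> field_differentiable (at x)" for n x
  proof (cases n)
    case 0
    then show ?thesis using d by (auto simp: field_differentiable_def)
  next
    case (Suc m)
    then show ?thesis using \<psi>[of m x] by (simp add: funpow_Suc_right e del: funpow.simps)
  qed
qed (use K in auto)

lemma absolutely_integrable_mult_continuous:
  fixes G :: "real \<Rightarrow> complex"
  assumes "continuous_on {c..d} \<phi>" "G absolutely_integrable_on {c..d}"
  shows "(\<lambda>x. of_real (\<phi> x) * G x) absolutely_integrable_on {c..d}"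
proof (rule absolutely_integrable_bounded_measurable_product[OF bounded_bilinear_mult[THEN bilinear_conv_bounded_bilinear[THEN iffD2]] _ _ _ assms(2)])
  have c: "continuous_on {c..d} (\<lambda>x. complex_of_real (\<phi> x))" by (intro continuous_on_of_real assms)
  show "(\<lambda>x. complex_of_real (\<phi> x)) \<in> borel_measurable (lebesgue_on {c..d})"
    by (rule continuous_imp_measurable_on_sets_lebesgue[OF c]) simp
  show "bounded ((\<lambda>x. complex_of_real (\<phi> x)) ` {c..d})"
    by (rule compact_imp_bounded[OF compact_continuous_image[OF c compact_Icc]])
qed simp

lemma integral_bump_tendsto:
  fixes G :: "real \<Rightarrow> complex"
  assumes G: "G absolutely_integrable_on {c..d}"
  shows "(\<lambda>n. integral {c..d} (\<lambda>x. of_real (bump c d n x) * G x)) \<longlonglongrightarrow> integral {c..d} G"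
proof -
  have i: "f integrable_on {c..d} \<longleftrightarrow> f integrable_on {c<..<d}" for f :: "real \<Rightarrow> 'e::banach"
    by (simp add: integrable_on_open_interval_real)
  have "(\<lambda>n. integral {c<..<d} (\<lambda>x. of_real (bump c d n x) * G x)) \<longlonglongrightarrow> integral {c<..<d} G"
  proof (rule dominated_convergence(2)[where h = "\<lambda>x. cmod (G x)"])
    show "(\<lambda>x. of_real (bump c d n x) * G x) integrable_on {c<..<d}" for n
      unfolding i[symmetric]
      using absolutely_integrable_mult_continuous[OF bump_continuous G] set_lebesgue_integral_eq_integral(1) by blast
    show "(\<lambda>x. cmod (G x)) integrable_on {c<..<d}"
      unfolding i[symmetric] using absolutely_integrable_norm[OF G] set_lebesgue_integral_eq_integral(1) by (auto simp: o_def)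
    show "cmod (of_real (bump c d n x) * G x) \<le> cmod (G x)" for n x
      using bump_bounds[of c d n x] by (simp add: norm_mult mult_left_le_one_le)
    show "(\<lambda>n. of_real (bump c d n x) * G x) \<longlonglongrightarrow> G x" if "x \<in> {c<..<d}" for x
      using tendsto_mult[OF tendsto_of_real[OF bump_tendsto[OF that]] tendsto_const, of "G x"] by simp
  qed
  then show ?thesis by (simp add: integral_open_interval_real)
qed

lemma integral_zero_of_test:
  fixes G :: "real \<Rightarrow> complex"
  assumes "G absolutely_integrable_on {c..d}" "{c..d} \<subseteq> S"
    and "\<And>\<phi>. test_function S \<phi> \<Longrightarrow> (\<And>x. x \<notin> {c..d} \<Longrightarrow> \<phi> x = 0) \<Longrightarrow>
      integral {c..d} (\<lambda>x. of_real (\<phi> x) * G x) = 0"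
  shows "integral {c..d} G = 0"
proof -
  have "integral {c..d} (\<lambda>x. of_real (bump c d n x) * G x) = 0" for n
    by (intro assms(3) test_function_bump assms(2)) (auto intro: bump_outside)
  then have "(\<lambda>n. 0) \<longlonglongrightarrow> integral {c..d} G" using integral_bump_tendsto[OF assms(1)] by simp
  then show ?thesis using LIMSEQ_unique tendsto_const by blast
qed

lemma integral_extend:
  fixes F :: "real \<Rightarrow> 'a::banach"
  assumes "\<And>x. x \<notin> {c..d} \<Longrightarrow> F x = 0" "l \<le> c" "d \<le> r"
  shows "integral {l..r} F = integral {c..d} F"
proof (rule integral_spike_set)
  have "{x \<in> {l..r} - {c..d}. F x \<noteq> 0} = {}" using assms(1) by blast
  then show "negligible {x \<in> {l..r} - {c..d}. F x \<noteq> 0}" by (metis negligible_empty)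
  have "{x \<in> {c..d} - {l..r}. F x \<noteq> 0} = {}" using assms(2,3) by force
  then show "negligible {x \<in> {c..d} - {l..r}. F x \<noteq> 0}" by (metis negligible_empty)
qed

text \<open>Testing with the antiderivative of a combination of two bumps of equal mass.\<close>

lemma du_bois_reymond:
  fixes F :: "real \<Rightarrow> complex"
  assumes S: "\<And>c d. c \<in> S \<Longrightarrow> d \<in> S \<Longrightarrow> {c..d} \<subseteq> S"
    and F: "\<And>c d. c \<in> S \<Longrightarrow> d \<in> S \<Longrightarrow> F absolutely_integrable_on {c..d}"
    and test: "\<And>\<phi> l r. test_function S \<phi> \<Longrightarrow> l \<in> S \<Longrightarrow> r \<in> S \<Longrightarrow> (\<And>x. x \<notin> {l..r} \<Longrightarrow> \<phi> x = 0) \<Longrightarrow>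
      integral {l..r} (\<lambda>x. of_real (deriv \<phi> x) * F x) = 0"
    and cd: "c \<in> S" "d \<in> S" "c \<le> d" and st: "s \<in> S" "t \<in> S" "s \<le> t"
  shows "of_real (t - s) * integral {c..d} F = of_real (d - c) * integral {s..t} F"
proof -
  define l r where "l = min c s" and "r = max d t"
  have lr: "l \<in> S" "r \<in> S" "l \<le> c" "d \<le> r" "l \<le> s" "t \<le> r" "l \<le> r"
    using cd st by (auto simp: l_def r_def min_def max_def)
  define I where "I = (\<lambda>a b n. integral {a..b} (bump a b n))"
  have eqn: "of_real (I s t n) * integral {c..d} (\<lambda>x. of_real (bump c d n x) * F x)
      = of_real (I c d n) * integral {s..t} (\<lambda>x. of_real (bump s t n x) * F x)" for n
  proof -
    define e where "e = 1 / real (Suc n)"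
    have e: "e > 0" by (simp add: e_def)
    \<comment> \<open>Each bump is multiplied by the mass of the other, so the total mass is 0 and
      the primitive \<phi> vanishes on both sides of [l,r]. The primitive starts at l - 1 so that
      its derivative at l is two-sided.\<close>
    define \<psi> where "\<psi> = (\<lambda>x. I s t n * bump c d n x - I c d n * bump s t n x)"
    define \<phi> where "\<phi> = (\<lambda>x. integral {l - 1..x} \<psi>)"
    have \<psi>c: "continuous_on A \<psi>" for A unfolding \<psi>_def by (intro continuous_intros bump_continuous)
    have \<psi>0: "\<psi> x = 0" if "x \<notin> {l..r}" for x
      using that lr bump_outside[of x c d n] bump_outside[of x s t n] by (auto simp: \<psi>_def)
    have \<psi>i: "\<psi> integrable_on {a..b}" for a b by (rule integrable_continuous_interval[OF \<psi>c])
    have Iext: "integral {a'..b'} (bump a b n) = I a b n" if "a' \<le> a" "b \<le> b'" for a b a' b'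
      unfolding I_def using that by (intro integral_extend bump_outside) auto
    have tot: "integral {a'..b'} \<psi> = 0" if "a' \<le> l" "r \<le> b'" for a' b'
    proof -
      have "integral {a'..b'} \<psi> = I s t n * integral {a'..b'} (bump c d n) - I c d n * integral {a'..b'} (bump s t n)"
        unfolding \<psi>_def
        by (subst integral_diff) (auto intro!: integrable_continuous_interval continuous_intros bump_continuous)
      also have "integral {a'..b'} (bump c d n) = I c d n" using that lr by (intro Iext) auto
      also have "integral {a'..b'} (bump s t n) = I s t n" using that lr by (intro Iext) auto
      finally show ?thesis by simp
    qed
    have \<phi>0: "\<phi> x = 0" if "x \<notin> {l..r}" for x
    proof (cases "x < l")
      case True
      have "integral {l - 1..x} \<psi> = integral {l - 1..x} (\<lambda>x. 0)"
        by (rule integral_cong) (use \<psi>0 True in auto)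
      then show ?thesis by (simp add: \<phi>_def)
    next
      case False
      then show ?thesis unfolding \<phi>_def using that by (intro tot) auto
    qed
    have d: "(\<phi> has_real_derivative \<psi> x) (at x)" for x
    proof (cases "x < l")
      case True
      have "((\<lambda>x. 0) has_real_derivative 0) (at x)" by simp
      then have "(\<phi> has_real_derivative 0) (at x)"
        by (rule has_field_derivative_transform_within_open[of _ _ _ "{..<l}"]) (use True \<phi>0 in auto)
      then show ?thesis using \<psi>0 True by simp
    next
      case False
      have "(\<phi> has_vector_derivative \<psi> x) (at x within {l - 1..x + 1})"
        unfolding \<phi>_def by (rule integral_has_vector_derivative[OF \<psi>c]) (use False in auto)
      moreover have "at x within {l - 1..x + 1} = at x"
        using False by (intro at_within_interior) auto
      ultimately show ?thesis by (simp add: has_real_derivative_iff_has_vector_derivative)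
    qed
    have sm: "(deriv ^^ m) \<psi> field_differentiable (at x)" for m x
    proof -
      have "\<exists>f g. bump_span e c d f \<and> bump_span e s t g \<and> (deriv ^^ m) \<psi> = (\<lambda>x. I s t n * f x - I c d n * g x)" for m
      proof (induction m)
        case 0
        show ?case unfolding \<psi>_def e_def using bump_in_span[of n] by auto
      next
        case (Suc m)
        then obtain f g where fg: "bump_span e c d f" "bump_span e s t g" "(deriv ^^ m) \<psi> = (\<lambda>x. I s t n * f x - I c d n * g x)"
          by blast
        obtain f' g' where f': "bump_span e c d f'" "\<And>x. (f has_real_derivative f' x) (at x)"
          and g': "bump_span e s t g'" "\<And>x. (g has_real_derivative g' x) (at x)"
          using bump_span_derivative[OF e fg(1)] bump_span_derivative[OF e fg(2)] by blast
        have "((deriv ^^ m) \<psi> has_real_derivative (I s t n * f' x - I c d n * g' x)) (at x)" for x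
          unfolding fg(3) by (intro DERIV_diff DERIV_cmult f' g')
        from DERIV_imp_deriv[OF this] have "(deriv ^^ Suc m) \<psi> = (\<lambda>x. I s t n * f' x - I c d n * g' x)"
          by (simp add: fun_eq_iff)
        with f' g' show ?case by blast
      qed
      then obtain f g where fg: "bump_span e c d f" "bump_span e s t g" "(deriv ^^ m) \<psi> = (\<lambda>x. I s t n * f x - I c d n * g x)"
        by blast
      obtain f' g' where f': "\<And>x. (f has_real_derivative f' x) (at x)"
        and g': "\<And>x. (g has_real_derivative g' x) (at x)"
        using bump_span_derivative[OF e fg(1)] bump_span_derivative[OF e fg(2)] by blast
      show ?thesis unfolding fg(3) field_differentiable_def
        by (rule exI[of _ "I s t n * f' x - I c d n * g' x"]) (intro DERIV_diff DERIV_cmult f' g')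
    qed
    have t\<phi>: "test_function S \<phi>"
      by (rule test_functionI_derivative[OF d sm \<phi>0 S[OF lr(1,2)]])
    have d\<phi>: "deriv \<phi> = \<psi>" using DERIV_imp_deriv[OF d] by (simp add: fun_eq_iff)
    have ai: "(\<lambda>x. of_real (bump a b n x) * F x) integrable_on {l..r}" for a b
      using absolutely_integrable_mult_continuous[OF bump_continuous F[OF lr(1,2)]] set_lebesgue_integral_eq_integral(1) by blast
    have "0 = integral {l..r} (\<lambda>x. of_real (\<psi> x) * F x)"
      using test[OF t\<phi> lr(1,2) \<phi>0] by (simp add: d\<phi>)
    also have "\<dots> = integral {l..r} (\<lambda>x. of_real (I s t n) * (of_real (bump c d n x) * F x) - of_real (I c d n) * (of_real (bump s t n x) * F x))"
      by (simp add: \<psi>_def algebra_simps)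
    also have "\<dots> = of_real (I s t n) * integral {l..r} (\<lambda>x. of_real (bump c d n x) * F x)
        - of_real (I c d n) * integral {l..r} (\<lambda>x. of_real (bump s t n x) * F x)"
      using ai by (subst integral_diff) (auto intro!: integrable_on_mult_right)
    also have "integral {l..r} (\<lambda>x. of_real (bump c d n x) * F x) = integral {c..d} (\<lambda>x. of_real (bump c d n x) * F x)"
      using lr bump_outside[of _ c d n] by (intro integral_extend) auto
    also have "integral {l..r} (\<lambda>x. of_real (bump s t n x) * F x) = integral {s..t} (\<lambda>x. of_real (bump s t n x) * F x)"
      using lr bump_outside[of _ s t n] by (intro integral_extend) auto
    finally show ?thesis by simp
  qed
  have Ilim: "(\<lambda>n. complex_of_real (I a b n)) \<longlonglongrightarrow> of_real (b - a)" if "a \<le> b" for a b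
  proof -
    have "integral {a..b} (\<lambda>x. complex_of_real (bump a b n x) * 1) = of_real (I a b n)" for n
    proof -
      have "(bump a b n has_integral I a b n) {a..b}"
        unfolding I_def by (intro integrable_integral integrable_continuous_interval bump_continuous)
      from has_integral_linear[OF this bounded_linear_of_real]
      have "((\<lambda>x. complex_of_real (bump a b n x)) has_integral of_real (I a b n)) {a..b}" by (simp add: o_def)
      then show ?thesis by (simp add: integral_unique)
    qed
    moreover have "integral {a..b} (\<lambda>x. 1 :: complex) = of_real (b - a)"
      using that by (simp add: scaleR_conv_of_real)
    moreover have "(\<lambda>x. 1 :: complex) absolutely_integrable_on {a..b}"
      by (intro absolutely_integrable_continuous_real continuous_on_const)
    ultimately show ?thesis
      using integral_bump_tendsto[where G = "\<lambda>x. 1" and c = a and d = b] by simp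
  qed
  \<comment> \<open>In the limit the bumps become indicators and their masses the lengths of the
    intervals.\<close>
  have "(\<lambda>n. of_real (I s t n) * integral {c..d} (\<lambda>x. of_real (bump c d n x) * F x)) \<longlonglongrightarrow> of_real (t - s) * integral {c..d} F"
    using cd st by (intro tendsto_mult Ilim integral_bump_tendsto F) auto
  moreover have "(\<lambda>n. of_real (I c d n) * integral {s..t} (\<lambda>x. of_real (bump s t n x) * F x)) \<longlonglongrightarrow> of_real (d - c) * integral {s..t} F"
    using cd st by (intro tendsto_mult Ilim integral_bump_tendsto F) auto
  ultimately show ?thesis unfolding eqn using LIMSEQ_unique by blast
qed

section \<open>Weak derivatives\<close>

lemma halfline_AE_I_compact:
  assumes "\<And>c d. 0 < c \<Longrightarrow> c \<le> d \<Longrightarrow> AE x in lebesgue_on {c..d}. P x"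
  shows "AE x in halfline. P x"
proof -
  have *: "AE x in lebesgue. x \<in> {1 / real (Suc n)..real (Suc n)} \<longrightarrow> P x" for n
  proof -
    have "1 / real (Suc n) \<le> 1 / 1" by (rule divide_left_mono) auto
    also have "\<dots> \<le> real (Suc n)" by simp
    finally have "1 / real (Suc n) \<le> real (Suc n)" .
    then show ?thesis
      using assms[of "1 / real (Suc n)" "real (Suc n)"] AE_restrict_space_iff[of "{1 / real (Suc n)..real (Suc n)}" lebesgue P]
      by simp
  qed
  have "AE x in lebesgue. \<forall>n. x \<in> {1 / real (Suc n)..real (Suc n)} \<longrightarrow> P x"
    unfolding AE_all_countable using * by blast
  then have "AE x in lebesgue. 0 < x \<longrightarrow> P x"
  proof (rule eventually_mono, intro impI)
    fix x :: real assume x: "\<forall>n. x \<in> {1 / real (Suc n)..real (Suc n)} \<longrightarrow> P x" and "0 < x"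
    obtain n where n: "x \<le> real n" using real_arch_simple by blast
    obtain m where m: "1 / real (Suc m) < x" using nat_approx_posE[OF \<open>0 < x\<close>] by (auto simp: inverse_eq_divide)
    have "1 / real (Suc (max m n)) \<le> 1 / real (Suc m)" by (intro divide_left_mono) auto
    then have "x \<in> {1 / real (Suc (max m n))..real (Suc (max m n))}" using n m by auto
    then show "P x" using x by blast
  qed
  then show ?thesis by (simp add: halfline_AE_iff)
qed

lemma LINT_test_function:
  fixes f :: "real \<Rightarrow> complex"
  assumes S: "S \<in> sets lebesgue" and lr: "{l..r} \<subseteq> S" and f: "f absolutely_integrable_on {l..r}"
    and \<phi>: "continuous_on {l..r} \<phi>" "\<And>x. x \<notin> {l..r} \<Longrightarrow> \<phi> x = 0"
  shows "(LINT x|lebesgue_on S. of_real (\<phi> x) * f x) = integral {l..r} (\<lambda>x. of_real (\<phi> x) * f x)"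
proof -
  have "(LINT x|lebesgue_on S. of_real (\<phi> x) * f x) = (LINT x|lebesgue. indicator S x *\<^sub>R (of_real (\<phi> x) * f x))"
    by (rule integral_restrict_space) (use S in auto)
  also have "\<dots> = (LINT x:{l..r}|lebesgue. of_real (\<phi> x) * f x)"
    unfolding set_lebesgue_integral_def
    by (rule Bochner_Integration.integral_cong) (use lr \<phi>(2) in \<open>auto simp: indicator_def\<close>)
  also have "\<dots> = integral {l..r} (\<lambda>x. of_real (\<phi> x) * f x)"
    by (rule set_lebesgue_integral_eq_integral(2)[OF absolutely_integrable_mult_continuous[OF \<phi>(1) f]])
  finally show ?thesis .
qed

lemma test_function_support_Icc:
  assumes "test_function S \<phi>" "S \<noteq> {}" and S: "\<And>c d. c \<in> S \<Longrightarrow> d \<in> S \<Longrightarrow> {c..d} \<subseteq> S"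
  obtains l r where "l \<in> S" "r \<in> S" "l \<le> r" "\<And>x. x \<notin> {l..r} \<Longrightarrow> \<phi> x = 0"
proof -
  obtain K where K: "compact K" "K \<subseteq> S" "\<And>x. x \<notin> K \<Longrightarrow> \<phi> x = 0"
    using assms(1) unfolding test_function_def by blast
  show thesis
  proof (cases "K = {}")
    case True
    obtain s where "s \<in> S" using assms(2) by blast
    then show thesis using that[of s s] K True by auto
  next
    case False
    obtain l r where "l \<in> K" "r \<in> K" "\<And>x. x \<in> K \<Longrightarrow> l \<le> x" "\<And>x. x \<in> K \<Longrightarrow> x \<le> r"
      using compact_attains_inf[OF K(1) False] compact_attains_sup[OF K(1) False] by blast
    then show thesis using K that[of l r] by auto
  qed
qed

text \<open>\<open>g\<close> is integrable up to 0, so its primitive from 0 is available. The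
  difference of f and this primitive has weak derivative zero, and by \<open>du_bois_reymond\<close>
  its integral over an interval is proportional to the length. The formula reaches x = 0 and thereby
  provides a boundary value.\<close>

lemma weak_derivative_L2:
  assumes f: "f \<in> L2" and g: "g \<in> L2"
    and weak: "\<And>\<phi>. test_function {0<..} \<phi> \<Longrightarrow>
      (LINT x|halfline. of_real (deriv \<phi> x) * f x) = - (LINT x|halfline. of_real (\<phi> x) * g x)"
  shows "\<exists>C. AE x in halfline. f x = C + integral {0..x} g"
proof -
  define G where "G = (\<lambda>x. integral {0..x} g)"
  have abs: "h absolutely_integrable_on {c..d}" if "h \<in> L2" "0 \<le> c" for h c d
    by (rule set_integrable_subset[OF L2_absolutely_integrable[OF that(1), of d]]) (use that in auto)
  have Gc: "continuous_on {c..d} G" if "0 \<le> c" for c d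
    unfolding G_def by (rule continuous_on_subset[OF indefinite_integral_continuous_1[OF L2_integrable_on[OF g, of d]]])
      (use that in auto)
  have Ga: "G absolutely_integrable_on {c..d}" if "0 \<le> c" for c d
    by (rule absolutely_integrable_continuous_real[OF Gc[OF that]])
  define F where "F = (\<lambda>x. f x - G x)"
  have Fa: "F absolutely_integrable_on {c..d}" if "0 \<le> c" for c d
    unfolding F_def by (intro set_integral_diff(1) abs Ga f that)
  have test: "integral {l..r} (\<lambda>x. of_real (deriv \<phi> x) * F x) = 0"
    if t: "test_function {0<..} \<phi>" and lr: "l \<in> {0<..}" "r \<in> {0<..}" and z: "\<And>x. x \<notin> {l..r} \<Longrightarrow> \<phi> x = 0" for \<phi> l r
  proof (cases "l \<le> r")
    case True
    \<comment> \<open>A slightly larger interval, at whose end points \<phi> vanishes.\<close>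
    define l' where "l' = l / 2"
    define r' where "r' = r + 1"
    have l': "0 < l'" "l' < l" "l' \<le> r'" "r < r'" using lr True by (auto simp: l'_def r'_def)
    have z': "deriv \<phi> x = 0" if "x \<notin> {l..r}" for x
      by (rule deriv_eq_0_outside[OF _ _ that]) (use z in auto)
    note t' = test_function_deriv[OF t]
    have L: "(LINT x|halfline. of_real (deriv \<phi> x) * f x) = integral {l..r} (\<lambda>x. of_real (deriv \<phi> x) * f x)"
      using lr by (intro LINT_test_function abs f test_function_continuous[OF t'] z') auto
    have R: "(LINT x|halfline. of_real (\<phi> x) * g x) = integral {l'..r'} (\<lambda>x. of_real (\<phi> x) * g x)"
      using l' by (intro LINT_test_function abs g test_function_continuous[OF t] z) auto
    have "((\<lambda>x. of_real (\<phi> x) * g x) has_integral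
        (of_real (\<phi> r') * G r' - of_real (\<phi> l') * G l' - integral {l'..r'} (\<lambda>x. of_real (deriv \<phi> x) * G x))) {l'..r'}"
    proof (rule integration_by_parts_ac[OF l'(3) abs[OF g]])
      show "G x = G l' + integral {l'..x} g" if "x \<in> {l'..r'}" for x
        unfolding G_def using l' that
        by (intro Henstock_Kurzweil_Integration.integral_combine[symmetric] L2_integrable_on g) auto
      show "((\<lambda>x. complex_of_real (\<phi> x)) has_vector_derivative of_real (deriv \<phi> x)) (at x within {l'..r'})" for x
        by (rule has_vector_derivative_of_real[OF DERIV_subset[OF test_function_derivative[OF t]]]) simp
      show "continuous_on {l'..r'} (\<lambda>x. complex_of_real (deriv \<phi> x))"
        by (intro continuous_on_of_real test_function_continuous[OF t'])
    qed (use l' in auto)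
    moreover have "\<phi> r' = 0" "\<phi> l' = 0" using z l' by auto
    ultimately have "integral {l'..r'} (\<lambda>x. of_real (\<phi> x) * g x) = - integral {l'..r'} (\<lambda>x. of_real (deriv \<phi> x) * G x)"
      by (simp add: integral_unique)
    also have "integral {l'..r'} (\<lambda>x. of_real (deriv \<phi> x) * G x) = integral {l..r} (\<lambda>x. of_real (deriv \<phi> x) * G x)"
      using l' z' by (intro integral_extend) auto
    finally have "integral {l..r} (\<lambda>x. of_real (deriv \<phi> x) * f x) = integral {l..r} (\<lambda>x. of_real (deriv \<phi> x) * G x)"
      using weak[OF t] L R by simp
    moreover have "(\<lambda>x. of_real (deriv \<phi> x) * h x) integrable_on {l..r}" if "h absolutely_integrable_on {l..r}" for h :: "real \<Rightarrow> complex"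
      using absolutely_integrable_mult_continuous[OF test_function_continuous[OF t'] that] set_lebesgue_integral_eq_integral(1) by blast
    ultimately show ?thesis
      unfolding F_def right_diff_distrib using abs[OF f, of l r] Ga[of l r] lr by (subst integral_diff) auto
  qed simp
  define C where "C = integral {1..2} F"
  have "AE x in halfline. F x - C = 0"
  proof (rule halfline_AE_I_compact, rule AE_zero_of_integrals_zero)
    fix c d :: real assume cd: "0 < c" "c \<le> d"
    show "(\<lambda>x. F x - C) absolutely_integrable_on {c..d}"
      using cd by (intro set_integral_diff(1) Fa absolutely_integrable_continuous_real continuous_on_const) auto
    fix a b assume ab: "c \<le> a" "a \<le> b" "b \<le> d"
    have "of_real (2 - 1) * integral {a..b} F = of_real (b - a) * integral {1..2} F"
      by (rule du_bois_reymond[where S = "{0<..}", OF _ _ test]) (use ab cd Fa in auto)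
    moreover have "F integrable_on {a..b}" using Fa[of a b] ab cd set_lebesgue_integral_eq_integral(1) by fastforce
    ultimately show "integral {a..b} (\<lambda>x. F x - C) = 0"
      using ab by (subst integral_diff) (auto simp: C_def scaleR_conv_of_real)
  qed
  then have "AE x in halfline. f x = C + integral {0..x} g"
    by (rule eventually_mono) (auto simp: F_def G_def algebra_simps)
  then show ?thesis by blast
qed

text \<open>This makes the choice in \<open>weak_deriv\<close> harmless: the norms in which it
  occurs do not depend on it.\<close>

lemma weak_derivative_AE_unique:
  assumes "has_weak_deriv f g" "has_weak_deriv f g'"
  shows "AE x in halfline. g x = g' x"
proof -
  have loc: "h absolutely_integrable_on {c..d}" if "locally_integrable h" "0 < c" for h c d
  proof -
    have "compact {c..d} \<and> {c..d} \<subseteq> {0<..}" using that(2) by auto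
    then show ?thesis using that(1) unfolding locally_integrable_def by blast
  qed
  have li: "locally_integrable g" "locally_integrable g'" using assms by (auto simp: has_weak_deriv_def)
  have eq: "(LINT x|halfline. of_real (\<phi> x) * g x) = (LINT x|halfline. of_real (\<phi> x) * g' x)"
    if "test_function {0<..} \<phi>" for \<phi>
  proof -
    have "- (LINT x|halfline. of_real (\<phi> x) * g x) = - (LINT x|halfline. of_real (\<phi> x) * g' x)"
      using assms that unfolding has_weak_deriv_def by metis
    then show ?thesis by simp
  qed
  have "AE x in halfline. g x - g' x = 0"
  proof (rule halfline_AE_I_compact, rule AE_zero_of_integrals_zero)
    fix c d :: real assume cd: "0 < c" "c \<le> d"
    show "(\<lambda>x. g x - g' x) absolutely_integrable_on {c..d}"
      by (intro set_integral_diff(1) loc li cd)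
    fix a b assume ab: "c \<le> a" "a \<le> b" "b \<le> d"
    have ga: "g absolutely_integrable_on {a..b}" "g' absolutely_integrable_on {a..b}"
      using ab cd by (auto intro: loc li)
    show "integral {a..b} (\<lambda>x. g x - g' x) = 0"
    proof (rule integral_zero_of_test[where S = "{0<..}"])
      show "(\<lambda>x. g x - g' x) absolutely_integrable_on {a..b}" by (intro set_integral_diff(1) ga)
      fix \<phi> assume t: "test_function {0<..} \<phi>" and z: "\<And>x. x \<notin> {a..b} \<Longrightarrow> \<phi> x = 0"
      have L: "(LINT x|halfline. of_real (\<phi> x) * h x) = integral {a..b} (\<lambda>x. of_real (\<phi> x) * h x)"
        if "h absolutely_integrable_on {a..b}" for h :: "real \<Rightarrow> complex"
        by (rule LINT_test_function[OF _ _ that test_function_continuous[OF t] z]) (use ab cd in auto)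
      have i: "(\<lambda>x. of_real (\<phi> x) * h x) integrable_on {a..b}" if "h absolutely_integrable_on {a..b}" for h :: "real \<Rightarrow> complex"
        using absolutely_integrable_mult_continuous[OF test_function_continuous[OF t] that] set_lebesgue_integral_eq_integral(1) by blast
      show "integral {a..b} (\<lambda>x. of_real (\<phi> x) * (g x - g' x)) = 0"
        unfolding right_diff_distrib
        by (subst integral_diff) (use eq[OF t] L[OF ga(1)] L[OF ga(2)] i[OF ga(1)] i[OF ga(2)] in auto)
    qed (use ab cd in auto)
  qed auto
  then show ?thesis by simp
qed

text \<open>Test functions live on the open interval, so \<open>f\<close> minus the primitive of
  \<open>g\<close> is first shown to be constant there. Continuity extends this to the end points,
  where the initial value is read off.\<close>

lemma weak_derivative_continuous:
  fixes f g :: "real \<Rightarrow> complex"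
  assumes T: "T > 0" and f: "continuous_on {0..T} f" and g: "continuous_on {0..T} g"
    and weak: "\<And>\<psi>. test_function {0<..<T} \<psi> \<Longrightarrow>
      integral {0..T} (\<lambda>t. of_real (deriv \<psi> t) * f t) = - integral {0..T} (\<lambda>t. of_real (\<psi> t) * g t)"
    and t: "t \<in> {0..T}"
  shows "(g has_integral (f t - f 0)) {0..t}"
proof -
  define G where "G = (\<lambda>x. integral {0..x} g)"
  have gi: "g integrable_on {0..T}" by (rule integrable_continuous_interval[OF g])
  have Gc: "continuous_on {0..T} G" unfolding G_def by (rule indefinite_integral_continuous_1[OF gi])
  define F where "F = (\<lambda>x. f x - G x)"
  have Fc: "continuous_on {0..T} F" unfolding F_def by (intro continuous_intros f Gc)
  have Fa: "F absolutely_integrable_on {c..d}" if "c \<in> {0<..<T}" "d \<in> {0<..<T}" for c d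
    by (rule absolutely_integrable_continuous_real, rule continuous_on_subset[OF Fc]) (use that in auto)
  have test: "integral {l..r} (\<lambda>x. of_real (deriv \<phi> x) * F x) = 0"
    if tf: "test_function {0<..<T} \<phi>" and lr: "l \<in> {0<..<T}" "r \<in> {0<..<T}" and z: "\<And>x. x \<notin> {l..r} \<Longrightarrow> \<phi> x = 0" for \<phi> l r
  proof -
    have z': "deriv \<phi> x = 0" if "x \<notin> {l..r}" for x
      by (rule deriv_eq_0_outside[OF _ _ that]) (use z in auto)
    note t' = test_function_deriv[OF tf]
    have "((\<lambda>x. of_real (\<phi> x) * g x) has_integral
        (of_real (\<phi> T) * G T - of_real (\<phi> 0) * G 0 - integral {0..T} (\<lambda>x. of_real (deriv \<phi> x) * G x))) {0..T}"
    proof (rule integration_by_parts_ac)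
      show "g absolutely_integrable_on {0..T}" by (rule absolutely_integrable_continuous_real[OF g])
      show "G x = G 0 + integral {0..x} g" for x by (simp add: G_def)
      show "((\<lambda>x. complex_of_real (\<phi> x)) has_vector_derivative of_real (deriv \<phi> x)) (at x within {0..T})" for x
        by (rule has_vector_derivative_of_real[OF DERIV_subset[OF test_function_derivative[OF tf]]]) simp
      show "continuous_on {0..T} (\<lambda>x. complex_of_real (deriv \<phi> x))"
        by (intro continuous_on_of_real test_function_continuous[OF t'])
    qed (use T in auto)
    moreover have "\<phi> T = 0" "\<phi> 0 = 0" using z lr by auto
    ultimately have "integral {0..T} (\<lambda>x. of_real (\<phi> x) * g x) = - integral {0..T} (\<lambda>x. of_real (deriv \<phi> x) * G x)"
      by (simp add: integral_unique)
    with weak[OF tf] have "integral {0..T} (\<lambda>x. of_real (deriv \<phi> x) * f x) = integral {0..T} (\<lambda>x. of_real (deriv \<phi> x) * G x)" by simp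
    then have "integral {0..T} (\<lambda>x. of_real (deriv \<phi> x) * F x) = 0"
      unfolding F_def right_diff_distrib
      by (subst integral_diff) (auto intro!: integrable_continuous_interval continuous_intros test_function_continuous[OF t'] f Gc)
    moreover have "integral {0..T} (\<lambda>x. of_real (deriv \<phi> x) * F x) = integral {l..r} (\<lambda>x. of_real (deriv \<phi> x) * F x)"
      using lr z' by (intro integral_extend) auto
    ultimately show ?thesis by simp
  qed
  define s where "s = T / 3"
  define C where "C = integral {s..2 * s} F / of_real s"
  have s: "s > 0" "s \<in> {0<..<T}" "2 * s \<in> {0<..<T}" using T by (auto simp: s_def)
  have FC: "F x = C" if x: "x \<in> {0<..<T}" for x
  proof -
    define a where "a = x / 2"
    have a: "0 < a" "a < x" using x by (auto simp: a_def)
    \<comment> \<open>By \<open>du_bois_reymond\<close> the integral of F over [a,y] is linear in y;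
      differentiating at x will give F x = C.\<close>
    have aC: "integral {a..y} F = of_real (y - a) * C" if "y \<in> {a..<T}" for y
    proof -
      have "of_real (2 * s - s) * integral {a..y} F = of_real (y - a) * integral {s..2 * s} F"
        by (rule du_bois_reymond[where S = "{0<..<T}", OF _ Fa test]) (use that a x s in auto)
      then show ?thesis using s(1) by (simp add: C_def field_simps)
    qed
    define b where "b = (x + T) / 2"
    have b: "x < b" "b < T" using x by (auto simp: b_def)
    have Fab: "continuous_on {a..b} F" by (rule continuous_on_subset[OF Fc]) (use a b in auto)
    have "((\<lambda>y. integral {a..y} F) has_vector_derivative F x) (at x within {a..b})"
      by (rule integral_has_vector_derivative[OF Fab]) (use a b in auto)
    moreover have "((\<lambda>y. integral {a..y} F) has_vector_derivative C) (at x within {a..b})"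
    proof (rule has_vector_derivative_transform)
      have "((\<lambda>y. (y - a) *\<^sub>R C) has_vector_derivative C) (at x within {a..b})"
        by (auto intro!: derivative_eq_intros simp: has_vector_derivative_def)
      then show "((\<lambda>y. of_real (y - a) * C) has_vector_derivative C) (at x within {a..b})"
        by (simp add: scaleR_conv_of_real)
    qed (use a b aC in auto)
    ultimately show ?thesis
      using a b by (intro vector_derivative_unique_within_closed_interval[of a b x]) auto
  qed
  have FC': "F x = C" if "x \<in> {0..T}" for x
  proof (rule continuous_constant_on_closure[where S = "{0<..<T}"])
    have cl: "closure {0<..<T} = {0..T}" using T by simp
    show "continuous_on (closure {0<..<T}) F" unfolding cl by (rule Fc)
    show "x \<in> closure {0<..<T}" unfolding cl by (rule that)
  qed (rule FC)
  have "F t = F 0" using FC'[OF t] FC'[of 0] T by simp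
  then have "integral {0..t} g = f t - f 0" by (simp add: F_def G_def algebra_simps)
  moreover have "g integrable_on {0..t}"
    by (rule integrable_continuous_interval, rule continuous_on_subset[OF g]) (use t in auto)
  ultimately show ?thesis by (metis integrable_integral)
qed

subsection \<open>The energy space and the Sobolev spaces\<close>

lemma halfline_measurable_AE:
  fixes f g :: "real \<Rightarrow> complex"
  assumes "f \<in> borel_measurable halfline" and ae: "AE x in halfline. f x = g x"
  shows "g \<in> borel_measurable halfline"
proof -
  have "(\<lambda>x. if x \<in> {0<..} then f x else 0) \<in> borel_measurable lebesgue"
    by (rule borel_measurable_if_I[OF assms(1)]) simp
  then have "(\<lambda>x. if x \<in> {0<..} then g x else 0) \<in> borel_measurable lebesgue"
    by (rule borel_measurable_AE) (use ae[unfolded halfline_AE_iff] in \<open>rule eventually_mono, auto\<close>)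
  then show ?thesis by (rule borel_measurable_if_D)
qed

lemma L2_cong:
  assumes "f \<in> L2" "AE x in halfline. f x = g x" shows "g \<in> L2"
  by (rule L2_AE_cong[OF assms halfline_measurable_AE[OF L2_measurable[OF assms(1)] assms(2)]])

lemma nsq_AE_cong:
  assumes "f \<in> L2" "AE x in halfline. f x = g x" shows "nsq f = nsq g"
  by (rule nsq_cong[OF assms(2,1) L2_cong[OF assms]])

lemma L2_locally_integrable:
  assumes "f \<in> L2" shows "locally_integrable f"
  unfolding locally_integrable_def
proof (intro allI impI)
  fix K :: "real set" assume K: "compact K \<and> K \<subseteq> {0<..}"
  then obtain b where "K \<subseteq> {-b..b}"
    using bounded_subset_cbox_symmetric[OF compact_imp_bounded[of K]] by (metis box_real(2))
  then have "K \<subseteq> {0..b}" using K by fastforce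
  then show "set_integrable lebesgue K f"
    using K by (intro set_integrable_subset[OF L2_absolutely_integrable[OF assms, of b]]) (auto simp: lmeasurable_compact fmeasurableD)
qed

lemma has_weak_deriv_AE_cong:
  assumes f: "f \<in> L2" "g \<in> L2" "has_weak_deriv f g" and ae: "AE x in halfline. f x = f' x"
  shows "has_weak_deriv f' g"
  unfolding has_weak_deriv_def
proof (intro conjI allI impI)
  show "locally_integrable f'" by (rule L2_locally_integrable[OF L2_cong[OF f(1) ae]])
  show "locally_integrable g" by (rule L2_locally_integrable[OF f(2)])
  fix \<phi> assume t: "test_function {0<..} \<phi>"
  have m: "(\<lambda>x. complex_of_real (deriv \<phi> x)) \<in> borel_measurable halfline"
    by (rule continuous_imp_measurable_on_sets_lebesgue) (auto intro!: continuous_on_of_real test_function_continuous[OF test_function_deriv[OF t]])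
  have "(LINT x|halfline. of_real (deriv \<phi> x) * f' x) = (LINT x|halfline. of_real (deriv \<phi> x) * f x)"
  proof (rule integral_cong_AE)
    show "AE x in halfline. of_real (deriv \<phi> x) * f' x = of_real (deriv \<phi> x) * f x"
      using ae by eventually_elim simp
  qed (intro borel_measurable_times m L2_measurable f L2_cong[OF f(1) ae])+
  then show "(LINT x|halfline. of_real (deriv \<phi> x) * f' x) = - (LINT x|halfline. of_real (\<phi> x) * g x)"
    using f(3) t by (simp add: has_weak_deriv_def)
qed

lemma has_weak_deriv_of_integral:
  assumes f: "f \<in> L2" and g: "g \<in> L2" and fg: "\<And>x. x \<ge> 0 \<Longrightarrow> f x = f 0 + integral {0..x} g"
  shows "has_weak_deriv f g"
  unfolding has_weak_deriv_def
proof (intro conjI allI impI L2_locally_integrable f g)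
  fix \<phi> assume t: "test_function {0<..} \<phi>"
  note t' = test_function_deriv[OF t]
  obtain l r where lr: "l > 0" "l \<le> r" "\<And>x. x \<notin> {l..r} \<Longrightarrow> \<phi> x = 0"
    using test_function_support_Icc[OF t] by (auto simp: subset_iff)
  define l' where "l' = l / 2"
  define r' where "r' = r + 1"
  have l': "0 < l'" "l' < l" "l' \<le> r'" "r < r'" using lr by (auto simp: l'_def r'_def)
  have z': "deriv \<phi> x = 0" if "x \<notin> {l'..r'}" for x
    by (rule deriv_eq_0_outside[OF _ _ that]) (use lr l' in auto)
  have abs: "h absolutely_integrable_on {l'..r'}" if "h \<in> L2" for h
    by (rule set_integrable_subset[OF L2_absolutely_integrable[OF that, of r']]) (use l' in auto)
  have L: "(LINT x|halfline. of_real (deriv \<phi> x) * f x) = integral {l'..r'} (\<lambda>x. of_real (deriv \<phi> x) * f x)"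
    by (rule LINT_test_function[OF _ _ abs[OF f] test_function_continuous[OF t'] z']) (use l' in auto)
  have R: "(LINT x|halfline. of_real (\<phi> x) * g x) = integral {l'..r'} (\<lambda>x. of_real (\<phi> x) * g x)"
    by (rule LINT_test_function[OF _ _ abs[OF g] test_function_continuous[OF t] lr(3)]) (use l' in auto)
  have "((\<lambda>x. of_real (\<phi> x) * g x) has_integral
      (of_real (\<phi> r') * f r' - of_real (\<phi> l') * f l' - integral {l'..r'} (\<lambda>x. of_real (deriv \<phi> x) * f x))) {l'..r'}"
  proof (rule integration_by_parts_ac[OF l'(3) abs[OF g]])
    show "f x = f l' + integral {l'..x} g" if x: "x \<in> {l'..r'}" for x
    proof -
      have "integral {0..l'} g + integral {l'..x} g = integral {0..x} g"
        using l' x by (intro Henstock_Kurzweil_Integration.integral_combine L2_integrable_on g) auto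
      then show ?thesis using fg[of x] fg[of l'] l' x by simp
    qed
    show "((\<lambda>x. complex_of_real (\<phi> x)) has_vector_derivative of_real (deriv \<phi> x)) (at x within {l'..r'})" for x
      by (rule has_vector_derivative_of_real[OF DERIV_subset[OF test_function_derivative[OF t]]]) simp
    show "continuous_on {l'..r'} (\<lambda>x. complex_of_real (deriv \<phi> x))"
      by (intro continuous_on_of_real test_function_continuous[OF t'])
  qed
  moreover have "\<phi> r' = 0" "\<phi> l' = 0" using lr l' by auto
  ultimately show "(LINT x|halfline. of_real (deriv \<phi> x) * f x) = - (LINT x|halfline. of_real (\<phi> x) * g x)"
    unfolding L R by (simp add: integral_unique)
qed

lemma has_weak_deriv_rep: "has_weak_deriv (rep u) (der u)"
  by (rule has_weak_deriv_of_integral[OF rep_L2 der_L2 rep_eq_integral_der])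

lemma rep_H10_H01: "rep u \<in> H10 \<inter> H01"
  using has_weak_deriv_rep rep_L2 der_L2 rep_H01 by (auto simp: H10_def)

lemma weak_deriv_eq_der:
  assumes "AE x in halfline. rep u x = f x"
  shows "AE x in halfline. der u x = weak_deriv f x"
proof -
  have "has_weak_deriv f (der u)"
    by (rule has_weak_deriv_AE_cong[OF rep_L2 der_L2 has_weak_deriv_rep assms])
  moreover from this have "has_weak_deriv f (weak_deriv f)"
    unfolding weak_deriv_def by (rule someI[of "has_weak_deriv f"])
  ultimately show ?thesis by (rule weak_derivative_AE_unique)
qed

lemma H10_norm_eq:
  assumes "AE x in halfline. rep u x = f x"
  shows "H10_norm f = sqrt (nsq (rep u)) + sqrt (nsq (der u))"
  using nsq_AE_cong[OF rep_L2 assms] nsq_AE_cong[OF der_L2 weak_deriv_eq_der[OF assms]]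
  by (simp add: H10_norm_def L2_norm_eq)

lemma H01_norm_eq:
  assumes ae: "AE x in halfline. rep u x = f x"
  shows "H01_norm f = sqrt (nsq (rep u)) + sqrt (nsq (wrep u))"
proof -
  have "AE x in halfline. wrep u x = of_real x * f x"
    using ae by eventually_elim (simp add: wrep_def)
  then show ?thesis
    using nsq_AE_cong[OF rep_L2 ae] nsq_AE_cong[OF wrep_L2] by (simp add: H01_norm_def L2_norm_eq)
qed

lemma norm_energy_equiv:
  assumes "AE x in halfline. rep u x = f x"
  shows "norm u \<le> H10_norm f + H01_norm f" "H10_norm f + H01_norm f \<le> 4 * norm u"
proof -
  define a b c where "a = sqrt (nsq (rep u))" and "b = sqrt (nsq (der u))" and "c = sqrt (nsq (wrep u))"
  have p: "a \<ge> 0" "b \<ge> 0" "c \<ge> 0" by (auto simp: a_def b_def c_def)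
  have n: "(norm u)\<^sup>2 = b\<^sup>2 + a\<^sup>2 + c\<^sup>2" by (simp add: norm_energy_sq a_def b_def c_def)
  have s: "H10_norm f + H01_norm f = (a + b) + (a + c)"
    by (simp only: H10_norm_eq[OF assms] H01_norm_eq[OF assms] a_def b_def c_def)
  have "(norm u)\<^sup>2 \<le> (a + b + c)\<^sup>2"
    unfolding n using p by (simp add: power2_sum)
  then have "norm u \<le> a + b + c" using p by (meson add_nonneg_nonneg power2_le_imp_le)
  then show "norm u \<le> H10_norm f + H01_norm f" unfolding s using p by linarith
  have "a \<le> norm u" "b \<le> norm u" "c \<le> norm u"
    by (rule power2_le_imp_le; simp add: n)+
  then show "H10_norm f + H01_norm f \<le> 4 * norm u" unfolding s by linarith
qed

lemma energy_of_H10_H01: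
  assumes "f \<in> H10 \<inter> H01"
  shows "\<exists>u. AE x in halfline. rep u x = f x"
proof -
  obtain g where g: "f \<in> L2" "g \<in> L2" "has_weak_deriv f g" using assms by (auto simp: H10_def)
  then obtain C where C: "AE x in halfline. f x = C + integral {0..x} g"
    using weak_derivative_L2[of f g] by (auto simp: has_weak_deriv_def)
  let ?F = "\<lambda>x. C + integral {0..x} g"
  have "AE x in halfline. of_real x * f x = of_real x * ?F x" using C by eventually_elim simp
  moreover have "(\<lambda>x. of_real x * f x) \<in> L2" using assms by (simp add: H01_def)
  ultimately have "(\<lambda>x. of_real x * ?F x) \<in> L2" by (rule L2_cong[rotated])
  then have "?F \<in> H01" using L2_cong[OF g(1) C] by (simp add: H01_def)
  then obtain u where u: "\<And>x. x \<ge> 0 \<Longrightarrow> rep u x = ?F x"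
    using energy_exists[of ?F g] g by auto
  have "AE x in halfline. rep u x = f x"
    using C unfolding halfline_AE_iff by (rule eventually_mono) (use u in auto)
  then show ?thesis by blast
qed

lemma continuous_AE_eq:
  fixes f g :: "real \<Rightarrow> complex"
  assumes f: "continuous_on {0..} f" and g: "continuous_on {0..} g" and ae: "AE x in halfline. f x = g x"
    and x: "x \<ge> 0"
  shows "f x = g x"
proof -
  define d where "d = (\<lambda>x. f x - g x)"
  have d: "continuous_on {0..x + 1} d"
    unfolding d_def by (rule continuous_on_subset[of "{0..}"]) (auto intro!: continuous_intros f g)
  have N: "negligible {y. 0 < y \<and> d y \<noteq> 0}"
    using ae unfolding halfline_AE_iff by (simp add: d_def negligible_iff_null_sets AE_iff_null_sets completion.AE_iff_null_sets)
  have z: "integral {0..y} d = 0" for y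
  proof -
    have "integral {0..y} d = integral {0..y} (\<lambda>x. 0)"
      by (rule integral_spike[of "{0} \<union> {y. 0 < y \<and> d y \<noteq> 0}"]) (use N in auto)
    then show ?thesis by simp
  qed
  have "((\<lambda>y. integral {0..y} d) has_vector_derivative d x) (at x within {0..x + 1})"
    by (rule integral_has_vector_derivative[OF d]) (use x in auto)
  then have "((\<lambda>y. 0) has_vector_derivative d x) (at x within {0..x + 1})" by (simp add: z)
  then have "d x = 0"
    using x by (intro vector_derivative_unique_within_closed_interval[of 0 "x + 1" x "\<lambda>y. 0"]) auto
  then show ?thesis by (simp add: d_def)
qed

lemma cont_rep_eq:
  assumes ae: "AE x in halfline. rep u x = f x" and x: "x \<ge> 0"
  shows "cont_rep f x = rep u x"
proof -
  have "continuous_on {0..} (cont_rep f) \<and> (AE x in halfline. cont_rep f x = f x)"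
    unfolding cont_rep_def by (rule someI[of _ "rep u"]) (use rep_continuous_on ae in auto)
  then have c: "continuous_on {0..} (cont_rep f)" "AE x in halfline. cont_rep f x = f x" by auto
  have "AE x in halfline. cont_rep f x = rep u x" using c(2) ae by eventually_elim simp
  from continuous_AE_eq[OF c(1) rep_continuous_on this x] show ?thesis .
qed

lemma energy_eqI_AE:
  assumes "AE x in halfline. rep u x = rep v x" shows "u = v"
  by (rule energy_eqI) (rule continuous_AE_eq[OF rep_continuous_on rep_continuous_on assms])

text \<open>By \<open>norm_energy_equiv\<close> the two Sobolev norms of a difference are controlled
  by, and control, its norm in \<open>energy\<close>. So continuity stated for arbitrary
  representatives becomes continuity of a curve in a Banach space.\<close>

lemma C_H10_H01_iff:
  assumes ae: "\<And>t. t \<in> {0..T} \<Longrightarrow> AE x in halfline. rep (e t) x = u t x"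
  shows "C_H10_H01 T u \<longleftrightarrow> (\<forall>t\<in>{0..T}. u t \<in> H10 \<inter> H01) \<and> continuous_on {0..T} e"
proof -
  have d: "AE x in halfline. rep (e s - e t) x = u s x - u t x" if "s \<in> {0..T}" "t \<in> {0..T}" for s t
    using ae[OF that(1)] ae[OF that(2)] by eventually_elim simp
  have "((\<lambda>s. H10_norm (\<lambda>x. u s x - u t x) + H01_norm (\<lambda>x. u s x - u t x)) \<longlongrightarrow> 0) (at t within {0..T})
      \<longleftrightarrow> (e \<longlongrightarrow> e t) (at t within {0..T})" (is "?l \<longleftrightarrow> ?r") if t: "t \<in> {0..T}" for t
  proof
    let ?n = "\<lambda>s. H10_norm (\<lambda>x. u s x - u t x) + H01_norm (\<lambda>x. u s x - u t x)"
    assume l: ?l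
    have "((\<lambda>s. e s - e t) \<longlongrightarrow> 0) (at t within {0..T})"
      by (rule Lim_null_comparison[OF _ l]) (use norm_energy_equiv(1)[OF d[OF _ t]] in \<open>auto simp: eventually_at_filter\<close>)
    then show ?r by (rule LIM_zero_cancel)
  next
    let ?n = "\<lambda>s. H10_norm (\<lambda>x. u s x - u t x) + H01_norm (\<lambda>x. u s x - u t x)"
    assume r: ?r
    have "((\<lambda>s. 4 * norm (e s - e t)) \<longlongrightarrow> 4 * norm (e t - e t)) (at t within {0..T})"
      by (intro tendsto_intros r)
    then have r': "((\<lambda>s. 4 * norm (e s - e t)) \<longlongrightarrow> 0) (at t within {0..T})" by simp
    show ?l
    proof (rule Lim_null_comparison[OF _ r'])
      have "norm (?n s) \<le> 4 * norm (e s - e t)" if "s \<in> {0..T}" for s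
        using norm_energy_equiv[OF d[OF that t]] norm_ge_zero[of "e s - e t"] by (simp del: norm_ge_zero)
      then show "\<forall>\<^sub>F s in at t within {0..T}. norm (?n s) \<le> 4 * norm (e s - e t)"
        by (auto simp: eventually_at_filter)
    qed
  qed
  then show ?thesis unfolding C_H10_H01_def continuous_on_def by blast
qed

subsection \<open>Testing in space and averaging in time\<close>

definition tst :: "(real \<Rightarrow> real) \<Rightarrow> energy \<Rightarrow> complex" where
  "tst \<phi> u = (LINT x|halfline. of_real (\<phi> x) * rep u x)"

lemma test_function_L2:
  assumes t: "test_function {0<..} \<phi>" shows "(\<lambda>x. complex_of_real (\<phi> x)) \<in> L2"
proof -
  obtain l r where lr: "l > 0" "l \<le> r" "\<And>x. x \<notin> {l..r} \<Longrightarrow> \<phi> x = 0"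
    using test_function_support_Icc[OF t] by (auto simp: subset_iff)
  have c: "continuous_on A (\<lambda>x. complex_of_real (\<phi> x))" for A
    by (intro continuous_on_of_real test_function_continuous[OF t])
  have "bounded ((\<lambda>x. complex_of_real (\<phi> x)) ` {l..r})"
    by (rule compact_imp_bounded[OF compact_continuous_image[OF c compact_Icc]])
  then obtain C where "C > 0" "\<And>x. x \<in> {l..r} \<Longrightarrow> cmod (\<phi> x) \<le> C" unfolding bounded_pos by blast
  then have C: "cmod (\<phi> x) \<le> C" for x using lr(3)[of x] by (cases "x \<in> {l..r}") auto
  have m: "(\<lambda>x. complex_of_real (\<phi> x)) \<in> borel_measurable halfline"
    by (rule continuous_imp_measurable_on_sets_lebesgue[OF c]) simp
  have "(\<lambda>x. complex_of_real (\<phi> x) * indicator {0<..r} x) \<in> L2"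
    by (rule L2_mult_bounded[OF L2_indicator m C])
  moreover have "complex_of_real (\<phi> x) * indicator {0<..r} x = \<phi> x" for x
    using lr(1) lr(3)[of x] by (cases "x \<in> {l..r}") (auto simp: indicator_def)
  ultimately show ?thesis by simp
qed

lemma tst_eq_pair: "tst \<phi> u = pair (rep u) (\<lambda>x. of_real (\<phi> x))"
  by (simp add: tst_def pair_def mult.commute)

lemma bounded_linear_tst:
  assumes t: "test_function {0<..} \<phi>" shows "bounded_linear (tst \<phi>)"
proof (rule bounded_linear_intro[where K = "sqrt (nsq (\<lambda>x. complex_of_real (\<phi> x)))"])
  note L = test_function_L2[OF t]
  show "tst \<phi> (u + v) = tst \<phi> u + tst \<phi> v" for u v
    unfolding tst_eq_pair rep_add' by (rule pair_add_left[OF rep_L2 rep_L2 L])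
  show "tst \<phi> (r *\<^sub>R u) = r *\<^sub>R tst \<phi> u" for r u
    unfolding tst_eq_pair rep_scaleR' by (rule pair_scaleR_left)
  fix u
  have "(cmod (tst \<phi> u))\<^sup>2 \<le> nsq (rep u) * nsq (\<lambda>x. complex_of_real (\<phi> x))"
    unfolding tst_eq_pair by (rule norm_pair_le[OF rep_L2 L])
  also have "\<dots> \<le> (norm u)\<^sup>2 * nsq (\<lambda>x. complex_of_real (\<phi> x))"
    by (rule mult_right_mono[OF nsq_rep_le nsq_nonneg])
  also have "\<dots> = (norm u * sqrt (nsq (\<lambda>x. complex_of_real (\<phi> x))))\<^sup>2"
    by (simp only: power_mult_distrib real_sqrt_pow2[OF nsq_nonneg])
  finally show "norm (tst \<phi> u) \<le> norm u * sqrt (nsq (\<lambda>x. complex_of_real (\<phi> x)))"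
    by (rule power2_le_imp_le[OF _ mult_nonneg_nonneg[OF norm_ge_zero real_sqrt_ge_zero[OF nsq_nonneg]]])
qed

lemma tst_cmul: "tst \<phi> (cmul c u) = c * tst \<phi> u"
proof -
  have "(\<lambda>x. of_real (\<phi> x) * rep (cmul c u) x) = (\<lambda>x. c * (of_real (\<phi> x) * rep u x))"
    by (rule ext) (simp only: rep_cmul mult.left_commute)
  then show ?thesis by (simp add: tst_def)
qed

lemma tst_AE_cong:
  assumes ae: "AE x in halfline. rep u x = f x" and t: "test_function {0<..} \<phi>"
  shows "(LINT x|halfline. of_real (\<phi> x) * f x) = tst \<phi> u"
  unfolding tst_def
proof (rule integral_cong_AE)
  have m: "(\<lambda>x. complex_of_real (\<phi> x)) \<in> borel_measurable halfline" by (rule L2_measurable[OF test_function_L2[OF t]])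
  show "(\<lambda>x. complex_of_real (\<phi> x) * f x) \<in> borel_measurable halfline"
    by (intro borel_measurable_times m L2_measurable L2_cong[OF rep_L2 ae])
  show "(\<lambda>x. complex_of_real (\<phi> x) * rep u x) \<in> borel_measurable halfline"
    by (intro borel_measurable_times m L2_measurable rep_L2)
  show "AE x in halfline. complex_of_real (\<phi> x) * f x = complex_of_real (\<phi> x) * rep u x"
    using ae by eventually_elim simp
qed

lemma tst_deriv_deriv:
  assumes t: "test_function {0<..} \<phi>"
  shows "tst (deriv (deriv \<phi>)) u = - (LINT x|halfline. of_real (deriv \<phi> x) * der u x)"
  using has_weak_deriv_rep[of u] test_function_deriv[OF t] by (simp add: has_weak_deriv_def tst_def)

lemma tst_twice:
  assumes tw: "twice u u1 v" and t: "test_function {0<..} \<phi>"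
  shows "tst (deriv (deriv \<phi>)) u = tst \<phi> v"
proof -
  note u1 = twice_C1[OF tw]
  have u1i: "u1 x = u1 0 + integral {0..x} (rep v)" if "x \<ge> 0" for x
  proof -
    have "(rep v has_integral (u1 x - u1 0)) {0..x}"
      using tw that by (intro fundamental_theorem_of_calculus has_vector_derivative_within_Icc) (auto simp: twice_def)
    then show ?thesis by (simp add: integral_unique)
  qed
  have "has_weak_deriv u1 (rep v)" by (rule has_weak_deriv_of_integral[OF u1(3) rep_L2 u1i])
  then have "(LINT x|halfline. of_real (deriv \<phi> x) * u1 x) = - tst \<phi> v"
    using t by (simp add: has_weak_deriv_def tst_def)
  moreover have "(LINT x|halfline. of_real (deriv \<phi> x) * der u x) = (LINT x|halfline. of_real (deriv \<phi> x) * u1 x)"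
  proof (rule integral_cong_AE)
    have m: "(\<lambda>x. complex_of_real (deriv \<phi> x)) \<in> borel_measurable halfline"
      by (rule L2_measurable[OF test_function_L2[OF test_function_deriv[OF t]]])
    show "(\<lambda>x. complex_of_real (deriv \<phi> x) * der u x) \<in> borel_measurable halfline"
      by (intro borel_measurable_times m L2_measurable der_L2)
    show "(\<lambda>x. complex_of_real (deriv \<phi> x) * u1 x) \<in> borel_measurable halfline"
      by (intro borel_measurable_times m L2_measurable u1)
    show "AE x in halfline. complex_of_real (deriv \<phi> x) * der u x = complex_of_real (deriv \<phi> x) * u1 x"
      using u1(2) by eventually_elim simp
  qed
  ultimately show ?thesis unfolding tst_deriv_deriv[OF t] by simp
qed

text \<open>The regularity step: a distributional second derivative that is itself an
  \<open>energy\<close> is continuous, so integrating it twice from 0 gives classical derivatives up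
  to the boundary. It is applied to time averages of solutions.\<close>

lemma twice_of_tst:
  assumes eq: "\<And>\<phi>. test_function {0<..} \<phi> \<Longrightarrow> tst (deriv (deriv \<phi>)) u = tst \<phi> v"
  shows "\<exists>u1. twice u u1 v"
proof -
  have "(LINT x|halfline. of_real (deriv \<phi> x) * der u x) = - (LINT x|halfline. of_real (\<phi> x) * rep v x)"
    if t: "test_function {0<..} \<phi>" for \<phi>
    unfolding tst_def[symmetric] eq[OF t, symmetric] tst_deriv_deriv[OF t] by simp
  then obtain C where C: "AE x in halfline. der u x = C + integral {0..x} (rep v)"
    using weak_derivative_L2[OF der_L2 rep_L2] by blast
  define u1 where "u1 = (\<lambda>x. C + integral {0..x} (rep v))"
  have within: "at x within {0..x + 1} = at x within {0..}" if "x \<ge> 0" for x :: real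
    using that by (intro at_within_nhd[of x "{..<x + 1}"]) auto
  have d1: "(u1 has_vector_derivative rep v x) (at x within {0..})" if x: "x \<ge> 0" for x
  proof -
    have "((\<lambda>x. integral {0..x} (rep v)) has_vector_derivative rep v x) (at x within {0..x + 1})"
      by (rule integral_has_vector_derivative[OF continuous_on_subset[OF rep_continuous_on]]) (use x in auto)
    then have "(u1 has_vector_derivative (0 + rep v x)) (at x within {0..x + 1})"
      unfolding u1_def by (intro has_vector_derivative_add has_vector_derivative_const)
    then show ?thesis unfolding within[OF x] by simp
  qed
  have c1: "continuous_on {0..} u1"
    by (rule continuous_on_of_vector_derivative[of _ _ "rep v"]) (use d1 in auto)
  have i1: "rep u x = rep u 0 + integral {0..x} u1" if x: "x \<ge> 0" for x
  proof -
    have "integral {0..x} (der u) = integral {0..x} u1"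
    proof (rule integral_spike[of "{0} \<union> {y. 0 < y \<and> der u y \<noteq> u1 y}"])
      have "negligible {y. 0 < y \<and> der u y \<noteq> u1 y}"
        using C unfolding halfline_AE_iff by (simp add: u1_def negligible_iff_null_sets completion.AE_iff_null_sets)
      then show "negligible ({0} \<union> {y. 0 < y \<and> der u y \<noteq> u1 y})" by simp
    qed auto
    then show ?thesis using rep_eq_integral_der[OF x, of u] by simp
  qed
  have "(rep u has_vector_derivative u1 x) (at x within {0..})" if x: "x \<ge> 0" for x
  proof -
    have "((\<lambda>x. integral {0..x} u1) has_vector_derivative u1 x) (at x within {0..x + 1})"
      by (rule integral_has_vector_derivative[OF continuous_on_subset[OF c1]]) (use x in auto)
    then have "((\<lambda>x. rep u 0 + integral {0..x} u1) has_vector_derivative (0 + u1 x)) (at x within {0..x + 1})"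
      by (intro has_vector_derivative_add has_vector_derivative_const)
    then have "((\<lambda>x. rep u 0 + integral {0..x} u1) has_vector_derivative u1 x) (at x within {0..})"
      unfolding within[OF x] by simp
    then show ?thesis
    proof (rule has_vector_derivative_transform[rotated 2])
      show "rep u y = rep u 0 + integral {0..y} u1" if "y \<in> {0..}" for y
        by (rule i1) (use that in simp)
    qed (use x in simp)
  qed
  then show ?thesis using d1 by (auto simp: twice_def)
qed

section \<open>Averages in time\<close>

text \<open>Averaging moves the time derivative onto \<psi>; what remains of the equation expresses
  u_xx by elements of \<open>energy\<close>.\<close>

definition avg :: "real \<Rightarrow> (real \<Rightarrow> real) \<Rightarrow> (real \<Rightarrow> 'a::banach) \<Rightarrow> 'a" where
  "avg T \<psi> f = integral {0..T} (\<lambda>t. \<psi> t *\<^sub>R f t)"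

lemma avg_integrable:
  fixes f :: "real \<Rightarrow> 'a::banach"
  assumes "test_function S \<psi>" "continuous_on {0..T} f"
  shows "(\<lambda>t. \<psi> t *\<^sub>R f t) integrable_on {0..T}"
  by (intro integrable_continuous_interval continuous_on_scaleR test_function_continuous[OF assms(1)] assms(2))

lemma avg_linear:
  assumes "bounded_linear L" "test_function S \<psi>" "continuous_on {0..T} f"
  shows "avg T \<psi> (\<lambda>t. L (f t)) = L (avg T \<psi> f)"
  using integral_linear[OF avg_integrable[OF assms(2,3)] assms(1)]
  by (simp add: avg_def o_def linear_simps[OF assms(1)])

lemma avg_add:
  assumes "test_function S \<psi>" "continuous_on {0..T} f" "continuous_on {0..T} g"
  shows "avg T \<psi> (\<lambda>t. f t + g t) = avg T \<psi> f + avg T \<psi> g"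
  unfolding avg_def scaleR_add_right by (intro integral_add avg_integrable[OF assms(1)] assms)

lemma avg_diff:
  assumes "test_function S \<psi>" "continuous_on {0..T} f" "continuous_on {0..T} g"
  shows "avg T \<psi> (\<lambda>t. f t - g t) = avg T \<psi> f - avg T \<psi> g"
  unfolding avg_def scaleR_diff_right by (intro integral_diff avg_integrable[OF assms(1)] assms)

lemma test_function_ends:
  assumes "test_function {0<..<T} \<psi>" shows "\<psi> 0 = 0" "\<psi> T = 0"
  using assms by (auto simp: test_function_def)

lemma avg_parts:
  fixes y y' :: "real \<Rightarrow> 'a::banach"
  assumes T: "T \<ge> 0" and t: "test_function {0<..<T} \<psi>"
    and y: "continuous_on {0..T} y" and y': "continuous_on {0..T} y'"
    and d: "\<And>s. s \<in> {0<..<T} \<Longrightarrow> (y has_vector_derivative y' s) (at s)"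
  shows "avg T (deriv \<psi>) y = - avg T \<psi> y'"
proof -
  have "((\<lambda>s. deriv \<psi> s *\<^sub>R y s) has_integral (\<psi> T *\<^sub>R y T - \<psi> 0 *\<^sub>R y 0 - avg T \<psi> y')) {0..T}"
  proof (rule integration_by_parts_interior[OF bounded_bilinear_scaleR T])
    show "(\<psi> has_vector_derivative deriv \<psi> s) (at s)" for s
      using test_function_derivative[OF t] by (simp add: has_real_derivative_iff_has_vector_derivative)
    show "((\<lambda>s. \<psi> s *\<^sub>R y' s) has_integral \<psi> T *\<^sub>R y T - \<psi> 0 *\<^sub>R y 0 - (\<psi> T *\<^sub>R y T - \<psi> 0 *\<^sub>R y 0 - avg T \<psi> y')) {0..T}"
      using integrable_integral[OF avg_integrable[OF t y']] by (simp add: avg_def)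
  qed (use d y test_function_continuous[OF t] in auto)
  then show ?thesis using test_function_ends[OF t] by (simp add: avg_def integral_unique)
qed

lemma avg_LINT:
  fixes f :: "real \<Rightarrow> complex"
  assumes T: "T > 0" and t: "test_function {0<..<T} \<psi>" and f: "continuous_on {0..T} f"
  shows "(LINT t|lebesgue_on {0<..<T}. of_real (\<psi> t) * f t) = avg T \<psi> f"
proof -
  obtain l r where lr: "l \<in> {0<..<T}" "r \<in> {0<..<T}" "l \<le> r" "\<And>x. x \<notin> {l..r} \<Longrightarrow> \<psi> x = 0"
    by (rule test_function_support_Icc[OF t]) (use T in auto)
  have "f absolutely_integrable_on {l..r}"
    by (intro absolutely_integrable_continuous_real continuous_on_subset[OF f]) (use lr in auto)
  then have "(LINT t|lebesgue_on {0<..<T}. of_real (\<psi> t) * f t) = integral {l..r} (\<lambda>t. of_real (\<psi> t) * f t)"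
    by (rule LINT_test_function[OF _ _ _ test_function_continuous[OF t] lr(4), rotated 2]) (use lr in auto)
  also have "\<dots> = integral {0..T} (\<lambda>t. of_real (\<psi> t) * f t)"
    by (rule integral_extend[symmetric]) (use lr in auto)
  finally show ?thesis by (simp add: avg_def scaleR_conv_of_real)
qed

lemma rep_quotient_tendsto:
  assumes "(rep u has_vector_derivative d) (at 0 within {0..})"
  shows "((\<lambda>\<epsilon>. (rep u \<epsilon> - rep u 0) / of_real \<epsilon>) \<longlongrightarrow> d) (at_right 0)"
proof -
  have "((\<lambda>y. (1 / norm (y - 0)) *\<^sub>R (rep u y - (rep u 0 + (y - 0) *\<^sub>R d))) \<longlongrightarrow> 0) (at 0 within {0..})"
    using assms by (simp add: has_vector_derivative_def has_derivative_within)
  then have "((\<lambda>y. (1 / norm (y - 0)) *\<^sub>R (rep u y - (rep u 0 + (y - 0) *\<^sub>R d))) \<longlongrightarrow> 0) (at_right 0)"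
    by (rule tendsto_within_subset) auto
  then have "((\<lambda>y. (rep u y - rep u 0) / of_real y - d) \<longlongrightarrow> 0) (at_right 0)"
  proof (rule Lim_transform_eventually)
    show "\<forall>\<^sub>F y in at_right 0. (1 / norm (y - 0)) *\<^sub>R (rep u y - (rep u 0 + (y - 0) *\<^sub>R d)) = (rep u y - rep u 0) / of_real y - d"
      by (auto simp: eventually_at_filter scaleR_conv_of_real field_simps)
  qed
  then show ?thesis by (rule LIM_zero_cancel)
qed

text \<open>At fixed \<epsilon> > 0 the difference quotient is a bounded functional of u(t), so it
  commutes with the time average. The distributional condition becomes an ordinary limit for the
  averaged element, which exists once that element is \<open>twice\<close> differentiable.\<close>

lemma robin_condition_iff:
  assumes T: "T > 0" and e: "continuous_on {0..T} e" and h: "continuous_on {0..T} h"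
    and ae: "\<And>t. t \<in> {0..T} \<Longrightarrow> AE x in halfline. rep (e t) x = u t x"
  shows "robin_condition \<alpha> h T u \<longleftrightarrow> (\<forall>\<psi>. test_function {0<..<T} \<psi> \<longrightarrow>
    ((\<lambda>\<epsilon>. rep (avg T \<psi> e) 0 + of_real \<alpha> * ((rep (avg T \<psi> e) \<epsilon> - rep (avg T \<psi> e) 0) / of_real \<epsilon>)) \<longlongrightarrow> avg T \<psi> h)
      (at_right 0))"
proof -
  have "(LINT t|lebesgue_on {0<..<T}. of_real (\<psi> t) *
             (cont_rep (u t) 0 + of_real \<alpha> * ((cont_rep (u t) \<epsilon> - cont_rep (u t) 0) / of_real \<epsilon>)))
     = rep (avg T \<psi> e) 0 + of_real \<alpha> * ((rep (avg T \<psi> e) \<epsilon> - rep (avg T \<psi> e) 0) / of_real \<epsilon>)"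
    if t: "test_function {0<..<T} \<psi>" and \<epsilon>: "\<epsilon> > 0" for \<psi> \<epsilon>
  proof -
    define L where "L = (\<lambda>v. rep v 0 + of_real \<alpha> * ((rep v \<epsilon> - rep v 0) / of_real \<epsilon>))"
    have L: "bounded_linear L"
      unfolding L_def divide_inverse
      by (intro bounded_linear_add bounded_linear_sub bounded_linear_const_mult bounded_linear_mult_const bounded_linear_rep)
    have "(LINT t|lebesgue_on {0<..<T}. of_real (\<psi> t) *
             (cont_rep (u t) 0 + of_real \<alpha> * ((cont_rep (u t) \<epsilon> - cont_rep (u t) 0) / of_real \<epsilon>)))
        = (LINT t|lebesgue_on {0<..<T}. of_real (\<psi> t) * L (e t))"
    proof (rule Bochner_Integration.integral_cong[OF refl])
      fix t assume "t \<in> space (lebesgue_on {0<..<T})"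
      then have "t \<in> {0..T}" by simp
      note c = cont_rep_eq[OF ae[OF this]]
      show "of_real (\<psi> t) * (cont_rep (u t) 0 + of_real \<alpha> * ((cont_rep (u t) \<epsilon> - cont_rep (u t) 0) / of_real \<epsilon>))
        = of_real (\<psi> t) * L (e t)"
        unfolding L_def c[OF order_refl] c[OF less_imp_le[OF \<epsilon>]] ..
    qed
    also have "\<dots> = avg T \<psi> (\<lambda>t. L (e t))"
      by (rule avg_LINT[OF T t]) (rule bounded_linear.continuous_on[OF L e])
    also have "\<dots> = L (avg T \<psi> e)" by (rule avg_linear[OF L t e])
    finally show ?thesis by (simp add: L_def)
  qed
  then have key: "((\<lambda>\<epsilon>. LINT t|lebesgue_on {0<..<T}. of_real (\<psi> t) *
             (cont_rep (u t) 0 + of_real \<alpha> * ((cont_rep (u t) \<epsilon> - cont_rep (u t) 0) / of_real \<epsilon>))) \<longlongrightarrow> l) (at_right 0)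
    \<longleftrightarrow> ((\<lambda>\<epsilon>. rep (avg T \<psi> e) 0 + of_real \<alpha> * ((rep (avg T \<psi> e) \<epsilon> - rep (avg T \<psi> e) 0) / of_real \<epsilon>)) \<longlongrightarrow> l) (at_right 0)"
    if "test_function {0<..<T} \<psi>" for \<psi> l
    using that by (intro tendsto_cong) (auto simp: eventually_at_filter)
  show ?thesis
    unfolding robin_condition_def
    by (intro all_cong1 imp_cong[OF refl]) (simp only: key avg_LINT[OF T _ h])
qed

lemma Nop_continuous_on:
  assumes p: "p \<ge> 2" and e: "continuous_on S e"
  shows "continuous_on S (\<lambda>t. Nop p (e t))"
proof -
  have b: "continuous_on (ball 0 R) (Nop p)" for R
  proof (rule lipschitz_on_continuous_on[where L = "max 0 (Nlip (p - 1) (R + 1))"], rule lipschitz_onI)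
    fix u v :: energy assume "u \<in> ball 0 R" "v \<in> ball 0 R"
    then have "norm (Nop p u - Nop p v) \<le> Nlip (p - 1) (R + 1) * norm (u - v)"
      by (intro Nop_lipschitz p) auto
    also have "\<dots> \<le> max 0 (Nlip (p - 1) (R + 1)) * norm (u - v)" by (rule mult_right_mono) auto
    finally show "dist (Nop p u) (Nop p v) \<le> max 0 (Nlip (p - 1) (R + 1)) * dist u v" by (simp add: dist_norm)
  qed simp
  have "isCont (Nop p) u" for u
    using b[of "norm u + 1"] continuous_on_eq_continuous_at[OF open_ball, of 0 "norm u + 1" "Nop p"] by simp
  then have "continuous_on UNIV (Nop p)" by (simp add: continuous_at_imp_continuous_on)
  from continuous_on_compose2[OF this e] show ?thesis by simp
qed

subsection \<open>Mild solutions and the boundary value problem\<close>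

locale robin =
  fixes \<alpha> :: real
  assumes \<alpha>: "\<alpha> \<noteq> 0"

sublocale robin \<subseteq> m_dissipative "bform \<alpha>" gen "dom \<alpha>" "1 / 2"
  by (rule robin_m_dissipative[OF \<alpha>])

context robin
begin

lemma mild_continuous: "mild T w f w0 \<Longrightarrow> continuous_on {0..T} w"
  by (simp add: mild_def)

lemma mild_derivative:
  assumes w: "mild T w f w0" and f: "continuous_on {0..T} f" and \<mu>: "\<mu> > 0" and t: "t \<in> {0..T}"
  shows "((\<lambda>t. J \<mu> (w t)) has_vector_derivative (Y \<mu> (w t) + J \<mu> (f t))) (at t within {0..T})"
proof -
  have c: "continuous_on {0..T} (\<lambda>s. Y \<mu> (w s) + J \<mu> (f s))"
    by (intro continuous_on_add bounded_linear.continuous_on[OF bounded_linear_Y[OF \<mu>]]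
        bounded_linear.continuous_on[OF bounded_linear_J[OF \<mu>]] mild_continuous[OF w] f)
  have "((\<lambda>t. integral {0..t} (\<lambda>s. Y \<mu> (w s) + J \<mu> (f s))) has_vector_derivative (Y \<mu> (w t) + J \<mu> (f t))) (at t within {0..T})"
    by (rule integral_has_vector_derivative[OF c t])
  then have "((\<lambda>t. J \<mu> w0 + integral {0..t} (\<lambda>s. Y \<mu> (w s) + J \<mu> (f s))) has_vector_derivative (0 + (Y \<mu> (w t) + J \<mu> (f t)))) (at t within {0..T})"
    by (intro has_vector_derivative_add has_vector_derivative_const)
  then have "((\<lambda>t. J \<mu> w0 + integral {0..t} (\<lambda>s. Y \<mu> (w s) + J \<mu> (f s))) has_vector_derivative (Y \<mu> (w t) + J \<mu> (f t))) (at t within {0..T})"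
    by simp
  then show ?thesis
  proof (rule has_vector_derivative_transform[OF t, rotated])
    fix s assume "s \<in> {0..T}"
    then have "((\<lambda>s. Y \<mu> (w s) + J \<mu> (f s)) has_integral (J \<mu> (w s) - J \<mu> w0)) {0..s}"
      using w \<mu> unfolding mild_def by blast
    then show "J \<mu> (w s) = J \<mu> w0 + integral {0..s} (\<lambda>s. Y \<mu> (w s) + J \<mu> (f s))"
      by (simp add: integral_unique)
  qed
qed

lemma Y_one: "Y 1 u = J 1 u - u"
  by (simp add: Y_def)

text \<open>A functional \<open>L\<close> for which \<open>L \<circ> gen\<close> extends continuously factors through the resolvent.\<close>

lemma mild_functional:
  fixes L L' :: "energy \<Rightarrow> complex"
  assumes w: "mild T w f w0" and f: "continuous_on {0..T} f"
    and L: "bounded_linear L" and L': "bounded_linear L'"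
    and eq: "\<And>u. u \<in> dom \<alpha> \<Longrightarrow> L (gen u) = L' u" and t: "t \<in> {0..T}"
  shows "((\<lambda>t. L (w t)) has_vector_derivative (L' (w t) + L (f t))) (at t within {0..T})"
proof -
  define m where "m = (\<lambda>u. L u - L' u)"
  have m: "bounded_linear m" unfolding m_def by (intro bounded_linear_sub L L')
  have mJ: "m (J 1 g) = L g" for g
  proof -
    have R: "R 1 g \<in> dom \<alpha>" "1 *\<^sub>R R 1 g - gen (R 1 g) = g" by (rule R_in_D R_eq; simp)+
    have "L g = L (R 1 g - gen (R 1 g))" using R(2) by simp
    also have "\<dots> = L (R 1 g) - L' (R 1 g)" by (simp only: linear_simps(2)[OF L] eq[OF R(1)])
    finally show ?thesis by (simp add: m_def J_def)
  qed
  have "((\<lambda>t. m (J 1 (w t))) has_vector_derivative m (Y 1 (w t) + J 1 (f t))) (at t within {0..T})"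
    by (rule bounded_linear.has_vector_derivative[OF m mild_derivative[OF w f _ t]]) simp
  moreover have "m (Y 1 (w t) + J 1 (f t)) = L' (w t) + L (f t)"
    unfolding Y_one linear_simps(1)[OF m] linear_simps(2)[OF m] mJ by (simp add: m_def)
  ultimately show ?thesis unfolding mJ by simp
qed

lemma at_within_Icc: "s \<in> {0<..<T} \<Longrightarrow> at s within {0..T} = at (s::real)"
  by (rule at_within_interior) simp

text \<open>Integrating the smoothed equation against \<psi> and using Y 1 = J 1 - 1 exhibits the
  average as a value of \<open>J 1\<close>, and such values lie in the domain.\<close>

lemma mild_avg_in_dom:
  assumes w: "mild T w f w0" and f: "continuous_on {0..T} f" and T: "T \<ge> 0" and t: "test_function {0<..<T} \<psi>"
  shows "avg T \<psi> w \<in> dom \<alpha>"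
proof -
  note wc = mild_continuous[OF w]
  note t' = test_function_deriv[OF t]
  have J: "bounded_linear (J 1)" and Y: "bounded_linear (Y 1)" by (rule bounded_linear_J bounded_linear_Y; simp)+
  have cY: "continuous_on {0..T} (\<lambda>s. Y 1 (w s))" and cf: "continuous_on {0..T} (\<lambda>s. J 1 (f s))"
    and cJ: "continuous_on {0..T} (\<lambda>s. J 1 (w s))"
    by (intro bounded_linear.continuous_on[OF J] bounded_linear.continuous_on[OF Y] wc f)+
  have "avg T (deriv \<psi>) (\<lambda>s. J 1 (w s)) = - avg T \<psi> (\<lambda>s. Y 1 (w s) + J 1 (f s))"
  proof (rule avg_parts[OF T t cJ])
    show "continuous_on {0..T} (\<lambda>s. Y 1 (w s) + J 1 (f s))" by (intro continuous_on_add cY cf)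
    show "((\<lambda>s. J 1 (w s)) has_vector_derivative (Y 1 (w s) + J 1 (f s))) (at s)" if "s \<in> {0<..<T}" for s
      using mild_derivative[OF w f, of 1 s] that by (simp add: at_within_Icc)
  qed
  then have "J 1 (avg T (deriv \<psi>) w) = - (Y 1 (avg T \<psi> w) + J 1 (avg T \<psi> f))"
    unfolding avg_add[OF t cY cf] avg_linear[OF J t' wc] avg_linear[OF J t f] avg_linear[OF Y t wc] .
  then have "avg T \<psi> w = J 1 (avg T (deriv \<psi>) w + avg T \<psi> w + avg T \<psi> f)"
    unfolding Y_one linear_simps(1)[OF J] by (simp add: algebra_simps)
  then show ?thesis by (metis J_in_D zero_less_one)
qed

text \<open>Apply \<open>J \<mu>\<close> to the averaged equation. On the domain
  \<open>J \<mu>\<close> after \<open>gen\<close> is the bounded \<open>Y \<mu>\<close>, so the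
  equation says that one continuous function is the weak time derivative of another.\<close>

lemma mildI_avg:
  assumes T: "T > 0" and w: "continuous_on {0..T} w" and f: "continuous_on {0..T} f"
    and D: "\<And>\<psi>. test_function {0<..<T} \<psi> \<Longrightarrow> avg T \<psi> w \<in> dom \<alpha>"
    and eq: "\<And>\<psi>. test_function {0<..<T} \<psi> \<Longrightarrow> gen (avg T \<psi> w) + avg T \<psi> f = - avg T (deriv \<psi>) w"
  shows "mild T w f (w 0)"
  unfolding mild_def
proof (intro conjI w allI impI ballI)
  fix \<mu> :: real and t :: real assume \<mu>: "\<mu> > 0" and t: "t \<in> {0..T}"
  have J: "bounded_linear (J \<mu>)" and Y: "bounded_linear (Y \<mu>)" by (rule bounded_linear_J[OF \<mu>] bounded_linear_Y[OF \<mu>])+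
  define g where "g = (\<lambda>s. Y \<mu> (w s) + J \<mu> (f s))"
  have cY: "continuous_on {0..T} (\<lambda>s. Y \<mu> (w s))" and cf: "continuous_on {0..T} (\<lambda>s. J \<mu> (f s))"
    and cJ: "continuous_on {0..T} (\<lambda>s. J \<mu> (w s))"
    by (intro bounded_linear.continuous_on[OF J] bounded_linear.continuous_on[OF Y] w f)+
  have cg: "continuous_on {0..T} g" unfolding g_def by (intro continuous_on_add cY cf)
  have avg: "avg T (deriv \<psi>) (\<lambda>s. J \<mu> (w s)) = - avg T \<psi> g" if \<psi>: "test_function {0<..<T} \<psi>" for \<psi>
  proof -
    have "avg T \<psi> g = Y \<mu> (avg T \<psi> w) + J \<mu> (avg T \<psi> f)"
      unfolding g_def avg_add[OF \<psi> cY cf] avg_linear[OF J \<psi> f] avg_linear[OF Y \<psi> w] ..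
    also have "Y \<mu> (avg T \<psi> w) = J \<mu> (gen (avg T \<psi> w))" by (rule J_A[OF \<mu> D[OF \<psi>], symmetric])
    also have "\<dots> + J \<mu> (avg T \<psi> f) = J \<mu> (- avg T (deriv \<psi>) w)"
      by (simp only: J_add[OF \<mu>, symmetric] eq[OF \<psi>])
    also have "\<dots> = - avg T (deriv \<psi>) (\<lambda>s. J \<mu> (w s))"
      by (simp only: avg_linear[OF J test_function_deriv[OF \<psi>] w] linear_neg[OF bounded_linear.linear[OF J]])
    finally show ?thesis by simp
  qed
  have gi: "g integrable_on {0..t}"
    by (rule integrable_continuous_interval, rule continuous_on_subset[OF cg]) (use t in auto)
  \<comment> \<open>\<open>weak_derivative_continuous\<close> concerns complex-valued functions, so
    it is applied at each point x separately.\<close>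
  have "rep (integral {0..t} g) x = rep (J \<mu> (w t) - J \<mu> (w 0)) x" for x
  proof -
    note r = bounded_linear_rep[of x]
    have "((\<lambda>s. rep (g s) x) has_integral (rep (J \<mu> (w t)) x - rep (J \<mu> (w 0)) x)) {0..t}"
    proof (rule weak_derivative_continuous[OF T _ _ _ t])
      show "continuous_on {0..T} (\<lambda>s. rep (J \<mu> (w s)) x)" "continuous_on {0..T} (\<lambda>s. rep (g s) x)"
        by (intro bounded_linear.continuous_on[OF r] cJ cg)+
      show "integral {0..T} (\<lambda>t. of_real (deriv \<psi> t) * rep (J \<mu> (w t)) x) = - integral {0..T} (\<lambda>t. of_real (\<psi> t) * rep (g t) x)"
        if \<psi>: "test_function {0<..<T} \<psi>" for \<psi>
        using avg[OF \<psi>] avg_linear[OF r test_function_deriv[OF \<psi>] cJ] avg_linear[OF r \<psi> cg]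
        by (simp add: avg_def scaleR_conv_of_real)
    qed
    moreover have "((\<lambda>s. rep (g s) x) has_integral rep (integral {0..t} g) x) {0..t}"
      using has_integral_linear[OF integrable_integral[OF gi] r] by (simp add: o_def)
    ultimately show ?thesis using has_integral_unique by (simp, blast)
  qed
  then have "integral {0..t} g = J \<mu> (w t) - J \<mu> (w 0)" by (rule energy_eqI)
  with integrable_integral[OF gi] show "((\<lambda>s. Y \<mu> (w s) + J \<mu> (f s)) has_integral (J \<mu> (w t) - J \<mu> (w 0))) {0..t}"
    by (simp add: g_def)
qed

end

lemma (in robin) mild_restrict:
  assumes "mild T w f w0" "T' \<le> T" "\<And>t. t \<in> {0..T'} \<Longrightarrow> f t = g t"
  shows "mild T' w g w0"
  unfolding mild_def
proof (intro conjI allI impI ballI)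
  show "continuous_on {0..T'} w" by (rule continuous_on_subset[OF mild_continuous[OF assms(1)]]) (use assms(2) in auto)
  fix \<mu> t :: real assume \<mu>: "\<mu> > 0" and t: "t \<in> {0..T'}"
  have "((\<lambda>s. Y \<mu> (w s) + J \<mu> (f s)) has_integral (J \<mu> (w t) - J \<mu> w0)) {0..t}"
    using assms(1,2) \<mu> t unfolding mild_def by simp
  then show "((\<lambda>s. Y \<mu> (w s) + J \<mu> (g s)) has_integral (J \<mu> (w t) - J \<mu> w0)) {0..t}"
    by (rule has_integral_eq[rotated]) (use assms(3) t in simp)
qed

lemma bounded_linear_cmul_left: "bounded_linear (\<lambda>c. cmul c u)"
proof (rule bounded_linear_intro[where K = "norm u"])
  show "cmul (a + b) u = cmul a u + cmul b u" for a b by (rule energy_eqI) (simp add: distrib_right)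
  show "cmul (r *\<^sub>R a) u = r *\<^sub>R cmul a u" for r a by (rule energy_eqI) simp
qed (simp add: norm_cmul)

lemma twice_cmul:
  assumes "twice u u1 v" shows "twice (cmul c u) (\<lambda>x. c * u1 x) (cmul c v)"
proof -
  have "rep (cmul c u) = (\<lambda>x. c * rep u x)" by (simp add: fun_eq_iff)
  then show ?thesis
    using assms by (auto simp: twice_def intro: has_vector_derivative_mult_right)
qed

text \<open>The forcing that the evolution by \<open>gen\<close> needs in order that \<open>w = e - h G\<close> solves the problem:
  its first two terms undo the shift by \<open>- 1\<close> in \<open>gen\<close>, the last two come from the boundary lift \<open>G\<close>
  with \<open>G2 = G''\<close>.\<close>

definition src :: "complex \<Rightarrow> real \<Rightarrow> (real \<Rightarrow> complex) \<Rightarrow> (real \<Rightarrow> complex) \<Rightarrow> energy \<Rightarrow> energy \<Rightarrow> real \<Rightarrow> energy \<Rightarrow> energy" where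
  "src lam p h h' G G2 t e = e - cmul (h t) G - cmul (\<i> * lam) (Nop p e) - cmul (h' t) G + cmul (\<i> / 2 * h t) G2"

locale robin_nls = robin \<alpha> for \<alpha> +
  fixes lam :: complex and p T :: real and h h' :: "real \<Rightarrow> complex" and G :: energy
    and G1 :: "real \<Rightarrow> complex" and G2 :: energy
  assumes p: "p \<ge> 2" and T: "T > 0"
    and h: "\<And>t. t \<in> {0..T} \<Longrightarrow> (h has_vector_derivative h' t) (at t within {0..T})"
    and h': "continuous_on {0..T} h'"
    and G: "twice G G1 G2" and G_robin: "rep G 0 + of_real \<alpha> * G1 0 = 1"
begin

abbreviation "f \<equiv> src lam p h h' G G2"

lemma h_continuous: "continuous_on {0..T} h"
  by (rule continuous_on_of_vector_derivative[OF h])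

lemma src_continuous:
  assumes "continuous_on {0..T} e" shows "continuous_on {0..T} (\<lambda>t. f t (e t))"
  unfolding src_def
  by (intro continuous_on_add continuous_on_diff assms bounded_linear.continuous_on[OF bounded_linear_cmul_left]
      bounded_linear.continuous_on[OF bounded_linear_cmul] Nop_continuous_on p continuous_on_mult continuous_on_const
      h_continuous h')

text \<open>For the equation, \<open>mild_functional\<close> is used with L =
  \<open>tst \<phi>\<close>: on the domain L (gen u) = (i/2) tst \<phi>'' u - L u, whose right side
  is bounded on all of \<open>energy\<close>. For the boundary condition, the averages of e - h G
  lie in the domain and the averaged lift is added back.\<close>

lemma solution_of_mild:
  assumes e: "continuous_on {0..T} e" and w: "mild T (\<lambda>t. e t - cmul (h t) G) (\<lambda>t. f t (e t)) w0"
  shows "nls_equation lam p T (\<lambda>t. rep (e t))" "robin_condition \<alpha> h T (\<lambda>t. rep (e t))"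
proof -
  show "nls_equation lam p T (\<lambda>t. rep (e t))"
    unfolding nls_equation_def
  proof (intro allI impI ballI)
    fix \<phi> t assume \<phi>: "test_function {0<..} \<phi>" and t: "t \<in> {0<..<T}"
    then have t0: "t \<in> {0..T}" by simp
    define L where "L = tst \<phi>"
    define L'' where "L'' = tst (deriv (deriv \<phi>))"
    have L: "bounded_linear L" and L'': "bounded_linear L''"
      unfolding L_def L''_def by (intro bounded_linear_tst \<phi> test_function_deriv)+
    note Lc = tst_cmul[of \<phi>, folded L_def] and L''c = tst_cmul[of "deriv (deriv \<phi>)", folded L''_def]
    have L'': "bounded_linear (\<lambda>u. \<i> / 2 * L'' u - L u)" "bounded_linear L''"
      by (intro bounded_linear_sub bounded_linear_const_mult L L'')+
    have eq: "L (gen u) = \<i> / 2 * L'' u - L u" if u: "u \<in> dom \<alpha>" for u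
    proof -
      obtain u1 v where tw: "twice u u1 v" using u by (auto simp: dom_def)
      show ?thesis unfolding gen_def lap_eq[OF tw] linear_simps(2)[OF L] Lc
        by (simp add: L_def L''_def tst_twice[OF tw \<phi>])
    qed
    have d1: "((\<lambda>s. L (e s - cmul (h s) G)) has_vector_derivative
        (\<i> / 2 * L'' (e t - cmul (h t) G) - L (e t - cmul (h t) G) + L (f t (e t)))) (at t)"
      using mild_functional[OF w src_continuous[OF e] L L''(1) eq t0] by (simp add: at_within_Icc[OF t])
    have d2: "((\<lambda>s. h s * L G) has_vector_derivative h' t * L G) (at t)"
      using has_vector_derivative_mult_left[OF h[OF t0]] by (simp add: at_within_Icc[OF t])
    define D where "D = \<i> / 2 * L'' (e t) - \<i> * lam * L (Nop p (e t))"
    have "((\<lambda>s. L (e s)) has_vector_derivative D) (at t)"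
    proof -
      have "L'' G = L G2" by (simp add: L_def L''_def tst_twice[OF G \<phi>])
      then have "\<i> / 2 * L'' (e t - cmul (h t) G) - L (e t - cmul (h t) G) + L (f t (e t)) + h' t * L G = D"
        unfolding src_def linear_simps(1,2)[OF L] linear_simps(2)[OF L''(2)] Lc L''c D_def by (simp add: algebra_simps)
      moreover have "(\<lambda>s. L (e s - cmul (h s) G) + h s * L G) = (\<lambda>s. L (e s))"
        unfolding linear_simps(2)[OF L] Lc by simp
      ultimately show ?thesis using has_vector_derivative_add[OF d1 d2] by simp
    qed
    moreover have "(LINT x|halfline. of_real (\<phi> x) * nonlinearity p (rep (e t) x)) = L (Nop p (e t))"
      unfolding L_def tst_def by (rule Bochner_Integration.integral_cong) (auto simp: rep_Nop p)
    moreover have "\<i> * D + 1 / 2 * L'' (e t) = lam * L (Nop p (e t))"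
      by (simp add: D_def algebra_simps)
    ultimately show "\<exists>D. ((\<lambda>s. LINT x|halfline. of_real (\<phi> x) * rep (e s) x) has_vector_derivative D) (at t) \<and>
        \<i> * D + 1 / 2 * (LINT x|halfline. of_real (deriv (deriv \<phi>) x) * rep (e t) x)
          = lam * (LINT x|halfline. of_real (\<phi> x) * nonlinearity p (rep (e t) x))"
      unfolding L_def L''_def tst_def by auto
  qed
  show "robin_condition \<alpha> h T (\<lambda>t. rep (e t))"
    unfolding robin_condition_iff[OF T e h_continuous AE_I2[OF refl]]
  proof (intro allI impI)
    fix \<psi> assume \<psi>: "test_function {0<..<T} \<psi>"
    define H where "H = avg T \<psi> h"
    have hG: "continuous_on {0..T} (\<lambda>t. cmul (h t) G)"
      by (rule bounded_linear.continuous_on[OF bounded_linear_cmul_left h_continuous])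
    have "avg T \<psi> (\<lambda>t. e t - cmul (h t) G) = avg T \<psi> e - cmul H G"
      unfolding avg_diff[OF \<psi> e hG] avg_linear[OF bounded_linear_cmul_left \<psi> h_continuous] H_def ..
    then have "avg T \<psi> e - cmul H G \<in> dom \<alpha>"
      using mild_avg_in_dom[OF w src_continuous[OF e] less_imp_le[OF T] \<psi>] by simp
    then obtain w1 v where tw: "twice (avg T \<psi> e - cmul H G) w1 v" and r: "rep (avg T \<psi> e - cmul H G) 0 + of_real \<alpha> * w1 0 = 0"
      by (auto simp: dom_def)
    have "twice (avg T \<psi> e) (\<lambda>x. w1 x + H * G1 x) (v + cmul H G2)"
      using twice_add[OF tw twice_cmul[OF G, of H]] by simp
    then have "(rep (avg T \<psi> e) has_vector_derivative (w1 0 + H * G1 0)) (at 0 within {0..})"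
      by (simp add: twice_def)
    from rep_quotient_tendsto[OF this]
    have "((\<lambda>\<epsilon>. rep (avg T \<psi> e) 0 + of_real \<alpha> * ((rep (avg T \<psi> e) \<epsilon> - rep (avg T \<psi> e) 0) / of_real \<epsilon>))
        \<longlongrightarrow> rep (avg T \<psi> e) 0 + of_real \<alpha> * (w1 0 + H * G1 0)) (at_right 0)"
      by (intro tendsto_add tendsto_mult tendsto_const)
    moreover have "rep (avg T \<psi> e) 0 + of_real \<alpha> * (w1 0 + H * G1 0) = H"
    proof -
      have "rep (avg T \<psi> e) 0 + of_real \<alpha> * (w1 0 + H * G1 0) = 0 + H * (rep G 0 + of_real \<alpha> * G1 0)"
        unfolding r[symmetric] by (simp add: algebra_simps)
      then show ?thesis by (simp add: G_robin)
    qed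
    ultimately show "((\<lambda>\<epsilon>. rep (avg T \<psi> e) 0 + of_real \<alpha> * ((rep (avg T \<psi> e) \<epsilon> - rep (avg T \<psi> e) 0) / of_real \<epsilon>)) \<longlongrightarrow> avg T \<psi> h)
      (at_right 0)" by (simp add: H_def)
  qed
qed

text \<open>Testing the equation in x and averaging it in t determines the second derivative of the
  average. After subtraction of the lift the average is in the domain, and \<open>mildI_avg\<close>
  returns to the mild equation.\<close>

lemma mild_of_solution:
  assumes e: "continuous_on {0..T} e"
    and ae: "\<And>t. t \<in> {0..T} \<Longrightarrow> AE x in halfline. rep (e t) x = u t x"
    and nls: "nls_equation lam p T u" and rob: "robin_condition \<alpha> h T u"
  shows "mild T (\<lambda>t. e t - cmul (h t) G) (\<lambda>t. f t (e t)) (e 0 - cmul (h 0) G)"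
proof -
  define N where "N = (\<lambda>t. Nop p (e t))"
  have N: "continuous_on {0..T} N" unfolding N_def by (rule Nop_continuous_on[OF p e])
  have aeN: "AE x in halfline. rep (N t) x = nonlinearity p (u t x)" if "t \<in> {0..T}" for t
    using ae[OF that] unfolding halfline_AE_iff by eventually_elim (simp add: N_def rep_Nop p)
  have hG: "continuous_on {0..T} (\<lambda>t. cmul (h t) G)" and h'G: "continuous_on {0..T} (\<lambda>t. cmul (h' t) G)"
    by (intro bounded_linear.continuous_on[OF bounded_linear_cmul_left] h_continuous h')+
  have lG2: "bounded_linear (\<lambda>c. cmul (\<i> / 2 * c) G2)"
    by (rule bounded_linear_compose[OF bounded_linear_cmul_left bounded_linear_mult_right])
  have hG2: "continuous_on {0..T} (\<lambda>t. cmul (\<i> / 2 * h t) G2)"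
    by (rule bounded_linear.continuous_on[OF lG2 h_continuous])
  have lN: "continuous_on {0..T} (\<lambda>t. cmul (\<i> * lam) (N t))"
    by (rule bounded_linear.continuous_on[OF bounded_linear_cmul N])
  have wc: "continuous_on {0..T} (\<lambda>t. e t - cmul (h t) G)" by (intro continuous_on_diff e hG)
  have key: "avg T \<psi> (\<lambda>t. e t - cmul (h t) G) \<in> dom \<alpha> \<and>
      gen (avg T \<psi> (\<lambda>t. e t - cmul (h t) G)) + avg T \<psi> (\<lambda>t. f t (e t)) = - avg T (deriv \<psi>) (\<lambda>t. e t - cmul (h t) G)"
    if \<psi>: "test_function {0<..<T} \<psi>" for \<psi>
  proof -
    note \<psi>' = test_function_deriv[OF \<psi>]
    define E P n H H' where "E = avg T \<psi> e" and "P = avg T (deriv \<psi>) e" and "n = avg T \<psi> N"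
      and "H = avg T \<psi> h" and "H' = avg T \<psi> h'"
    \<comment> \<open>The second derivative of \<open>E\<close> forced by the averaged equation: the
      average of u_t is - P, so (1/2) E'' = lam n + i P.\<close>
    define K where "K = cmul (2 * lam) n + cmul (2 * \<i>) P"
    have "tst (deriv (deriv \<phi>)) E = tst \<phi> K" if \<phi>: "test_function {0<..} \<phi>" for \<phi>
    proof -
      define L where "L = tst \<phi>"
      define L'' where "L'' = tst (deriv (deriv \<phi>))"
      have L: "bounded_linear L" and L'': "bounded_linear L''"
        unfolding L_def L''_def by (intro bounded_linear_tst \<phi> test_function_deriv)+
      have L2: "bounded_linear (\<lambda>v. \<i> / 2 * L'' v)" and L1: "bounded_linear (\<lambda>v. \<i> * lam * L v)"
        by (intro bounded_linear_const_mult L L'')+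
      have c2: "continuous_on {0..T} (\<lambda>s. \<i> / 2 * L'' (e s))" and c1: "continuous_on {0..T} (\<lambda>s. \<i> * lam * L (N s))"
        by (rule bounded_linear.continuous_on[OF L2 e] bounded_linear.continuous_on[OF L1 N])+
      have "avg T (deriv \<psi>) (\<lambda>s. L (e s)) = - avg T \<psi> (\<lambda>s. \<i> / 2 * L'' (e s) - \<i> * lam * L (N s))"
      proof (rule avg_parts[OF less_imp_le[OF T] \<psi> bounded_linear.continuous_on[OF L e] continuous_on_diff[OF c2 c1]])
        fix s assume s: "s \<in> {0<..<T}"
        then have s0: "s \<in> {0..T}" by simp
        obtain D where D: "((\<lambda>s. LINT x|halfline. of_real (\<phi> x) * u s x) has_vector_derivative D) (at s)"
          "\<i> * D + 1/2 * (LINT x|halfline. of_real (deriv (deriv \<phi>) x) * u s x)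
            = lam * (LINT x|halfline. of_real (\<phi> x) * nonlinearity p (u s x))"
          using nls \<phi> s unfolding nls_equation_def by blast
        have "\<i> * D + 1/2 * L'' (e s) = lam * L (N s)"
          using D(2) unfolding tst_AE_cong[OF ae[OF s0] test_function_deriv[OF test_function_deriv[OF \<phi>]]]
            tst_AE_cong[OF aeN[OF s0] \<phi>] L_def L''_def .
        then have "\<i> * D = lam * L (N s) - 1/2 * L'' (e s)" by (simp add: algebra_simps)
        then have "- \<i> * (\<i> * D) = - \<i> * (lam * L (N s) - 1/2 * L'' (e s))" by simp
        then have "D = \<i> / 2 * L'' (e s) - \<i> * lam * L (N s)" by (simp add: algebra_simps)
        moreover have "((\<lambda>s. L (e s)) has_vector_derivative D) (at s)"
          by (rule has_vector_derivative_transform_within_open[OF D(1), of "{0<..<T}"])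
             (use s tst_AE_cong[OF ae \<phi>] in \<open>auto simp: L_def\<close>)
        ultimately show "((\<lambda>s. L (e s)) has_vector_derivative (\<i> / 2 * L'' (e s) - \<i> * lam * L (N s))) (at s)" by simp
      qed
      then have "L P = - (\<i> / 2 * L'' E - \<i> * lam * L n)"
        unfolding avg_diff[OF \<psi> c2 c1] avg_linear[OF L2 \<psi> e] avg_linear[OF L1 \<psi> N] avg_linear[OF L \<psi>' e]
          E_def P_def n_def .
      then have "L K = 2 * lam * L n + 2 * \<i> * (- (\<i> / 2 * L'' E - \<i> * lam * L n))"
        unfolding K_def linear_simps(1)[OF L] by (simp add: L_def tst_cmul)
      then have "L K = L'' E" by (simp add: algebra_simps)
      then show ?thesis by (simp add: L_def L''_def)
    qed
    then obtain E1 where E1: "twice E E1 K" using twice_of_tst by blast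
    \<comment> \<open>Now that \<open>E\<close> has a classical derivative at 0, the difference
      quotients converge to \<open>E1 0\<close>, and uniqueness of limits gives the Robin condition
      with datum \<open>H\<close>.\<close>
    have rE: "rep E 0 + of_real \<alpha> * E1 0 = H"
    proof (rule tendsto_unique[OF trivial_limit_at_right_real])
      have "(rep E has_vector_derivative E1 0) (at 0 within {0..})" using E1 by (simp add: twice_def)
      from rep_quotient_tendsto[OF this]
      show "((\<lambda>\<epsilon>. rep E 0 + of_real \<alpha> * ((rep E \<epsilon> - rep E 0) / of_real \<epsilon>)) \<longlongrightarrow> rep E 0 + of_real \<alpha> * E1 0) (at_right 0)"
        by (intro tendsto_add tendsto_mult tendsto_const)
      show "((\<lambda>\<epsilon>. rep E 0 + of_real \<alpha> * ((rep E \<epsilon> - rep E 0) / of_real \<epsilon>)) \<longlongrightarrow> H) (at_right 0)"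
        using robin_condition_iff[OF T e h_continuous ae] rob \<psi> unfolding E_def H_def by blast
    qed
    define W where "W = avg T \<psi> (\<lambda>t. e t - cmul (h t) G)"
    have W: "W = E - cmul H G"
      unfolding W_def avg_diff[OF \<psi> e hG] avg_linear[OF bounded_linear_cmul_left \<psi> h_continuous] E_def H_def ..
    have "W = E + cmul (- H) G" unfolding W by (rule energy_eqI) simp
    then have tW: "twice W (\<lambda>x. E1 x + - H * G1 x) (K + cmul (- H) G2)"
      using twice_add[OF E1 twice_cmul[OF G, of "- H"]] by (simp only:)
    have "rep W 0 + of_real \<alpha> * (E1 0 + - H * G1 0) = (rep E 0 + of_real \<alpha> * E1 0) - H * (rep G 0 + of_real \<alpha> * G1 0)"
      unfolding W by (simp add: algebra_simps)
    also have "\<dots> = 0" by (simp add: rE G_robin)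
    finally have dW: "W \<in> dom \<alpha>" unfolding dom_def using tW by blast
    have aF: "avg T \<psi> (\<lambda>t. f t (e t)) = W - cmul (\<i> * lam) n - cmul H' G + cmul (\<i> / 2 * H) G2"
    proof -
      have fe: "(\<lambda>t. f t (e t)) = (\<lambda>t. e t - cmul (h t) G - cmul (\<i> * lam) (N t) - cmul (h' t) G + cmul (\<i> / 2 * h t) G2)"
        by (simp only: src_def N_def)
      show ?thesis
        unfolding fe avg_add[OF \<psi> continuous_on_diff[OF continuous_on_diff[OF wc lN] h'G] hG2]
        avg_diff[OF \<psi> continuous_on_diff[OF wc lN] h'G] avg_diff[OF \<psi> wc lN]
        avg_linear[OF bounded_linear_cmul \<psi> N] avg_linear[OF bounded_linear_cmul_left \<psi> h'] avg_linear[OF lG2 \<psi> h_continuous]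
        W_def n_def H'_def H_def ..
    qed
    have pH: "avg T (deriv \<psi>) h = - H'"
      unfolding H'_def
      by (rule avg_parts[OF less_imp_le[OF T] \<psi> h_continuous h']) (use h in \<open>auto simp flip: at_within_Icc\<close>)
    have aW: "avg T (deriv \<psi>) (\<lambda>t. e t - cmul (h t) G) = P - cmul (- H') G"
      unfolding avg_diff[OF \<psi>' e hG] avg_linear[OF bounded_linear_cmul_left \<psi>' h_continuous] pH P_def ..
    have "gen W + avg T \<psi> (\<lambda>t. f t (e t)) = - avg T (deriv \<psi>) (\<lambda>t. e t - cmul (h t) G)"
      unfolding gen_def lap_eq[OF tW] aF aW K_def by (rule energy_eqI) (simp add: algebra_simps)
    then show ?thesis using dW unfolding W_def by blast
  qed
  show ?thesis
    by (rule mildI_avg[OF T wc src_continuous[OF e]]) (use key in blast)+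
qed

text \<open>Two continuous curves on [0,T] have bounded range, so one Lipschitz constant of the
  power covers both. Hence solutions are unique in the whole class, not just below a truncation
  threshold.\<close>

lemma mild_src_unique:
  assumes e: "continuous_on {0..T} e" and v: "continuous_on {0..T} v"
    and me: "mild T (\<lambda>t. e t - cmul (h t) G) (\<lambda>t. f t (e t)) w0"
    and mv: "mild T (\<lambda>t. v t - cmul (h t) G) (\<lambda>t. f t (v t)) w0" and t: "t \<in> {0..T}"
  shows "e t = v t"
proof -
  have "bounded (e ` {0..T} \<union> v ` {0..T})"
    by (simp add: compact_imp_bounded compact_continuous_image e v)
  then obtain M where "\<And>x. x \<in> e ` {0..T} \<union> v ` {0..T} \<Longrightarrow> norm x \<le> M" unfolding bounded_iff by blast
  then have M: "norm (e t) \<le> M" "norm (v t) \<le> M" if "t \<in> {0..T}" for t using that by blast+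
  obtain K where K: "K > 0" "\<And>u. q u \<le> K * (norm u)\<^sup>2" using q_bound by blast
  define c where "c = 1 + cmod lam * Nlip (p - 1) (M + 1)"
  have le: "q (f t (e t) - f t (v t)) \<le> (2 * K * c\<^sup>2) * q ((e t - cmul (h t) G) - (v t - cmul (h t) G))"
    if t: "t \<in> {0..T}" for t
  proof -
    have eq: "f t (e t) - f t (v t) = (e t - v t) - cmul (\<i> * lam) (Nop p (e t) - Nop p (v t))"
      unfolding src_def by (rule energy_eqI) (simp add: algebra_simps)
    have "norm (f t (e t) - f t (v t)) \<le> norm (e t - v t) + norm (cmul (\<i> * lam) (Nop p (e t) - Nop p (v t)))"
      unfolding eq by (rule norm_triangle_ineq4)
    also have "norm (cmul (\<i> * lam) (Nop p (e t) - Nop p (v t))) = cmod lam * norm (Nop p (e t) - Nop p (v t))"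
      by (simp add: norm_cmul norm_mult)
    also have "\<dots> \<le> cmod lam * (Nlip (p - 1) (M + 1) * norm (e t - v t))"
      by (intro mult_left_mono Nop_lipschitz p M t) simp
    finally have n: "norm (f t (e t) - f t (v t)) \<le> c * norm (e t - v t)" by (simp add: c_def algebra_simps)
    have "q (f t (e t) - f t (v t)) \<le> K * (norm (f t (e t) - f t (v t)))\<^sup>2" by (rule K(2))
    also have "\<dots> \<le> K * (c * norm (e t - v t))\<^sup>2"
      using K(1) by (intro mult_left_mono power_mono n) auto
    also have "\<dots> = K * c\<^sup>2 * (norm (e t - v t))\<^sup>2" by (simp add: power_mult_distrib)
    also have "\<dots> \<le> K * c\<^sup>2 * (q (e t - v t) / (1 / 2))"
      using K(1) by (intro mult_left_mono norm_sq_le_q) auto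
    finally show ?thesis by simp
  qed
  have "e t - cmul (h t) G = v t - cmul (h t) G"
    by (rule mild_unique[OF me mv src_continuous[OF e] src_continuous[OF v] _ le t]) (use K in auto)
  then show ?thesis by simp
qed

end

section \<open>Truncation, boundary lift and the local solution\<close>

definition retract :: "real \<Rightarrow> 'a::real_normed_vector \<Rightarrow> 'a" where
  "retract M u = min 1 (M / norm u) *\<^sub>R u"

lemma retract_id: "norm u \<le> M \<Longrightarrow> retract M u = u"
  by (cases "u = 0") (auto simp: retract_def min_def le_divide_eq)

lemma norm_retract: "M \<ge> 0 \<Longrightarrow> norm (retract M u) = min (norm u) M"
  by (cases "u = 0") (auto simp: retract_def min_def divide_le_eq le_divide_eq)

text \<open>For norm v \<le> norm u the difference is a (u - v) - (b - a) v with the two scaling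
  factors a and b. Each part is at most norm (u - v), by the triangle inequality alone, which gives
  the constant 2 in every normed space.\<close>

lemma retract_lipschitz:
  assumes M: "M \<ge> 0" shows "norm (retract M u - retract M v) \<le> 2 * norm (u - v)"
proof -
  have *: "norm (retract M u - retract M v) \<le> 2 * norm (u - v)" if le: "norm v \<le> norm u" for u v :: 'a
  proof -
    define a b where "a = min 1 (M / norm u)" and "b = min 1 (M / norm v)"
    have a: "0 \<le> a" "a \<le> 1" "0 \<le> b" using M by (auto simp: a_def b_def)
    have na: "a * norm u = min (norm u) M" and nb: "b * norm v = min (norm v) M"
      using norm_retract[OF M, of u] norm_retract[OF M, of v] a by (simp_all add: retract_def a_def[symmetric] b_def[symmetric])
    have nab: "a * norm v \<le> b * norm v"
    proof (cases "v = 0")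
      case False
      then have "norm u * norm v > 0" using le by (intro mult_pos_pos) auto
      then have "M / norm u \<le> M / norm v" using M le by (intro divide_left_mono)
      then have "a \<le> b" by (auto simp: a_def b_def)
      then show ?thesis by (rule mult_right_mono) simp
    qed simp
    have "retract M u - retract M v = a *\<^sub>R (u - v) - (b - a) *\<^sub>R v"
      by (simp add: retract_def a_def b_def algebra_simps)
    then have "norm (retract M u - retract M v) \<le> norm (a *\<^sub>R (u - v)) + norm ((b - a) *\<^sub>R v)"
      by (simp only: norm_triangle_ineq4)
    also have "norm (a *\<^sub>R (u - v)) = a * norm (u - v)" using a by simp
    also have "norm ((b - a) *\<^sub>R v) = b * norm v - a * norm v"
    proof -
      have "norm ((b - a) *\<^sub>R v) = \<bar>(b - a) * norm v\<bar>" by (simp add: abs_mult)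
      also have "\<dots> = b * norm v - a * norm v" using nab by (simp add: left_diff_distrib)
      finally show ?thesis .
    qed
    also have "b * norm v \<le> a * norm u" unfolding na nb using le by auto
    also have "a * norm u - a * norm v \<le> a * norm (u - v)"
      unfolding right_diff_distrib[symmetric] by (rule mult_left_mono[OF norm_triangle_ineq2 a(1)])
    finally have "norm (retract M u - retract M v) \<le> a * norm (u - v) + a * norm (u - v)" by simp
    also have "\<dots> \<le> 1 * norm (u - v) + 1 * norm (u - v)" by (intro add_mono mult_right_mono a) auto
    finally show ?thesis by simp
  qed
  show ?thesis
    using *[of v u] *[of u v] by (cases "norm v \<le> norm u") (auto simp: norm_minus_commute)
qed

context robin_nls
begin

text \<open>The retraction is applied to w + h G, that is to u itself, so that below the threshold
  the forcing is exactly \<open>src\<close>. Lipschitz continuity of h and h' is the time regularity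
  that \<open>lipschitz_forcing\<close> asks for.\<close>

lemma truncated_mild_exists:
  assumes M: "M \<ge> 0" and Hh: "\<And>s t. s \<in> {0..T} \<Longrightarrow> t \<in> {0..T} \<Longrightarrow> cmod (h t - h s) \<le> H * \<bar>t - s\<bar>"
    and Hh': "\<And>s t. s \<in> {0..T} \<Longrightarrow> t \<in> {0..T} \<Longrightarrow> cmod (h' t - h' s) \<le> H * \<bar>t - s\<bar>" and H: "H \<ge> 0"
  shows "\<exists>w. mild T w (\<lambda>t. w t - cmul (\<i> * lam) (Nop p (retract M (w t + cmul (h t) G))) - cmul (h' t) G + cmul (\<i> / 2 * h t) G2) w0"
proof -
  define F where "F = (\<lambda>t w. w - cmul (\<i> * lam) (Nop p (retract M (w + cmul (h t) G))) - cmul (h' t) G + cmul (\<i> / 2 * h t) G2)"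
  define c where "c = max 0 (Nlip (p - 1) (M + 1))"
  \<comment> \<open>Collects 1 from the identity, 2 |lam| c from the power, with 2 from
    \<open>retract_lipschitz\<close>, and the contributions of the lift moving in time.\<close>
  define L where "L = 1 + 2 * cmod lam * c * (1 + H * norm G) + H * norm G + H * norm G2"
  have c: "c \<ge> 0" by (simp add: c_def)
  have N: "norm (Nop p (retract M u) - Nop p (retract M v)) \<le> c * (2 * norm (u - v))" for u v
  proof -
    have "norm (Nop p (retract M u) - Nop p (retract M v)) \<le> Nlip (p - 1) (M + 1) * norm (retract M u - retract M v)"
      by (rule Nop_lipschitz[OF p]) (auto simp: norm_retract[OF M])
    also have "\<dots> \<le> c * (2 * norm (u - v))"
      by (rule mult_mono[OF _ retract_lipschitz[OF M] c]) (auto simp: c_def)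
    finally show ?thesis .
  qed
  have "lipschitz_forcing (bform \<alpha>) gen (dom \<alpha>) (1 / 2) F T L"
  proof (intro lipschitz_forcing.intro m_dissipative_axioms lipschitz_forcing_axioms.intro T)
    show "L \<ge> 0" using c H by (simp add: L_def)
    fix s t :: real and x y :: energy assume t: "t \<in> {0..T}" "s \<in> {0..T}"
    have hs: "norm (cmul (h t) u - cmul (h s) u) \<le> H * \<bar>t - s\<bar> * norm u"
      and h's: "norm (cmul (h' t) u - cmul (h' s) u) \<le> H * \<bar>t - s\<bar> * norm u" for u
      using mult_right_mono[OF Hh[OF t(2,1)] norm_ge_zero, of u] mult_right_mono[OF Hh'[OF t(2,1)] norm_ge_zero, of u]
      by (simp_all only: linear_simps(2)[OF bounded_linear_cmul_left, symmetric] norm_cmul)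
    define d where "d = \<bar>t - s\<bar>"
    define n where "n = norm (x - y)"
    have d: "d \<ge> 0" "n \<ge> 0" by (auto simp: d_def n_def)
    define A where "A = cmul (\<i> * lam) (Nop p (retract M (x + cmul (h t) G)) - Nop p (retract M (y + cmul (h s) G)))"
    define B where "B = cmul (h' t) G - cmul (h' s) G"
    define D where "D = cmul (\<i> / 2) (cmul (h t) G2 - cmul (h s) G2)"
    have eq: "F t x - F s y = (x - y) - A - B + D"
      unfolding F_def A_def B_def D_def by (rule energy_eqI) (simp add: algebra_simps)
    have "norm (F t x - F s y) \<le> n + norm A + norm B + norm D"
      unfolding eq n_def
      using norm_triangle_ineq[of "(x - y) - A - B" D] norm_triangle_ineq4[of "(x - y) - A" B] norm_triangle_ineq4[of "x - y" A]
      by linarith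
    moreover have "norm A \<le> cmod lam * (c * (2 * (n + H * d * norm G)))"
    proof -
      have "norm A = cmod lam * norm (Nop p (retract M (x + cmul (h t) G)) - Nop p (retract M (y + cmul (h s) G)))"
        by (simp add: A_def norm_cmul norm_mult)
      also have "\<dots> \<le> cmod lam * (c * (2 * norm ((x + cmul (h t) G) - (y + cmul (h s) G))))"
        by (rule mult_left_mono[OF N norm_ge_zero])
      also have "\<dots> \<le> cmod lam * (c * (2 * (n + H * d * norm G)))"
      proof (intro mult_left_mono c norm_ge_zero)
        have eq: "(x + cmul (h t) G) - (y + cmul (h s) G) = (x - y) + (cmul (h t) G - cmul (h s) G)" by simp
        show "norm ((x + cmul (h t) G) - (y + cmul (h s) G)) \<le> n + H * d * norm G"
          unfolding eq n_def d_def
          using norm_triangle_ineq[of "x - y" "cmul (h t) G - cmul (h s) G"] hs[of G] by linarith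
      qed simp
      finally show ?thesis .
    qed
    moreover have "norm B \<le> H * d * norm G" using h's[of G] by (simp add: B_def d_def)
    moreover have "norm D \<le> H * d * norm G2"
    proof -
      have "norm D \<le> norm (cmul (h t) G2 - cmul (h s) G2)"
        by (simp add: D_def norm_cmul norm_divide)
      then show ?thesis using hs[of G2] by (simp add: d_def)
    qed
    ultimately have "norm (F t x - F s y) \<le> n + cmod lam * (c * (2 * (n + H * d * norm G))) + H * d * norm G + H * d * norm G2"
      by linarith
    also have "\<dots> \<le> L * (d + n)"
    proof -
      have "L * (d + n) = n + cmod lam * (c * (2 * (n + H * d * norm G))) + H * d * norm G + H * d * norm G2
        + (d + cmod lam * c * (2 * d) + cmod lam * c * (2 * (H * norm G * n)) + H * norm G * n + H * norm G2 * n)"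
        by (simp add: L_def algebra_simps)
      moreover have "d + cmod lam * c * (2 * d) + cmod lam * c * (2 * (H * norm G * n)) + H * norm G * n + H * norm G2 * n \<ge> 0"
        by (intro add_nonneg_nonneg mult_nonneg_nonneg d c H norm_ge_zero) simp_all
      ultimately show ?thesis by linarith
    qed
    finally show "norm (F t x - F s y) \<le> L * (\<bar>t - s\<bar> + norm (x - y))" by (simp add: d_def n_def)
  qed
  then interpret lipschitz_forcing "bform \<alpha>" gen "dom \<alpha>" "1 / 2" F T L .
  show ?thesis using mild_exists[of w0] by (simp add: F_def)
qed

end

text \<open>The lift is G = x exp(-x) / \<alpha>, with G(0) = 0 and G'(0) = 1/\<alpha>. It is
  produced by the damped equations a' = - a and b' = a - b because
  \<open>first_order_from_boundary\<close> then supplies membership in H01.\<close>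

lemma boundary_lift_exists:
  assumes \<alpha>: "\<alpha> \<noteq> 0"
  obtains G G1 G2 where "twice G G1 G2" "rep G 0 + of_real \<alpha> * G1 0 = 1"
proof -
  have z: "(\<lambda>x. 0) \<in> H01" by (simp add: H01_def L2_def)
  obtain a where a: "\<And>x. x \<ge> 0 \<Longrightarrow> (a has_vector_derivative (0 - 1 * a x)) (at x within {0..})"
    "a \<in> H01" "a 0 = 1 / of_real \<alpha>"
    by (rule first_order_from_boundary[of 1 "\<lambda>x. 0" "1 / of_real \<alpha>"]) (use z in auto)
  have ac: "continuous_on {0..} a" by (rule continuous_on_of_vector_derivative[OF a(1)]) simp
  obtain b where b: "\<And>x. x \<ge> 0 \<Longrightarrow> (b has_vector_derivative (a x - 1 * b x)) (at x within {0..})"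
    "b \<in> H01" "b 0 = 0"
    by (rule first_order_from_boundary[of 1 a 0]) (use a ac in auto)
  have bc: "continuous_on {0..} b" by (rule continuous_on_of_vector_derivative[OF b(1)]) simp
  have db: "((\<lambda>x. a x - b x) has_vector_derivative (b x - 2 * a x)) (at x within {0..})" if "x \<ge> 0" for x
    using has_vector_derivative_diff[OF a(1)[OF that] b(1)[OF that]] by (simp add: algebra_simps)
  have ddb: "((\<lambda>x. b x - 2 * a x) has_vector_derivative (3 * a x - b x)) (at x within {0..})" if "x \<ge> 0" for x
    using has_vector_derivative_diff[OF b(1)[OF that] has_vector_derivative_mult_right[OF a(1)[OF that], of 2]]
    by (simp add: algebra_simps)
  have L2H: "g \<in> L2" if "g \<in> H01" for g using that by (simp add: H01_def)
  obtain G where G: "\<And>x. x \<ge> 0 \<Longrightarrow> rep G x = b x"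
    "\<And>x. x \<ge> 0 \<Longrightarrow> (rep G has_vector_derivative (a x - b x)) (at x within {0..})"
    by (rule energy_of_C1[of b "\<lambda>x. a x - b x"])
       (use b in \<open>auto intro!: L2H H01_diff a b continuous_on_diff ac bc\<close>)
  obtain G2 where G2: "\<And>x. x \<ge> 0 \<Longrightarrow> rep G2 x = b x - 2 * a x"
    by (rule energy_of_C1[of "\<lambda>x. b x - 2 * a x" "\<lambda>x. 3 * a x - b x"])
       (use ddb in \<open>auto intro!: L2H H01_diff H01_cmult a b continuous_intros ac bc\<close>)
  have "twice G (\<lambda>x. a x - b x) G2" unfolding twice_def using G(2) db G2 by simp
  moreover have "rep G 0 + of_real \<alpha> * (a 0 - b 0) = 1" using G(1)[of 0] a(3) b(3) \<alpha> by simp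
  ultimately show thesis by (rule that)
qed

lemma lipschitz_of_C1:
  fixes g g' :: "real \<Rightarrow> complex"
  assumes d: "\<And>t. t \<in> {a..b} \<Longrightarrow> (g has_vector_derivative g' t) (at t within {a..b})"
    and c: "continuous_on {a..b} g'"
  obtains H where "H \<ge> 0" "\<And>s t. s \<in> {a..b} \<Longrightarrow> t \<in> {a..b} \<Longrightarrow> cmod (g t - g s) \<le> H * \<bar>t - s\<bar>"
proof -
  have "bounded (g' ` {a..b})" by (intro compact_imp_bounded compact_continuous_image c) simp
  then obtain H where H: "H > 0" "\<And>t. t \<in> {a..b} \<Longrightarrow> cmod (g' t) \<le> H" unfolding bounded_pos by blast
  have "cmod (g t - g s) \<le> H * norm (t - s)" if "s \<in> {a..b}" "t \<in> {a..b}" for s t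
  proof (rule differentiable_bound[of "{a..b}" g "\<lambda>t x. x *\<^sub>R g' t"])
    show "onorm (\<lambda>x. x *\<^sub>R g' t) \<le> H" if "t \<in> {a..b}" for t
    proof (rule onorm_le)
      show "norm (x *\<^sub>R g' t) \<le> H * norm x" for x
        using mult_left_mono[OF H(2)[OF that], of "\<bar>x\<bar>"] by (simp add: mult.commute)
    qed
  qed (use d that in \<open>auto simp: has_vector_derivative_def\<close>)
  with H(1) show thesis by (intro that[of H]) auto
qed

lemma C2_on_derivatives:
  assumes "C2_on {0..T} h" and T: "T > 0"
  obtains h' h'' where "\<And>t. t \<in> {0..T} \<Longrightarrow> (h has_vector_derivative h' t) (at t within {0..T})"
    "\<And>t. t \<in> {0..T} \<Longrightarrow> (h' has_vector_derivative h'' t) (at t within {0..T})" "continuous_on {0..T} h''"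
proof -
  have d: "(g has_vector_derivative deriv_within {0..T} g t) (at t within {0..T})"
    if "g differentiable_on {0..T}" "t \<in> {0..T}" for g t
    using that unfolding deriv_within_def differentiable_on_def by (simp add: vector_derivative_works)
  show thesis
    by (rule that[of "deriv_within {0..T} h" "deriv_within {0..T} (deriv_within {0..T} h)"])
       (use assms d in \<open>auto simp: C2_on_def\<close>)
qed

theorem theorem1p1:
  fixes lam :: complex and \<alpha> p T\<^sub>0 \<rho> :: real
    and u\<^sub>0 h :: "real \<Rightarrow> complex"
  assumes "\<alpha> \<noteq> 0" and "p > 2" and "T\<^sub>0 > 0"
    and "u\<^sub>0 \<in> H10 \<inter> H01"
    and "C2_on {0..T\<^sub>0} h"
    and "cont_rep u\<^sub>0 0 = 0" and "h 0 = 0" and "deriv_within {0..T\<^sub>0} h 0 = 0"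
    and "\<rho> > 0"
    and "(SUP t\<in>{0..T\<^sub>0}. cmod (h t)) + (SUP t\<in>{0..T\<^sub>0}. cmod (deriv_within {0..T\<^sub>0} h t)) \<le> \<rho> powr p"
  shows "\<exists>C T. C > 0 \<and> 0 < T \<and> T \<le> T\<^sub>0 \<and> T \<le> (C * \<rho> + 1) powr (- (4 / 3)) \<and>
    (\<exists>u. nls_robin_solution lam \<alpha> p u\<^sub>0 h T u \<and>
      (\<forall>v. nls_robin_solution lam \<alpha> p u\<^sub>0 h T v \<longrightarrow>
        (\<forall>t\<in>{0..T}. AE x in halfline. v t x = u t x)))"
proof -
  obtain h' h'' where h: "\<And>t. t \<in> {0..T\<^sub>0} \<Longrightarrow> (h has_vector_derivative h' t) (at t within {0..T\<^sub>0})"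
    and h': "\<And>t. t \<in> {0..T\<^sub>0} \<Longrightarrow> (h' has_vector_derivative h'' t) (at t within {0..T\<^sub>0})" and h'': "continuous_on {0..T\<^sub>0} h''"
    using C2_on_derivatives[OF assms(5,3)] by blast
  have h'c: "continuous_on {0..T\<^sub>0} h'" by (rule continuous_on_of_vector_derivative[OF h'])
  obtain H1 where H1: "H1 \<ge> 0" "\<And>s t. s \<in> {0..T\<^sub>0} \<Longrightarrow> t \<in> {0..T\<^sub>0} \<Longrightarrow> cmod (h t - h s) \<le> H1 * \<bar>t - s\<bar>"
    using lipschitz_of_C1[OF h h'c] by blast
  obtain H2 where H2: "H2 \<ge> 0" "\<And>s t. s \<in> {0..T\<^sub>0} \<Longrightarrow> t \<in> {0..T\<^sub>0} \<Longrightarrow> cmod (h' t - h' s) \<le> H2 * \<bar>t - s\<bar>"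
    using lipschitz_of_C1[OF h' h''] by blast
  define H where "H = max H1 H2"
  have H: "H \<ge> 0" "\<And>s t. s \<in> {0..T\<^sub>0} \<Longrightarrow> t \<in> {0..T\<^sub>0} \<Longrightarrow> cmod (h t - h s) \<le> H * \<bar>t - s\<bar>"
    "\<And>s t. s \<in> {0..T\<^sub>0} \<Longrightarrow> t \<in> {0..T\<^sub>0} \<Longrightarrow> cmod (h' t - h' s) \<le> H * \<bar>t - s\<bar>"
    using H1(1) order_trans[OF H1(2) mult_right_mono[of H1 H]] order_trans[OF H2(2) mult_right_mono[of H2 H]]
    by (auto simp: H_def)
  obtain G G1 G2 where G: "twice G G1 G2" "rep G 0 + of_real \<alpha> * G1 0 = 1"
    using boundary_lift_exists[OF assms(1)] by blast
  obtain w0 where w0: "AE x in halfline. rep w0 x = u\<^sub>0 x" using energy_of_H10_H01[OF assms(4)] by blast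
  \<comment> \<open>One more than the size of the initial value, so that the solution stays below
    the threshold for a positive time.\<close>
  define M where "M = norm w0 + 1"
  \<comment> \<open>The setting is used twice: on the whole interval to construct the truncated
    solution, and on [0,T] for the original problem.\<close>
  have nls: "robin_nls \<alpha> p T h h' G G1 G2" if "0 < T" "T \<le> T\<^sub>0" for T
  proof unfold_locales
    have sub: "{0..T} \<subseteq> {0..T\<^sub>0}" using that by auto
    show "(h has_vector_derivative h' t) (at t within {0..T})" if "t \<in> {0..T}" for t
      using has_vector_derivative_within_subset[OF h sub] sub that by blast
    show "continuous_on {0..T} h'" by (rule continuous_on_subset[OF h'c sub])
  qed (use assms that G in auto)
  interpret N0: robin_nls \<alpha> lam p T\<^sub>0 h h' G G1 G2 using nls assms(3) by simp
  obtain w where w: "N0.mild T\<^sub>0 w (\<lambda>t. w t - cmul (\<i> * lam) (Nop p (retract M (w t + cmul (h t) G))) - cmul (h' t) G + cmul (\<i> / 2 * h t) G2) w0"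
    using N0.truncated_mild_exists[OF _ H(2,3,1), of M w0] by (auto simp: M_def)
  define e where "e = (\<lambda>t. w t + cmul (h t) G)"
  have e0: "e 0 = w0"
    using N0.mild_initial[OF w] assms(3,7) by (simp add: e_def linear_simps[OF bounded_linear_cmul_left])
  have ec0: "continuous_on {0..T\<^sub>0} e"
    unfolding e_def by (intro continuous_on_add N0.mild_continuous[OF w]
        bounded_linear.continuous_on[OF bounded_linear_cmul_left N0.h_continuous])
  obtain \<delta> where \<delta>: "\<delta> > 0" "\<And>t. t \<in> {0..T\<^sub>0} \<Longrightarrow> dist t 0 < \<delta> \<Longrightarrow> dist (e t) (e 0) < 1"
    using ec0 assms(3) unfolding continuous_on_iff by (metis atLeastAtMost_iff less_imp_le order_refl zero_less_one)
  \<comment> \<open>Half of \<delta> keeps the closed interval [0,T] inside the range where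
    \<open>e\<close> moves by less than 1.\<close>
  define T where "T = min (min T\<^sub>0 (\<delta> / 2)) ((1 * \<rho> + 1) powr (- (4 / 3)))"
  have T: "0 < T" "T \<le> T\<^sub>0" "T \<le> (1 * \<rho> + 1) powr (- (4 / 3))" "T < \<delta>"
    using assms(3,9) \<delta>(1) by (auto simp: T_def)
  interpret N: robin_nls \<alpha> lam p T h h' G G1 G2 using nls T by simp
  have ec: "continuous_on {0..T} e" by (rule continuous_on_subset[OF ec0]) (use T in auto)
  have small: "norm (e t) \<le> M" if "t \<in> {0..T}" for t
    using \<delta>(2)[of t] that T norm_triangle_ineq2[of "e t" w0] by (simp add: M_def e0 dist_norm)
  \<comment> \<open>On [0,T] the retraction is the identity, so the truncated forcing is the true
    one.\<close>
  have "N0.mild T w (\<lambda>t. N.f t (e t)) w0"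
    by (rule N0.mild_restrict[OF w T(2)]) (use retract_id[OF small] in \<open>simp add: src_def e_def\<close>)
  then have me: "N0.mild T (\<lambda>t. e t - cmul (h t) G) (\<lambda>t. N.f t (e t)) w0" by (simp add: e_def)
  have sol: "nls_robin_solution lam \<alpha> p u\<^sub>0 h T (\<lambda>t. rep (e t))"
    unfolding nls_robin_solution_def
  proof (intro conjI N.solution_of_mild[OF ec me])
    show "C_H10_H01 T (\<lambda>t. rep (e t))"
      by (subst C_H10_H01_iff[of T e]) (use rep_H10_H01 ec in auto)
    show "AE x in halfline. rep (e 0) x = u\<^sub>0 x" using w0 by (simp add: e0)
  qed
  have "AE x in halfline. v t x = rep (e t) x"
    if v: "nls_robin_solution lam \<alpha> p u\<^sub>0 h T v" and t: "t \<in> {0..T}" for v t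
  proof -
    have vC: "C_H10_H01 T v" and v0: "AE x in halfline. v 0 x = u\<^sub>0 x"
      and vn: "nls_equation lam p T v" and vr: "robin_condition \<alpha> h T v"
      using v by (auto simp: nls_robin_solution_def)
    \<comment> \<open>An arbitrary solution is given by functions up to null sets; their
      representatives form a curve in \<open>energy\<close>, continuous by
      \<open>C_H10_H01_iff\<close>.\<close>
    have "\<forall>s. \<exists>y. s \<in> {0..T} \<longrightarrow> (AE x in halfline. rep y x = v s x)"
      using vC energy_of_H10_H01 unfolding C_H10_H01_def by blast
    from choice[OF this] obtain y where y: "\<And>s. s \<in> {0..T} \<Longrightarrow> AE x in halfline. rep (y s) x = v s x" by blast
    have yc: "continuous_on {0..T} y" using C_H10_H01_iff[of T y v, OF y] vC by blast
    have "0 \<in> {0..T}" using T(1) by simp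
    from y[OF this] v0 w0 have "AE x in halfline. rep (y 0) x = rep w0 x" by eventually_elim simp
    \<comment> \<open>Since h 0 = 0 the lifted part vanishes at time 0, and both mild solutions
      start from \<open>w0\<close>.\<close>
    then have "y 0 - cmul (h 0) G = w0"
      using energy_eqI_AE assms(7) by (simp add: linear_simps[OF bounded_linear_cmul_left])
    with N.mild_of_solution[OF yc y vn vr]
    have "N0.mild T (\<lambda>t. y t - cmul (h t) G) (\<lambda>t. N.f t (y t)) w0" by simp
    from N.mild_src_unique[OF yc ec this me t] y[OF t]
    have "AE x in halfline. rep (e t) x = v t x" by simp
    then show ?thesis by eventually_elim simp
  qed
  with T sol show ?thesis by (intro exI[of _ 1] exI[of _ T]) auto
qed

end
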